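(* Let $d\ge2$, $0<\alpha<2$, and $$d_k(\alpha)=\frac{\Gamma(\gamma_k+\frac{d-\alpha}2)}{c_k\,2^{\alpha-\gamma_k-d/2}\,\Gamma(\frac\alpha2)} .$$ Then the function $$f_\alpha(x)=d_k(\alpha)\,|x|^{-(2\gamma_k+d-\alpha)}$$ is a fundamental solution for $(-\Delta_k)^{\alpha/2}$, that is, $(-\Delta_k)^{\alpha/2}f_\alpha=\delta$, in the sense that $$\int_{\mathbb R^d}f_\alpha(x)\,(-\Delta_k)^{\alpha/2}\varphi(x)\,w_k(x)\,dx=\varphi(0)\qquad\text{for all }\varphi\in\mathcal S(\mathbb R^d).$$
   Context: Let $\mathcal R\subset\mathbb R^d\setminus\{0\}$ be a reduced root system with reflections $\sigma_v(x)=x-2\frac{\langle x,v\rangle}{|v|^2}v$, $v\in\mathcal R$, let $G$ be the finite group generated by them, let $k:\mathcal R\to[0,\infty)$ be $G$-invariant, and let $\mathcal R_+$ be a positive subsystem; $\gamma_k=\sum_{v\in\mathcal R_+}k(v)$. Dunkl operators: $T_jf(x)=\partial_jf(x)+\sum_{v\in\mathcal R_+}k(v)\langle v,e_j\rangle\frac{f(x)-f(\sigma_v(x))}{\langle v,x\rangle}$; $\Delta_k=\sum_{j=1}^dT_j^2$. Weight: $w_k(x)=\prod_{v\in\mathcal R_+}|\langle x,v\rangle|^{2k(v)}$. For $z\in\mathbb C^d$ the Dunkl kernel $\mathcal E_k(z,\cdot)$ is the unique analytic solution on $\mathbb R^d$ of $T_jf=z_jf$ ($1\le j\le d$), $f(0)=1$.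 Put $c_k=\int_{\mathbb R^d}e^{-|x|^2/2}w_k(x)\,dx$. Dunkl transform: $\mathcal F_kf(\xi)=\frac1{c_k}\int_{\mathbb R^d}f(x)\mathcal E_k(-i\xi,x)w_k(x)\,dx$, an automorphism of $\mathcal S(\mathbb R^d)$ with inverse $\mathcal F_k^{-1}g(x)=\frac1{c_k}\int_{\mathbb R^d}g(\xi)\mathcal E_k(ix,\xi)w_k(\xi)\,d\xi$. For $\varphi\in\mathcal S(\mathbb R^d)$, $(-\Delta_k)^{\alpha/2}\varphi=\mathcal F_k^{-1}\big(|\xi|^\alpha\mathcal F_k\varphi(\xi)\big)$. *)

theory Defs
  imports "HOL-Analysis.Analysis"
begin

definition root_refl :: "real^'n \<Rightarrow> real^'n \<Rightarrow> real^'n" where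
  "root_refl v x = x - (2 * (x \<bullet> v) / (norm v)\<^sup>2) *\<^sub>R v"

text \<open>As usual in Dunkl theory, a root system is not required to be crystallographic or to
  span the space.\<close>

definition reduced_root_system :: "(real^'n) set \<Rightarrow> bool" where
  "reduced_root_system R \<longleftrightarrow>
     finite R \<and> 0 \<notin> R \<and>
     (\<forall>v\<in>R. root_refl v ` R = R) \<and>
     (\<forall>v\<in>R. R \<inter> range (\<lambda>c::real. c *\<^sub>R v) = {v, - v})"

inductive_set refl_group :: "(real^'n) set \<Rightarrow> (real^'n \<Rightarrow> real^'n) set"
  for R :: "(real^'n) set" where
  refl: "v \<in> R \<Longrightarrow> root_refl v \<in> refl_group R"
| one: "id \<in> refl_group R"
| mult: "g \<in> refl_group R \<Longrightarrow> h \<in> refl_group R \<Longrightarrow> g \<circ> h \<in> refl_group R"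
| inverse: "g \<in> refl_group R \<Longrightarrow> inv g \<in> refl_group R"

definition multiplicity_function :: "(real^'n) set \<Rightarrow> (real^'n \<Rightarrow> real) \<Rightarrow> bool" where
  "multiplicity_function R k \<longleftrightarrow>
     (\<forall>v\<in>R. k v \<ge> 0) \<and> (\<forall>g\<in>refl_group R. \<forall>v\<in>R. k (g v) = k v)"

definition positive_subsystem :: "(real^'n) set \<Rightarrow> (real^'n) set \<Rightarrow> bool" where
  "positive_subsystem R Rp \<longleftrightarrow>
     (\<exists>u. (\<forall>v\<in>R. v \<bullet> u \<noteq> 0) \<and> Rp = {v\<in>R. v \<bullet> u > 0})"

definition dunkl_gamma :: "(real^'n) set \<Rightarrow> (real^'n \<Rightarrow> real) \<Rightarrow> real" where
  "dunkl_gamma Rp k = (\<Sum>v\<in>Rp. k v)"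

text \<open>Since \<open>0 powr 0 = 0\<close> in the library, for \<open>k v = 0\<close> the factor of \<open>v\<close> is \<open>0\<close>
  instead of \<open>1\<close> on the hyperplane orthogonal to \<open>v\<close>. This is a null set, and the weight only
  occurs inside integrals.\<close>

definition dunkl_weight :: "(real^'n) set \<Rightarrow> (real^'n \<Rightarrow> real) \<Rightarrow> real^'n \<Rightarrow> real" where
  "dunkl_weight Rp k x = (\<Prod>v\<in>Rp. \<bar>x \<bullet> v\<bar> powr (2 * k v))"

definition partial_deriv :: "'n \<Rightarrow> (real^'n \<Rightarrow> complex) \<Rightarrow> real^'n \<Rightarrow> complex" where
  "partial_deriv j f x = vector_derivative (\<lambda>t::real. f (x + t *\<^sub>R axis j 1)) (at 0)"

primrec iter_partial :: "'n list \<Rightarrow> (real^'n \<Rightarrow> complex) \<Rightarrow> real^'n \<Rightarrow> complex" where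
  "iter_partial [] f = f"
| "iter_partial (j # js) f = partial_deriv j (iter_partial js f)"

text \<open>The lists \<open>js\<close> run over all iterated partial derivatives, and \<open>b\<close> over all multi-indices;
  differentiability of all iterated partial derivatives is smoothness.\<close>

definition schwartz :: "(real^'n \<Rightarrow> complex) \<Rightarrow> bool" where
  "schwartz f \<longleftrightarrow>
     (\<forall>js x. iter_partial js f differentiable (at x)) \<and>
     (\<forall>js. \<forall>b::'n \<Rightarrow> nat. bounded (range (\<lambda>x. (\<Prod>i\<in>UNIV. (x $ i) ^ b i) *\<^sub>R iter_partial js f x)))"

text \<open>Multivariate power series converge unconditionally, which is what \<open>has_sum\<close> expresses.\<close>

definition real_analytic :: "(real^'n \<Rightarrow> complex) \<Rightarrow> bool" where
  "real_analytic f \<longleftrightarrow>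
     (\<forall>a. \<exists>r>0. \<exists>c :: ('n \<Rightarrow> nat) \<Rightarrow> complex. \<forall>x\<in>ball a r.
        ((\<lambda>m. c m * of_real (\<Prod>i\<in>UNIV. (x $ i - a $ i) ^ m i)) has_sum f x) UNIV)"

text \<open>On the hyperplane orthogonal to \<open>v\<close>, the difference quotient in the Dunkl operator is
  understood, as usual, as its continuous extension (which exists for continuously differentiable
  functions).\<close>

definition dunkl_quotient :: "real^'n \<Rightarrow> (real^'n \<Rightarrow> complex) \<Rightarrow> real^'n \<Rightarrow> complex" where
  "dunkl_quotient v f x =
     (if v \<bullet> x \<noteq> 0 then (f x - f (root_refl v x)) / of_real (v \<bullet> x)
      else Lim (at x within {y. v \<bullet> y \<noteq> 0})
             (\<lambda>y. (f y - f (root_refl v y)) / of_real (v \<bullet> y)))"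

definition dunkl_op ::
  "(real^'n) set \<Rightarrow> (real^'n \<Rightarrow> real) \<Rightarrow> 'n \<Rightarrow> (real^'n \<Rightarrow> complex) \<Rightarrow> real^'n \<Rightarrow> complex" where
  "dunkl_op Rp k j f x =
     partial_deriv j f x + (\<Sum>v\<in>Rp. of_real (k v * (v $ j)) * dunkl_quotient v f x)"

definition dunkl_kernel ::
  "(real^'n) set \<Rightarrow> (real^'n \<Rightarrow> real) \<Rightarrow> complex^'n \<Rightarrow> real^'n \<Rightarrow> complex" where
  "dunkl_kernel Rp k z =
     (THE f. real_analytic f \<and> (\<forall>j x. dunkl_op Rp k j f x = z $ j * f x) \<and> f 0 = 1)"

definition dunkl_c :: "(real^'n) set \<Rightarrow> (real^'n \<Rightarrow> real) \<Rightarrow> real" where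
  "dunkl_c Rp k = (LINT x|lborel. exp (- (norm x)\<^sup>2 / 2) * dunkl_weight Rp k x)"

definition dunkl_transform ::
  "(real^'n) set \<Rightarrow> (real^'n \<Rightarrow> real) \<Rightarrow> (real^'n \<Rightarrow> complex) \<Rightarrow> real^'n \<Rightarrow> complex" where
  "dunkl_transform Rp k f \<xi> =
     1 / of_real (dunkl_c Rp k) *
     (LINT x|lborel. f x * dunkl_kernel Rp k (\<chi> j. - \<i> * of_real (\<xi> $ j)) x
                       * of_real (dunkl_weight Rp k x))"

definition inv_dunkl_transform ::
  "(real^'n) set \<Rightarrow> (real^'n \<Rightarrow> real) \<Rightarrow> (real^'n \<Rightarrow> complex) \<Rightarrow> real^'n \<Rightarrow> complex" where
  "inv_dunkl_transform Rp k g x =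
     1 / of_real (dunkl_c Rp k) *
     (LINT \<xi>|lborel. g \<xi> * dunkl_kernel Rp k (\<chi> j. \<i> * of_real (x $ j)) \<xi>
                       * of_real (dunkl_weight Rp k \<xi>))"

definition frac_dunkl_laplacian ::
  "(real^'n) set \<Rightarrow> (real^'n \<Rightarrow> real) \<Rightarrow> real \<Rightarrow> (real^'n \<Rightarrow> complex) \<Rightarrow> real^'n \<Rightarrow> complex" where
  "frac_dunkl_laplacian Rp k \<alpha> \<phi> =
     inv_dunkl_transform Rp k (\<lambda>\<xi>. of_real (norm \<xi> powr \<alpha>) * dunkl_transform Rp k \<phi> \<xi>)"

definition riesz_const :: "(real^'n) set \<Rightarrow> (real^'n \<Rightarrow> real) \<Rightarrow> real \<Rightarrow> real" where
  "riesz_const Rp k \<alpha> =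
     Gamma (dunkl_gamma Rp k + (real CARD('n) - \<alpha>) / 2) /
     (dunkl_c Rp k * 2 powr (\<alpha> - dunkl_gamma Rp k - real CARD('n) / 2) * Gamma (\<alpha> / 2))"

definition riesz_fun :: "(real^'n) set \<Rightarrow> (real^'n \<Rightarrow> real) \<Rightarrow> real \<Rightarrow> real^'n \<Rightarrow> real" where
  "riesz_fun Rp k \<alpha> x =
     riesz_const Rp k \<alpha> * norm x powr - (2 * dunkl_gamma Rp k + real CARD('n) - \<alpha>)"

end

theory Submission
  imports Defs
begin

text \<open>
  The kernel \<open>E(i x, \<sqdot>)\<close> is the sum of the homogeneous polynomials \<open>i\<^sup>n p\<^sub>n\<close> with
  \<open>T\<^sub>j p\<^sub>n\<^sub>+\<^sub>1 = x\<^sub>j p\<^sub>n\<close>; they exist because by Euler's identity the recursion amounts to inverting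
  \<open>n + \<gamma> - \<Sum> k(v) \<sigma>\<^sub>v\<close> on functions on the finite group \<open>G\<close>, and this inverse is the
  resolvent of a random walk. Differentiating in the parameter \<open>t\<close> shows that the transform of the
  Gaussian \<open>exp (- t |x|\<^sup>2)\<close> is again a Gaussian, which also gives the inversion formula at \<open>0\<close>.

  The Riesz kernel is a mixture of the Gaussians with respect to the density \<open>t powr (s - 1)\<close>. By Fubini
  the pairing with \<open>(- \<Delta>\<^sub>k) powr (\<alpha> / 2) \<phi>\<close> becomes a mixture of Gaussians on the Fourier side,
  which equals a multiple of \<open>|\<xi>| powr (- \<alpha>)\<close> and cancels the symbol \<open>|\<xi>| powr \<alpha>\<close>; what remains
  is the inversion formula for \<open>\<phi> 0\<close>. Fubini requires absolute convergence, that is, the decay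
  \<open>O(|x| powr (-2))\<close> of the fractional Laplacian of \<open>\<phi>\<close>. It follows by letting \<open>\<Delta>\<^sub>k\<close> act on the
  symbol, regularised at \<open>0\<close> and at infinity with estimates that are uniform in the
  regularisation.
\<close>

section \<open>Reflections and root systems\<close>

text \<open>The decay exponent 2 is exactly what fits. By homogeneity |x| powr (-(2 \<gamma> + d -
  \<alpha>)) times the weight is O(|x| powr (\<alpha> - d)): integrable at 0 because \<alpha> > 0,
  and at infinity after a gain of |x| powr (-2) because \<alpha> < 2. The gain costs two derivatives
  of the symbol, which leave |\<xi>| powr (\<alpha> - 2), integrable at 0 because d \<ge> 2. The
  kernel is a definite description over analytic functions, so existence, analyticity and uniqueness
  come before any use of it; later only its eigenvalue equation, its symmetry, its continuity and a
  bound uniform in both arguments matter. The difference quotients are limits on the reflecting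
  hyperplanes; identities are proved off them, then extended by continuity or integrated across a
  null set. In the constant, Gamma at s = \<gamma> + (d - \<alpha>) / 2 comes from the mixture in x,
  and Gamma (\<alpha> / 2) with 2 powr \<alpha> from the mixture in \<xi>. The Gaussian transform
  contributes 2 powr (-\<gamma> - d / 2) and one factor c_k, inversion two more, and the two
  normalised transforms take two away.\<close>

lemma inner_root_refl: "root_refl v x \<bullet> y = x \<bullet> root_refl v y"
  by (simp add: root_refl_def inner_diff_left inner_diff_right inner_commute)

lemma root_refl_involution [simp]: "root_refl v (root_refl v x) = x"
proof (cases "v = 0")
  case False
  then have "x \<bullet> v - 2 * (x \<bullet> v) = - (x \<bullet> v)" "v \<bullet> v = (norm v)\<^sup>2" "(norm v)\<^sup>2 \<noteq> 0"
    by (auto simp: power2_norm_eq_inner)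
  then show ?thesis
    by (simp add: root_refl_def inner_diff_left algebra_simps flip: scaleR_add_left)
qed (simp add: root_refl_def)

lemma linear_root_refl: "linear (root_refl v)"
  unfolding root_refl_def
  by (rule linearI) (simp_all add: inner_add_left algebra_simps add_divide_distrib scaleR_left_distrib)

lemma root_refl_scaleR: "root_refl v (c *\<^sub>R x) = c *\<^sub>R root_refl v x"
  using linear_root_refl by (rule linear_scale)

lemma root_refl_diff: "root_refl v (x - y) = root_refl v x - root_refl v y"
  using linear_root_refl by (rule linear_diff)

lemma root_refl_sum: "root_refl v (\<Sum>i\<in>A. f i) = (\<Sum>i\<in>A. root_refl v (f i))"
  using linear_root_refl by (rule linear_sum)

lemma orthogonal_root_refl: "orthogonal_transformation (root_refl v)"
  unfolding orthogonal_transformation_def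
  by (simp add: linear_root_refl inner_root_refl)

lemma norm_root_refl [simp]: "norm (root_refl v x) = norm x"
  by (rule orthogonal_transformation_norm[OF orthogonal_root_refl])

lemma root_refl_self: "v \<noteq> 0 \<Longrightarrow> root_refl v v = - v"
  by (simp add: root_refl_def power2_norm_eq_inner scaleR_2)

lemma root_refl_uminus_root: "root_refl (- v) = root_refl v"
  by (rule ext) (simp add: root_refl_def)

lemma root_refl_fixed: "x \<bullet> v = 0 \<Longrightarrow> root_refl v x = x"
  by (simp add: root_refl_def)

text \<open>An orthogonal map carries the hyperplane of \<open>v\<close> to the hyperplane of its
  image. This is what lets a reflection pass through sums over roots at the price of permuting
  them.\<close>

lemma root_refl_conjugate:
  "root_refl u (root_refl v x) = root_refl (root_refl u v) (root_refl u x)"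
proof -
  have "root_refl u x \<bullet> root_refl u v = x \<bullet> v"
    by (simp add: inner_root_refl)
  then show ?thesis
    by (simp add: root_refl_def[of "root_refl u v"] root_refl_def[of v] root_refl_diff root_refl_scaleR)
qed

locale dunkl =
  fixes R Rp :: "(real^'n) set" and k :: "real^'n \<Rightarrow> real"
  assumes root_system: "reduced_root_system R"
    and positive: "positive_subsystem R Rp"
    and multiplicity: "multiplicity_function R k"
begin

abbreviation G :: "(real^'n \<Rightarrow> real^'n) set" where "G \<equiv> refl_group R"
abbreviation \<gamma> :: real where "\<gamma> \<equiv> dunkl_gamma Rp k"
abbreviation w :: "real^'n \<Rightarrow> real" where "w \<equiv> dunkl_weight Rp k"

lemma finite_R: "finite R" and zero_notin_R: "0 \<notin> R"
  and refl_R: "v \<in> R \<Longrightarrow> root_refl v ` R = R"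
  using root_system by (auto simp: reduced_root_system_def)

lemma Rp_subset: "Rp \<subseteq> R"
  using positive by (auto simp: positive_subsystem_def)

lemma RpD: "v \<in> Rp \<Longrightarrow> v \<in> R"
  using Rp_subset by auto

lemma finite_Rp [simp]: "finite Rp"
  using Rp_subset finite_R finite_subset by blast

lemma R_nonzero: "v \<in> R \<Longrightarrow> v \<noteq> 0"
  using zero_notin_R by auto

lemma Rp_nonzero: "v \<in> Rp \<Longrightarrow> v \<noteq> 0"
  using R_nonzero RpD by blast

lemma uminus_R: "v \<in> R \<Longrightarrow> - v \<in> R"
  using refl_R[of v] root_refl_self[of v] R_nonzero[of v] by (metis imageI)

lemma Rp_cases: "v \<in> R \<Longrightarrow> v \<in> Rp \<or> - v \<in> Rp"
  and Rp_uminus: "v \<in> Rp \<Longrightarrow> - v \<notin> Rp"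
proof -
  obtain u where u: "\<forall>v\<in>R. v \<bullet> u \<noteq> 0" "Rp = {v\<in>R. v \<bullet> u > 0}"
    using positive by (auto simp: positive_subsystem_def)
  show "v \<in> R \<Longrightarrow> v \<in> Rp \<or> - v \<in> Rp"
    using u uminus_R[of v] by (cases "v \<bullet> u > 0") (auto simp: not_less less_le)
  show "v \<in> Rp \<Longrightarrow> - v \<notin> Rp"
    using u by auto
qed

lemma k_nonneg: "v \<in> R \<Longrightarrow> k v \<ge> 0"
  using multiplicity by (auto simp: multiplicity_function_def)

lemma k_nonneg_Rp: "v \<in> Rp \<Longrightarrow> k v \<ge> 0"
  using k_nonneg RpD by blast

lemma k_refl: "u \<in> R \<Longrightarrow> v \<in> R \<Longrightarrow> k (root_refl u v) = k v"
  using multiplicity refl_group.refl[of u R] unfolding multiplicity_function_def by blast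

lemma k_uminus: "v \<in> R \<Longrightarrow> k (- v) = k v"
  using k_refl[of v v] root_refl_self[of v] R_nonzero[of v] by simp

lemma gamma_nonneg: "\<gamma> \<ge> 0"
  unfolding dunkl_gamma_def by (intro sum_nonneg k_nonneg_Rp)

text \<open>A reflection need not preserve the positive subsystem. It does permute the pairs {v,
  -v}, and the sign correction selects the positive member of the image pair.\<close>

definition perm_pos :: "real^'n \<Rightarrow> real^'n \<Rightarrow> real^'n" where
  "perm_pos u v = (if root_refl u v \<in> Rp then root_refl u v else - root_refl u v)"

lemma perm_pos_in: "u \<in> R \<Longrightarrow> v \<in> Rp \<Longrightarrow> perm_pos u v \<in> Rp"
  using Rp_cases[of "root_refl u v"] refl_R[of u] RpD[of v] unfolding perm_pos_def by auto

lemma perm_pos_perm_pos: "v \<in> Rp \<Longrightarrow> perm_pos u (perm_pos u v) = v"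
  using Rp_uminus[of v] linear_neg[OF linear_root_refl, of u] unfolding perm_pos_def by auto

lemma bij_perm_pos: "u \<in> R \<Longrightarrow> bij_betw (perm_pos u) Rp Rp"
  by (rule bij_betw_byWitness[where f' = "perm_pos u"]) (auto simp: perm_pos_in perm_pos_perm_pos)

lemma k_perm_pos: "u \<in> R \<Longrightarrow> v \<in> Rp \<Longrightarrow> k (perm_pos u v) = k v"
  using k_refl[of u v] k_uminus[of "root_refl u v"] RpD[of v] refl_R[of u]
  unfolding perm_pos_def by auto

text \<open>A summand even in \<open>v\<close> depends only on the pair {v, -v}, and on such pairs
  the reflection is a bijection preserving \<open>k\<close>.\<close>

lemma sum_Rp_refl:
  fixes F :: "real^'n \<Rightarrow> 'b::real_vector"
  assumes "u \<in> R" and even: "\<And>v. F (- v) = F v"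
  shows "(\<Sum>v\<in>Rp. k v *\<^sub>R F (root_refl u v)) = (\<Sum>v\<in>Rp. k v *\<^sub>R F v)"
proof -
  have "(\<Sum>v\<in>Rp. k v *\<^sub>R F v) = (\<Sum>v\<in>Rp. k (perm_pos u v) *\<^sub>R F (perm_pos u v))"
    by (rule sum.reindex_bij_betw[OF bij_perm_pos[OF assms(1)], symmetric])
  also have "\<dots> = (\<Sum>v\<in>Rp. k v *\<^sub>R F (root_refl u v))"
    by (rule sum.cong) (use k_perm_pos[OF assms(1)] in \<open>auto simp: perm_pos_def even split: if_splits\<close>)
  finally show ?thesis by simp
qed

lemma weight_refl:
  assumes "u \<in> R" shows "w (root_refl u x) = w x"
proof -
  have "w x = (\<Prod>v\<in>Rp. \<bar>x \<bullet> perm_pos u v\<bar> powr (2 * k (perm_pos u v)))"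
    unfolding dunkl_weight_def
    by (rule prod.reindex_bij_betw[OF bij_perm_pos[OF assms(1)], symmetric])
  also have "\<dots> = w (root_refl u x)"
    unfolding dunkl_weight_def
    by (rule prod.cong) (use k_perm_pos[OF assms(1)] in \<open>auto simp: perm_pos_def inner_root_refl split: if_splits\<close>)
  finally show ?thesis by simp
qed

lemma weight_nonneg: "w x \<ge> 0"
  unfolding dunkl_weight_def by (intro prod_nonneg) auto

section \<open>The reflection group and its finiteness\<close>

lemma G_orthogonal: "g \<in> G \<Longrightarrow> orthogonal_transformation g"
proof (induction rule: refl_group.induct)
  case (inverse g) show ?case by (rule orthogonal_transformation_inv[OF inverse.IH])
next
  case (mult g h)
  from orthogonal_transformation_compose[OF mult.IH(1) mult.IH(2)] show ?case by (simp add: o_def)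
qed (auto simp: orthogonal_root_refl id_def)

lemma G_linear: "g \<in> G \<Longrightarrow> linear g"
  using G_orthogonal orthogonal_transformation_linear by blast

lemma G_norm: "g \<in> G \<Longrightarrow> norm (g x) = norm x"
  using G_orthogonal orthogonal_transformation_norm by blast

lemma G_bij: "g \<in> G \<Longrightarrow> bij g"
  using G_orthogonal orthogonal_transformation_bij by blast

lemma G_inner: "g \<in> G \<Longrightarrow> x \<bullet> g y = inv g x \<bullet> y"
  using G_orthogonal[of g] G_bij[of g]
  by (metis bij_inv_eq_iff orthogonal_transformation_def)

lemma G_image_R: "g \<in> G \<Longrightarrow> g ` R = R"
proof (induction rule: refl_group.induct)
  case (mult g h) then show ?case by (metis image_comp)
next
  case (inverse g)
  then show ?case using G_bij by (metis bij_is_inj image_inv_f_f)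
qed (auto simp: refl_R)

lemma G_fix: "g \<in> G \<Longrightarrow> (\<forall>v\<in>R. x \<bullet> v = 0) \<Longrightarrow> g x = x"
proof (induction rule: refl_group.induct)
  case (inverse g) then show ?case using G_bij by (metis bij_is_inj inv_f_f)
qed (auto simp: root_refl_fixed)

text \<open>A group element permutes the finite set \<open>R\<close> and is determined by that
  permutation. Since \<open>R\<close> need not span, this uses that every element is the identity on
  the orthogonal complement of the span (\<open>G_fix\<close>).\<close>

lemma finite_G: "finite G"
proof -
  have "inj_on (\<lambda>g. restrict g R) G"
  proof (rule inj_onI)
    fix g h assume g: "g \<in> G" and h: "h \<in> G" and eq: "restrict g R = restrict h R"
    have "g v = h v" if "v \<in> R" for v
      using eq that by (metis restrict_apply')
    then have span: "g v = h v" if "v \<in> span R" for v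
      using linear_eq_on_span[OF G_linear[OF g] G_linear[OF h]] that by blast
    show "g = h"
    proof
      fix x
      obtain y z where yz: "y \<in> span R" "\<And>w. w \<in> span R \<Longrightarrow> orthogonal z w" "x = y + z"
        using orthogonal_subspace_decomp_exists by metis
      then have "\<forall>v\<in>R. z \<bullet> v = 0" by (simp add: orthogonal_def span_base)
      then have "g z = z" "h z = z" using G_fix g h by auto
      then show "g x = h x"
        using span[OF yz(1)] by (simp add: yz(3) linear_add[OF G_linear] g h)
    qed
  qed
  moreover have "(\<lambda>g. restrict g R) ` G \<subseteq> R \<rightarrow>\<^sub>E R"
    using G_image_R by fastforce
  ultimately show ?thesis
    using finite_PiE[OF finite_R, of "\<lambda>_. R"] finite_R finite_imageD finite_subset by metis
qed

section \<open>The resolvent of the weighted reflection walk\<close>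

lemma id_in_G: "id \<in> G" by (rule refl_group.one)

lemma G_nonempty: "G \<noteq> {}" using id_in_G by auto

lemma refl_in_G: "v \<in> Rp \<Longrightarrow> root_refl v \<in> G"
  by (intro refl_group.refl RpD)

lemma bij_right_mult: "v \<in> Rp \<Longrightarrow> bij_betw (\<lambda>g. g \<circ> root_refl v) G G"
  by (rule bij_betw_byWitness[where f' = "\<lambda>g. g \<circ> root_refl v"])
     (auto simp: o_def refl_group.mult[OF _ refl_in_G, unfolded o_def])

lemma bij_left_mult: "v \<in> Rp \<Longrightarrow> bij_betw (\<lambda>g. root_refl v \<circ> g) G G"
  by (rule bij_betw_byWitness[where f' = "\<lambda>g. root_refl v \<circ> g"])
     (auto simp: o_def refl_group.mult[OF refl_in_G, unfolded o_def])

lemma sum_G_right: 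
  assumes "v \<in> Rp" shows "(\<Sum>g\<in>G. F (g \<circ> root_refl v)) = (\<Sum>g\<in>G. F g)"
  by (rule sum.reindex_bij_betw[OF bij_right_mult[OF assms]])

lemma sum_G_left:
  assumes "v \<in> Rp" shows "(\<Sum>g\<in>G. F (root_refl v \<circ> g)) = (\<Sum>g\<in>G. F g)"
  by (rule sum.reindex_bij_betw[OF bij_left_mult[OF assms]])

text \<open>The orbit of \<open>y\<close> is finite, so \<open>F\<close> attains its maximum on it.
  There the right side is at most \<gamma> times the maximum, and m > 0 forces the maximum to be
  nonpositive. Only the orbit is involved, so the principle also serves identities known at regular
  points alone.\<close>

lemma max_principle:
  fixes F :: "real^'n \<Rightarrow> real"
  assumes "m > 0" and nonneg: "\<And>g. g \<in> G \<Longrightarrow> F (g y) \<ge> 0"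
    and le: "\<And>g. g \<in> G \<Longrightarrow> (m + \<gamma>) * F (g y) \<le> (\<Sum>v\<in>Rp. k v * F (root_refl v (g y)))"
  shows "F y = 0"
proof -
  let ?A = "(\<lambda>g. F (g y)) ` G"
  have fin: "finite ?A" "?A \<noteq> {}" using finite_G G_nonempty by auto
  have "Max ?A \<in> ?A" using fin by (rule Max_in)
  then obtain g where g: "Max ?A = F (g y)" "g \<in> G" by (rule imageE)
  have bd: "F (h y) \<le> F (g y)" if "h \<in> G" for h
    unfolding g(1)[symmetric] using that by (intro Max_ge fin imageI)
  have "(m + \<gamma>) * F (g y) \<le> (\<Sum>v\<in>Rp. k v * F (root_refl v (g y)))"
    by (rule le[OF g(2)])
  also have "\<dots> \<le> (\<Sum>v\<in>Rp. k v * F (g y))"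
  proof (intro sum_mono mult_left_mono k_nonneg_Rp)
    fix v assume "v \<in> Rp"
    from bd[OF refl_group.mult[OF refl_in_G[OF this] g(2)]]
    show "F (root_refl v (g y)) \<le> F (g y)" by simp
  qed
  also have "\<dots> = \<gamma> * F (g y)" by (simp add: dunkl_gamma_def sum_distrib_right)
  finally have "m * F (g y) \<le> 0" by (simp add: algebra_simps)
  then have "F (g y) \<le> 0" using \<open>m > 0\<close> by (simp add: mult_le_0_iff)
  then show ?thesis using bd[OF id_in_G] nonneg[OF id_in_G] by simp
qed

text \<open>The maximum principle for the absolute difference; nonnegativity of \<open>k\<close> is
  what allows the triangle inequality inside the sum.\<close>

lemma resolvent_unique:
  fixes f h :: "real^'n \<Rightarrow> real"
  assumes "m > 0"
    and f: "\<And>y. (m + \<gamma>) * f y - (\<Sum>v\<in>Rp. k v * f (root_refl v y)) = b y"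
    and h: "\<And>y. (m + \<gamma>) * h y - (\<Sum>v\<in>Rp. k v * h (root_refl v y)) = b y"
  shows "f = h"
proof
  fix y
  have "\<bar>f y - h y\<bar> = 0"
  proof (rule max_principle[OF assms(1), of "\<lambda>y. \<bar>f y - h y\<bar>"])
    fix g assume "g \<in> G"
    let ?z = "g y"
    have "(m + \<gamma>) * (f ?z - h ?z) = (\<Sum>v\<in>Rp. k v * (f (root_refl v ?z) - h (root_refl v ?z)))"
      using f[of ?z] h[of ?z] by (simp add: algebra_simps sum_subtractf)
    moreover have "\<bar>(m + \<gamma>) * (f ?z - h ?z)\<bar> = (m + \<gamma>) * \<bar>f ?z - h ?z\<bar>"
      using assms(1) gamma_nonneg by (simp add: abs_mult)
    ultimately have "(m + \<gamma>) * \<bar>f ?z - h ?z\<bar> = \<bar>\<Sum>v\<in>Rp. k v * (f (root_refl v ?z) - h (root_refl v ?z))\<bar>"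
      by simp
    also have "\<dots> \<le> (\<Sum>v\<in>Rp. \<bar>k v * (f (root_refl v ?z) - h (root_refl v ?z))\<bar>)"
      by (rule sum_abs)
    also have "\<dots> = (\<Sum>v\<in>Rp. k v * \<bar>f (root_refl v ?z) - h (root_refl v ?z)\<bar>)"
      by (rule sum.cong) (auto simp: abs_mult k_nonneg_Rp)
    finally show "(m + \<gamma>) * \<bar>f ?z - h ?z\<bar>
        \<le> (\<Sum>v\<in>Rp. k v * \<bar>f (root_refl v ?z) - h (root_refl v ?z)\<bar>)" .
  qed auto
  then show "f y = h y" by simp
qed

text \<open>The total weight, with one factor k(v) per step, of the words of \<open>i\<close>
  positive reflections whose product is \<open>g\<close>.\<close>

primrec walk :: "nat \<Rightarrow> (real^'n \<Rightarrow> real^'n) \<Rightarrow> real" where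
  "walk 0 g = (if g = id then 1 else 0)"
| "walk (Suc i) g = (\<Sum>v\<in>Rp. k v * walk i (g \<circ> root_refl v))"

text \<open>The Neumann series for the inverse of m + \<gamma> - \<Sum> k(v) \<sigma>_v, with
  coefficients in the group. Walks of length \<open>i\<close> have weight at most \<gamma> ^ i, so m
  > 0 makes it converge geometrically.\<close>

definition resolvent :: "real \<Rightarrow> (real^'n \<Rightarrow> real^'n) \<Rightarrow> real" where
  "resolvent m g = (\<Sum>i. walk i g / (m + \<gamma>) ^ Suc i)"

lemma walk_bounds: "0 \<le> walk i g \<and> walk i g \<le> \<gamma> ^ i"
proof (induction i arbitrary: g)
  case (Suc i)
  have "(\<Sum>v\<in>Rp. k v * walk i (g \<circ> root_refl v)) \<le> (\<Sum>v\<in>Rp. k v * \<gamma> ^ i)"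
    using Suc by (intro sum_mono mult_left_mono) (auto simp: k_nonneg_Rp)
  also have "\<dots> = \<gamma> ^ Suc i" by (simp add: dunkl_gamma_def sum_distrib_right)
  finally show ?case using Suc by (auto intro!: sum_nonneg mult_nonneg_nonneg k_nonneg_Rp)
qed auto

lemma summable_walk:
  assumes "m > 0" shows "summable (\<lambda>i. walk i g / (m + \<gamma>) ^ Suc i)"
proof (rule summable_comparison_test')
  have "\<gamma> / (m + \<gamma>) < 1" "0 \<le> \<gamma> / (m + \<gamma>)" using assms gamma_nonneg by (auto simp: divide_simps)
  then have "summable (\<lambda>i. (\<gamma> / (m + \<gamma>)) ^ i)" by (intro summable_geometric) (simp only: real_norm_def abs_of_nonneg)
  then show "summable (\<lambda>i. 1 / (m + \<gamma>) * (\<gamma> / (m + \<gamma>)) ^ i)" by (rule summable_mult)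
  show "norm (walk i g / (m + \<gamma>) ^ Suc i) \<le> 1 / (m + \<gamma>) * (\<gamma> / (m + \<gamma>)) ^ i" if "i \<ge> 0" for i
    using walk_bounds[of i g] assms gamma_nonneg by (simp add: power_divide divide_right_mono)
qed

lemma resolvent_nonneg: "m > 0 \<Longrightarrow> resolvent m g \<ge> 0"
  unfolding resolvent_def
  using gamma_nonneg walk_bounds by (intro suminf_nonneg summable_walk) (auto intro!: divide_nonneg_nonneg)

lemma resolvent_eq:
  assumes "m > 0"
  shows "(m + \<gamma>) * resolvent m g = (if g = id then 1 else 0) + (\<Sum>v\<in>Rp. k v * resolvent m (g \<circ> root_refl v))"
proof -
  have pos: "m + \<gamma> > 0" using assms gamma_nonneg by simp
  have "(m + \<gamma>) * resolvent m g = (\<Sum>i. (m + \<gamma>) * (walk i g / (m + \<gamma>) ^ Suc i))"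
    unfolding resolvent_def by (rule suminf_mult[OF summable_walk[OF assms], symmetric])
  also have "\<dots> = (\<Sum>i. walk i g / (m + \<gamma>) ^ i)" using pos by simp
  also have "\<dots> = walk 0 g / (m + \<gamma>) ^ 0 + (\<Sum>i. walk (Suc i) g / (m + \<gamma>) ^ Suc i)"
  proof -
    have "summable (\<lambda>i. (m + \<gamma>) * (walk i g / (m + \<gamma>) ^ Suc i))"
      by (rule summable_mult[OF summable_walk[OF assms]])
    then have "summable (\<lambda>i. walk i g / (m + \<gamma>) ^ i)" using pos by simp
    from suminf_split_head[OF this] show ?thesis by simp
  qed
  also have "(\<Sum>i. walk (Suc i) g / (m + \<gamma>) ^ Suc i)
      = (\<Sum>i. \<Sum>v\<in>Rp. k v * (walk i (g \<circ> root_refl v) / (m + \<gamma>) ^ Suc i))"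
    by (simp add: sum_divide_distrib)
  also have "\<dots> = (\<Sum>v\<in>Rp. \<Sum>i. k v * (walk i (g \<circ> root_refl v) / (m + \<gamma>) ^ Suc i))"
    by (rule suminf_sum) (intro summable_mult summable_walk assms)
  also have "\<dots> = (\<Sum>v\<in>Rp. k v * resolvent m (g \<circ> root_refl v))"
    unfolding resolvent_def by (intro sum.cong[OF HOL.refl] suminf_mult summable_walk assms)
  finally show ?thesis by simp
qed

text \<open>Reindexing the group by right multiplication moves the reflection from the argument of
  \<open>u\<close> onto the resolvent, where \<open>resolvent_eq\<close> leaves only the point mass
  at the identity.\<close>

lemma resolvent_apply:
  fixes f :: "real^'n \<Rightarrow> real"
  assumes "m > 0"
  defines "u \<equiv> \<lambda>y. \<Sum>g\<in>G. resolvent m g * f (g y)"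
  shows "(m + \<gamma>) * u y - (\<Sum>v\<in>Rp. k v * u (root_refl v y)) = f y"
proof -
  have *: "u (root_refl v y) = (\<Sum>g\<in>G. resolvent m (g \<circ> root_refl v) * f (g y))" if "v \<in> Rp" for v
    unfolding u_def using sum_G_right[OF that, of "\<lambda>g. resolvent m (g \<circ> root_refl v) * f (g y)"]
    by (simp add: o_def)
  have "(m + \<gamma>) * u y = (\<Sum>g\<in>G. ((m + \<gamma>) * resolvent m g) * f (g y))"
    unfolding u_def by (simp add: sum_distrib_left mult.assoc)
  also have "\<dots> = (\<Sum>g\<in>G. (if g = id then f y else 0))
       + (\<Sum>g\<in>G. \<Sum>v\<in>Rp. k v * (resolvent m (g \<circ> root_refl v) * f (g y)))"
    by (simp only: resolvent_eq[OF assms(1)])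
       (simp add: distrib_right sum.distrib sum_distrib_right mult.assoc if_distrib[of "\<lambda>x. x * f _"] cong: if_cong)
  also have "(\<Sum>g\<in>G. (if g = id then f y else 0)) = f y"
    using finite_G id_in_G by simp
  also have "(\<Sum>g\<in>G. \<Sum>v\<in>Rp. k v * (resolvent m (g \<circ> root_refl v) * f (g y)))
      = (\<Sum>v\<in>Rp. k v * u (root_refl v y))"
    by (subst sum.swap) (simp add: * sum_distrib_left)
  finally show ?thesis by simp
qed

text \<open>On constants the inverted operator is multiplication by \<open>m\<close>. With m = n + 1
  this total mass is the source of every factorial in the kernel estimates.\<close>

lemma sum_resolvent: 
  assumes "m > 0" shows "(\<Sum>g\<in>G. resolvent m g) = 1 / m"
proof -
  have "(m + \<gamma>) * (\<Sum>g\<in>G. resolvent m g) - \<gamma> * (\<Sum>g\<in>G. resolvent m g) = 1"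
    using resolvent_apply[OF assms, of "\<lambda>_. 1"] by (simp add: dunkl_gamma_def sum_distrib_right)
  then show ?thesis using assms by (simp add: algebra_simps eq_divide_eq)
qed

end

section \<open>Homogeneous components of the Dunkl kernel\<close>

text \<open>The summable majorant of the operator norms gives the tail estimate, uniform in the
  point, that \<open>has_derivative_series\<close> asks for.\<close>

lemma has_derivative_suminf:
  fixes f :: "nat \<Rightarrow> 'a::real_normed_vector \<Rightarrow> 'b::banach"
  assumes S: "convex S" "open S" "x \<in> S"
    and deriv: "\<And>n x. x \<in> S \<Longrightarrow> (f n has_derivative f' n x) (at x)"
    and bound: "\<And>n x h. x \<in> S \<Longrightarrow> norm (f' n x h) \<le> M n * norm h"
    and M: "summable M"
    and summ: "\<And>x. x \<in> S \<Longrightarrow> summable (\<lambda>n. f n x)"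
  shows "((\<lambda>x. \<Sum>n. f n x) has_derivative (\<lambda>h. \<Sum>n. f' n x h)) (at x)"
proof -
  have "\<exists>g. \<forall>x\<in>S. (\<lambda>n. f n x) sums (g x) \<and> (g has_derivative (\<lambda>h. \<Sum>n. f' n x h)) (at x within S)"
  proof (rule has_derivative_series[OF S(1)])
    show "(f n has_derivative f' n x) (at x within S)" if "x \<in> S" for n x
      using deriv[OF that] by (rule has_derivative_at_withinI)
    show "(\<lambda>n. f n x) sums (\<Sum>n. f n x)" using summ[OF S(3)] by (rule summable_sums)
    show "\<forall>\<^sub>F n in sequentially. \<forall>x\<in>S. \<forall>h.
        norm (sum (\<lambda>i. f' i x h) {..<n} - (\<Sum>n. f' n x h)) \<le> e * norm h" if "e > 0" for e
    proof -
      obtain N where N: "\<forall>n\<ge>N. norm (\<Sum>i. M (i + n)) < e"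
        using suminf_exist_split[OF \<open>e > 0\<close> M] by blast
      have "norm (sum (\<lambda>i. f' i x h) {..<n} - (\<Sum>n. f' n x h)) \<le> e * norm h"
        if n: "n \<ge> N" and x: "x \<in> S" for n x h
      proof -
        have sM: "summable (\<lambda>i. M i * norm h)" using M by (rule summable_mult2)
        have sf: "summable (\<lambda>i. f' i x h)"
          by (rule summable_comparison_test'[OF sM]) (rule bound[OF x])
        have sM': "summable (\<lambda>i. M (i + n) * norm h)" using summable_ignore_initial_segment[OF sM, of n] .
        have "norm (sum (\<lambda>i. f' i x h) {..<n} - (\<Sum>n. f' n x h)) = norm (\<Sum>i. f' (i + n) x h)"
          using suminf_minus_initial_segment[OF sf, of n] by (simp add: norm_minus_commute)
        also have "\<dots> \<le> (\<Sum>i. M (i + n) * norm h)"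
          by (rule norm_suminf_le[OF bound[OF x] sM'])
        also have "\<dots> = (\<Sum>i. M (i + n)) * norm h"
          by (rule suminf_mult2[symmetric]) (rule summable_ignore_initial_segment[OF M])
        also have "\<dots> \<le> e * norm h"
        proof (intro mult_right_mono norm_ge_zero)
          from N n have "norm (\<Sum>i. M (i + n)) < e" by blast
          then show "(\<Sum>i. M (i + n)) \<le> e" by simp
        qed
        finally show ?thesis .
      qed
      then show ?thesis unfolding eventually_sequentially by blast
    qed
  qed (rule S(3))
  then obtain g where g: "\<And>x. x \<in> S \<Longrightarrow> (\<lambda>n. f n x) sums g x"
    and dg: "(g has_derivative (\<lambda>h. \<Sum>n. f' n x h)) (at x within S)"
    using S(3) by blast
  have "((\<lambda>x. \<Sum>n. f n x) has_derivative (\<lambda>h. \<Sum>n. f' n x h)) (at x within S)"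
    by (rule has_derivative_transform[OF S(3) _ dg]) (rule sums_unique[OF g, symmetric])
  then show ?thesis by (simp only: at_within_open[OF S(3) S(2)])
qed

lemma partial_deriv_eqI:
  assumes "(f has_derivative D) (at x)" shows "partial_deriv j f x = D (axis j 1)"
proof -
  have "((\<lambda>t::real. x + t *\<^sub>R axis j 1) has_derivative (\<lambda>t. t *\<^sub>R axis j 1)) (at 0)"
    by (auto intro!: derivative_eq_intros)
  from has_derivative_compose[OF this, of f D] assms
  have "((\<lambda>t. f (x + t *\<^sub>R axis j 1)) has_derivative (\<lambda>t. D (t *\<^sub>R axis j 1))) (at 0)" by simp
  moreover have "D (t *\<^sub>R axis j 1) = t *\<^sub>R D (axis j 1)" for t
    using has_derivative_linear[OF assms] by (rule linear_scale)
  ultimately have "((\<lambda>t. f (x + t *\<^sub>R axis j 1)) has_vector_derivative D (axis j 1)) (at 0)"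
    by (simp add: has_vector_derivative_def)
  then show ?thesis unfolding partial_deriv_def by (rule vector_derivative_at)
qed

lemma vec_eq_sum_axis: "(x::real^'n) = (\<Sum>j\<in>UNIV. (x $ j) *\<^sub>R axis j 1)"
  using basis_expansion[of x] by (simp add: scalar_mult_eq_scaleR)

lemma linear_eq_sum_axis:
  assumes "linear D" shows "D (h::real^'n) = (\<Sum>j\<in>UNIV. h $ j *\<^sub>R D (axis j 1))"
proof -
  have "D h = D (\<Sum>j\<in>UNIV. (h $ j) *\<^sub>R axis j 1)" by (simp only: vec_eq_sum_axis[symmetric])
  then show ?thesis by (simp only: linear_sum[OF assms] linear_scale[OF assms])
qed

lemma differentiable_has_derivative_partial:
  assumes "f differentiable (at x)"
  shows "(f has_derivative (\<lambda>h. \<Sum>j\<in>UNIV. h $ j *\<^sub>R partial_deriv j f x)) (at x)"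
proof -
  obtain D where D: "(f has_derivative D) (at x)" using assms by (auto simp: differentiable_def)
  have "D = (\<lambda>h. \<Sum>j\<in>UNIV. h $ j *\<^sub>R partial_deriv j f x)"
    unfolding partial_deriv_eqI[OF D]
    by (rule ext) (rule linear_eq_sum_axis[OF has_derivative_linear[OF D]])
  then show ?thesis using D by simp
qed

context dunkl
begin

text \<open>The homogeneous component of degree \<open>n\<close> of the Dunkl kernel, without the
  power of \<i>. For k = 0 the resolvent is 1 / (n + 1) at the identity and 0 elsewhere, and the
  recursion yields (x . y) ^ n / n!.\<close>

primrec kco :: "nat \<Rightarrow> real^'n \<Rightarrow> real^'n \<Rightarrow> real" where
  "kco 0 x y = 1"
| "kco (Suc n) x y = (\<Sum>g\<in>G. resolvent (real (Suc n)) g * ((x \<bullet> g y) * kco n x (g y)))"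

text \<open>The recursion of \<open>kco\<close> differentiated in the direction \<open>h\<close>.
  Keeping it explicit lets the derivative be bounded by the same induction as the value.\<close>

primrec kder :: "nat \<Rightarrow> real^'n \<Rightarrow> real^'n \<Rightarrow> real^'n \<Rightarrow> real" where
  "kder 0 x y h = 0"
| "kder (Suc n) x y h = (\<Sum>g\<in>G. resolvent (real (Suc n)) g *
     ((x \<bullet> g h) * kco n x (g y) + (x \<bullet> g y) * kder n x (g y) (g h)))"

lemma kco_eq:
  "(real (Suc n) + \<gamma>) * kco (Suc n) x y - (\<Sum>v\<in>Rp. k v * kco (Suc n) x (root_refl v y))
    = (x \<bullet> y) * kco n x y"
  using resolvent_apply[of "real (Suc n)" "\<lambda>y. (x \<bullet> y) * kco n x y" y] by simp

lemma kco_unique: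
  assumes "\<And>y. (real (Suc n) + \<gamma>) * f y - (\<Sum>v\<in>Rp. k v * f (root_refl v y)) = (x \<bullet> y) * kco n x y"
  shows "f y = kco (Suc n) x y"
  using resolvent_unique[of "real (Suc n)" f "\<lambda>y. (x \<bullet> y) * kco n x y" "kco (Suc n) x"] assms kco_eq
  by simp

lemma kco_scaleR_right: "kco n x (t *\<^sub>R y) = t ^ n * kco n x y"
proof (induction n arbitrary: y)
  case (Suc n)
  have "kco (Suc n) x (t *\<^sub>R y) =
     (\<Sum>g\<in>G. t ^ Suc n * (resolvent (real (Suc n)) g * ((x \<bullet> g y) * kco n x (g y))))"
    unfolding kco.simps by (intro sum.cong) (auto simp: linear_scale[OF G_linear] Suc)
  then show ?case by (simp add: sum_distrib_left)
qed auto

text \<open>Both sides solve the same resolvent equation: conjugation by a reflection only permutes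
  the positive reflections, up to sign, and preserves their weights. Uniqueness does the
  rest.\<close>

lemma kco_refl:
  assumes "u \<in> Rp" shows "kco n (root_refl u x) (root_refl u y) = kco n x y"
proof (induction n arbitrary: y)
  case (Suc n)
  show ?case
  proof (rule kco_unique[of n "\<lambda>y. kco (Suc n) (root_refl u x) (root_refl u y)" x y])
    fix y
    have "(\<Sum>v\<in>Rp. k v * kco (Suc n) (root_refl u x) (root_refl u (root_refl v y)))
       = (\<Sum>v\<in>Rp. k v *\<^sub>R kco (Suc n) (root_refl u x) (root_refl (root_refl u v) (root_refl u y)))"
      by (simp add: root_refl_conjugate[of u])
    also have "\<dots> = (\<Sum>v\<in>Rp. k v *\<^sub>R kco (Suc n) (root_refl u x) (root_refl v (root_refl u y)))"
      by (rule sum_Rp_refl[of u "\<lambda>v. kco (Suc n) (root_refl u x) (root_refl v (root_refl u y))"])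
         (auto simp: root_refl_uminus_root RpD[OF assms])
    finally have *: "(\<Sum>v\<in>Rp. k v * kco (Suc n) (root_refl u x) (root_refl u (root_refl v y)))
       = (\<Sum>v\<in>Rp. k v * kco (Suc n) (root_refl u x) (root_refl v (root_refl u y)))" by simp
    show "(real (Suc n) + \<gamma>) * kco (Suc n) (root_refl u x) (root_refl u y)
       - (\<Sum>v\<in>Rp. k v * kco (Suc n) (root_refl u x) (root_refl u (root_refl v y))) = (x \<bullet> y) * kco n x y"
      unfolding * kco_eq Suc by (simp add: inner_root_refl)
  qed
qed auto

text \<open>By equivariance a reflection of one argument equals a reflection of the other. Hence the
  transposed function satisfies the resolvent equation in \<open>y\<close>, with right side
  symmetric by induction.\<close>

lemma kco_commute: "kco n x y = kco n y x"
proof (induction n arbitrary: x y)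
  case (Suc n)
  have "(\<lambda>y. kco (Suc n) y x) y = kco (Suc n) x y"
  proof (rule kco_unique)
    fix y
    have "kco (Suc n) (root_refl v y) x = kco (Suc n) y (root_refl v x)" if "v \<in> Rp" for v
      using kco_refl[OF that, of "Suc n" "root_refl v y" x] by (simp del: kco.simps)
    then have "(\<Sum>v\<in>Rp. k v * kco (Suc n) (root_refl v y) x) = (\<Sum>v\<in>Rp. k v * kco (Suc n) y (root_refl v x))"
      by (intro sum.cong) auto
    then show "(real (Suc n) + \<gamma>) * kco (Suc n) y x - (\<Sum>v\<in>Rp. k v * kco (Suc n) (root_refl v y) x)
        = (x \<bullet> y) * kco n x y"
      using kco_eq[of n y x] Suc[of x y] by (simp del: kco.simps add: inner_commute)
  qed
  then show ?case by simp
qed auto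

lemma kco_scaleR_left: "kco n (t *\<^sub>R x) y = t ^ n * kco n x y"
  using kco_scaleR_right[of n y t x] by (simp add: kco_commute)

text \<open>The group acts by isometries, so each step contributes at most \<kappa>, and the total
  mass 1 / (n + 1) of the resolvent produces the factorial.\<close>

lemma kco_bound:
  assumes "norm x * norm y \<le> \<kappa>" shows "\<bar>kco n x y\<bar> \<le> \<kappa> ^ n / fact n"
  using assms
proof (induction n arbitrary: y)
  case (Suc n)
  have \<kappa>: "\<kappa> \<ge> 0" using Suc.prems by (rule order_trans[rotated]) simp
  have "\<bar>kco (Suc n) x y\<bar> \<le> (\<Sum>g\<in>G. \<bar>resolvent (real (Suc n)) g * ((x \<bullet> g y) * kco n x (g y))\<bar>)"
    unfolding kco.simps by (rule sum_abs)
  also have "\<dots> \<le> (\<Sum>g\<in>G. resolvent (real (Suc n)) g * (\<kappa> * (\<kappa> ^ n / fact n)))"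
  proof (rule sum_mono)
    fix g assume g: "g \<in> G"
    have "\<bar>x \<bullet> g y\<bar> \<le> \<kappa>"
      using Cauchy_Schwarz_ineq2[of x "g y"] Suc.prems by (simp add: G_norm[OF g])
    moreover have "\<bar>kco n x (g y)\<bar> \<le> \<kappa> ^ n / fact n"
      using Suc by (simp add: G_norm[OF g])
    ultimately show "\<bar>resolvent (real (Suc n)) g * ((x \<bullet> g y) * kco n x (g y))\<bar>
        \<le> resolvent (real (Suc n)) g * (\<kappa> * (\<kappa> ^ n / fact n))"
      using \<kappa> resolvent_nonneg[of "real (Suc n)" g]
      by (simp only: abs_mult) (intro mult_mono, auto)
  qed
  also have "\<dots> = \<kappa> ^ Suc n / fact (Suc n)"
    by (simp only: sum_distrib_right[symmetric] sum_resolvent[of "real (Suc n)"] of_nat_0_less_iff zero_less_Suc)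
       (simp add: divide_simps)
  finally show ?case .
qed auto

text \<open>In the product rule one factor x . g y is replaced by x . g h, which has no
  \<open>y\<close> to be bounded with; hence the additional hypothesis that the norm of
  \<open>x\<close> alone is at most \<kappa>.\<close>

lemma kder_bound:
  assumes "norm x \<le> \<kappa>" "norm x * norm y \<le> \<kappa>"
  shows "\<bar>kder n x y h\<bar> \<le> real n * (\<kappa> ^ n / fact n) * norm h"
  using assms
proof (induction n arbitrary: y h)
  case (Suc n)
  have \<kappa>: "\<kappa> \<ge> 0" using Suc.prems(1) by (rule order_trans[rotated]) simp
  let ?c = "\<kappa> ^ n / fact n"
  have c: "?c \<ge> 0" using \<kappa> by simp
  have "\<bar>kder (Suc n) x y h\<bar> \<le> (\<Sum>g\<in>G. \<bar>resolvent (real (Suc n)) g *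
     ((x \<bullet> g h) * kco n x (g y) + (x \<bullet> g y) * kder n x (g y) (g h))\<bar>)"
    unfolding kder.simps by (rule sum_abs)
  also have "\<dots> \<le> (\<Sum>g\<in>G. resolvent (real (Suc n)) g * (\<kappa> * norm h * ?c + \<kappa> * (real n * ?c * norm h)))"
  proof (rule sum_mono)
    fix g assume g: "g \<in> G"
    have 1: "\<bar>x \<bullet> g y\<bar> \<le> \<kappa>"
      using Cauchy_Schwarz_ineq2[of x "g y"] Suc.prems by (simp add: G_norm[OF g])
    have 2: "\<bar>x \<bullet> g h\<bar> \<le> \<kappa> * norm h"
      using Cauchy_Schwarz_ineq2[of x "g h"] mult_right_mono[OF Suc.prems(1) norm_ge_zero[of h]]
      by (simp add: G_norm[OF g])
    have 3: "\<bar>kco n x (g y)\<bar> \<le> ?c" by (rule kco_bound) (use Suc.prems in \<open>simp add: G_norm[OF g]\<close>)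
    have 4: "\<bar>kder n x (g y) (g h)\<bar> \<le> real n * ?c * norm h"
      using Suc.IH[of "g y" "g h"] Suc.prems by (simp add: G_norm[OF g])
    have "\<bar>(x \<bullet> g h) * kco n x (g y) + (x \<bullet> g y) * kder n x (g y) (g h)\<bar>
       \<le> \<bar>x \<bullet> g h\<bar> * \<bar>kco n x (g y)\<bar> + \<bar>x \<bullet> g y\<bar> * \<bar>kder n x (g y) (g h)\<bar>"
      by (metis abs_mult abs_triangle_ineq)
    also have "\<dots> \<le> \<kappa> * norm h * ?c + \<kappa> * (real n * ?c * norm h)"
      using 1 2 3 4 \<kappa> by (intro add_mono mult_mono) auto
    finally show "\<bar>resolvent (real (Suc n)) g *
       ((x \<bullet> g h) * kco n x (g y) + (x \<bullet> g y) * kder n x (g y) (g h))\<bar>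
       \<le> resolvent (real (Suc n)) g * (\<kappa> * norm h * ?c + \<kappa> * (real n * ?c * norm h))"
      using resolvent_nonneg[of "real (Suc n)" g] by (simp only: abs_mult) (intro mult_mono, auto)
  qed
  also have "\<dots> = real (Suc n) * (\<kappa> ^ Suc n / fact (Suc n)) * norm h"
    by (simp only: sum_distrib_right[symmetric] sum_resolvent[of "real (Suc n)"] of_nat_0_less_iff zero_less_Suc)
       (simp add: field_simps)
  finally show ?case .
qed auto

lemma kco_has_derivative: "(kco n x has_derivative kder n x y) (at y)"
proof (induction n arbitrary: y)
  case (Suc n)
  have g: "(g has_derivative g) (at y)" if "g \<in> G" for g
    using G_linear[OF that] linear_conv_bounded_linear bounded_linear_imp_has_derivative by blast
  have "((\<lambda>y. kco n x (g y)) has_derivative (\<lambda>h. kder n x (g y) (g h))) (at y)" if "g \<in> G" for g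
    using has_derivative_compose[OF g[OF that] Suc] .
  then have "((\<lambda>y. \<Sum>g\<in>G. resolvent (real (Suc n)) g * ((x \<bullet> g y) * kco n x (g y))) has_derivative
     (\<lambda>h. \<Sum>g\<in>G. resolvent (real (Suc n)) g * ((x \<bullet> g h) * kco n x (g y) + (x \<bullet> g y) * kder n x (g y) (g h)))) (at y)"
    by (auto intro!: has_derivative_sum derivative_eq_intros g simp: algebra_simps)
  then show ?case by (simp only: kco.simps[abs_def] kder.simps[abs_def])
next
  case 0
  then show ?case by (simp add: kco.simps[abs_def] kder.simps[abs_def])
qed

lemma G_continuous: "g \<in> G \<Longrightarrow> continuous_on S g"
  using G_linear linear_conv_bounded_linear linear_continuous_on by blast

lemma continuous_kco: "continuous_on UNIV (\<lambda>p. kco n (fst p) (snd p))"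
proof (induction n)
  case (Suc n)
  have 0: "continuous_on UNIV (\<lambda>p::(real^'n) \<times> (real^'n). g (snd p))" if "g \<in> G" for g
    by (rule continuous_on_compose2[OF G_continuous[OF that, of UNIV] continuous_on_snd[OF continuous_on_id]]) auto
  have 1: "continuous_on UNIV (\<lambda>p. kco n (fst p) (g (snd p)))" if "g \<in> G" for g
    using continuous_on_compose2[OF Suc continuous_on_Pair[OF continuous_on_fst[OF continuous_on_id] 0[OF that]]]
    by simp
  show ?case unfolding kco.simps
    by (intro continuous_on_sum continuous_on_mult continuous_on_const continuous_on_inner
        continuous_on_fst continuous_on_id 0 1)
qed auto

lemma continuous_kder: "continuous_on UNIV (\<lambda>y. kder n x y h)"
proof (induction n arbitrary: h)
  case (Suc n)
  have 1: "continuous_on UNIV (\<lambda>y. kder n x (g y) (g h))" if "g \<in> G" for g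
    by (rule continuous_on_compose2[OF Suc G_continuous[OF that, of UNIV]]) auto
  have c: "continuous_on UNIV (kco n x)"
    by (intro continuous_at_imp_continuous_on ballI has_derivative_continuous[OF kco_has_derivative])
  have 2: "continuous_on UNIV (\<lambda>y. kco n x (g y))" if "g \<in> G" for g
    by (rule continuous_on_compose2[OF c G_continuous[OF that, of UNIV]]) auto
  show ?case unfolding kder.simps
    by (intro continuous_on_sum continuous_on_mult continuous_on_const continuous_on_inner continuous_on_add
        G_continuous 1 2)
qed auto

section \<open>The Dunkl gradient of the homogeneous components off the hyperplanes\<close>

definition regular :: "real^'n \<Rightarrow> bool" where
  "regular y \<longleftrightarrow> (\<forall>v\<in>Rp. v \<bullet> y \<noteq> 0)"

lemma regular_G: 
  assumes g: "g \<in> G" and y: "regular y" shows "regular (g y)"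
proof -
  have *: "g ` R = R" "\<And>v. v \<in> R \<Longrightarrow> inv g v \<in> R" if "g \<in> G" for g
    using G_image_R that refl_group.inverse[OF that] by auto
  show ?thesis unfolding regular_def
  proof
    fix v assume v: "v \<in> Rp"
    have "inv g v \<in> R" using *(2)[OF g RpD[OF v]] .
    then have "inv g v \<bullet> y \<noteq> 0" using y Rp_cases[of "inv g v"] by (auto simp: regular_def)
    then show "v \<bullet> g y \<noteq> 0" by (simp add: G_inner[OF g])
  qed
qed

text \<open>The difference part of all Dunkl operators at once, as a vector: its component
  \<open>j\<close> is the sum occurring in T_j. As a vector it transforms simply under reflections
  (\<open>dquot_refl\<close>). The division is meant for regular points only.\<close>

definition dquot :: "(real^'n \<Rightarrow> real) \<Rightarrow> real^'n \<Rightarrow> real^'n" where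
  "dquot p y = (\<Sum>v\<in>Rp. k v *\<^sub>R (((p y - p (root_refl v y)) / (v \<bullet> y)) *\<^sub>R v))"

lemma dquot_refl:
  assumes "u \<in> Rp"
  shows "dquot (\<lambda>y. p (root_refl u y)) y = root_refl u (dquot p (root_refl u y))"
proof -
  define F where "F v = ((p (root_refl u y) - p (root_refl v (root_refl u y))) / (v \<bullet> root_refl u y)) *\<^sub>R v" for v
  have "dquot p (root_refl u y) = (\<Sum>v\<in>Rp. k v *\<^sub>R F v)"
    by (simp add: dquot_def F_def)
  also have "\<dots> = (\<Sum>v\<in>Rp. k v *\<^sub>R F (root_refl u v))"
    by (rule sum_Rp_refl[symmetric]) (auto simp: RpD[OF assms] F_def root_refl_uminus_root)
  finally have "root_refl u (dquot p (root_refl u y)) = (\<Sum>v\<in>Rp. k v *\<^sub>R root_refl u (F (root_refl u v)))"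
    by (simp add: root_refl_sum root_refl_scaleR)
  also have "\<dots> = dquot (\<lambda>y. p (root_refl u y)) y"
    unfolding dquot_def F_def
    by (intro sum.cong) (simp_all add: root_refl_scaleR root_refl_conjugate[of u] inner_root_refl)
  finally show ?thesis by simp
qed

text \<open>The linear factor x . y is not invariant: reflecting \<open>y\<close> changes it by a
  multiple of v . y, which cancels the denominator and leaves the second sum as the defect of the
  product rule.\<close>

lemma dquot_mult:
  assumes "regular y"
  shows "dquot (\<lambda>y. (x \<bullet> y) * p y) y =
    (x \<bullet> y) *\<^sub>R dquot p y + (\<Sum>v\<in>Rp. k v *\<^sub>R ((2 * (x \<bullet> v) / (norm v)\<^sup>2 * p (root_refl v y)) *\<^sub>R v))"
proof -
  have "k v *\<^sub>R ((((x \<bullet> y) * p y - (x \<bullet> root_refl v y) * p (root_refl v y)) / (v \<bullet> y)) *\<^sub>R v)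
     = (x \<bullet> y) *\<^sub>R (k v *\<^sub>R (((p y - p (root_refl v y)) / (v \<bullet> y)) *\<^sub>R v))
       + k v *\<^sub>R ((2 * (x \<bullet> v) / (norm v)\<^sup>2 * p (root_refl v y)) *\<^sub>R v)" if "v \<in> Rp" for v
  proof -
    have nz: "v \<bullet> y \<noteq> 0" using assms that by (auto simp: regular_def)
    define A where "A = 2 * (x \<bullet> v) / (norm v)\<^sup>2"
    have eq: "x \<bullet> root_refl v y = x \<bullet> y - (v \<bullet> y) * A"
      by (simp add: A_def root_refl_def inner_diff_right inner_commute)
    have "((x \<bullet> y) * p y - (x \<bullet> root_refl v y) * p (root_refl v y)) / (v \<bullet> y)
      = (x \<bullet> y) * ((p y - p (root_refl v y)) / (v \<bullet> y)) + A * p (root_refl v y)"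
      unfolding eq using nz by (simp add: field_simps)
    then have "((x \<bullet> y) * p y - (x \<bullet> root_refl v y) * p (root_refl v y)) / (v \<bullet> y)
      = (x \<bullet> y) * ((p y - p (root_refl v y)) / (v \<bullet> y)) + 2 * (x \<bullet> v) / (norm v)\<^sup>2 * p (root_refl v y)"
      by (simp only: A_def)
    then show ?thesis by (simp add: algebra_simps)
  qed
  then show ?thesis unfolding dquot_def by (simp add: sum.distrib scaleR_sum_right)
qed

definition kgrad :: "nat \<Rightarrow> real^'n \<Rightarrow> real^'n \<Rightarrow> real^'n" where
  "kgrad n x y = (\<chi> j. kder n x y (axis j 1))"

lemma kder_eq_inner: "kder n x y h = kgrad n x y \<bullet> h"
proof -
  have "linear (kder n x y)" by (rule has_derivative_linear[OF kco_has_derivative])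
  then have "kder n x y h = (\<Sum>j\<in>UNIV. h $ j *\<^sub>R kder n x y (axis j 1))" by (rule linear_eq_sum_axis)
  then show ?thesis by (simp add: kgrad_def inner_vec_def mult.commute)
qed

text \<open>The derivative of \<open>kco_eq\<close> in \<open>y\<close>. The reflection inside the
  argument also acts on the gradient, being its own adjoint.\<close>

lemma kgrad_eq:
  "(real (Suc n) + \<gamma>) *\<^sub>R kgrad (Suc n) x y - (\<Sum>v\<in>Rp. k v *\<^sub>R root_refl v (kgrad (Suc n) x (root_refl v y)))
    = kco n x y *\<^sub>R x + (x \<bullet> y) *\<^sub>R kgrad n x y"
proof -
  have rd: "(root_refl v has_derivative root_refl v) (at y)" for v y
    using linear_root_refl linear_conv_bounded_linear bounded_linear_imp_has_derivative by blast
  have 1: "((\<lambda>y. kco (Suc n) x (root_refl v y)) has_derivative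
      (\<lambda>h. kder (Suc n) x (root_refl v y) (root_refl v h))) (at y)" for v
    by (rule has_derivative_compose[OF rd kco_has_derivative])
  have "((\<lambda>y. (real (Suc n) + \<gamma>) * kco (Suc n) x y - (\<Sum>v\<in>Rp. k v * kco (Suc n) x (root_refl v y)))
    has_derivative (\<lambda>h. (real (Suc n) + \<gamma>) * kder (Suc n) x y h
       - (\<Sum>v\<in>Rp. k v * kder (Suc n) x (root_refl v y) (root_refl v h)))) (at y)"
    by (intro has_derivative_diff has_derivative_mult_right has_derivative_sum kco_has_derivative 1)
  then have "((\<lambda>y. (x \<bullet> y) * kco n x y) has_derivative (\<lambda>h. (real (Suc n) + \<gamma>) * kder (Suc n) x y h
       - (\<Sum>v\<in>Rp. k v * kder (Suc n) x (root_refl v y) (root_refl v h)))) (at y)"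
    by (simp only: kco_eq)
  moreover have "((\<lambda>y. (x \<bullet> y) * kco n x y) has_derivative
      (\<lambda>h. (x \<bullet> h) * kco n x y + (x \<bullet> y) * kder n x y h)) (at y)"
    by (auto intro!: derivative_eq_intros kco_has_derivative simp: algebra_simps)
  ultimately have eq: "(real (Suc n) + \<gamma>) * kder (Suc n) x y h
       - (\<Sum>v\<in>Rp. k v * kder (Suc n) x (root_refl v y) (root_refl v h))
      = (x \<bullet> h) * kco n x y + (x \<bullet> y) * kder n x y h" for h
    using has_derivative_unique by (metis (mono_tags, lifting))
  show ?thesis
  proof (rule vector_eq_rdot[THEN iffD1], rule allI)
    fix h
    show "((real (Suc n) + \<gamma>) *\<^sub>R kgrad (Suc n) x y
        - (\<Sum>v\<in>Rp. k v *\<^sub>R root_refl v (kgrad (Suc n) x (root_refl v y)))) \<bullet> h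
      = (kco n x y *\<^sub>R x + (x \<bullet> y) *\<^sub>R kgrad n x y) \<bullet> h"
      using eq[of h] unfolding kder_eq_inner
      by (simp add: inner_diff_left inner_add_left inner_sum_left inner_root_refl mult.commute)
  qed
qed

text \<open>This is T_j p_(n+1) = x_j p_n in vector form. The resolvent equation gives at first only
  the contraction of this identity with \<open>y\<close>. To recover the full gradient, the defect
  of the identity is shown to satisfy a homogeneous resolvent equation, which has only the zero
  solution.\<close>

lemma kco_dunkl:
  assumes "regular y"
  shows "kgrad (Suc n) x y + dquot (kco (Suc n) x) y = kco n x y *\<^sub>R x"
  using assms
proof (induction n arbitrary: y)
  \<comment> \<open>The step uses degree \<open>n\<close> only after multiplication by x . y, and
    with \<open>kco_eq\<close> already inserted on the right. In this shape the hypothesis also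
    makes sense for n = 0, where both sides vanish.\<close>
  have main: "kgrad (Suc n) x y + dquot (kco (Suc n) x) y = kco n x y *\<^sub>R x"
    if IH: "\<And>y. regular y \<Longrightarrow> (x \<bullet> y) *\<^sub>R (kgrad n x y + dquot (kco n x) y) =
      ((real n + \<gamma>) * kco n x y - (\<Sum>v\<in>Rp. k v * kco n x (root_refl v y))) *\<^sub>R x"
      and reg: "regular y" for n y
  proof -
    define q where "q y = kgrad (Suc n) x y + dquot (kco (Suc n) x) y - kco n x y *\<^sub>R x" for y
    \<comment> \<open>Here the reflections act on the values of the defect as well as on its
      argument. They are isometries, so the maximum principle still applies to the norm.\<close>
    have q: "(real (Suc n) + \<gamma>) *\<^sub>R q z = (\<Sum>v\<in>Rp. k v *\<^sub>R root_refl v (q (root_refl v z)))"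
      if z: "regular z" for z
    proof -
      have lin: "dquot (\<lambda>y. (real (Suc n) + \<gamma>) * kco (Suc n) x y - (\<Sum>v\<in>Rp. k v * kco (Suc n) x (root_refl v y))) z
         = (real (Suc n) + \<gamma>) *\<^sub>R dquot (kco (Suc n) x) z
           - (\<Sum>v\<in>Rp. k v *\<^sub>R dquot (\<lambda>y. kco (Suc n) x (root_refl v y)) z)"
      proof -
        have 1: "dquot (\<lambda>y. a y - b y) z = dquot a z - dquot b z" for a b
          by (simp add: dquot_def sum_subtractf[symmetric] diff_divide_distrib add_divide_distrib algebra_simps)
        have 2: "dquot (\<lambda>y. c * a y) z = c *\<^sub>R dquot a z" for c a
          by (simp add: dquot_def scaleR_sum_right mult.left_commute flip: right_diff_distrib)
        have 3: "dquot (\<lambda>y. \<Sum>v\<in>A. a v y) z = (\<Sum>v\<in>A. dquot (a v) z)" for a and A :: "(real^'n) set"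
          unfolding dquot_def by (subst sum.swap)
            (simp add: sum_subtractf[symmetric] sum_divide_distrib scaleR_sum_left scaleR_sum_right)
        show ?thesis by (simp only: 1 2 3)
      qed
      have "(real (Suc n) + \<gamma>) *\<^sub>R dquot (kco (Suc n) x) z
           - (\<Sum>v\<in>Rp. k v *\<^sub>R root_refl v (dquot (kco (Suc n) x) (root_refl v z)))
         = (x \<bullet> z) *\<^sub>R dquot (kco n x) z
           + (\<Sum>v\<in>Rp. k v *\<^sub>R ((2 * (x \<bullet> v) / (norm v)\<^sup>2 * kco n x (root_refl v z)) *\<^sub>R v))"
      proof -
        have "(\<Sum>v\<in>Rp. k v *\<^sub>R root_refl v (dquot (kco (Suc n) x) (root_refl v z)))
          = (\<Sum>v\<in>Rp. k v *\<^sub>R dquot (\<lambda>y. kco (Suc n) x (root_refl v y)) z)"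
          by (intro sum.cong HOL.refl) (simp only: dquot_refl[of _ "kco (Suc n) x"])
        then show ?thesis
          using lin dquot_mult[OF z, of x "kco n x"] by (simp only: kco_eq)
      qed
      note eq2 = this
      have aux: "a1 - b1 = c1 \<Longrightarrow> a2 - b2 = c2 \<Longrightarrow> a1 + a2 - (b1 + b2) = c1 + c2"
        for a1 a2 b1 b2 c1 c2 :: "real^'n"
        by (metis add_diff_add)
      from aux[OF kgrad_eq[of n x z] eq2] have
        "(real (Suc n) + \<gamma>) *\<^sub>R (kgrad (Suc n) x z + dquot (kco (Suc n) x) z)
         - (\<Sum>v\<in>Rp. k v *\<^sub>R root_refl v (kgrad (Suc n) x (root_refl v z) + dquot (kco (Suc n) x) (root_refl v z)))
         = kco n x z *\<^sub>R x + (x \<bullet> z) *\<^sub>R (kgrad n x z + dquot (kco n x) z)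
           + (\<Sum>v\<in>Rp. k v *\<^sub>R ((2 * (x \<bullet> v) / (norm v)\<^sup>2 * kco n x (root_refl v z)) *\<^sub>R v))"
        by (simp add: scaleR_add_right linear_add[OF linear_root_refl] sum.distrib del: kco.simps of_nat_Suc)
      \<comment> \<open>Reflecting the constant vector \<open>x\<close> subtracts 2 (x . v) / |v|^2
        times \<open>v\<close>; these are exactly the defect terms contributed by
        \<open>dquot_mult\<close>.\<close>
      also have "\<dots> = (real (Suc n) + \<gamma>) *\<^sub>R (kco n x z *\<^sub>R x)
          - (\<Sum>v\<in>Rp. k v *\<^sub>R root_refl v (kco n x (root_refl v z) *\<^sub>R x))"
      proof -
        have "(\<Sum>v\<in>Rp. k v *\<^sub>R root_refl v (kco n x (root_refl v z) *\<^sub>R x))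
          = (\<Sum>v\<in>Rp. (k v * kco n x (root_refl v z)) *\<^sub>R x)
           - (\<Sum>v\<in>Rp. k v *\<^sub>R ((2 * (x \<bullet> v) / (norm v)\<^sup>2 * kco n x (root_refl v z)) *\<^sub>R v))"
          by (simp add: root_refl_scaleR root_refl_def sum_subtractf[symmetric] algebra_simps)
        then show ?thesis
          unfolding IH[OF z] by (simp add: scaleR_left_diff_distrib scaleR_sum_left algebra_simps)
      qed
      finally show ?thesis
        unfolding q_def
        by (simp add: scaleR_diff_right root_refl_diff sum_subtractf algebra_simps del: kco.simps of_nat_Suc)
    qed
    have "norm (q y) = 0"
    proof (rule max_principle[of "real (Suc n)" "\<lambda>y. norm (q y)"])
      fix g assume g: "g \<in> G"
      have "(real (Suc n) + \<gamma>) * norm (q (g y)) = norm ((real (Suc n) + \<gamma>) *\<^sub>R q (g y))"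
        using gamma_nonneg by simp
      also have "\<dots> \<le> (\<Sum>v\<in>Rp. norm (k v *\<^sub>R root_refl v (q (root_refl v (g y)))))"
        unfolding q[OF regular_G[OF g reg]] by (rule norm_sum)
      also have "\<dots> = (\<Sum>v\<in>Rp. k v * norm (q (root_refl v (g y))))"
        by (intro sum.cong) (auto simp: k_nonneg_Rp)
      finally show "(real (Suc n) + \<gamma>) * norm (q (g y)) \<le> (\<Sum>v\<in>Rp. k v * norm (q (root_refl v (g y))))" .
    qed auto
    then show ?thesis by (simp add: q_def)
  qed
  case 0
  show ?case
  proof (rule main[OF _ 0])
    fix y
    have "kgrad 0 x y = 0" by (simp add: kgrad_def vec_eq_iff)
    moreover have "dquot (kco 0 x) y = 0" by (simp add: dquot_def)
    ultimately show "(x \<bullet> y) *\<^sub>R (kgrad 0 x y + dquot (kco 0 x) y) =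
      ((real 0 + \<gamma>) * kco 0 x y - (\<Sum>v\<in>Rp. k v * kco 0 x (root_refl v y))) *\<^sub>R x"
      by (simp add: dunkl_gamma_def)
  qed
  case (Suc n)
  show ?case
  proof (rule main[OF _ Suc.prems])
    fix y assume "regular y"
    from Suc.IH[OF this] show "(x \<bullet> y) *\<^sub>R (kgrad (Suc n) x y + dquot (kco (Suc n) x) y) =
      ((real (Suc n) + \<gamma>) * kco (Suc n) x y - (\<Sum>v\<in>Rp. k v * kco (Suc n) x (root_refl v y))) *\<^sub>R x"
      unfolding kco_eq by (simp del: kco.simps)
  qed
qed

declare kco.simps(2) [simp del] kder.simps(2) [simp del]

end

section \<open>The Dunkl kernel at imaginary arguments\<close>

definition C1 :: "(real^'n \<Rightarrow> complex) \<Rightarrow> bool" where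
  "C1 f \<longleftrightarrow> (\<forall>x. f differentiable (at x)) \<and> (\<forall>j. continuous_on UNIV (partial_deriv j f))"

lemma C1I:
  assumes "\<And>x. (f has_derivative D x) (at x)" "\<And>j. continuous_on UNIV (\<lambda>x. D x (axis j 1))"
  shows "C1 f"
proof -
  have "partial_deriv j f = (\<lambda>x. D x (axis j 1))" for j
    by (rule ext) (rule partial_deriv_eqI[OF assms(1)])
  then show ?thesis using assms by (auto simp: C1_def differentiable_def)
qed

lemma C1_has_derivative:
  "C1 f \<Longrightarrow> (f has_derivative (\<lambda>h. \<Sum>j\<in>UNIV. h $ j *\<^sub>R partial_deriv j f x)) (at x)"
  by (intro differentiable_has_derivative_partial) (auto simp: C1_def)

lemma C1_continuous: "C1 f \<Longrightarrow> continuous_on UNIV f"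
  unfolding C1_def by (auto intro!: continuous_at_imp_continuous_on differentiable_imp_continuous_within)

lemma C1_continuous_partial: "C1 f \<Longrightarrow> continuous_on UNIV (partial_deriv j f)"
  by (simp add: C1_def)

definition dir_deriv :: "real^'n \<Rightarrow> (real^'n \<Rightarrow> complex) \<Rightarrow> real^'n \<Rightarrow> complex" where
  "dir_deriv v f x = (\<Sum>j\<in>UNIV. (v $ j) *\<^sub>R partial_deriv j f x)"

text \<open>The mean over the segment from \<open>x\<close> to its reflection; the difference quotient of \<open>f\<close> is
  such a mean (with \<open>m = 0\<close>) of a directional derivative, and the powers \<open>s ^ m\<close> arise when
  these means are differentiated.\<close>

definition refl_mean :: "real^'n \<Rightarrow> nat \<Rightarrow> (real^'n \<Rightarrow> complex) \<Rightarrow> real^'n \<Rightarrow> complex" where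
  "refl_mean v m f x =
     integral {0..1} (\<lambda>s. s ^ m *\<^sub>R f (x - (s * (2 * (x \<bullet> v) / (norm v)\<^sup>2)) *\<^sub>R v))"

lemma continuous_refl_segment:
  "continuous_on A (\<lambda>(x, s). x - (s * (2 * (x \<bullet> v) / (norm v)\<^sup>2)) *\<^sub>R v)"
  unfolding case_prod_beta divide_inverse by (intro continuous_intros)

lemma continuous_refl_integrand:
  fixes f :: "real^'n \<Rightarrow> complex"
  assumes "continuous_on UNIV f"
  shows "continuous_on A (\<lambda>(x, s). s ^ m *\<^sub>R f (x - (s * (2 * (x \<bullet> v) / (norm v)\<^sup>2)) *\<^sub>R v))"
proof -
  have "continuous_on A (\<lambda>p. f ((\<lambda>(x, s). x - (s * (2 * (x \<bullet> v) / (norm v)\<^sup>2)) *\<^sub>R v) p))"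
    by (rule continuous_on_compose2[OF assms continuous_refl_segment]) auto
  from continuous_on_scaleR[OF continuous_on_power[OF continuous_on_snd[OF continuous_on_id]] this]
  show ?thesis unfolding case_prod_beta .
qed

lemma continuous_refl_integrand1:
  fixes f :: "real^'n \<Rightarrow> complex"
  assumes "continuous_on UNIV f"
  shows "continuous_on A (\<lambda>s. s ^ m *\<^sub>R f (x - (s * (2 * (x \<bullet> v) / (norm v)\<^sup>2)) *\<^sub>R v))"
proof -
  have "continuous_on A (\<lambda>s. (\<lambda>(x, s). s ^ m *\<^sub>R f (x - (s * (2 * (x \<bullet> v) / (norm v)\<^sup>2)) *\<^sub>R v)) (x, s))"
    by (rule continuous_on_compose2[OF continuous_refl_integrand[OF assms, of UNIV m v]])
       (auto intro!: continuous_intros)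
  then show ?thesis by simp
qed

lemma continuous_refl_mean:
  assumes "continuous_on UNIV f" shows "continuous_on UNIV (refl_mean v m f)"
  unfolding refl_mean_def[abs_def] box_real[symmetric]
  by (rule integral_continuous_on_param) (rule continuous_refl_integrand[OF assms])

lemma continuous_dir_deriv: "C1 f \<Longrightarrow> continuous_on UNIV (dir_deriv v f)"
  unfolding dir_deriv_def[abs_def] by (intro continuous_intros C1_continuous_partial)

text \<open>The fundamental theorem of calculus on the segment from \<open>x\<close> to its
  reflection, whose direction is a multiple of \<open>v\<close>.\<close>

lemma refl_difference:
  assumes "C1 f"
  shows "f x - f (root_refl v x) = (2 * (x \<bullet> v) / (norm v)\<^sup>2) *\<^sub>R refl_mean v 0 (dir_deriv v f) x"
proof -
  define c where "c = 2 * (x \<bullet> v) / (norm v)\<^sup>2"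
  let ?p = "\<lambda>s::real. x - (s * c) *\<^sub>R v"
  have "((\<lambda>s. f (?p s)) has_vector_derivative (- c) *\<^sub>R dir_deriv v f (?p s)) (at s within {0..1})" for s
  proof -
    have "(?p has_derivative (\<lambda>t. - (t * c) *\<^sub>R v)) (at s within {0..1})"
      by (auto intro!: derivative_eq_intros)
    from has_derivative_compose[OF this C1_has_derivative[OF assms]]
    have "((\<lambda>s. f (?p s)) has_derivative
       (\<lambda>t. \<Sum>j\<in>UNIV. (- (t * c) *\<^sub>R v) $ j *\<^sub>R partial_deriv j f (?p s))) (at s within {0..1})" .
    then show ?thesis
      unfolding has_vector_derivative_def dir_deriv_def
      by (simp add: scaleR_sum_right sum_negf mult.assoc)
  qed
  then have "((\<lambda>s. (- c) *\<^sub>R dir_deriv v f (?p s)) has_integral (f (?p 1) - f (?p 0))) {0..1}"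
    by (intro fundamental_theorem_of_calculus) auto
  then have "f (?p 1) - f (?p 0) = integral {0..1} (\<lambda>s. (- c) *\<^sub>R dir_deriv v f (?p s))"
    by (rule integral_unique[symmetric])
  also have "\<dots> = (- c) *\<^sub>R integral {0..1} (\<lambda>s. dir_deriv v f (?p s))"
    by (rule integral_cmul)
  finally have "f (?p 1) - f (?p 0) = (- c) *\<^sub>R refl_mean v 0 (dir_deriv v f) x"
    by (simp add: refl_mean_def c_def)
  moreover have "?p 1 = root_refl v x" "?p 0 = x"
    by (simp_all add: root_refl_def c_def)
  ultimately have "f (root_refl v x) - f x = (- c) *\<^sub>R refl_mean v 0 (dir_deriv v f) x" by simp
  then show ?thesis unfolding c_def by (simp add: algebra_simps)
qed

text \<open>Off the hyperplane this is \<open>refl_difference\<close> divided by v . x. The mean is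
  continuous everywhere, hence it also computes the limit that defines the quotient on the
  hyperplane.\<close>

lemma dunkl_quotient_eq_mean:
  assumes "C1 f" "v \<noteq> 0"
  shows "dunkl_quotient v f x = (2 / (norm v)\<^sup>2) *\<^sub>R refl_mean v 0 (dir_deriv v f) x"
proof -
  let ?H = "\<lambda>x. (2 / (norm v)\<^sup>2) *\<^sub>R refl_mean v 0 (dir_deriv v f) x"
  have eq: "(f y - f (root_refl v y)) / of_real (v \<bullet> y) = ?H y" if "v \<bullet> y \<noteq> 0" for y
    using that by (simp add: refl_difference[OF assms(1)] scaleR_conv_of_real inner_commute)
  show ?thesis
  proof (cases "v \<bullet> x = 0")
    case True
    let ?S = "{y. v \<bullet> y \<noteq> 0}"
    have "continuous_on UNIV ?H"
      by (intro continuous_intros continuous_refl_mean continuous_dir_deriv assms)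
    then have "(?H \<longlongrightarrow> ?H x) (at x within ?S)"
      by (metis UNIV_I continuous_on_def subset_UNIV tendsto_within_subset)
    then have lim: "((\<lambda>y. (f y - f (root_refl v y)) / of_real (v \<bullet> y)) \<longlongrightarrow> ?H x) (at x within ?S)"
      by (rule Lim_transform_eventually) (auto simp: eventually_at_filter eq)
    \<comment> \<open>\<open>Lim\<close> is determined only along a nontrivial filter: points of the
      hyperplane must be accumulated by its complement, which follows by moving along
      \<open>v\<close>.\<close>
    have "x islimpt ?S"
      unfolding islimpt_approachable
    proof (intro allI impI)
      fix e :: real assume "e > 0"
      let ?y = "x + (e / (2 * norm v)) *\<^sub>R v"
      have "v \<bullet> ?y \<noteq> 0" using True assms(2) \<open>e > 0\<close> by (simp add: inner_add_right)
      moreover have "?y \<noteq> x" "dist ?y x < e" using assms(2) \<open>e > 0\<close> by (auto simp: dist_norm)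
      ultimately show "\<exists>y\<in>?S. y \<noteq> x \<and> dist y x < e" by blast
    qed
    then have "\<not> trivial_limit (at x within ?S)" by (simp add: trivial_limit_within)
    from tendsto_Lim[OF this lim] show ?thesis using True by (simp add: dunkl_quotient_def)
  qed (simp add: dunkl_quotient_def eq)
qed

lemma continuous_dunkl_quotient:
  assumes "C1 f" "v \<noteq> 0" shows "continuous_on UNIV (dunkl_quotient v f)"
  unfolding dunkl_quotient_eq_mean[OF assms, abs_def]
  by (intro continuous_intros continuous_refl_mean continuous_dir_deriv assms)

lemma inner_dunkl_quotient:
  "of_real (v \<bullet> x) * dunkl_quotient v f x = f x - f (root_refl v x)"
  by (cases "v \<bullet> x = 0") (simp_all add: dunkl_quotient_def root_refl_fixed inner_commute)

context dunkl
begin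

abbreviation T :: "'n \<Rightarrow> (real^'n \<Rightarrow> complex) \<Rightarrow> real^'n \<Rightarrow> complex" where
  "T \<equiv> dunkl_op Rp k"

lemma continuous_dunkl_op: "C1 f \<Longrightarrow> continuous_on UNIV (T j f)"
  unfolding dunkl_op_def[abs_def]
  by (intro continuous_intros continuous_dunkl_quotient C1_continuous_partial Rp_nonzero)

lemma negligible_not_regular: "negligible {y. \<not> regular y}"
proof -
  have "{y. \<not> regular y} = (\<Union>v\<in>Rp. {y. v \<bullet> y = 0})" by (auto simp: regular_def)
  then show ?thesis using Rp_nonzero by (auto intro!: negligible_Union negligible_hyperplane)
qed

text \<open>Two continuous functions differ on an open set; contained in finitely many hyperplanes
  it is negligible, hence empty.\<close>

lemma eq_of_eq_regular:
  fixes f g :: "real^'n \<Rightarrow> complex"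
  assumes "continuous_on UNIV f" "continuous_on UNIV g" "\<And>y. regular y \<Longrightarrow> f y = g y"
  shows "f x = g x"
proof (rule ccontr)
  assume ne: "f x \<noteq> g x"
  have "closed {y. f y = g y}" using assms(1,2) by (intro closed_Collect_eq)
  then have "open {y. f y \<noteq> g y}" by (simp add: open_closed Compl_eq)
  moreover have "negligible {y. f y \<noteq> g y}"
    by (rule negligible_subset[OF negligible_not_regular]) (use assms(3) in auto)
  ultimately show False using open_not_negligible ne by blast
qed

text \<open>Contracting the Dunkl gradient with \<open>y\<close> cancels every denominator v . y.
  What is left are the radial derivative and plain differences, without any limit, so it holds on
  the hyperplanes too.\<close>

lemma euler_dunkl:
  "(\<Sum>j\<in>UNIV. y $ j *\<^sub>R T j f y)
    = (\<Sum>j\<in>UNIV. y $ j *\<^sub>R partial_deriv j f y) + (\<Sum>v\<in>Rp. k v *\<^sub>R (f y - f (root_refl v y)))"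
proof -
  have "(\<Sum>j\<in>UNIV. y $ j *\<^sub>R (\<Sum>v\<in>Rp. of_real (k v * v $ j) * dunkl_quotient v f y))
     = (\<Sum>v\<in>Rp. \<Sum>j\<in>UNIV. y $ j *\<^sub>R (of_real (k v * v $ j) * dunkl_quotient v f y))"
    unfolding scaleR_sum_right by (rule sum.swap)
  also have "\<dots> = (\<Sum>v\<in>Rp. k v *\<^sub>R (of_real (v \<bullet> y) * dunkl_quotient v f y))"
  proof (rule sum.cong[OF HOL.refl])
    fix v
    show "(\<Sum>j\<in>UNIV. y $ j *\<^sub>R (of_real (k v * v $ j) * dunkl_quotient v f y))
      = k v *\<^sub>R (of_real (v \<bullet> y) * dunkl_quotient v f y)"
      by (simp add: inner_vec_def scaleR_conv_of_real sum_distrib_left sum_distrib_right mult_ac)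
  qed
  finally show ?thesis
    by (simp add: dunkl_op_def scaleR_add_right sum.distrib inner_dunkl_quotient)
qed

section \<open>The kernel as a power series in its homogeneous components\<close>

definition kern :: "real^'n \<Rightarrow> real^'n \<Rightarrow> complex" where
  "kern x y = (\<Sum>n. \<i> ^ n * of_real (kco n x y))"

lemma norm_kern_term: "norm (\<i> ^ n * complex_of_real (kco n x y)) \<le> (norm x * norm y) ^ n / fact n"
  using kco_bound[of x y "norm x * norm y" n] by (simp add: norm_mult norm_power)

lemma summable_pow_fact: "summable (\<lambda>n. (c::real) ^ n / fact n)"
  using summable_exp[of c] by (simp add: field_simps)

lemma summable_kern: "summable (\<lambda>n. \<i> ^ n * complex_of_real (kco n x y))"
  by (rule summable_comparison_test'[OF summable_pow_fact[of "norm x * norm y"]])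
     (rule norm_kern_term)

lemma kern_scaleR_left: "kern (t *\<^sub>R x) y = kern x (t *\<^sub>R y)"
  by (simp add: kern_def kco_scaleR_left kco_scaleR_right)

lemma kern_commute: "kern x y = kern y x"
  unfolding kern_def by (subst kco_commute) simp

lemma kern_zero_right: "kern x 0 = 1"
proof -
  have "kco n x 0 = 0 ^ n * kco n x 0" for n
    using kco_scaleR_right[of n x 0 0] by simp
  then have "kco n x 0 = (if n = 0 then 1 else 0)" for n
    by (cases "n = 0") (simp, metis mult_zero_left power_0_left)
  then have "kern x 0 = (\<Sum>n. if n = 0 then 1 else 0)"
    unfolding kern_def by (intro suminf_cong) auto
  then show ?thesis using suminf_finite[of "{0}" "\<lambda>n::nat. if n = 0 then 1 else (0::complex)"] by simp
qed

lemma kern_zero_left: "kern 0 y = 1"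
  using kern_zero_right kern_commute by metis

lemma summable_nat_pow_fact: "summable (\<lambda>n. real n * ((c::real) ^ n / fact n))"
proof -
  have "summable (\<lambda>n. c * (c ^ n / fact n))" by (intro summable_mult summable_pow_fact)
  moreover have "c * (c ^ n / fact n) = real (Suc n) * (c ^ Suc n / fact (Suc n))" for n
    by (simp add: divide_simps)
  ultimately have "summable (\<lambda>n. real (Suc n) * (c ^ Suc n / fact (Suc n)))" by simp
  then show ?thesis by (subst (asm) summable_Suc_iff)
qed

lemma kder_bound_ball:
  assumes "norm y \<le> r" "r \<ge> 1"
  shows "norm (\<i> ^ n * complex_of_real (kder n x y h)) \<le> real n * ((norm x * r) ^ n / fact n) * norm h"
proof -
  have "norm x * 1 \<le> norm x * r" "norm x * norm y \<le> norm x * r"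
    using assms by (intro mult_left_mono; simp)+
  then show ?thesis
    using kder_bound[of x "norm x * r" y n h] by (simp add: norm_mult norm_power)
qed

lemma kern_has_derivative:
  "(kern x has_derivative (\<lambda>h. \<Sum>n. \<i> ^ n * of_real (kder n x y h))) (at y)"
  unfolding kern_def[abs_def]
proof (rule has_derivative_suminf[where S = "ball 0 (norm y + 1)"
      and M = "\<lambda>n. real n * ((norm x * (norm y + 1)) ^ n / fact n)"])
  show "((\<lambda>y. \<i> ^ n * complex_of_real (kco n x y)) has_derivative
      (\<lambda>h. \<i> ^ n * of_real (kder n x y h))) (at y)" for n y
    by (intro has_derivative_mult_right has_derivative_of_real kco_has_derivative)
  show "norm (\<i> ^ n * complex_of_real (kder n x z h))
      \<le> real n * ((norm x * (norm y + 1)) ^ n / fact n) * norm h"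
    if "z \<in> ball 0 (norm y + 1)" for n z h
    by (rule kder_bound_ball) (use that in auto)
qed (auto intro: summable_kern summable_nat_pow_fact simp del: times_divide_eq_right)

lemma partial_deriv_kern: "partial_deriv j (kern x) y = (\<Sum>n. \<i> ^ n * of_real (kgrad n x y $ j))"
  by (subst partial_deriv_eqI[OF kern_has_derivative]) (simp add: kgrad_def)

lemma summable_kgrad: "summable (\<lambda>n. \<i> ^ n * complex_of_real (kgrad n x y $ j))"
proof (rule summable_comparison_test'[OF summable_nat_pow_fact[of "norm x * (norm y + 1)"]])
  show "norm (\<i> ^ n * complex_of_real (kgrad n x y $ j)) \<le> real n * ((norm x * (norm y + 1)) ^ n / fact n)" for n
    using kder_bound_ball[of y "norm y + 1" n x "axis j 1"] by (simp add: kgrad_def norm_axis_1)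
qed

lemma C1_kern: "C1 (kern x)"
proof (rule C1I[OF kern_has_derivative])
  fix j
  have cont: "continuous_on (ball 0 r) (\<lambda>y. \<Sum>n. \<i> ^ n * complex_of_real (kder n x y (axis j 1)))"
    if "r \<ge> 1" for r
  proof (rule uniform_limit_theorem)
    show "uniform_limit (ball 0 r) (\<lambda>N y. \<Sum>n<N. \<i> ^ n * complex_of_real (kder n x y (axis j 1)))
        (\<lambda>y. \<Sum>n. \<i> ^ n * of_real (kder n x y (axis j 1))) sequentially"
    proof (rule Weierstrass_m_test[OF _ summable_nat_pow_fact[of "norm x * r"]])
      show "norm (\<i> ^ n * complex_of_real (kder n x y (axis j 1))) \<le> real n * ((norm x * r) ^ n / fact n)"
        if "y \<in> ball 0 r" for n y
        using kder_bound_ball[of y r n x "axis j 1"] that \<open>r \<ge> 1\<close> by (simp add: norm_axis_1)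
    qed
    show "\<forall>\<^sub>F N in sequentially. continuous_on (ball 0 r)
        (\<lambda>y. \<Sum>n<N. \<i> ^ n * complex_of_real (kder n x y (axis j 1)))"
      by (intro always_eventually allI continuous_intros continuous_on_subset[OF continuous_kder]) auto
  qed simp
  have "isCont (\<lambda>y. \<Sum>n. \<i> ^ n * complex_of_real (kder n x y (axis j 1))) y" for y
    by (rule continuous_on_interior[OF cont[of "norm y + 1"]]) auto
  then show "continuous_on UNIV (\<lambda>y. \<Sum>n. \<i> ^ n * complex_of_real (kder n x y (axis j 1)))"
    by (simp add: continuous_at_imp_continuous_on)
qed

text \<open>At a regular point the Dunkl operator is a finite combination of a derivative and point
  values, so it may be applied term by term and \<open>kco_dunkl\<close> lowers each degree by
  one.\<close>

lemma kern_dunkl_regular: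
  assumes "regular y" shows "T j (kern x) y = \<i> * of_real (x $ j) * kern x y"
proof -
  have q: "dunkl_quotient v (kern x) y = (\<Sum>n. \<i> ^ n * of_real ((kco n x y - kco n x (root_refl v y)) / (v \<bullet> y)))"
    and qs: "summable (\<lambda>n. \<i> ^ n * complex_of_real ((kco n x y - kco n x (root_refl v y)) / (v \<bullet> y)))"
    if "v \<in> Rp" for v
  proof -
    have nz: "v \<bullet> y \<noteq> 0" using assms that by (auto simp: regular_def)
    have eq: "(\<lambda>n. \<i> ^ n * complex_of_real ((kco n x y - kco n x (root_refl v y)) / (v \<bullet> y)))
      = (\<lambda>n. (\<i> ^ n * of_real (kco n x y) - \<i> ^ n * of_real (kco n x (root_refl v y))) / of_real (v \<bullet> y))"
      by (simp add: fun_eq_iff algebra_simps diff_divide_distrib)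
    show "summable (\<lambda>n. \<i> ^ n * complex_of_real ((kco n x y - kco n x (root_refl v y)) / (v \<bullet> y)))"
      unfolding eq by (intro summable_divide summable_diff summable_kern)
    show "dunkl_quotient v (kern x) y = (\<Sum>n. \<i> ^ n * of_real ((kco n x y - kco n x (root_refl v y)) / (v \<bullet> y)))"
      unfolding eq using nz
      by (simp add: dunkl_quotient_def kern_def suminf_divide[OF summable_diff[OF summable_kern summable_kern]]
          suminf_diff[OF summable_kern summable_kern])
  qed
  let ?D = "\<lambda>n. \<i> ^ n * complex_of_real ((kgrad n x y + dquot (kco n x) y) $ j)"
  have D_eq: "?D n = \<i> ^ n * of_real (kgrad n x y $ j) + (\<Sum>v\<in>Rp. of_real (k v * v $ j) *
      (\<i> ^ n * of_real ((kco n x y - kco n x (root_refl v y)) / (v \<bullet> y))))" for n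
    by (simp add: dquot_def distrib_left sum_distrib_left mult_ac)
  have sums2: "summable (\<lambda>n. \<Sum>v\<in>Rp. of_real (k v * v $ j) *
      (\<i> ^ n * of_real ((kco n x y - kco n x (root_refl v y)) / (v \<bullet> y))))"
    by (intro summable_sum summable_mult qs)
  have "T j (kern x) y = (\<Sum>n. \<i> ^ n * of_real (kgrad n x y $ j)) + (\<Sum>v\<in>Rp. of_real (k v * v $ j) *
      (\<Sum>n. \<i> ^ n * of_real ((kco n x y - kco n x (root_refl v y)) / (v \<bullet> y))))"
    unfolding dunkl_op_def partial_deriv_kern by (simp add: q)
  also have "\<dots> = (\<Sum>n. \<i> ^ n * of_real (kgrad n x y $ j)) + (\<Sum>n. \<Sum>v\<in>Rp. of_real (k v * v $ j) *
      (\<i> ^ n * of_real ((kco n x y - kco n x (root_refl v y)) / (v \<bullet> y))))"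
    by (simp only: suminf_sum[OF summable_mult[OF qs]] suminf_mult[OF qs] cong: sum.cong)
  also have "\<dots> = (\<Sum>n. ?D n)"
    unfolding D_eq by (rule suminf_add[OF summable_kgrad sums2])
  \<comment> \<open>The component of degree 0 is constant and is annihilated. Shifting the index in
    the other terms leaves over the one factor \<i> of the eigenvalue.\<close>
  also have "\<dots> = (\<Sum>n. ?D (Suc n)) + ?D 0"
  proof (rule suminf_split_head[THEN eq_diff_eq[THEN iffD1], symmetric, OF _ ])
    show "summable ?D" unfolding D_eq by (rule summable_add[OF summable_kgrad sums2])
  qed
  also have "?D 0 = 0" by (simp add: kgrad_def dquot_def)
  also have "(\<lambda>n. ?D (Suc n)) = (\<lambda>n. (\<i> * of_real (x $ j)) * (\<i> ^ n * of_real (kco n x y)))"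
    by (simp add: kco_dunkl[OF assms] fun_eq_iff mult_ac)
  also have "(\<Sum>n. (\<i> * of_real (x $ j)) * (\<i> ^ n * complex_of_real (kco n x y))) = \<i> * of_real (x $ j) * kern x y"
    unfolding kern_def by (rule suminf_mult[OF summable_kern])
  finally show ?thesis by simp
qed

lemma kern_dunkl: "T j (kern x) y = \<i> * of_real (x $ j) * kern x y"
  by (rule eq_of_eq_regular[where f = "T j (kern x)" and g = "\<lambda>y. \<i> * of_real (x $ j) * kern x y"])
     (intro continuous_dunkl_op C1_kern continuous_intros C1_continuous kern_dunkl_regular; assumption)+

lemma measurable_kern [measurable]: "(\<lambda>p. kern (fst p) (snd p)) \<in> borel_measurable (borel \<Otimes>\<^sub>M borel)"
proof (rule borel_measurable_LIMSEQ_metric)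
  fix p :: "(real^'n) \<times> (real^'n)"
  show "(\<lambda>N. \<Sum>n<N. \<i> ^ n * complex_of_real (kco n (fst p) (snd p))) \<longlonglongrightarrow> kern (fst p) (snd p)"
    unfolding kern_def using summable_kern by (rule summable_LIMSEQ)
next
  fix N
  show "(\<lambda>p. \<Sum>n<N. \<i> ^ n * complex_of_real (kco n (fst p) (snd p))) \<in> borel_measurable (borel \<Otimes>\<^sub>M borel)"
    unfolding borel_prod
    by (intro borel_measurable_continuous_onI continuous_intros continuous_kco)
qed

text \<open>Along rays \<open>T\<^sub>j f = \<i> x\<^sub>j f\<close> becomes a linear differential equation for the vector
  \<open>(f (g y))\<close>, \<open>g \<in> G\<close>, whose real part is minus the positive semidefinite form of
  \<open>1 - \<sigma>\<^sub>v\<close>, so its Euclidean norm decreases.\<close>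

lemma ray_bound:
  assumes diff: "\<And>y. f differentiable (at y)"
    and euler: "\<And>y. (\<Sum>j\<in>UNIV. y $ j *\<^sub>R partial_deriv j f y) + (\<Sum>v\<in>Rp. k v *\<^sub>R (f y - f (root_refl v y)))
       = \<i> * of_real (x \<bullet> y) * f y"
  shows "(\<Sum>g\<in>G. (norm (f (g y)))\<^sup>2) \<le> real (card G) * (norm (f 0))\<^sup>2"
proof -
  let ?D = "\<lambda>z h. \<Sum>j\<in>UNIV. h $ j *\<^sub>R partial_deriv j f z"
  define U where "U t = (\<Sum>g\<in>G. f (t *\<^sub>R g y) \<bullet> f (t *\<^sub>R g y))" for t :: real
  define U' where "U' t = (\<Sum>g\<in>G. 2 * (f (t *\<^sub>R g y) \<bullet> ?D (t *\<^sub>R g y) (g y)))" for t :: real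
  have fd: "((\<lambda>t. f (t *\<^sub>R z)) has_derivative (\<lambda>s. ?D (t *\<^sub>R z) (s *\<^sub>R z))) (at t)" for t z
    by (rule has_derivative_compose[of "\<lambda>t. t *\<^sub>R z" "\<lambda>t. t *\<^sub>R z"])
       (auto intro!: derivative_eq_intros differentiable_has_derivative_partial diff)
  have Dlin: "?D z (s *\<^sub>R h) = s *\<^sub>R ?D z h" for z s h by (simp add: scaleR_sum_right)
  have DU: "(U has_real_derivative U' t) (at t)" for t
  proof -
    have "(U has_derivative (\<lambda>s. \<Sum>g\<in>G. f (t *\<^sub>R g y) \<bullet> ?D (t *\<^sub>R g y) (s *\<^sub>R g y)
         + ?D (t *\<^sub>R g y) (s *\<^sub>R g y) \<bullet> f (t *\<^sub>R g y))) (at t)"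
      unfolding U_def[abs_def] by (intro has_derivative_sum has_derivative_inner fd)
    moreover have "(\<lambda>s. \<Sum>g\<in>G. f (t *\<^sub>R g y) \<bullet> ?D (t *\<^sub>R g y) (s *\<^sub>R g y)
         + ?D (t *\<^sub>R g y) (s *\<^sub>R g y) \<bullet> f (t *\<^sub>R g y)) = (\<lambda>s. U' t * s)"
      unfolding Dlin U'_def sum_distrib_right by (intro ext sum.cong) (auto simp: inner_commute)
    ultimately show ?thesis by (simp add: has_field_derivative_def)
  qed
  have neg: "U' t \<le> 0" if t: "t > 0" for t
  proof -
    let ?z = "\<lambda>g. t *\<^sub>R g y"
    have Dz: "t *\<^sub>R ?D (?z g) (g y) = \<i> * of_real (x \<bullet> ?z g) * f (?z g)
        - (\<Sum>v\<in>Rp. k v *\<^sub>R (f (?z g) - f (root_refl v (?z g))))"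
      for g
      unfolding Dlin[symmetric] using euler[of "?z g"] by (simp add: algebra_simps)
    \<comment> \<open>Multiplication by an imaginary number is skew for the real inner product on
      the complex plane. So the eigenvalue term does not affect the norm, and the bound does not
      depend on \<open>x\<close>.\<close>
    have i0: "a \<bullet> (\<i> * of_real r * a) = 0" for a r by (simp add: inner_complex_def)
    have "t * U' t = (\<Sum>g\<in>G. 2 * (f (?z g) \<bullet> (t *\<^sub>R ?D (?z g) (g y))))"
      unfolding U'_def sum_distrib_left by (intro sum.cong) auto
    also have "\<dots> = (\<Sum>g\<in>G. - 2 * (\<Sum>v\<in>Rp. k v * (f (?z g) \<bullet> f (?z g) - f (?z g) \<bullet> f (root_refl v (?z g)))))"
      unfolding Dz by (simp add: inner_diff_right inner_sum_right i0 del: inner_scaleR_right)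
         (simp add: inner_diff_right)
    also have "\<dots> = - 2 * (\<Sum>v\<in>Rp. k v * (\<Sum>g\<in>G. f (?z g) \<bullet> f (?z g) - f (?z g) \<bullet> f (root_refl v (?z g))))"
      unfolding sum_distrib_left[symmetric] by (subst sum.swap) (simp add: sum_distrib_left)
    also have "\<dots> \<le> 0"
    proof -
      have "(\<Sum>g\<in>G. f (?z g) \<bullet> f (?z g) - f (?z g) \<bullet> f (root_refl v (?z g))) \<ge> 0" if v: "v \<in> Rp" for v
      proof -
        have "(\<Sum>g\<in>G. f (?z g) \<bullet> f (root_refl v (?z g)))
          \<le> (\<Sum>g\<in>G. (f (?z g) \<bullet> f (?z g) + f (root_refl v (?z g)) \<bullet> f (root_refl v (?z g))) / 2)"
        proof (rule sum_mono)
          fix g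
          have "0 \<le> (f (?z g) - f (root_refl v (?z g))) \<bullet> (f (?z g) - f (root_refl v (?z g)))" by simp
          then show "f (?z g) \<bullet> f (root_refl v (?z g))
            \<le> (f (?z g) \<bullet> f (?z g) + f (root_refl v (?z g)) \<bullet> f (root_refl v (?z g))) / 2"
            by (simp add: inner_diff_left inner_diff_right inner_commute)
        qed
        also have "\<dots> = (\<Sum>g\<in>G. f (?z g) \<bullet> f (?z g))"
        proof -
          have "(\<Sum>g\<in>G. f (root_refl v (?z g)) \<bullet> f (root_refl v (?z g))) = (\<Sum>g\<in>G. f (?z g) \<bullet> f (?z g))"
            using sum_G_left[OF v, of "\<lambda>g. f (?z g) \<bullet> f (?z g)"] by (simp add: root_refl_scaleR)
          then show ?thesis by (simp add: sum.distrib sum_divide_distrib[symmetric])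
        qed
        finally show ?thesis by (simp add: sum_subtractf)
      qed
      then have "(\<Sum>v\<in>Rp. k v * (\<Sum>g\<in>G. f (?z g) \<bullet> f (?z g) - f (?z g) \<bullet> f (root_refl v (?z g)))) \<ge> 0"
        by (intro sum_nonneg[of Rp] mult_nonneg_nonneg k_nonneg_Rp)
      then show ?thesis by simp
    qed
    finally show ?thesis using t by (simp add: mult_le_0_iff)
  qed
  have "U 1 \<le> U 0"
  proof (rule DERIV_nonpos_imp_decreasing_open[of 0 1 U])
    show "continuous_on {0..1} U"
      by (intro continuous_at_imp_continuous_on ballI DERIV_isCont[OF DU])
    show "\<exists>d. DERIV U t :> d \<and> d \<le> 0" if "0 < t" "t < 1" for t
      using DU neg[OF that(1)] by blast
  qed simp
  then show ?thesis by (simp add: U_def power2_norm_eq_inner)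
qed

lemma ray_bound_single:
  assumes "\<And>y. f differentiable (at y)"
    and "\<And>y. (\<Sum>j\<in>UNIV. y $ j *\<^sub>R partial_deriv j f y) + (\<Sum>v\<in>Rp. k v *\<^sub>R (f y - f (root_refl v y)))
       = \<i> * of_real (x \<bullet> y) * f y"
  shows "(norm (f y))\<^sup>2 \<le> real (card G) * (norm (f 0))\<^sup>2"
proof -
  have "(norm (f (id y)))\<^sup>2 \<le> (\<Sum>g\<in>G. (norm (f (g y)))\<^sup>2)"
    by (rule member_le_sum[OF id_in_G]) (auto simp: finite_G)
  then show ?thesis using ray_bound[OF assms, of y] by simp
qed

lemma euler_eigenfunction:
  assumes "\<And>j. T j f y = \<i> * of_real (x $ j) * f y"
  shows "(\<Sum>j\<in>UNIV. y $ j *\<^sub>R partial_deriv j f y) + (\<Sum>v\<in>Rp. k v *\<^sub>R (f y - f (root_refl v y)))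
       = \<i> * of_real (x \<bullet> y) * f y"
  unfolding euler_dunkl[symmetric] assms
  by (simp add: inner_vec_def scaleR_conv_of_real sum_distrib_left sum_distrib_right mult_ac)

text \<open>One orbit value is compared with the sum over the orbit, and at the origin each of the
  |G| summands is 1. For the integral estimates any bound uniform in both arguments will do.\<close>

definition kern_sup :: real where "kern_sup = sqrt (real (card G))"

lemma norm_kern_le: "norm (kern x y) \<le> kern_sup"
proof -
  have "(norm (kern x y))\<^sup>2 \<le> real (card G) * (norm (kern x 0))\<^sup>2"
    by (rule ray_bound_single[OF _ euler_eigenfunction[OF kern_dunkl]])
       (use C1_kern in \<open>auto simp: C1_def\<close>)
  then show ?thesis unfolding kern_sup_def by (simp add: kern_zero_right real_le_rsqrt)
qed

lemma kern_sup_nonneg: "kern_sup \<ge> 0"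
  by (simp add: kern_sup_def)

end

section \<open>Analyticity and uniqueness of the kernel\<close>

definition monom_at :: "('n \<Rightarrow> nat) \<Rightarrow> real^'n \<Rightarrow> real" where
  "monom_at m h = (\<Prod>i\<in>UNIV. h $ i ^ m i)"

lemma abs_monom_at_le_1: "(\<And>i. \<bar>h $ i\<bar> \<le> 1) \<Longrightarrow> \<bar>monom_at m h\<bar> \<le> 1"
  unfolding monom_at_def abs_prod power_abs by (intro prod_le_1) (auto intro: power_le_one)

lemma monom_at_Suc: "h $ i * monom_at m h = monom_at (m(i := Suc (m i))) h"
proof -
  have "monom_at m h = h $ i ^ m i * (\<Prod>j\<in>UNIV - {i}. h $ j ^ m j)"
    unfolding monom_at_def by (rule prod.remove) auto
  moreover have "monom_at (m(i := Suc (m i))) h = h $ i ^ Suc (m i) * (\<Prod>j\<in>UNIV - {i}. h $ j ^ m j)"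
    unfolding monom_at_def by (subst prod.remove[of UNIV i]) (auto intro!: prod.cong)
  ultimately show ?thesis by simp
qed

text \<open>The \<open>\<ell>\<^sup>1\<close>-bound \<open>M\<close> on the coefficients makes this class closed under infinite sums.\<close>

definition power_series_at :: "real^'n \<Rightarrow> (real^'n \<Rightarrow> complex) \<Rightarrow> real \<Rightarrow> bool" where
  "power_series_at a f M \<longleftrightarrow> (\<exists>c. (\<lambda>m. norm (c m)) summable_on UNIV \<and> (\<Sum>\<^sub>\<infinity>m. norm (c m)) \<le> M \<and>
     (\<forall>h. (\<forall>i. \<bar>h $ i\<bar> \<le> 1) \<longrightarrow> ((\<lambda>m. c m * of_real (monom_at m h)) has_sum f (a + h)) UNIV))"

lemma power_series_at_const:
  fixes a :: "real^'n"
  shows "power_series_at a (\<lambda>_. z) (norm z)"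
proof -
  define c where "c m = (if m = (\<lambda>_. 0) then z else 0)" for m :: "'n::finite \<Rightarrow> nat"
  have "((\<lambda>m. norm (c m)) has_sum norm z) {\<lambda>_. 0}"
    by (rule has_sum_finiteI) (auto simp: c_def)
  then have 1: "((\<lambda>m. norm (c m)) has_sum norm z) UNIV"
    by (rule has_sum_cong_neutral[THEN iffD1, rotated -1]) (auto simp: c_def)
  have "((\<lambda>m. c m * of_real (monom_at m h)) has_sum z) {\<lambda>_. 0}" for h
    by (rule has_sum_finiteI) (auto simp: c_def monom_at_def)
  then have 2: "((\<lambda>m. c m * of_real (monom_at m h)) has_sum z) UNIV" for h
    by (rule has_sum_cong_neutral[THEN iffD1, rotated -1]) (auto simp: c_def)
  show ?thesis unfolding power_series_at_def
    using 1 2 by (intro exI[of _ c]) (auto simp: has_sum_iff)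
qed

lemma power_series_at_mono:
  fixes a :: "real^'n"
  shows "power_series_at a f M \<Longrightarrow> M \<le> M' \<Longrightarrow> power_series_at a f M'"
  unfolding power_series_at_def using order_trans by blast

lemma power_series_at_cmult:
  fixes a :: "real^'n"
  assumes "power_series_at a f M" shows "power_series_at a (\<lambda>y. z * f y) (norm z * M)"
proof -
  obtain c where c: "(\<lambda>m. norm (c m)) summable_on UNIV" "(\<Sum>\<^sub>\<infinity>m. norm (c m)) \<le> M"
    "\<And>h. (\<forall>i. \<bar>h $ i\<bar> \<le> 1) \<Longrightarrow> ((\<lambda>m. c m * of_real (monom_at m h)) has_sum f (a + h)) UNIV"
    using assms unfolding power_series_at_def by blast
  have "((\<lambda>m. norm (z * c m)) has_sum (norm z * (\<Sum>\<^sub>\<infinity>m. norm (c m)))) UNIV"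
    unfolding norm_mult by (intro has_sum_cmult_right has_sum_infsum c(1))
  moreover have "norm z * (\<Sum>\<^sub>\<infinity>m. norm (c m)) \<le> norm z * M" by (intro mult_left_mono c(2)) auto
  moreover have "((\<lambda>m. z * c m * of_real (monom_at m h)) has_sum z * f (a + h)) UNIV" if "\<forall>i. \<bar>h $ i\<bar> \<le> 1" for h
    using has_sum_cmult_right[OF c(3)[OF that], of z] by (simp add: mult.assoc)
  ultimately show ?thesis unfolding power_series_at_def
    by (intro exI[of _ "\<lambda>m. z * c m"]) (auto simp: has_sum_iff)
qed

lemma power_series_at_add:
  fixes a :: "real^'n"
  assumes "power_series_at a f M" "power_series_at a f' M'"
  shows "power_series_at a (\<lambda>y. f y + f' y) (M + M')"
proof -
  obtain c where c: "(\<lambda>m. norm (c m)) summable_on UNIV" "(\<Sum>\<^sub>\<infinity>m. norm (c m)) \<le> M"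
    "\<And>h. (\<forall>i. \<bar>h $ i\<bar> \<le> 1) \<Longrightarrow> ((\<lambda>m. c m * of_real (monom_at m h)) has_sum f (a + h)) UNIV"
    using assms unfolding power_series_at_def by blast
  obtain c' where c': "(\<lambda>m. norm (c' m)) summable_on UNIV" "(\<Sum>\<^sub>\<infinity>m. norm (c' m)) \<le> M'"
    "\<And>h. (\<forall>i. \<bar>h $ i\<bar> \<le> 1) \<Longrightarrow> ((\<lambda>m. c' m * of_real (monom_at m h)) has_sum f' (a + h)) UNIV"
    using assms unfolding power_series_at_def by blast
  have s: "(\<lambda>m. norm (c m) + norm (c' m)) summable_on UNIV" by (intro summable_on_add c c')
  have s': "(\<lambda>m. norm (c m + c' m)) summable_on UNIV"
    by (rule summable_on_comparison_test[OF s]) (auto intro: norm_triangle_ineq)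
  have "(\<Sum>\<^sub>\<infinity>m. norm (c m + c' m)) \<le> (\<Sum>\<^sub>\<infinity>m. norm (c m) + norm (c' m))"
    by (rule infsum_mono[OF s' s]) (rule norm_triangle_ineq)
  also have "\<dots> = (\<Sum>\<^sub>\<infinity>m. norm (c m)) + (\<Sum>\<^sub>\<infinity>m. norm (c' m))" by (rule infsum_add[OF c(1) c'(1)])
  finally have "(\<Sum>\<^sub>\<infinity>m. norm (c m + c' m)) \<le> M + M'" using c(2) c'(2) by simp
  moreover have "((\<lambda>m. (c m + c' m) * of_real (monom_at m h)) has_sum f (a + h) + f' (a + h)) UNIV"
    if "\<forall>i. \<bar>h $ i\<bar> \<le> 1" for h
    using has_sum_add[OF c(3)[OF that] c'(3)[OF that]] by (simp add: distrib_right)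
  ultimately show ?thesis unfolding power_series_at_def
    using s' by (intro exI[of _ "\<lambda>m. c m + c' m"]) auto
qed

lemma power_series_at_sum:
  fixes a :: "real^'n"
  assumes "finite A" "\<And>i. i \<in> A \<Longrightarrow> power_series_at a (f i) (M i)"
  shows "power_series_at a (\<lambda>y. \<Sum>i\<in>A. f i y) (\<Sum>i\<in>A. M i)"
  using assms
proof (induction A rule: finite_induct)
  case empty
  then show ?case using power_series_at_const[of a 0] by simp
next
  case (insert i A)
  then show ?case using power_series_at_add[of a "f i" "M i" "\<lambda>y. \<Sum>i\<in>A. f i y"] by simp
qed

text \<open>Multiplication by a centred coordinate shifts the coefficients along one axis and puts 0
  at the multi-indices with zero entry, so the \<ell>1 norm is preserved.\<close>

lemma power_series_at_coord_shift:
  fixes a :: "real^'n"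
  assumes "power_series_at a f M" shows "power_series_at a (\<lambda>y. of_real (y $ i - a $ i) * f y) M"
proof -
  obtain c where c: "(\<lambda>m. norm (c m)) summable_on UNIV" "(\<Sum>\<^sub>\<infinity>m. norm (c m)) \<le> M"
    "\<And>h. (\<forall>i. \<bar>h $ i\<bar> \<le> 1) \<Longrightarrow> ((\<lambda>m. c m * of_real (monom_at m h)) has_sum f (a + h)) UNIV"
    using assms unfolding power_series_at_def by blast
  define S where "S m = m(i := Suc (m i))" for m :: "'n::finite \<Rightarrow> nat"
  define P where "P m = m(i := m i - 1)" for m :: "'n::finite \<Rightarrow> nat"
  define c' where "c' m = (if m i = 0 then 0 else c (P m))" for m
  have PS: "P (S m) = m" for m by (auto simp: P_def S_def)
  have inj: "inj S" by (rule inj_on_inverseI[of _ P]) (rule PS)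
  have nS: "m i = 0" if "m \<notin> range S" for m
  proof (rule ccontr)
    assume "m i \<noteq> 0"
    then have "m = S (P m)" by (auto simp: S_def P_def)
    then show False using that by blast
  qed
  have c'S: "c' (S m) = c m" for m using PS by (simp add: c'_def S_def)
  have shift: "(F has_sum s) UNIV" if "((\<lambda>m. F (S m)) has_sum s) UNIV" "\<And>m. m i = 0 \<Longrightarrow> F m = 0"
    for F :: "('n \<Rightarrow> nat) \<Rightarrow> 'b::real_normed_vector" and s
  proof -
    have "(F has_sum s) (range S)" using that(1) has_sum_reindex[OF inj, of F s] by (simp add: o_def)
    then show ?thesis
      by (rule has_sum_cong_neutral[THEN iffD1, rotated -1]) (auto simp: that(2) nS)
  qed
  have "((\<lambda>m. norm (c' m)) has_sum (\<Sum>\<^sub>\<infinity>m. norm (c m))) UNIV"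
  proof (rule shift)
    show "((\<lambda>m. norm (c' (S m))) has_sum (\<Sum>\<^sub>\<infinity>m. norm (c m))) UNIV"
      unfolding c'S by (rule has_sum_infsum[OF c(1)])
  qed (simp add: c'_def)
  moreover have "((\<lambda>m. c' m * of_real (monom_at m h)) has_sum of_real (h $ i) * f (a + h)) UNIV"
    if h: "\<forall>i. \<bar>h $ i\<bar> \<le> 1" for h
  proof (rule shift)
    have "((\<lambda>m. of_real (h $ i) * (c m * of_real (monom_at m h))) has_sum of_real (h $ i) * f (a + h)) UNIV"
      by (intro has_sum_cmult_right c(3) h)
    moreover have "of_real (h $ i) * (c m * of_real (monom_at m h)) = c' (S m) * complex_of_real (monom_at (S m) h)"
        for m
      unfolding S_def[of m] monom_at_Suc[symmetric] c'S[unfolded S_def] by simp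
    ultimately show "((\<lambda>m. c' (S m) * complex_of_real (monom_at (S m) h)) has_sum of_real (h $ i) * f (a + h)) UNIV"
      by simp
  qed (simp add: c'_def)
  ultimately show ?thesis unfolding power_series_at_def
    using c(2) by (intro exI[of _ c']) (auto simp: has_sum_iff)
qed

lemma power_series_at_nonneg:
  fixes a :: "real^'n"
  assumes "power_series_at a f M" shows "M \<ge> 0"
proof -
  obtain c :: "('n \<Rightarrow> nat) \<Rightarrow> complex" where "(\<Sum>\<^sub>\<infinity>m. norm (c m)) \<le> M"
    using assms unfolding power_series_at_def by blast
  moreover have "(\<Sum>\<^sub>\<infinity>m. norm (c m)) \<ge> 0" by (rule infsum_nonneg) simp
  ultimately show ?thesis by simp
qed

text \<open>Each coordinate of \<open>y\<close> is split as (y_i - a_i) + a_i: the first part is a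
  coefficient shift, the second a scalar. The resulting factor depends on the degree of nothing, so
  iteration gives a geometric bound.\<close>

lemma power_series_at_inner:
  fixes a :: "real^'n"
  assumes "power_series_at a f M" "norm u \<le> \<nu>"
  shows "power_series_at a (\<lambda>y. of_real (u \<bullet> y) * f y) (\<nu> * (\<Sum>i\<in>UNIV. 1 + \<bar>a $ i\<bar>) * M)"
proof -
  have "power_series_at a (\<lambda>y. \<Sum>i\<in>UNIV. complex_of_real (u $ i) * (of_real (y $ i - a $ i) * f y + of_real (a $ i)
      * f y))
     (\<Sum>i\<in>UNIV. norm (complex_of_real (u $ i)) * (M + norm (complex_of_real (a $ i)) * M))"
    by (intro power_series_at_sum power_series_at_cmult power_series_at_add power_series_at_coord_shift assms finite)
  moreover have "(\<Sum>i\<in>UNIV. complex_of_real (u $ i) * (of_real (y $ i - a $ i) * f y + of_real (a $ i) * f y))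
      = of_real (u \<bullet> y) * f y" for y
    by (simp add: inner_vec_def algebra_simps sum_distrib_left)
  moreover have "(\<Sum>i\<in>UNIV. norm (complex_of_real (u $ i)) * (M + norm (complex_of_real (a $ i)) * M))
      \<le> \<nu> * (\<Sum>i\<in>UNIV. 1 + \<bar>a $ i\<bar>) * M"
    unfolding sum_distrib_left sum_distrib_right
  proof (rule sum_mono)
    fix i
    have "\<bar>u $ i\<bar> \<le> \<nu>" using component_le_norm_cart[of u i] assms(2) by simp
    then have "\<bar>u $ i\<bar> * ((1 + \<bar>a $ i\<bar>) * M) \<le> \<nu> * ((1 + \<bar>a $ i\<bar>) * M)"
      by (intro mult_right_mono) (auto simp: power_series_at_nonneg[OF assms(1)])
    then show "norm (complex_of_real (u $ i)) * (M + norm (complex_of_real (a $ i)) * M) \<le> \<nu> * (1 + \<bar>a $ i\<bar>) * M"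
      by (simp add: algebra_simps)
  qed
  ultimately show ?thesis by (simp add: power_series_at_mono)
qed

text \<open>The double family of coefficients is absolutely summable, with total at most the sum of
  the \<open>M n\<close>, so the order of summation may be exchanged. Monomials are at most 1 on the
  unit polydisc, so the same majorant serves for every \<open>h\<close>.\<close>

lemma power_series_at_suminf:
  fixes f :: "nat \<Rightarrow> real^'n \<Rightarrow> complex"
  assumes "\<And>n. power_series_at a (f n) (M n)" "summable M"
    and sums: "\<And>y. (\<lambda>n. f n y) sums F y"
  shows "power_series_at a F (\<Sum>n. M n)"
proof -
  have "\<forall>n. \<exists>c. (\<lambda>m. norm (c m)) summable_on UNIV \<and> (\<Sum>\<^sub>\<infinity>m. norm (c m)) \<le> M n \<and>
     (\<forall>h. (\<forall>i. \<bar>h $ i\<bar> \<le> 1) \<longrightarrow> ((\<lambda>m. c m * of_real (monom_at m h)) has_sum f n (a + h)) UNIV)"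
    using assms(1) unfolding power_series_at_def by (rule allI)
  from choice[OF this] obtain c where all: "\<forall>n. (\<lambda>m. norm (c n m)) summable_on UNIV \<and> (\<Sum>\<^sub>\<infinity>m. norm (c n m)) \<le> M n \<and>
     (\<forall>h. (\<forall>i. \<bar>h $ i\<bar> \<le> 1) \<longrightarrow> ((\<lambda>m. c n m * of_real (monom_at m h)) has_sum f n (a + h)) UNIV)" ..
  have c: "\<And>n. (\<lambda>m. norm (c n m)) summable_on UNIV" "\<And>n. (\<Sum>\<^sub>\<infinity>m. norm (c n m)) \<le> M n"
    "\<And>n h. (\<forall>i. \<bar>h $ i\<bar> \<le> 1) \<Longrightarrow> ((\<lambda>m. c n m * of_real (monom_at m h)) has_sum f n (a + h)) UNIV"
    using all by simp_all
  have M0: "M n \<ge> 0" for n using power_series_at_nonneg[OF assms(1)] .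
  have Msum: "(M has_sum (\<Sum>n. M n)) UNIV"
    using assms(2) M0 by (simp add: sums_nonneg_imp_has_sum summable_sums)
  have Q: "(\<lambda>n. \<Sum>\<^sub>\<infinity>m. norm (c n m)) summable_on UNIV"
    by (rule summable_on_comparison_test[OF has_sum_imp_summable[OF Msum]]) (auto simp: c(2) infsum_nonneg)
  have abs: "(\<lambda>p. norm (case p of (n, m) \<Rightarrow> c n m)) summable_on (UNIV \<times> UNIV)"
    by (rule Infinite_Sum.abs_summable_on_Sigma_iff[THEN iffD2]) (use c(1) Q in \<open>simp add: infsum_nonneg\<close>)
  have abs': "(\<lambda>p. norm (case p of (m, n) \<Rightarrow> c n m)) summable_on (UNIV \<times> UNIV)"
    using summable_on_swap[of "\<lambda>p. norm (case p of (n, m) \<Rightarrow> c n m)" UNIV UNIV] abs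
    by (simp add: case_prod_unfold)
  have col: "(\<lambda>n. norm (c n m)) summable_on UNIV" for m
    using abs' unfolding Infinite_Sum.abs_summable_on_Sigma_iff by auto
  have col': "(\<lambda>n. c n m) summable_on UNIV" for m
    by (rule abs_summable_summable[OF col])
  define C where "C m = (\<Sum>\<^sub>\<infinity>n. c n m)" for m
  have Cn: "norm (C m) \<le> (\<Sum>\<^sub>\<infinity>n. norm (c n m))" for m
    unfolding C_def by (rule norm_infsum_bound) (rule col)
  have rows: "(\<lambda>m. \<Sum>\<^sub>\<infinity>n. norm (c n m)) summable_on UNIV"
    using abs' unfolding Infinite_Sum.abs_summable_on_Sigma_iff by (auto simp: infsum_nonneg)
  have Csum: "(\<lambda>m. norm (C m)) summable_on UNIV"
    by (rule summable_on_comparison_test[OF rows]) (auto simp: Cn)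
  have "(\<Sum>\<^sub>\<infinity>m. norm (C m)) \<le> (\<Sum>\<^sub>\<infinity>m. \<Sum>\<^sub>\<infinity>n. norm (c n m))"
    by (rule infsum_mono[OF Csum rows Cn])
  also have "\<dots> = (\<Sum>\<^sub>\<infinity>n. \<Sum>\<^sub>\<infinity>m. norm (c n m))"
    by (rule infsum_swap_banach) (use abs' in \<open>simp add: case_prod_unfold\<close>)
  also have "\<dots> \<le> (\<Sum>n. M n)"
    using infsum_mono[OF Q has_sum_imp_summable[OF Msum] c(2)] infsumI[OF Msum] by simp
  finally have bound: "(\<Sum>\<^sub>\<infinity>m. norm (C m)) \<le> (\<Sum>n. M n)" .
  have "((\<lambda>m. C m * of_real (monom_at m h)) has_sum F (a + h)) UNIV" if h: "\<forall>i. \<bar>h $ i\<bar> \<le> 1" for h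
  proof -
    let ?t = "\<lambda>n m. c n m * complex_of_real (monom_at m h)"
    have "(\<lambda>p. norm (case p of (n, m) \<Rightarrow> ?t n m)) summable_on (UNIV \<times> UNIV)"
    proof (rule Infinite_Sum.abs_summable_on_comparison_test[OF abs])
      fix p :: "nat \<times> ('n \<Rightarrow> nat)"
      show "norm (case p of (n, m) \<Rightarrow> ?t n m) \<le> norm (case p of (n, m) \<Rightarrow> c n m)"
        using abs_monom_at_le_1[of h "snd p"] h
        by (auto simp: case_prod_beta norm_mult mult_left_le)
    qed
    then have sm: "(\<lambda>(n, m). ?t n m) summable_on (UNIV \<times> UNIV)" by (rule abs_summable_summable)
    define V where "V = infsum (\<lambda>(n, m). ?t n m) (UNIV \<times> UNIV)"
    have V: "((\<lambda>(n, m). ?t n m) has_sum V) (UNIV \<times> UNIV)" unfolding V_def using sm by (rule has_sum_infsum)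
    have "((\<lambda>n. f n (a + h)) has_sum V) UNIV"
      by (rule has_sum_SigmaD[OF V]) (use c(3)[OF h] in simp)
    then have "V = F (a + h)" using has_sum_imp_sums sums sums_unique2 by blast
    have V': "((\<lambda>(m, n). ?t n m) has_sum V) (UNIV \<times> UNIV)"
      using has_sum_swap[THEN iffD1, OF V] by (simp add: case_prod_beta)
    have "((\<lambda>m. C m * of_real (monom_at m h)) has_sum V) UNIV"
    proof (rule has_sum_SigmaD[OF V'])
      fix m
      show "((\<lambda>n. (case (m, n) of (m, n) \<Rightarrow> ?t n m)) has_sum C m * of_real (monom_at m h)) UNIV"
        unfolding C_def using has_sum_cmult_left[OF has_sum_infsum[OF col']] by simp
    qed
    then show ?thesis using \<open>V = F (a + h)\<close> by simp
  qed
  then show ?thesis unfolding power_series_at_def using Csum bound by blast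
qed

text \<open>Differentiability is what the uniqueness argument along rays draws from analyticity. The
  terms of degree 1 form the derivative, and those of degree at least 2 are O(|h|^2) by absolute
  convergence at one point with all coordinates positive.\<close>

lemma real_analytic_differentiable:
  fixes f :: "real^'n \<Rightarrow> complex"
  assumes "real_analytic f" shows "f differentiable (at a)"
proof -
  obtain r c where r: "r > 0"
    and c: "\<And>x. x \<in> ball a r \<Longrightarrow>
        ((\<lambda>m. c m * of_real (\<Prod>i\<in>UNIV. (x $ i - a $ i) ^ m i)) has_sum f x) UNIV"
    using assms unfolding real_analytic_def by blast
  have c: "((\<lambda>m. c m * of_real (monom_at m h)) has_sum f (a + h)) UNIV" if "norm h < r" for h
    using c[of "a + h"] that by (simp add: monom_at_def dist_norm)
  \<comment> \<open>The point with all coordinates \<rho> has \<ell>1 norm r / 2, hence lies in the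
    ball of convergence; there every monomial is \<rho> to its degree.\<close>
  define \<rho> where "\<rho> = r / (2 * real CARD('n))"
  have \<rho>: "\<rho> > 0" using r by (simp add: \<rho>_def)
  define b :: "real^'n" where "b = (\<chi> i. \<rho>)"
  have "norm b \<le> (\<Sum>i\<in>UNIV. \<bar>b $ i\<bar>)" by (rule norm_le_l1_cart)
  also have "\<dots> = r / 2" using r by (simp add: b_def \<rho>_def)
  finally have b: "norm b < r" using r by simp
  define deg where "deg m = (\<Sum>i\<in>UNIV. m i)" for m :: "'n::finite \<Rightarrow> nat"
  have mb: "monom_at m b = \<rho> ^ deg m" for m
    by (simp add: monom_at_def b_def deg_def power_sum)
  have "(\<lambda>m. c m * of_real (monom_at m b)) summable_on UNIV"
    using c[OF b] by (rule has_sum_imp_summable)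
  then have "(\<lambda>m. norm (c m * of_real (monom_at m b))) summable_on UNIV"
    by (simp only: summable_on_iff_abs_summable_on_complex)
  then have A: "(\<lambda>m. norm (c m) * \<rho> ^ deg m) summable_on UNIV"
    using \<rho> by (simp add: norm_mult mb norm_power)
  define K where "K = (\<Sum>\<^sub>\<infinity>m. norm (c m) * \<rho> ^ deg m)"
  let ?L = "{m. deg m = 1}"
  have L: "\<exists>i. \<forall>h. monom_at m h = h $ i" if d: "deg m = 1" for m
  proof -
    obtain i where i: "m i = 1" "\<forall>j. j \<noteq> i \<longrightarrow> m j = 0"
      using d sum_eq_1_iff[of UNIV m] by (auto simp: deg_def)
    have "monom_at m h = h $ i" for h
      unfolding monom_at_def by (subst prod.remove[of UNIV i]) (use i in \<open>auto intro!: prod.neutral\<close>)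
    then show ?thesis by blast
  qed
  have finL: "finite ?L"
  proof -
    have "?L \<subseteq> (\<lambda>i j. if j = i then 1 else 0) ` UNIV"
    proof
      fix m assume "m \<in> ?L"
      then obtain i where i: "m i = 1" "\<forall>j. j \<noteq> i \<longrightarrow> m j = 0"
        using sum_eq_1_iff[of UNIV m] by (auto simp: deg_def)
      then have "m = (\<lambda>j. if j = i then 1 else 0)" by auto
      then show "m \<in> (\<lambda>i j. if j = i then 1 else 0) ` UNIV" by blast
    qed
    then show ?thesis by (rule finite_subset) simp
  qed
  let ?Z = "{m. deg m = 0}"
  have Z: "?Z = {\<lambda>_. 0}" by (auto simp: deg_def)
  define D where "D h = (\<Sum>m\<in>?L. c m * of_real (monom_at m h))" for h
  have D: "bounded_linear D"
  proof -
    have "bounded_linear (\<lambda>h. c m * complex_of_real (monom_at m h))" if m: "m \<in> ?L" for m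
    proof -
      obtain i where "\<forall>h. monom_at m h = h $ i" using L[of m] m by auto
      then show ?thesis
        by (simp add: bounded_linear_const_mult bounded_linear_compose[OF bounded_linear_of_real
            bounded_linear_vec_nth])
    qed
    then show ?thesis unfolding D_def[abs_def] by (intro bounded_linear_sum) auto
  qed
  have bound: "norm (f (a + h) - f a - D h) \<le> K / \<rho>\<^sup>2 * (norm h)\<^sup>2" if h: "norm h \<le> \<rho>" for h
  proof -
    have "real CARD('n) \<ge> 1" by (simp add: Suc_leI)
    then have "1 < 2 * real CARD('n)" by linarith
    then have "\<rho> < r" using r by (simp add: \<rho>_def divide_less_eq mult_less_cancel_left1)
    then have hr: "norm h < r" using h by simp
    let ?t = "\<lambda>m. c m * complex_of_real (monom_at m h)"
    have "(?t has_sum sum ?t (?Z \<union> ?L)) (?Z \<union> ?L)" by (rule has_sum_finite) (use finL Z in auto)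
    then have hs: "(?t has_sum (f (a + h) - sum ?t (?Z \<union> ?L))) (UNIV - (?Z \<union> ?L))"
      by (intro has_sum_Diff c hr) auto
    have "sum ?t (?Z \<union> ?L) = ?t (\<lambda>_. 0) + D h"
      unfolding D_def Z by (subst sum.union_disjoint) (use finL in \<open>auto simp: deg_def\<close>)
    moreover have "f a = c (\<lambda>_. 0)"
    proof -
      have h1: "((\<lambda>m. c m * complex_of_real (monom_at m 0)) has_sum c (\<lambda>_. 0)) {\<lambda>_. 0}"
        by (rule has_sum_finiteI) (auto simp: monom_at_def)
      have h2: "monom_at m 0 = 0" if m: "m \<noteq> (\<lambda>_. 0)" for m :: "'n::finite \<Rightarrow> nat"
      proof -
        obtain i where "m i \<noteq> 0" using m by auto
        then show ?thesis unfolding monom_at_def by (intro prod_zero) (auto intro!: bexI[of _ i])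
      qed
      have "((\<lambda>m. c m * complex_of_real (monom_at m 0)) has_sum c (\<lambda>_. 0)) UNIV"
        by (rule has_sum_cong_neutral[THEN iffD1, OF _ _ _ h1]) (use h2 in auto)
      moreover have "((\<lambda>m. c m * complex_of_real (monom_at m 0)) has_sum f (a + 0)) UNIV"
        by (rule c) (use r in simp)
      ultimately have "c (\<lambda>_. 0) = f (a + 0)" by (rule has_sum_unique)
      then show ?thesis by simp
    qed
    ultimately have eq: "f (a + h) - sum ?t (?Z \<union> ?L) = f (a + h) - f a - D h" by (simp add: monom_at_def)
    have hs: "(?t has_sum (f (a + h) - f a - D h)) (UNIV - (?Z \<union> ?L))" by (rule hs[unfolded eq])
    \<comment> \<open>The remaining multi-indices have degree at least 2: two factors |h| are split
      off, and in the other ones |h| is replaced by \<rho>.\<close>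
    have le: "norm (?t m) \<le> (norm h)\<^sup>2 / \<rho>\<^sup>2 * (norm (c m) * \<rho> ^ deg m)" if "m \<in> UNIV - (?Z \<union> ?L)" for m
    proof -
      have "deg m \<ge> 2" using that by auto
      have "\<bar>monom_at m h\<bar> \<le> (\<Prod>i\<in>UNIV. norm h ^ m i)"
        unfolding monom_at_def abs_prod power_abs
        by (intro prod_mono conjI power_mono component_le_norm_cart) auto
      also have "\<dots> = norm h ^ deg m" by (simp add: deg_def power_sum)
      also have "\<dots> = (norm h)\<^sup>2 * norm h ^ (deg m - 2)" 
        by (subst power_add[symmetric]) (simp only: le_add_diff_inverse[OF \<open>deg m \<ge> 2\<close>])
      also have "\<dots> \<le> (norm h)\<^sup>2 * \<rho> ^ (deg m - 2)" by (intro mult_left_mono power_mono h) auto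
      also have "\<dots> = (norm h)\<^sup>2 / \<rho>\<^sup>2 * \<rho> ^ deg m"
        using \<rho> \<open>deg m \<ge> 2\<close> by (simp add: power_diff)
      finally have "norm (c m) * \<bar>monom_at m h\<bar> \<le> norm (c m) * ((norm h)\<^sup>2 / \<rho>\<^sup>2 * \<rho> ^ deg m)"
        by (intro mult_left_mono) auto
      then show ?thesis by (simp add: norm_mult mult_ac)
    qed
    have A': "(\<lambda>m. (norm h)\<^sup>2 / \<rho>\<^sup>2 * (norm (c m) * \<rho> ^ deg m)) summable_on UNIV"
      by (intro summable_on_cmult_right A)
    have A'': "(\<lambda>m. (norm h)\<^sup>2 / \<rho>\<^sup>2 * (norm (c m) * \<rho> ^ deg m)) summable_on (UNIV - (?Z \<union> ?L))"
      using A' by (rule summable_on_subset_banach) auto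
    have "norm (f (a + h) - f a - D h) = norm (\<Sum>\<^sub>\<infinity>m\<in>UNIV - (?Z \<union> ?L). ?t m)"
      using infsumI[OF hs] by simp
    also have "\<dots> \<le> (\<Sum>\<^sub>\<infinity>m\<in>UNIV - (?Z \<union> ?L). (norm h)\<^sup>2 / \<rho>\<^sup>2 * (norm (c m) * \<rho> ^ deg m))"
      by (rule norm_infsum_le[OF has_sum_infsum[OF has_sum_imp_summable[OF hs]] has_sum_infsum[OF A''] le])
    also have "\<dots> \<le> (\<Sum>\<^sub>\<infinity>m. (norm h)\<^sup>2 / \<rho>\<^sup>2 * (norm (c m) * \<rho> ^ deg m))"
      by (rule infsum_mono_neutral[OF A'' A']) (use \<rho> in auto)
    also have "\<dots> = (norm h)\<^sup>2 / \<rho>\<^sup>2 * K" unfolding K_def by (rule infsum_cmult_right) (rule A)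
    finally show ?thesis by (simp add: mult.commute)
  qed
  have "(f has_derivative D) (at a)"
    unfolding has_derivative_at
  proof (intro conjI D)
    show "(\<lambda>h. norm (f (a + h) - f a - D h) / norm h) \<midarrow>0\<rightarrow> 0"
    proof (rule Lim_null_comparison)
      show "((\<lambda>h::real^'n. K / \<rho>\<^sup>2 * norm h) \<longlongrightarrow> 0) (at 0)" 
        by (rule tendsto_mult_right_zero[OF tendsto_norm_zero[OF tendsto_ident_at]])
      have "\<forall>\<^sub>F h in at (0::real^'n). norm h < \<rho>"
        using \<rho> unfolding eventually_at by (intro exI[of _ \<rho>]) simp
      then show "\<forall>\<^sub>F h in at 0. norm (norm (f (a + h) - f a - D h) / norm h) \<le> K / \<rho>\<^sup>2 * norm h"
      proof eventually_elim
        case (elim h)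
        show ?case
        proof (cases "h = 0")
          case False
          have "norm (f (a + h) - f a - D h) / norm h \<le> K / \<rho>\<^sup>2 * (norm h)\<^sup>2 / norm h"
            by (intro divide_right_mono bound) (use elim in auto)
          then show ?thesis using False by (simp add: power2_eq_square)
        qed simp
      qed
    qed
  qed
  then show ?thesis by (auto simp: differentiable_def)
qed

context dunkl
begin

text \<open>The claim is made for all compositions with group elements because the recursion
  evaluates at them. The total mass of the resolvent again gives the factorial, so these bounds are
  summable over \<open>n\<close> on a polydisc of fixed radius.\<close>

lemma power_series_at_kco:
  assumes "g \<in> G"
  shows "power_series_at a (\<lambda>y. of_real (kco n x (g y))) ((norm x * (\<Sum>i\<in>UNIV. 1 + \<bar>a $ i\<bar>)) ^ n / fact n)"
  using assms
proof (induction n arbitrary: g)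
  case 0
  then show ?case using power_series_at_const[of a 1] by simp
next
  case (Suc n)
  define K where "K = norm x * (\<Sum>i\<in>UNIV. 1 + \<bar>a $ i\<bar>)"
  have "power_series_at a (\<lambda>y. of_real (inv (h \<circ> g) x \<bullet> y) * of_real (kco n x ((h \<circ> g) y)))
      (K * (K ^ n / fact n))" if "h \<in> G" for h
  proof -
    have hg: "h \<circ> g \<in> G" using that Suc.prems by (rule refl_group.mult)
    have "norm (inv (h \<circ> g) x) \<le> norm x" using G_norm[OF refl_group.inverse[OF hg]] by simp
    from power_series_at_inner[OF Suc.IH[OF hg] this] show ?thesis by (simp add: K_def)
  qed
  then have 1: "power_series_at a (\<lambda>y. \<Sum>h\<in>G. of_real (resolvent (real (Suc n)) h) *
      (of_real (inv (h \<circ> g) x \<bullet> y) * of_real (kco n x ((h \<circ> g) y))))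
    (\<Sum>h\<in>G. norm (complex_of_real (resolvent (real (Suc n)) h)) * (K * (K ^ n / fact n)))"
    by (intro power_series_at_sum power_series_at_cmult finite_G)
  have "(\<Sum>h\<in>G. of_real (resolvent (real (Suc n)) h) *
      (of_real (inv (h \<circ> g) x \<bullet> y) * of_real (kco n x ((h \<circ> g) y)))) = complex_of_real (kco (Suc n) x (g y))" for y
  proof -
    have "x \<bullet> h (g y) = inv (h \<circ> g) x \<bullet> y" if "h \<in> G" for h
      using G_inner[OF refl_group.mult[OF that Suc.prems], of x y] by simp
    then show ?thesis by (simp add: kco.simps(2) cong: sum.cong)
  qed
  moreover have "(\<Sum>h\<in>G. norm (complex_of_real (resolvent (real (Suc n)) h)) * (K * (K ^ n / fact n)))
      = K ^ Suc n / fact (Suc n)"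
  proof -
    have "(\<Sum>h\<in>G. norm (complex_of_real (resolvent (real (Suc n)) h)) * (K * (K ^ n / fact n)))
      = (\<Sum>h\<in>G. resolvent (real (Suc n)) h) * (K * (K ^ n / fact n))"
      unfolding sum_distrib_right
      by (intro sum.cong) (auto simp: resolvent_nonneg simp del: of_nat_Suc)
    then show ?thesis
      by (simp only: sum_resolvent[of "real (Suc n)"] of_nat_0_less_iff zero_less_Suc) (simp add: divide_simps)
  qed
  ultimately show ?case using 1 by (simp add: K_def)
qed

lemma real_analytic_kern: "real_analytic (kern x)"
  unfolding real_analytic_def
proof
  fix a :: "real^'n"
  define M where "M n = (norm x * (\<Sum>i\<in>UNIV. 1 + \<bar>a $ i\<bar>)) ^ n / fact n" for n
  have "power_series_at a (kern x) (\<Sum>n. M n)"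
  proof (rule power_series_at_suminf[where f = "\<lambda>n y. \<i> ^ n * of_real (kco n x y)"])
    show "power_series_at a (\<lambda>y. \<i> ^ n * complex_of_real (kco n x y)) (M n)" for n
      using power_series_at_cmult[OF power_series_at_kco[OF id_in_G, of a n x], of "\<i> ^ n"]
      by (simp add: M_def norm_power)
    show "summable M" unfolding M_def by (rule summable_pow_fact)
    show "(\<lambda>n. \<i> ^ n * complex_of_real (kco n x y)) sums kern x y" for y
      unfolding kern_def by (rule summable_sums[OF summable_kern])
  qed
  then obtain c where c: "\<And>h. (\<forall>i. \<bar>h $ i\<bar> \<le> 1) \<Longrightarrow> ((\<lambda>m. c m * of_real (monom_at m h)) has_sum kern x (a + h)) UNIV"
    unfolding power_series_at_def by blast
  have "((\<lambda>m. c m * of_real (\<Prod>i\<in>UNIV. (y $ i - a $ i) ^ m i)) has_sum kern x y) UNIV" if "y \<in> ball a 1" for y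
  proof -
    have "\<bar>(y - a) $ i\<bar> \<le> 1" for i
      using component_le_norm_cart[of "y - a" i] that by (simp add: dist_norm norm_minus_commute)
    then show ?thesis using c[of "y - a"] by (simp add: monom_at_def)
  qed
  then show "\<exists>r>0. \<exists>c. \<forall>y\<in>ball a r. ((\<lambda>m. c m * of_real (\<Prod>i\<in>UNIV. (y $ i - a $ i) ^ m i)) has_sum kern x y) UNIV"
    by (intro exI[of _ 1] conjI exI[of _ c]) auto
qed

text \<open>The difference of two solutions satisfies the linear equation along rays and vanishes at
  the origin, so \<open>ray_bound_single\<close> makes it vanish everywhere.\<close>

lemma kern_unique:
  assumes "real_analytic f" "\<And>j y. T j f y = \<i> * of_real (x $ j) * f y" "f 0 = 1"
  shows "f = kern x"
proof
  fix y
  define d where "d y = f y - kern x y" for y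
  have fd: "f differentiable (at y)" for y using assms(1) by (rule real_analytic_differentiable)
  have kd: "kern x differentiable (at y)" for y using C1_kern by (simp add: C1_def)
  have pd: "partial_deriv j d y = partial_deriv j f y - partial_deriv j (kern x) y" for j y
  proof -
    have "(d has_derivative (\<lambda>h. (\<Sum>j\<in>UNIV. h $ j *\<^sub>R partial_deriv j f y)
        - (\<Sum>j\<in>UNIV. h $ j *\<^sub>R partial_deriv j (kern x) y))) (at y)"
      unfolding d_def[abs_def] by (intro has_derivative_diff differentiable_has_derivative_partial fd kd)
    from partial_deriv_eqI[OF this, of j] show ?thesis
      by (simp add: axis_def if_distrib[of "\<lambda>c. c *\<^sub>R _"] cong: if_cong)
  qed
  have "(norm (d y))\<^sup>2 \<le> real (card G) * (norm (d 0))\<^sup>2"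
  proof (rule ray_bound_single)
    show "d differentiable (at y)" for y unfolding d_def[abs_def] by (intro differentiable_diff fd kd)
    show "(\<Sum>j\<in>UNIV. y $ j *\<^sub>R partial_deriv j d y) + (\<Sum>v\<in>Rp. k v *\<^sub>R (d y - d (root_refl v y)))
       = \<i> * of_real (x \<bullet> y) * d y" for y
      using euler_eigenfunction[OF assms(2), of y] euler_eigenfunction[OF kern_dunkl, of y x]
      unfolding pd unfolding d_def
      by (simp add: scaleR_diff_right sum_subtractf sum.distrib algebra_simps)
  qed
  then show "f y = kern x y" by (simp add: d_def assms(3) kern_zero_right)
qed

lemma dunkl_kernel_eq: "dunkl_kernel Rp k (\<chi> j. \<i> * of_real (x $ j)) = kern x"
  unfolding dunkl_kernel_def
  by (rule the_equality) (auto simp: real_analytic_kern kern_dunkl kern_zero_right intro: kern_unique)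

lemma dunkl_kernel_minus_eq: "dunkl_kernel Rp k (\<chi> j. - \<i> * of_real (\<xi> $ j)) = kern (- \<xi>)"
  using dunkl_kernel_eq[of "- \<xi>"] by simp

end

section \<open>Integration against the Dunkl weight\<close>

lemma measurable_root_refl [measurable]: "root_refl v \<in> borel_measurable borel"
  by (intro borel_measurable_continuous_onI linear_continuous_on)
     (use linear_root_refl linear_conv_bounded_linear in blast)

lemma nn_integral_lborel_shift:
  fixes c :: "'a::euclidean_space" and f :: "'a \<Rightarrow> ennreal"
  assumes [measurable]: "f \<in> borel_measurable borel"
  shows "(\<integral>\<^sup>+ y. f (y + c) \<partial>lborel) = (\<integral>\<^sup>+ y. f y \<partial>lborel)"
proof -
  have "(\<integral>\<^sup>+ y. f y \<partial>lborel) = (\<integral>\<^sup>+ y. f y \<partial>(distr lborel borel ((+) c)))"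
    by (simp add: lborel_distr_plus)
  also have "\<dots> = (\<integral>\<^sup>+ y. f (y + c) \<partial>lborel)"
    by (subst nn_integral_distr) (auto simp: add.commute)
  finally show ?thesis by simp
qed

lemma nn_integral_lborel_reflect:
  fixes c :: "'a::euclidean_space" and f :: "'a \<Rightarrow> ennreal"
  assumes [measurable]: "f \<in> borel_measurable borel"
  shows "(\<integral>\<^sup>+ y. f (c - y) \<partial>lborel) = (\<integral>\<^sup>+ y. f y \<partial>lborel)"
proof -
  have "(\<integral>\<^sup>+ y. f y \<partial>lborel) = (\<integral>\<^sup>+ y. f y \<partial>(distr lborel borel (\<lambda>x. c + (-1) *\<^sub>R x)))"
    using lborel_affine[of "-1" c] by (simp add: density_1)
  also have "\<dots> = (\<integral>\<^sup>+ y. f (c - y) \<partial>lborel)"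
    by (subst nn_integral_distr) auto
  finally show ?thesis by simp
qed

text \<open>The change of variables theorems of the library need a well-ordered index type. Here
  uniqueness of Haar measure does the job: both sides are translation invariant, and they agree
  on the unit ball.\<close>

lemma nn_integral_root_refl:
  fixes f :: "real^'n \<Rightarrow> ennreal"
  assumes f [measurable]: "f \<in> borel_measurable borel"
  shows "(\<integral>\<^sup>+ x. f (root_refl v x) \<partial>lborel) = (\<integral>\<^sup>+ x. f x \<partial>lborel)"
proof -
  define g :: "real^'n \<Rightarrow> ennreal" where "g = indicator (ball 0 1)"
  have g [measurable]: "g \<in> borel_measurable borel" unfolding g_def by (intro borel_measurable_indicator) simp
  let ?s = "root_refl v"
  have [measurable]: "?s \<in> borel_measurable lborel" by simp
  let ?I = "\<integral>\<^sup>+ y. g y \<partial>lborel"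
  have I: "?I = emeasure lborel (ball (0::real^'n) 1)" unfolding g_def by (simp add: nn_integral_indicator)
  have I0: "?I \<noteq> 0"
  proof
    assume "?I = 0"
    then have "measure lborel (ball (0::real^'n) 1) = 0" by (simp add: I measure_def)
    then show False using content_ball_pos[of 1 "0::real^'n"] by simp
  qed
  have I1: "?I \<noteq> \<infinity>" using emeasure_lborel_ball_finite[of "0::real^'n" 1] by (simp add: I)
  have "(\<integral>\<^sup>+ x. f (?s x) \<partial>lborel) * ?I = (\<integral>\<^sup>+ x. f (?s x) * ?I \<partial>lborel)"
    by (rule nn_integral_multc[symmetric]) measurable
  also have "\<dots> = (\<integral>\<^sup>+ x. \<integral>\<^sup>+ y. f (?s x) * g (y + ?s x) \<partial>lborel \<partial>lborel)"
    by (simp add: nn_integral_cmult nn_integral_lborel_shift)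
  also have "\<dots> = (\<integral>\<^sup>+ y. \<integral>\<^sup>+ x. f (?s x) * g (y + ?s x) \<partial>lborel \<partial>lborel)"
    by (rule lborel_pair.Fubini'[symmetric]) measurable
  \<comment> \<open>Translating \<open>x\<close> by the reflection of \<open>y\<close> moves
    \<open>y\<close> from the argument of \<open>g\<close> to that of \<open>f\<close>, because the
    reflection is linear and involutive.\<close>
  also have "\<dots> = (\<integral>\<^sup>+ y. \<integral>\<^sup>+ x. f (?s x - y) * g (?s x) \<partial>lborel \<partial>lborel)"
  proof (rule nn_integral_cong)
    fix y
    have "(\<integral>\<^sup>+ x. f (?s x - y) * g (?s x) \<partial>lborel)
        = (\<integral>\<^sup>+ x. f (?s (x + ?s y) - y) * g (?s (x + ?s y)) \<partial>lborel)"
      by (rule nn_integral_lborel_shift[symmetric]) measurable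
    then show "(\<integral>\<^sup>+ x. f (?s x) * g (y + ?s x) \<partial>lborel) = (\<integral>\<^sup>+ x. f (?s x - y) * g (?s x) \<partial>lborel)"
      by (simp add: linear_add[OF linear_root_refl] add.commute)
  qed
  also have "\<dots> = (\<integral>\<^sup>+ x. \<integral>\<^sup>+ y. f (?s x - y) * g (?s x) \<partial>lborel \<partial>lborel)"
    by (rule lborel_pair.Fubini') measurable
  also have "\<dots> = (\<integral>\<^sup>+ x. (\<integral>\<^sup>+ y. f y \<partial>lborel) * g (?s x) \<partial>lborel)"
    by (simp add: nn_integral_multc nn_integral_lborel_reflect)
  also have "\<dots> = (\<integral>\<^sup>+ y. f y \<partial>lborel) * (\<integral>\<^sup>+ x. g (?s x) \<partial>lborel)"
    by (rule nn_integral_cmult) measurable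
  also have "(\<integral>\<^sup>+ x. g (?s x) \<partial>lborel) = ?I"
    by (intro nn_integral_cong) (simp add: g_def indicator_def)
  finally have eq: "(\<integral>\<^sup>+ x. f (?s x) \<partial>lborel) * ?I = (\<integral>\<^sup>+ y. f y \<partial>lborel) * ?I" .
  have cancel: "a * ?I / ?I = a" for a using I0 I1 by (intro mult_divide_eq_ennreal) auto
  show ?thesis using arg_cong[OF eq, of "\<lambda>a. a / ?I"] unfolding cancel .
qed

lemma distr_lborel_root_refl: "distr lborel borel (root_refl v) = (lborel :: (real^'n) measure)"
proof (rule measure_eqI)
  fix A assume "A \<in> sets (distr lborel borel (root_refl v))"
  then have A [measurable]: "A \<in> sets borel" by simp
  have "emeasure (distr lborel borel (root_refl v)) A = (\<integral>\<^sup>+ x. indicator A (root_refl v x) \<partial>lborel)"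
    by (simp add: nn_integral_distr flip: nn_integral_indicator)
  also have "\<dots> = emeasure lborel A" by (subst nn_integral_root_refl) auto
  finally show "emeasure (distr lborel borel (root_refl v)) A = emeasure lborel A" .
qed simp

lemma integral_root_refl:
  fixes f :: "real^'n \<Rightarrow> 'b::{banach, second_countable_topology}"
  assumes "f \<in> borel_measurable borel"
  shows "(LINT x|lborel. f (root_refl v x)) = (LINT x|lborel. f x)"
  using integral_distr[of "root_refl v" lborel borel f] assms by (simp add: distr_lborel_root_refl)

lemma integrable_abs_coordinate_reflect:
  fixes h :: "real \<Rightarrow> real"
  assumes "integrable lborel h" shows "integrable lborel (\<lambda>t. h (- t))"
  using lborel_integrable_real_affine[OF assms, of "-1" 0] by simp

lemma integrable_powr_decay:
  assumes a: "0 \<le> a" "a < 1" and b: "0 \<le> b" "a + b > 1"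
  shows "integrable lborel (\<lambda>t::real. \<bar>t\<bar> powr - a * (1 + \<bar>t\<bar>) powr - b)"
proof -
  define h1 where "h1 t = indicator {0..1} t * t powr - a" for t :: real
  define h2 where "h2 t = indicator {1..} t * t powr - (a + b)" for t :: real
  have "(\<lambda>t::real. t powr - a) integrable_on {0..1}" using a by (intro integrable_on_powr_from_0) auto
  then have "set_integrable lebesgue {0..1} (\<lambda>t::real. t powr - a)"
    by (rule nonnegative_absolutely_integrable_1) simp
  then have h1: "integrable lborel h1"
    unfolding set_integrable_def h1_def[abs_def] by (subst (asm) integrable_completion) auto
  have "(\<lambda>t::real. t powr - (a + b)) integrable_on {1..}"
    using has_integral_powr_to_inf[of "- (a + b)" 1] b by (auto simp: integrable_on_def)
  then have "set_integrable lebesgue {1..} (\<lambda>t::real. t powr - (a + b))"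
    by (rule nonnegative_absolutely_integrable_1) simp
  then have h2: "integrable lborel h2"
    unfolding set_integrable_def h2_def[abs_def] by (subst (asm) integrable_completion) auto
  have "integrable lborel (\<lambda>t. (h1 t + h2 t) + (h1 (- t) + h2 (- t)))"
    by (intro Bochner_Integration.integrable_add integrable_abs_coordinate_reflect h1 h2)
  then show ?thesis
  proof (rule Bochner_Integration.integrable_bound)
    have pos: "h1 t \<ge> 0" "h2 t \<ge> 0" for t by (auto simp: h1_def h2_def)
    have key: "\<bar>t\<bar> powr - a * (1 + \<bar>t\<bar>) powr - b \<le> h1 \<bar>t\<bar> + h2 \<bar>t\<bar>" for t
    proof (cases "\<bar>t\<bar> \<le> 1")
      case True
      have "\<bar>t\<bar> powr - a * (1 + \<bar>t\<bar>) powr - b \<le> \<bar>t\<bar> powr - a * 1"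
        using b by (intro mult_left_mono) (auto simp: powr_minus divide_simps ge_one_powr_ge_zero)
      then show ?thesis using True pos(2)[of "\<bar>t\<bar>"] by (simp add: h1_def)
    next
      case False
      have "\<bar>t\<bar> powr - a * (1 + \<bar>t\<bar>) powr - b \<le> \<bar>t\<bar> powr - a * \<bar>t\<bar> powr - b"
        using b False by (intro mult_left_mono powr_mono2') auto
      also have "\<dots> = h2 \<bar>t\<bar>" using False by (simp add: h2_def flip: powr_add)
      finally show ?thesis using pos(1)[of "\<bar>t\<bar>"] by simp
    qed
    have le: "norm (\<bar>t\<bar> powr - a * (1 + \<bar>t\<bar>) powr - b) \<le> norm ((h1 t + h2 t) + (h1 (- t) + h2 (- t)))" for t
      using key[of t] pos[of t] pos[of "- t"] by (cases "t \<ge> 0") auto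
    show "AE t in lborel. norm (\<bar>t\<bar> powr - a * (1 + \<bar>t\<bar>) powr - b) \<le> norm ((h1 t + h2 t) + (h1 (- t) + h2 (- t)))"
      using le by (rule AE_I2)
  qed measurable
qed

lemma integrable_prod_coord:
  fixes u :: "real \<Rightarrow> real"
  assumes "integrable lborel u"
  shows "integrable lborel (\<lambda>x::real^'n. \<Prod>i\<in>UNIV. u (x $ i))"
proof -
  interpret product_sigma_finite "\<lambda>_. lborel::real measure" by standard
  have [measurable]: "u \<in> borel_measurable borel" using assms by (simp add: borel_measurable_integrable)
  let ?T = "\<lambda>f. \<Sum>b\<in>Basis. f b *\<^sub>R (b::real^'n)"
  have "integrable (\<Pi>\<^sub>M b\<in>(Basis::(real^'n) set). lborel) (\<lambda>f. \<Prod>b\<in>Basis. u (f b))"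
    by (rule product_integrable_prod) (auto intro: assms)
  moreover have "(\<Prod>i\<in>UNIV. u (?T f $ i)) = (\<Prod>b\<in>Basis. u (f b))" for f
  proof -
    have "?T f $ i = f (axis i 1)" for i
    proof -
      have "?T f \<bullet> axis i 1 = f (axis i 1)" by (rule inner_sum_left_Basis) (auto simp: Basis_vec_def)
      then show ?thesis by (simp only: cart_eq_inner_axis)
    qed
    moreover have "(\<Prod>i\<in>UNIV. u (f (axis i 1))) = (\<Prod>b\<in>range (\<lambda>i::'n. axis i (1::real)). u (f b))"
      by (subst prod.reindex) (auto simp: inj_def axis_eq_axis)
    moreover have "Basis = range (\<lambda>i::'n. axis i (1::real))" by (auto simp: Basis_vec_def)
    ultimately show ?thesis by (simp only:)
  qed
  ultimately have 1: "integrable (\<Pi>\<^sub>M b\<in>(Basis::(real^'n) set). lborel) (\<lambda>f. \<Prod>i\<in>UNIV. u (?T f $ i))" by simp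
  show ?thesis
    by (subst lborel_eq, subst integrable_distr_eq) (use 1 in auto)
qed

lemma AE_lborel_component_nonzero: "AE x::real^'n in lborel. \<forall>i. x $ i \<noteq> 0"
proof -
  have "AE x::real^'n in lborel. x $ i \<noteq> 0" for i
  proof -
    have "axis i (1::real) \<in> Basis" by (auto simp: Basis_vec_def)
    from AE_lborel_inner_neq[OF this, of 0] show ?thesis by (simp add: cart_eq_inner_axis)
  qed
  then show ?thesis by (subst AE_all_countable) auto
qed

text \<open>This avoids polar coordinates. Both exponents are nonpositive and each coordinate is at
  most the norm, so distributing them evenly over the coordinates gives a product majorant,
  integrable by the one-dimensional case.\<close>

lemma integrable_radial:
  fixes A B :: real
  assumes "0 \<le> A" "A < real CARD('n)" "0 \<le> B" "A + B > real CARD('n)"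
  shows "integrable lborel (\<lambda>x::real^'n. norm x powr - A * (1 + norm x) powr - B)"
proof -
  let ?d = "real CARD('n)"
  define a where "a = A / ?d" define b where "b = B / ?d"
  have d: "?d > 0" by simp
  have "a + b > 1" using assms d by (simp add: a_def b_def flip: add_divide_distrib)
  then have "integrable lborel (\<lambda>t::real. \<bar>t\<bar> powr - a * (1 + \<bar>t\<bar>) powr - b)"
    using assms d by (intro integrable_powr_decay) (auto simp: a_def b_def)
  then have "integrable lborel (\<lambda>x::real^'n. \<Prod>i\<in>UNIV. \<bar>x $ i\<bar> powr - a * (1 + \<bar>x $ i\<bar>) powr - b)"
    by (rule integrable_prod_coord)
  then show ?thesis
  proof (rule Bochner_Integration.integrable_bound)
    show "AE x::real^'n in lborel. norm (norm x powr - A * (1 + norm x) powr - B)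
       \<le> norm (\<Prod>i\<in>UNIV. \<bar>x $ i\<bar> powr - a * (1 + \<bar>x $ i\<bar>) powr - b)"
      using AE_lborel_component_nonzero
    proof eventually_elim
      case (elim x)
      have "x \<noteq> 0" using elim by auto
      have *: "(\<Prod>i\<in>(UNIV::'n set). norm x powr - a * (1 + norm x) powr - b) = norm x powr - A * (1 + norm x) powr - B"
      proof -
        have "(\<Prod>i\<in>(UNIV::'n set). norm x powr - a * (1 + norm x) powr - b)
          = (norm x powr - a) powr ?d * ((1 + norm x) powr - b) powr ?d"
        proof -
          have "norm x powr - a > 0" "(1 + norm x) powr - b > 0"
            using \<open>x \<noteq> 0\<close> add_pos_nonneg[OF zero_less_one norm_ge_zero[of x]] by auto
          then show ?thesis by (simp add: power_mult_distrib powr_realpow)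
        qed
        then show ?thesis using d by (simp add: powr_powr a_def b_def)
      qed
      have "(\<Prod>i\<in>(UNIV::'n set). norm x powr - a * (1 + norm x) powr - b)
         \<le> (\<Prod>i\<in>UNIV. \<bar>x $ i\<bar> powr - a * (1 + \<bar>x $ i\<bar>) powr - b)"
      proof (intro prod_mono conjI mult_mono powr_mono2')
        show "\<bar>x $ i\<bar> \<le> norm x" "1 + \<bar>x $ i\<bar> \<le> 1 + norm x" for i using component_le_norm_cart[of x i] by auto
      qed (use elim assms in \<open>auto simp: a_def b_def\<close>)
      then show ?case unfolding * by (simp add: abs_prod)
    qed
  qed measurable
qed

text \<open>By translation invariance the integral of \<open>F'\<close> equals its average over the
  translates by t e with t in [0, 1]. By Fubini this is the integral of F (x + e) - F x, which is 0.
  Only the integrated derivative on almost every line is used, so singularities of \<open>F'\<close>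
  are allowed.\<close>

lemma integral_zero_of_line_derivative:
  fixes F F' :: "real^'n \<Rightarrow> complex"
  assumes F: "integrable lborel F" and F': "integrable lborel F'"
    and ftc: "AE x in lborel. ((\<lambda>t. F' (x + t *\<^sub>R e)) has_integral (F (x + e) - F x)) {0..1}"
  shows "(LINT x|lborel. F' x) = 0"
proof -
  have [measurable]: "F \<in> borel_measurable borel" "F' \<in> borel_measurable borel"
    using F F' by (auto simp: borel_measurable_integrable)
  have shift: "integrable lborel (\<lambda>x. H (x + c))" "(LINT x|lborel. H (x + c)) = (LINT x|lborel. H x)"
    if "integrable lborel H" for H :: "real^'n \<Rightarrow> 'b::{banach,second_countable_topology}" and c
  proof -
    have [measurable]: "H \<in> borel_measurable borel" using that by (auto simp: borel_measurable_integrable)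
    have "integrable (distr lborel borel ((+) c)) H" using that by (simp add: lborel_distr_plus)
    then show "integrable lborel (\<lambda>x. H (x + c))" by (subst (asm) integrable_distr_eq) (auto simp: add.commute)
    have "(LINT x|lborel. H x) = (LINT x|distr lborel borel ((+) c). H x)" by (simp add: lborel_distr_plus)
    also have "\<dots> = (LINT x|lborel. H (x + c))" by (subst integral_distr) (auto simp: add.commute)
    finally show "(LINT x|lborel. H (x + c)) = (LINT x|lborel. H x)" by simp
  qed
  define P where "P t x = indicator {0..1::real} t *\<^sub>R F' (x + t *\<^sub>R e)" for t x
  have [measurable]: "case_prod P \<in> borel_measurable (lborel \<Otimes>\<^sub>M lborel)"
    unfolding P_def by measurable
  have Pt: "integrable lborel (P t)" "(LINT x|lborel. P t x) = indicator {0..1} t *\<^sub>R (LINT x|lborel. F' x)"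
    "(LINT x|lborel. norm (P t x)) = indicator {0..1} t * (LINT x|lborel. norm (F' x))" for t
    using shift(1)[OF F', of "t *\<^sub>R e"] shift(2)[OF F', of "t *\<^sub>R e"]
      shift(2)[OF integrable_norm[OF F'], of "t *\<^sub>R e"] by (auto simp: P_def[abs_def])
  have ind: "integrable lborel (\<lambda>t. indicator {0..1::real} t * c)" for c :: real
    by (intro integrable_mult_left integrable_real_indicator) auto
  have int: "integrable (lborel \<Otimes>\<^sub>M lborel) (case_prod P)"
    by (rule lborel_pair.Fubini_integrable) (auto simp: Pt ind)
  have AE: "AE x in lborel. integrable lborel (\<lambda>t. P t x)"
    using lborel_pair.AE_integrable_snd[OF int] by simp
  have "(LINT x|lborel. F' x) = (LINT t|lborel. LINT x|lborel. P t x)"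
    by (simp add: Pt)
  also have "\<dots> = (LINT x|lborel. LINT t|lborel. P t x)"
    using lborel_pair.Fubini_integral[OF int] by simp
  also have "\<dots> = (LINT x|lborel. F (x + e) - F x)"
  proof (rule integral_cong_AE)
    show "AE x in lborel. (LINT t|lborel. P t x) = F (x + e) - F x"
      using AE ftc
    proof eventually_elim
      case (elim x)
      then have "set_integrable lborel {0..1} (\<lambda>t. F' (x + t *\<^sub>R e))"
        by (simp add: set_integrable_def P_def)
      from set_borel_integral_eq_integral(2)[OF this]
      show ?case using integral_unique[OF elim(2)] by (simp add: set_lebesgue_integral_def P_def)
    qed
  qed measurable
  also have "\<dots> = 0"
    using shift[OF F, of e] F by simp
  finally show ?thesis .
qed

text \<open>The integral is averaged over translates by t v with t in [0, 1]. The decaying factor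
  changes by at most a constant, and the singular factor has an integral over \<open>t\<close> that
  is bounded uniformly in \<open>x\<close>. This replaces an orthogonal change of
  coordinates.\<close>

lemma integrable_powr_inner_decay:
  fixes v :: "real^'n"
  assumes v: "v \<noteq> 0" and a: "0 \<le> a" "a < 1"
  shows "integrable lborel (\<lambda>x. \<bar>v \<bullet> x\<bar> powr - a / (1 + norm x) ^ (2 * CARD('n)))"
proof -
  let ?M = "2 * CARD('n)"
  define D where "D x = 1 / (1 + norm x) ^ ?M" for x :: "real^'n"
  have D0: "D x \<ge> 0" for x by (simp add: D_def)
  have [measurable]: "D \<in> borel_measurable borel" unfolding D_def[abs_def] by measurable
  have intD: "integrable lborel D"
  proof (rule Bochner_Integration.integrable_bound)
    show "integrable lborel (\<lambda>x::real^'n. norm x powr - 0 * (1 + norm x) powr - real ?M)"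
      by (rule integrable_radial) auto
    show "AE x in lborel. norm (D x) \<le> norm (norm x powr - 0 * (1 + norm x) powr - real ?M)"
      using AE_lborel_component_nonzero
    proof eventually_elim
      case (elim x)
      then have "x \<noteq> 0" by auto
      then show ?case by (simp add: D_def powr_minus powr_realpow add_pos_nonneg divide_simps del: of_nat_mult)
    qed
  qed measurable
  define c where "c = (norm v)\<^sup>2"
  have c: "c > 0" using v by (simp add: c_def)
  define p where "p y = ennreal (\<bar>y\<bar> powr - a)" for y :: real
  have [measurable]: "p \<in> borel_measurable borel" unfolding p_def[abs_def] by measurable
  \<comment> \<open>The part of the singular factor near its pole. Away from the pole the factor is
    at most 1, which accounts for the summand 1 in \<open>Q\<close>.\<close>
  define q where "q y = indicator {-1..1} y * p y" for y :: real
  have [measurable]: "q \<in> borel_measurable borel" unfolding q_def[abs_def] by measurable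
  have q_fin: "(\<integral>\<^sup>+ y. q y \<partial>lborel) < \<infinity>"
  proof -
    have "integrable lborel (\<lambda>t::real. \<bar>t\<bar> powr - a * (1 + \<bar>t\<bar>) powr - 2)"
      using a by (intro integrable_powr_decay) auto
    then have "integrable lborel (\<lambda>t::real. 4 * (\<bar>t\<bar> powr - a * (1 + \<bar>t\<bar>) powr - 2))" by simp
    then have f1: "(\<integral>\<^sup>+ y. ennreal (4 * (\<bar>y\<bar> powr - a * (1 + \<bar>y\<bar>) powr - 2)) \<partial>lborel) < \<infinity>"
      by (subst nn_integral_eq_integral) auto
    have f2: "q y \<le> ennreal (4 * (\<bar>y\<bar> powr - a * (1 + \<bar>y\<bar>) powr - 2))" for y
    proof (cases "\<bar>y\<bar> \<le> 1")
      case True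
      then have "(1 + \<bar>y\<bar>)\<^sup>2 \<le> 2\<^sup>2" by (intro power_mono) auto
      then have "1 \<le> 4 * (1 + \<bar>y\<bar>) powr - 2"
        by (simp add: powr_minus powr_numeral divide_simps add_pos_nonneg)
      then have "\<bar>y\<bar> powr - a * 1 \<le> \<bar>y\<bar> powr - a * (4 * (1 + \<bar>y\<bar>) powr - 2)" by (intro mult_left_mono) auto
      then show ?thesis using True by (auto simp: q_def p_def indicator_def mult_ac intro!: ennreal_leI)
    qed (auto simp: q_def indicator_def)
    show ?thesis by (rule order_le_less_trans[OF nn_integral_mono[OF f2] f1])
  qed
  define Q where "Q = 1 + ennreal (1 / c) * (\<integral>\<^sup>+ y. q y \<partial>lborel)"
  have Q_fin: "Q < \<infinity>" using q_fin by (simp add: Q_def ennreal_mult_less_top)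
  have inner: "(\<integral>\<^sup>+ t. indicator {0..1} t * p (b + t * c) \<partial>lborel) \<le> Q" for b
  proof -
    have "(\<integral>\<^sup>+ t. indicator {0..1} t * p (b + t * c) \<partial>lborel) \<le> (\<integral>\<^sup>+ t. indicator {0..1} t + q (b + c * t) \<partial>lborel)"
    proof (intro nn_integral_mono)
      fix t :: real
      have "p y \<le> 1 + q y" for y
      proof (cases "\<bar>y\<bar> \<le> 1")
        case False
        then have "\<bar>y\<bar> powr - a \<le> 1" using a by (simp add: powr_minus divide_simps ge_one_powr_ge_zero)
        then show ?thesis by (auto simp: p_def intro: add_increasing2)
      qed (auto simp: q_def indicator_def)
      then show "indicator {0..1} t * p (b + t * c) \<le> indicator {0..1} t + q (b + c * t)"
        by (auto simp: indicator_def mult.commute)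
    qed
    also have "\<dots> = 1 + (\<integral>\<^sup>+ t. q (b + c * t) \<partial>lborel)"
      by (subst nn_integral_add) (auto simp: nn_integral_indicator)
    also have "(\<integral>\<^sup>+ t. q (b + c * t) \<partial>lborel) = ennreal (1 / c) * (\<integral>\<^sup>+ y. q y \<partial>lborel)"
    proof -
      have "(\<integral>\<^sup>+ y. q y \<partial>lborel) = ennreal c * (\<integral>\<^sup>+ t. q (b + c * t) \<partial>lborel)"
        using nn_integral_real_affine[of q c b] c by simp
      then have "ennreal (1 / c) * (\<integral>\<^sup>+ y. q y \<partial>lborel)
          = (ennreal (1 / c) * ennreal c) * (\<integral>\<^sup>+ t. q (b + c * t) \<partial>lborel)"
        by (simp add: mult.assoc)
      also have "ennreal (1 / c) * ennreal c = 1" using c by (simp flip: ennreal_mult')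
      finally show ?thesis by simp
    qed
    finally show ?thesis by (simp add: Q_def)
  qed
  have shiftD: "D (x + t *\<^sub>R v) \<le> (1 + norm v) ^ ?M * D x" if "0 \<le> t" "t \<le> 1" for t x
  proof -
    have "norm x \<le> norm (x + t *\<^sub>R v) + norm (t *\<^sub>R v)"
        by (metis add_diff_cancel norm_triangle_sub norm_triangle_ineq4)
    also have "norm (t *\<^sub>R v) \<le> norm v" using that by (simp add: mult_left_le_one_le)
    finally have "norm x \<le> norm (x + t *\<^sub>R v) + norm v" by simp
    moreover have "0 \<le> norm v * norm (x + t *\<^sub>R v)" by simp
    ultimately have "1 + norm x \<le> (1 + norm v) * (1 + norm (x + t *\<^sub>R v))"
      unfolding distrib_left distrib_right by linarith
    then have "(1 + norm x) ^ ?M \<le> ((1 + norm v) * (1 + norm (x + t *\<^sub>R v))) ^ ?M" by (intro power_mono) auto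
    then show ?thesis unfolding D_def power_mult_distrib
      by (simp add: divide_simps add_pos_nonneg zero_less_power mult.commute)
  qed
  define F where "F x = p (v \<bullet> x) * ennreal (D x)" for x
  have [measurable]: "F \<in> borel_measurable borel" unfolding F_def[abs_def] by measurable
  have "(\<integral>\<^sup>+ x. F x \<partial>lborel) = (\<integral>\<^sup>+ t. indicator {0..1::real} t * (\<integral>\<^sup>+ x. F x \<partial>lborel) \<partial>lborel)"
    by (subst nn_integral_multc) (auto simp: nn_integral_indicator)
  also have "\<dots> = (\<integral>\<^sup>+ t. \<integral>\<^sup>+ x. indicator {0..1::real} t * F (x + t *\<^sub>R v) \<partial>lborel \<partial>lborel)"
    by (intro nn_integral_cong) (simp add: nn_integral_cmult nn_integral_lborel_shift)
  also have "\<dots> = (\<integral>\<^sup>+ x. \<integral>\<^sup>+ t. indicator {0..1::real} t * F (x + t *\<^sub>R v) \<partial>lborel \<partial>lborel)"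
    by (rule lborel_pair.Fubini') measurable
  also have "\<dots> \<le> (\<integral>\<^sup>+ x. \<integral>\<^sup>+ t. (indicator {0..1::real} t * p (v \<bullet> x + t * c)) * ennreal ((1 + norm v) ^ ?M
      * D x) \<partial>lborel \<partial>lborel)"
  proof (intro nn_integral_mono)
    fix x t
    have "v \<bullet> (x + t *\<^sub>R v) = v \<bullet> x + t * c" by (simp add: inner_add_right c_def power2_norm_eq_inner)
    then show "indicator {0..1::real} t * F (x + t *\<^sub>R v)
      \<le> (indicator {0..1::real} t * p (v \<bullet> x + t * c)) * ennreal ((1 + norm v) ^ ?M * D x)"
      using shiftD[of t x] by (auto simp: indicator_def F_def intro!: mult_left_mono ennreal_leI)
  qed
  also have "\<dots> = (\<integral>\<^sup>+ x. (\<integral>\<^sup>+ t. indicator {0..1::real} t * p (v \<bullet> x + t * c) \<partial>lborel) * ennreal ((1 + norm v) ^ ?M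
      * D x) \<partial>lborel)"
    by (intro nn_integral_cong nn_integral_multc) measurable
  also have "\<dots> \<le> (\<integral>\<^sup>+ x. Q * ennreal ((1 + norm v) ^ ?M * D x) \<partial>lborel)"
    by (intro nn_integral_mono mult_right_mono inner) auto
  also have "\<dots> = Q * (\<integral>\<^sup>+ x. ennreal ((1 + norm v) ^ ?M * D x) \<partial>lborel)"
    by (rule nn_integral_cmult) measurable
  also have "\<dots> < \<infinity>"
  proof -
    have "integrable lborel (\<lambda>x. (1 + norm v) ^ ?M * D x)" using intD by simp
    then have "(\<integral>\<^sup>+ x. ennreal ((1 + norm v) ^ ?M * D x) \<partial>lborel) < \<infinity>"
      by (subst nn_integral_eq_integral) (auto simp: D0)
    then show ?thesis using Q_fin by (simp add: ennreal_mult_less_top)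
  qed
  finally have fin: "(\<integral>\<^sup>+ x. F x \<partial>lborel) < \<infinity>" .
  show ?thesis
  proof (rule integrableI_bounded)
    have "(\<integral>\<^sup>+ x. ennreal (norm (\<bar>v \<bullet> x\<bar> powr - a / (1 + norm x) ^ ?M)) \<partial>lborel) = (\<integral>\<^sup>+ x. F x \<partial>lborel)"
      by (intro nn_integral_cong) (simp add: F_def p_def D_def flip: ennreal_mult)
    then show "(\<integral>\<^sup>+ x. ennreal (norm (\<bar>v \<bullet> x\<bar> powr - a / (1 + norm x) ^ ?M)) \<partial>lborel) < \<infinity>" using fin by simp
  qed measurable
qed

context dunkl
begin

section \<open>Growth and integrability of the weight\<close>

lemma measurable_weight [measurable]: "w \<in> borel_measurable borel"
  unfolding dunkl_weight_def[abs_def] by measurable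

lemma AE_regular: "AE x in lborel. regular x"
proof -
  have "{y. \<not> regular y} \<in> null_sets lebesgue" using negligible_not_regular negligible_iff_null_sets by blast
  then have "AE x in lebesgue. x \<notin> {y. \<not> regular y}" by (rule AE_not_in)
  then show ?thesis by (simp add: AE_completion_iff)
qed

text \<open>The degree 2 \<gamma> of the weight rounded up, so that growth and decay can be
  expressed by natural powers.\<close>

definition wdeg :: nat where "wdeg = nat \<lceil>2 * \<gamma>\<rceil>"

lemma wdeg: "2 * \<gamma> \<le> real wdeg"
  using gamma_nonneg by (simp add: wdeg_def)

text \<open>Stated for subproducts because \<open>integrable_weight_quotient\<close> treats the
  factor of one root separately.\<close>

lemma prod_powr_le:
  assumes "A \<subseteq> Rp"
  shows "(\<Prod>v\<in>A. \<bar>x \<bullet> v\<bar> powr (2 * k v)) \<le> (\<Prod>v\<in>Rp. (1 + norm v) powr (2 * k v)) * (1 + norm x) ^ wdeg"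
proof -
  have fin: "finite A" using assms finite_Rp finite_subset by blast
  have "(\<Prod>v\<in>A. \<bar>x \<bullet> v\<bar> powr (2 * k v)) \<le> (\<Prod>v\<in>A. ((1 + norm v) * (1 + norm x)) powr (2 * k v))"
  proof (intro prod_mono conjI powr_mono2)
    fix v assume "v \<in> A"
    have "\<bar>x \<bullet> v\<bar> \<le> norm x * norm v" by (rule Cauchy_Schwarz_ineq2)
    also have "\<dots> \<le> (1 + norm v) * (1 + norm x)" by (simp add: algebra_simps)
    finally show "\<bar>x \<bullet> v\<bar> \<le> (1 + norm v) * (1 + norm x)" .
  qed (use assms in \<open>auto simp: k_nonneg_Rp subset_iff\<close>)
  also have "\<dots> \<le> (\<Prod>v\<in>Rp. ((1 + norm v) * (1 + norm x)) powr (2 * k v))"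
  proof (rule prod_mono2[OF finite_Rp assms])
    fix v assume "v \<in> Rp - A"
    have "1 * 1 \<le> (1 + norm v) * (1 + norm x)" by (intro mult_mono) auto
    then show "1 \<le> ((1 + norm v) * (1 + norm x)) powr (2 * k v)"
      using \<open>v \<in> Rp - A\<close> by (intro ge_one_powr_ge_zero) (auto simp: k_nonneg_Rp)
  qed auto
  also have "\<dots> = (\<Prod>v\<in>Rp. (1 + norm v) powr (2 * k v)) * (1 + norm x) powr (2 * \<gamma>)"
    unfolding dunkl_gamma_def sum_distrib_left
    by (simp add: powr_mult prod.distrib powr_sum add_pos_nonneg less_imp_neq[THEN not_sym])
  also have "\<dots> \<le> (\<Prod>v\<in>Rp. (1 + norm v) powr (2 * k v)) * (1 + norm x) ^ wdeg"
  proof (rule mult_left_mono)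
    have "(1 + norm x) powr (2 * \<gamma>) \<le> (1 + norm x) powr real wdeg" by (intro powr_mono wdeg) auto
    then show "(1 + norm x) powr (2 * \<gamma>) \<le> (1 + norm x) ^ wdeg" by (simp add: powr_realpow add_pos_nonneg)
  qed (auto intro: prod_nonneg)
  finally show ?thesis .
qed

definition wC :: real where "wC = (\<Prod>v\<in>Rp. (1 + norm v) powr (2 * k v))"

lemma wC_nonneg: "wC \<ge> 0" unfolding wC_def by (intro prod_nonneg) auto

lemma weight_le: "w x \<le> wC * (1 + norm x) ^ wdeg"
  unfolding dunkl_weight_def wC_def by (rule prod_powr_le) auto

text \<open>Near 0 the bound by a power of 1 + |x| loses too much against the Riesz kernel; here the
  exact degree of homogeneity is kept.\<close>

lemma weight_le_norm:
  assumes "x \<noteq> 0" shows "w x \<le> wC * norm x powr (2 * \<gamma>)"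
proof -
  have "w x \<le> (\<Prod>v\<in>Rp. ((1 + norm v) * norm x) powr (2 * k v))"
    unfolding dunkl_weight_def
  proof (intro prod_mono conjI powr_mono2)
    fix v
    have "\<bar>x \<bullet> v\<bar> \<le> norm x * norm v" by (rule Cauchy_Schwarz_ineq2)
    then show "\<bar>x \<bullet> v\<bar> \<le> (1 + norm v) * norm x" by (simp add: algebra_simps add_increasing)
  qed (auto simp: k_nonneg_Rp)
  also have "\<dots> = wC * norm x powr (2 * \<gamma>)"
    unfolding dunkl_gamma_def sum_distrib_left wC_def using assms
    by (simp add: powr_mult prod.distrib powr_sum)
  finally show ?thesis .
qed

lemma weight_scaleR:
  assumes "t > 0" shows "w (t *\<^sub>R x) = t powr (2 * \<gamma>) * w x"
  unfolding dunkl_weight_def dunkl_gamma_def sum_distrib_left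
  using assms by (simp add: abs_mult powr_mult prod.distrib powr_sum)

text \<open>The decay that absorbs the growth of the weight and leaves (1 + |x|) ^ (-2 d),
  integrable with room to spare.\<close>

definition dec :: "real^'n \<Rightarrow> real" where
  "dec x = 1 / (1 + norm x) ^ (2 * CARD('n) + wdeg)"

lemma dec_pos: "dec x > 0"
  by (simp add: dec_def add_pos_nonneg)

lemma dec_le_1: "dec x \<le> 1"
  by (simp add: dec_def divide_simps add_pos_nonneg one_le_power)

lemma dec_refl [simp]: "dec (root_refl v x) = dec x"
  by (simp add: dec_def)

lemma measurable_dec [measurable]: "dec \<in> borel_measurable borel"
  unfolding dec_def[abs_def] by measurable

lemma integrable_poly_decay: "integrable lborel (\<lambda>x::real^'n. 1 / (1 + norm x) ^ (2 * CARD('n)))"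
proof -
  obtain v :: "real^'n" where v: "v \<noteq> 0" by (metis axis_eq_0_iff zero_neq_one)
  have "AE x in lborel. v \<bullet> x \<noteq> 0"
  proof -
    have "{x. v \<bullet> x = 0} \<in> null_sets lebesgue" using negligible_hyperplane[of v 0] v negligible_iff_null_sets by blast
    then have "AE x in lebesgue. x \<notin> {x. v \<bullet> x = 0}" by (rule AE_not_in)
    then show ?thesis by (simp add: AE_completion_iff)
  qed
  then show ?thesis
    by (intro Bochner_Integration.integrable_bound[OF integrable_powr_inner_decay[OF v, of 0]])
       (auto elim!: eventually_mono)
qed

lemma integrable_weight_dec: "integrable lborel (\<lambda>x. w x * dec x)"
proof (rule Bochner_Integration.integrable_bound)
  show "integrable lborel (\<lambda>x::real^'n. wC * (1 / (1 + norm x) ^ (2 * CARD('n))))"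
    by (intro integrable_mult_right integrable_poly_decay)
  have "norm (w x * dec x) \<le> norm (wC * (1 / (1 + norm x) ^ (2 * CARD('n))))" for x
  proof -
    have "w x * dec x \<le> (wC * (1 + norm x) ^ wdeg) * dec x"
      using weight_le dec_pos by (intro mult_right_mono) (auto intro: less_imp_le)
    also have "\<dots> = wC * (1 / (1 + norm x) ^ (2 * CARD('n)))"
      by (simp add: dec_def power_add add_pos_nonneg less_imp_neq[THEN not_sym])
    finally show ?thesis using weight_nonneg[of x] dec_pos[of x] wC_nonneg by (simp add: abs_mult)
  qed
  then show "AE x in lborel. norm (w x * dec x) \<le> norm (wC * (1 / (1 + norm x) ^ (2 * CARD('n))))" by simp
qed measurable

text \<open>The factor of \<open>v\<close> in the weight becomes |v . x| to the power 2 k(v) - 1 >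
  -1, still integrable across the hyperplane. Integration by parts needs this in order to integrate
  the contribution of each root separately.\<close>

lemma integrable_weight_quotient:
  assumes v: "v \<in> Rp" "k v \<noteq> 0"
  shows "integrable lborel (\<lambda>x. w x / \<bar>v \<bullet> x\<bar> * dec x)"
proof -
  have kv: "k v > 0" using k_nonneg_Rp[OF v(1)] v(2) by simp
  \<comment> \<open>If the exponent 2 k(v) - 1 is negative, \<open>a\<close> is its absolute value;
    otherwise there is no singularity and \<open>a\<close> is 0.\<close>
  define a where "a = max 0 (1 - 2 * k v)"
  have a: "0 \<le> a" "a < 1" using kv by (auto simp: a_def)
  let ?h = "\<lambda>x. wC * (\<bar>v \<bullet> x\<bar> powr - a / (1 + norm x) ^ (2 * CARD('n))) + w x * dec x"
  show ?thesis
  proof (rule Bochner_Integration.integrable_bound)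
    show "integrable lborel ?h"
      by (intro Bochner_Integration.integrable_add integrable_weight_dec integrable_mult_right
          integrable_powr_inner_decay[OF Rp_nonzero[OF v(1)] a])
    have "w x / \<bar>v \<bullet> x\<bar> * dec x \<le> ?h x" if x: "regular x" for x
    proof -
      define s where "s = \<bar>x \<bullet> v\<bar>"
      have s: "s > 0" using x v(1) by (auto simp: regular_def s_def inner_commute)
      define Oth where "Oth = (\<Prod>u\<in>Rp - {v}. \<bar>x \<bullet> u\<bar> powr (2 * k u))"
      have Oth: "0 \<le> Oth" "Oth \<le> wC * (1 + norm x) ^ wdeg"
        unfolding Oth_def wC_def by (auto intro!: prod_nonneg prod_powr_le)
      have w: "w x = s powr (2 * k v) * Oth"
        unfolding dunkl_weight_def Oth_def s_def by (rule prod.remove[OF finite_Rp v(1)])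
      have "s powr (2 * k v) / s = s powr (2 * k v - 1)" using s by (simp add: powr_diff)
      also have "\<dots> \<le> s powr - a + s powr (2 * k v)"
      proof (cases "s \<le> 1")
        case True
        have "s powr (2 * k v - 1) \<le> s powr - a" using s True by (intro powr_mono') (auto simp: a_def)
        then show ?thesis by (simp add: add_increasing2)
      next
        case False
        have "s powr (2 * k v - 1) \<le> s powr (2 * k v)" using s False by (intro powr_mono) auto
        then show ?thesis by (simp add: add_increasing)
      qed
      finally have "s powr (2 * k v) / s * Oth \<le> (s powr - a + s powr (2 * k v)) * Oth"
        using Oth by (intro mult_right_mono)
      also have "\<dots> \<le> s powr - a * (wC * (1 + norm x) ^ wdeg) + w x"
        unfolding distrib_right w using Oth by (intro add_right_mono mult_left_mono) auto
      finally have "w x / s * dec x \<le> (s powr - a * (wC * (1 + norm x) ^ wdeg) + w x) * dec x"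
        using dec_pos[of x] by (intro mult_right_mono) (auto simp: w)
      also have "\<dots> = wC * (s powr - a / (1 + norm x) ^ (2 * CARD('n))) + w x * dec x"
        by (simp add: dec_def power_add distrib_right add_pos_nonneg less_imp_neq[THEN not_sym] field_simps)
      finally show ?thesis by (simp add: s_def inner_commute)
    qed
    then have "norm (w x / \<bar>v \<bullet> x\<bar> * dec x) \<le> norm (?h x)" if "regular x" for x
      using that weight_nonneg[of x] dec_pos[of x] by (force simp: abs_mult)
    then show "AE x in lborel. norm (w x / \<bar>v \<bullet> x\<bar> * dec x) \<le> norm (?h x)"
      using AE_regular by (auto elim!: eventually_mono)
  qed measurable
qed

end

section \<open>Integration by parts\<close>

lemma abs_powr_has_real_derivative:
  fixes s p :: real
  assumes "s \<noteq> 0"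
  shows "((\<lambda>s. \<bar>s\<bar> powr p) has_real_derivative p * \<bar>s\<bar> powr p / s) (at s)"
proof (cases "s > 0")
  case True
  have "((\<lambda>s. s powr p) has_real_derivative p * \<bar>s\<bar> powr p / s) (at s)"
    using True by (auto intro!: derivative_eq_intros simp: powr_diff)
  then show ?thesis
    by (rule has_field_derivative_transform_within_open[of _ _ _ "{0<..}"]) (use True in auto)
next
  case False
  then have s: "s < 0" using assms by simp
  have "((\<lambda>s. (- s) powr p) has_real_derivative p * \<bar>s\<bar> powr p / s) (at s)"
    using s by (auto intro!: derivative_eq_intros simp: powr_diff)
  then show ?thesis
    by (rule has_field_derivative_transform_within_open[of _ _ _ "{..<0}"]) (use s in auto)
qed

lemma C1_line:
  assumes "C1 f"
  shows "((\<lambda>t. f (x + t *\<^sub>R axis j 1)) has_vector_derivative partial_deriv j f (x + t *\<^sub>R axis j 1)) (at t)"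
proof -
  have "((\<lambda>t::real. x + t *\<^sub>R axis j 1) has_derivative (\<lambda>t. t *\<^sub>R axis j 1)) (at t)"
    by (auto intro!: derivative_eq_intros)
  from has_derivative_compose[OF this C1_has_derivative[OF assms]]
  have "((\<lambda>t. f (x + t *\<^sub>R axis j 1)) has_derivative
    (\<lambda>s. \<Sum>i\<in>UNIV. (s *\<^sub>R axis j 1) $ i *\<^sub>R partial_deriv i f (x + t *\<^sub>R axis j 1))) (at t)" .
  moreover have "(\<Sum>i\<in>UNIV. (s *\<^sub>R axis j 1) $ i *\<^sub>R partial_deriv i f (x + t *\<^sub>R axis j 1))
      = s *\<^sub>R partial_deriv j f (x + t *\<^sub>R axis j 1)" for s
    by (simp add: axis_def if_distrib[of "\<lambda>c. (_ * c) *\<^sub>R _"] cong: if_cong)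
  ultimately show ?thesis by (simp add: has_vector_derivative_def)
qed

context dunkl
begin

text \<open>Unlike \<open>w\<close>, this version of the weight is continuous: it skips the factors \<open>0 powr 0\<close>.\<close>

definition wk :: "real^'n \<Rightarrow> real" where
  "wk x = (\<Prod>v\<in>{v\<in>Rp. k v \<noteq> 0}. \<bar>x \<bullet> v\<bar> powr (2 * k v))"

lemma wk_eq: "regular x \<Longrightarrow> wk x = w x"
  unfolding wk_def dunkl_weight_def
  by (rule prod.mono_neutral_left) (auto simp: regular_def inner_commute)

lemma continuous_wk: "continuous_on UNIV wk"
  unfolding wk_def[abs_def]
proof (intro continuous_on_prod)
  fix v assume "v \<in> {v \<in> Rp. k v \<noteq> 0}"
  then have "2 * k v > 0" using k_nonneg_Rp[of v] by auto
  then show "continuous_on UNIV (\<lambda>x. \<bar>x \<bullet> v\<bar> powr (2 * k v))"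
    by (intro continuous_on_powr' continuous_intros) auto
qed

lemma wk_line:
  assumes "regular (x + t *\<^sub>R e)"
  shows "((\<lambda>t. wk (x + t *\<^sub>R e)) has_real_derivative
    w (x + t *\<^sub>R e) * (\<Sum>v\<in>Rp. 2 * (k v * (v \<bullet> e)) / (v \<bullet> (x + t *\<^sub>R e)))) (at t)"
proof -
  let ?A = "{v\<in>Rp. k v \<noteq> 0}"
  let ?y = "x + t *\<^sub>R e"
  have s: "?y \<bullet> v \<noteq> 0" if "v \<in> ?A" for v using assms that by (auto simp: regular_def inner_commute)
  have "((\<lambda>t. \<Prod>v\<in>?A. \<bar>(x + t *\<^sub>R e) \<bullet> v\<bar> powr (2 * k v)) has_real_derivative
     (\<Prod>v\<in>?A. \<bar>?y \<bullet> v\<bar> powr (2 * k v)) *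
     (\<Sum>v\<in>?A. (2 * k v * \<bar>?y \<bullet> v\<bar> powr (2 * k v) / (?y \<bullet> v) * (e \<bullet> v)) / \<bar>?y \<bullet> v\<bar> powr (2 * k v))) (at t)"
  proof (rule has_field_derivative_prod')
    fix v assume v: "v \<in> ?A"
    show "\<bar>?y \<bullet> v\<bar> powr (2 * k v) \<noteq> 0" using s[OF v] by simp
    have "((\<lambda>t. (x + t *\<^sub>R e) \<bullet> v) has_real_derivative e \<bullet> v) (at t)"
      unfolding inner_add_left inner_scaleR_left by (auto intro!: derivative_eq_intros)
    from DERIV_chain2[OF abs_powr_has_real_derivative[OF s[OF v]] this]
    show "((\<lambda>t. \<bar>(x + t *\<^sub>R e) \<bullet> v\<bar> powr (2 * k v)) has_real_derivative
      2 * k v * \<bar>?y \<bullet> v\<bar> powr (2 * k v) / (?y \<bullet> v) * (e \<bullet> v)) (at t)" .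
  qed
  moreover have "(\<Sum>v\<in>?A. (2 * k v * \<bar>?y \<bullet> v\<bar> powr (2 * k v) / (?y \<bullet> v) * (e \<bullet> v)) / \<bar>?y \<bullet> v\<bar> powr (2 * k v))
      = (\<Sum>v\<in>Rp. 2 * (k v * (v \<bullet> e)) / (v \<bullet> ?y))"
    by (rule sum.mono_neutral_cong_left) (use s in \<open>auto simp: inner_commute\<close>)
  moreover have "(\<Prod>v\<in>?A. \<bar>?y \<bullet> v\<bar> powr (2 * k v)) = w ?y"
    using wk_eq[OF assms] by (simp add: wk_def)
  ultimately show ?thesis by (simp add: wk_def[abs_def])
qed

lemma dunkl_op_regular:
  assumes "regular y"
  shows "T j f y = partial_deriv j f y + (\<Sum>v\<in>Rp. of_real (k v * v $ j) * ((f y - f (root_refl v y))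
      / of_real (v \<bullet> y)))"
  unfolding dunkl_op_def
proof (intro arg_cong2[where f = "(+)"] sum.cong HOL.refl)
  fix v assume "v \<in> Rp"
  then show "complex_of_real (k v * v $ j) * dunkl_quotient v f y =
      of_real (k v * v $ j) * ((f y - f (root_refl v y)) / of_real (v \<bullet> y))"
    using assms by (simp add: dunkl_quotient_def regular_def)
qed

text \<open>The ordinary derivative of f g w equals (T f) g w + f (T g) w plus one remainder for
  each root. The derivative of the weight and the unreflected terms of the quotients cancel, so the
  remainder of \<open>v\<close> is odd under the reflection in \<open>v\<close> and has integral
  0.\<close>

theorem dunkl_ibp:
  fixes f g :: "real^'n \<Rightarrow> complex"
  assumes C1: "C1 f" "C1 g"
    and f: "\<And>x. norm (f x) \<le> Cf * dec x" "\<And>x. regular x \<Longrightarrow> norm (T j f x) \<le> Cf * dec x"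
    and g: "\<And>x. norm (g x) \<le> Cg" "\<And>x. regular x \<Longrightarrow> norm (T j g x) \<le> Cg"
  shows "(LINT x|lborel. T j f x * g x * of_real (w x)) = - (LINT x|lborel. f x * T j g x * of_real (w x))"
proof -
  have Cg: "Cg \<ge> 0" using g(1)[of 0] norm_ge_zero order_trans by blast
  have Cf: "Cf \<ge> 0" using f(1)[of 0] dec_pos[of 0] norm_ge_zero[of "f 0"]
    by (metis less_eq_real_def mult_neg_pos not_less order_trans)
  have [measurable]: "f \<in> borel_measurable borel" "g \<in> borel_measurable borel"
    "T j f \<in> borel_measurable borel" "T j g \<in> borel_measurable borel" "wk \<in> borel_measurable borel"
    by (intro borel_measurable_continuous_onI C1_continuous continuous_dunkl_op continuous_wk C1)+
  have le: "norm (a * b) \<le> Cf * Cg * dec x" if "norm a \<le> Cf * dec x" "norm b \<le> Cg" for a b :: complex and x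
  proof -
    have "norm a * norm b \<le> (Cf * dec x) * Cg"
      using that Cf dec_pos[of x] by (intro mult_mono) auto
    then show ?thesis by (simp add: norm_mult mult_ac)
  qed
  have le2: "norm (a + b) \<le> 2 * (Cf * Cg) * dec x" if "norm a \<le> Cf * Cg * dec x" "norm b \<le> Cf * Cg * dec x"
    for a b :: complex and x using norm_triangle_ineq[of a b] that by simp
  define A where "A x = (T j f x * g x + f x * T j g x) * of_real (w x)" for x
  \<comment> \<open>What the root \<open>v\<close> leaves over. The expression in \<open>f\<close>
    and \<open>g\<close> and the weight are invariant under the reflection in \<open>v\<close>,
    while v . x changes sign.\<close>
  define B where "B v x = of_real (k v * v $ j) * (f (root_refl v x) * g x + f x * g (root_refl v x))
      * of_real (w x / (v \<bullet> x))"
    for v x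
  have [measurable]: "A \<in> borel_measurable borel" "\<And>v. B v \<in> borel_measurable borel"
    unfolding A_def[abs_def] B_def[abs_def] by measurable
  have int1: "integrable lborel (\<lambda>x. T j f x * g x * of_real (w x))"
    and int2: "integrable lborel (\<lambda>x. f x * T j g x * of_real (w x))"
    and intF: "integrable lborel (\<lambda>x. wk x *\<^sub>R (f x * g x))"
  proof -
    have base: "integrable lborel (\<lambda>x. (Cf * Cg) * (w x * dec x))"
      by (intro integrable_mult_right integrable_weight_dec)
    have bd: "norm (a * of_real (w x)) \<le> norm ((Cf * Cg) * (w x * dec x))" if "norm a \<le> Cf * Cg * dec x"
      for a :: complex and x
      using mult_right_mono[OF that weight_nonneg[of x]] weight_nonneg[of x] dec_pos[of x] Cf Cg
      by (simp add: norm_mult abs_mult mult_ac)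
    show "integrable lborel (\<lambda>x. T j f x * g x * of_real (w x))"
      by (rule Bochner_Integration.integrable_bound[OF base], measurable, rule eventually_mono[OF AE_regular])
         (intro bd le f g)
    show "integrable lborel (\<lambda>x. f x * T j g x * of_real (w x))"
      by (rule Bochner_Integration.integrable_bound[OF base], measurable, rule eventually_mono[OF AE_regular])
         (intro bd le f g)
    show "integrable lborel (\<lambda>x. wk x *\<^sub>R (f x * g x))"
    proof (rule Bochner_Integration.integrable_bound[OF base])
      show "AE x in lborel. norm (wk x *\<^sub>R (f x * g x)) \<le> norm ((Cf * Cg) * (w x * dec x))"
        using AE_regular
      proof eventually_elim
        case (elim x)
        have "wk x *\<^sub>R (f x * g x) = (f x * g x) * of_real (w x)"
          by (simp add: wk_eq[OF elim] scaleR_conv_of_real)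
        then show ?case using bd[OF le[OF f(1) g(1)], of x] by simp
      qed
    qed measurable
  qed
  have intA: "integrable lborel A"
    unfolding A_def[abs_def] distrib_right by (intro Bochner_Integration.integrable_add int1 int2)
  have intB: "integrable lborel (B v)" if v: "v \<in> Rp" for v
  proof (cases "k v = 0")
    case True
    then show ?thesis by (simp add: B_def[abs_def])
  next
    case False
    have base: "integrable lborel (\<lambda>x. (\<bar>k v * v $ j\<bar> * (2 * (Cf * Cg))) * (w x / \<bar>v \<bullet> x\<bar> * dec x))"
      by (intro integrable_mult_right integrable_weight_quotient v False)
    show ?thesis
    proof (rule Bochner_Integration.integrable_bound[OF base])
      have bdB: "norm (B v x) \<le> (\<bar>k v * v $ j\<bar> * (2 * (Cf * Cg))) * (w x / \<bar>v \<bullet> x\<bar> * dec x)" for x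
      proof -
        have "norm (f (root_refl v x) * g x + f x * g (root_refl v x)) \<le> 2 * (Cf * Cg) * dec x"
          by (rule le2[OF le le]) (use f(1)[of "root_refl v x"] f(1)[of x] g in auto)
        then have "\<bar>k v * v $ j\<bar> * norm (f (root_refl v x) * g x + f x * g (root_refl v x)) * (w x / \<bar>v \<bullet> x\<bar>)
           \<le> \<bar>k v * v $ j\<bar> * (2 * (Cf * Cg) * dec x) * (w x / \<bar>v \<bullet> x\<bar>)"
          using weight_nonneg[of x] by (intro mult_left_mono mult_right_mono) auto
        moreover have "norm (B v x) = \<bar>k v * v $ j\<bar> * norm (f (root_refl v x) * g x + f x * g (root_refl v x))
            * (w x / \<bar>v \<bullet> x\<bar>)"
          unfolding B_def norm_mult norm_of_real using weight_nonneg[of x] by (simp add: abs_mult)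
        ultimately show ?thesis by (simp add: mult_ac)
      qed
      show "AE x in lborel. norm (B v x) \<le> norm ((\<bar>k v * v $ j\<bar> * (2 * (Cf * Cg))) * (w x / \<bar>v \<bullet> x\<bar> * dec x))"
        unfolding real_norm_def by (rule AE_I2) (rule order_trans[OF bdB abs_ge_self])
    qed measurable
  qed
  have B0: "(LINT x|lborel. B v x) = 0" if v: "v \<in> Rp" for v
  proof -
    have "v \<bullet> root_refl v x = - (v \<bullet> x)" for x
      using inner_root_refl[of v v x] root_refl_self[OF Rp_nonzero[OF v]] by simp
    then have "B v (root_refl v x) = - B v x" for x
      by (simp add: B_def weight_refl[OF RpD[OF v]] algebra_simps)
    then have "(LINT x|lborel. B v x) = (LINT x|lborel. - B v x)"
      using integral_root_refl[of "B v" v] by simp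
    then show ?thesis by simp
  qed
  let ?F = "\<lambda>x. wk x *\<^sub>R (f x * g x)"
  let ?F' = "\<lambda>x. A x + (\<Sum>v\<in>Rp. B v x)"
  let ?e = "axis j (1::real)"
  have "(LINT x|lborel. ?F' x) = 0"
  proof (rule integral_zero_of_line_derivative[OF intF])
    show "integrable lborel ?F'" by (intro Bochner_Integration.integrable_add Bochner_Integration.integrable_sum intA
        intB)
    show "AE x in lborel. ((\<lambda>t. ?F' (x + t *\<^sub>R ?e)) has_integral (?F (x + ?e) - ?F x)) {0..1}"
      using AE_regular
    proof eventually_elim
      case (elim x)
      \<comment> \<open>The times at which the line crosses a hyperplane. A hyperplane parallel to
        the line (v $ j = 0) is never met, since \<open>x\<close> is regular; division by zero then
        merely adds the point 0 to the exceptional set.\<close>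
      define S where "S = (\<lambda>v. - (v \<bullet> x) / v $ j) ` Rp"
      have reg: "regular (x + t *\<^sub>R ?e)" if "t \<notin> S" for t
        unfolding regular_def
      proof
        fix v assume v: "v \<in> Rp"
        have vx: "v \<bullet> x \<noteq> 0" using elim v by (auto simp: regular_def)
        have eq: "v \<bullet> (x + t *\<^sub>R ?e) = v \<bullet> x + t * v $ j" by (simp add: inner_add_right inner_axis)
        show "v \<bullet> (x + t *\<^sub>R ?e) \<noteq> 0"
        proof (cases "v $ j = 0")
          case False
          have "t \<noteq> - (v \<bullet> x) / v $ j" using that v by (auto simp: S_def)
          then show ?thesis unfolding eq using False by (simp add: field_simps add_eq_0_iff2)
        qed (simp add: eq vx)
      qed
      have "((\<lambda>t. ?F' (x + t *\<^sub>R ?e)) has_integral (?F (x + 1 *\<^sub>R ?e) - ?F (x + 0 *\<^sub>R ?e))) {0..1}"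
      proof (rule fundamental_theorem_of_calculus_interior_strong[of S])
        show "finite S" by (simp add: S_def)
        show "continuous_on {0..1} (\<lambda>t. ?F (x + t *\<^sub>R ?e))"
        proof -
          have "continuous_on UNIV ?F" by (intro continuous_intros continuous_wk C1_continuous C1)
          then show ?thesis by (rule continuous_on_compose2) (auto intro!: continuous_intros)
        qed
        fix t assume "t \<in> {0<..<1} - S"
        then have y: "regular (x + t *\<^sub>R ?e)" using reg by simp
        let ?y = "x + t *\<^sub>R ?e"
        let ?c = "\<lambda>v. complex_of_real (k v * v $ j)"
        let ?s = "\<lambda>v. complex_of_real (v \<bullet> ?y)"
        let ?q = "\<Sum>v\<in>Rp. 2 * (k v * (v \<bullet> ?e)) / (v \<bullet> ?y)"
        have "((\<lambda>t. ?F (x + t *\<^sub>R ?e)) has_vector_derivative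
           wk ?y *\<^sub>R (f ?y * partial_deriv j g ?y + partial_deriv j f ?y * g ?y)
           + (w ?y * ?q) *\<^sub>R (f ?y * g ?y)) (at t)"
          by (intro has_vector_derivative_scaleR has_vector_derivative_mult C1_line C1 wk_line[OF y])
        moreover have "wk ?y *\<^sub>R (f ?y * partial_deriv j g ?y + partial_deriv j f ?y * g ?y)
           + (w ?y * ?q) *\<^sub>R (f ?y * g ?y) = ?F' ?y"
        proof -
          have pf: "partial_deriv j f ?y = T j f ?y - (\<Sum>v\<in>Rp. ?c v * ((f ?y - f (root_refl v ?y)) / ?s v))"
            and pg: "partial_deriv j g ?y = T j g ?y - (\<Sum>v\<in>Rp. ?c v * ((g ?y - g (root_refl v ?y)) / ?s v))"
            using dunkl_op_regular[OF y, of j f] dunkl_op_regular[OF y, of j g] by auto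
          have q: "complex_of_real ?q = (\<Sum>v\<in>Rp. 2 * ?c v / ?s v)"
            by (simp add: inner_axis)
          have "(\<Sum>v\<in>Rp. B v ?y) = (\<Sum>v\<in>Rp. of_real (w ?y) * (2 * ?c v / ?s v * (f ?y * g ?y)
              - ?c v * ((f ?y - f (root_refl v ?y)) / ?s v) * g ?y - f ?y *
                  (?c v * ((g ?y - g (root_refl v ?y)) / ?s v))))"
            unfolding B_def
          proof (rule sum.cong[OF HOL.refl])
            fix v assume "v \<in> Rp"
            then have "?s v \<noteq> 0" using y by (auto simp: regular_def)
            then show "?c v * (f (root_refl v ?y) * g ?y + f ?y * g (root_refl v ?y)) * of_real (w ?y / (v \<bullet> ?y))
              = of_real (w ?y) * (2 * ?c v / ?s v * (f ?y * g ?y)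
              - ?c v * ((f ?y - f (root_refl v ?y)) / ?s v) * g ?y - f ?y *
                  (?c v * ((g ?y - g (root_refl v ?y)) / ?s v)))"
              unfolding of_real_divide by (simp add: field_simps del: of_real_mult)
          qed
          also have "\<dots> = of_real (w ?y) * ((\<Sum>v\<in>Rp. 2 * ?c v / ?s v) * (f ?y * g ?y)
              - (\<Sum>v\<in>Rp. ?c v * ((f ?y - f (root_refl v ?y)) / ?s v)) * g ?y
              - f ?y * (\<Sum>v\<in>Rp. ?c v * ((g ?y - g (root_refl v ?y)) / ?s v)))"
            by (simp only: sum_distrib_left[symmetric] sum_distrib_right[symmetric] sum_subtractf)
          finally have eqB: "(\<Sum>v\<in>Rp. B v ?y) = of_real (w ?y) * ((\<Sum>v\<in>Rp. 2 * ?c v / ?s v) * (f ?y * g ?y)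
              - (\<Sum>v\<in>Rp. ?c v * ((f ?y - f (root_refl v ?y)) / ?s v)) * g ?y
              - f ?y * (\<Sum>v\<in>Rp. ?c v * ((g ?y - g (root_refl v ?y)) / ?s v)))" .
          have sc: "r *\<^sub>R z = of_real r * z" for r and z :: complex by (rule scaleR_conv_of_real)
          show ?thesis
            unfolding eqB pf pg A_def wk_eq[OF y] sc of_real_mult[of "w ?y"] q
            by (simp only: algebra_simps)
        qed
        ultimately show "((\<lambda>t. ?F (x + t *\<^sub>R ?e)) has_vector_derivative ?F' ?y) (at t)" by simp
      qed simp
      then show ?case by simp
    qed
  qed
  moreover have "(LINT x|lborel. ?F' x) = (LINT x|lborel. A x) + (\<Sum>v\<in>Rp. LINT x|lborel. B v x)"
    using intA intB by (simp add: Bochner_Integration.integral_sum)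
  ultimately have "(LINT x|lborel. A x) = 0" by (simp add: B0)
  moreover have "(LINT x|lborel. A x) = (LINT x|lborel. T j f x * g x * of_real (w x))
      + (LINT x|lborel. f x * T j g x * of_real (w x))"
    unfolding A_def distrib_right using int1 int2 by (rule Bochner_Integration.integral_add)
  ultimately show ?thesis by (simp add: eq_neg_iff_add_eq_0)
qed

end

section \<open>Schwartz functions and the Dunkl transform\<close>

definition rapid_on :: "(real^'n) set \<Rightarrow> (real^'n \<Rightarrow> complex) \<Rightarrow> bool" where
  "rapid_on A f \<longleftrightarrow> (\<forall>N. \<exists>C. \<forall>x\<in>A. norm (f x) * (1 + norm x) ^ N \<le> C)"

lemma rapid_onD: "rapid_on A f \<Longrightarrow> \<exists>C\<ge>0. \<forall>x\<in>A. norm (f x) * (1 + norm x) ^ N \<le> C"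
proof -
  assume "rapid_on A f"
  then obtain C where "\<forall>x\<in>A. norm (f x) * (1 + norm x) ^ N \<le> C" unfolding rapid_on_def by blast
  then show ?thesis by (intro exI[of _ "max 0 C"]) force
qed

lemma rapid_on_add:
  assumes "rapid_on A f" "rapid_on A g" shows "rapid_on A (\<lambda>x. f x + g x)"
  unfolding rapid_on_def
proof
  fix N
  obtain C D where C: "\<forall>x\<in>A. norm (f x) * (1 + norm x) ^ N \<le> C" and D: "\<forall>x\<in>A. norm (g x) * (1 + norm x) ^ N \<le> D"
    using assms unfolding rapid_on_def by meson
  have "norm (f x + g x) * (1 + norm x) ^ N \<le> C + D" if "x \<in> A" for x
  proof -
    have "norm (f x + g x) * (1 + norm x) ^ N \<le> (norm (f x) + norm (g x)) * (1 + norm x) ^ N"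
      by (intro mult_right_mono norm_triangle_ineq) auto
    also have "\<dots> \<le> C + D" using C D that by (simp add: distrib_right add_mono)
    finally show ?thesis .
  qed
  then show "\<exists>C. \<forall>x\<in>A. norm (f x + g x) * (1 + norm x) ^ N \<le> C" by blast
qed

lemma rapid_on_bound:
  assumes "rapid_on A f" "\<And>x. x \<in> A \<Longrightarrow> norm (g x) \<le> c * (norm (f x) * (1 + norm x) ^ M)"
    and "c \<ge> 0"
  shows "rapid_on A g"
  unfolding rapid_on_def
proof
  fix N
  obtain C where C: "\<forall>x\<in>A. norm (f x) * (1 + norm x) ^ (M + N) \<le> C"
    using assms(1) unfolding rapid_on_def by meson
  have "norm (g x) * (1 + norm x) ^ N \<le> c * C" if "x \<in> A" for x
  proof -
    have "norm (g x) * (1 + norm x) ^ N \<le> (c * (norm (f x) * (1 + norm x) ^ M)) * (1 + norm x) ^ N"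
      by (intro mult_right_mono assms(2) that) auto
    also have "\<dots> = c * (norm (f x) * (1 + norm x) ^ (M + N))" by (simp add: power_add)
    also have "\<dots> \<le> c * C" using C that assms(3) by (intro mult_left_mono) auto
    finally show ?thesis .
  qed
  then show "\<exists>C. \<forall>x\<in>A. norm (g x) * (1 + norm x) ^ N \<le> C" by blast
qed

lemma rapid_on_cmult: "rapid_on A f \<Longrightarrow> rapid_on A (\<lambda>x. c * f x)"
  by (rule rapid_on_bound[where M = 0 and c = "norm c"]) (auto simp: norm_mult)

lemma sum_axis_scaleR:
  fixes F :: "'n::finite \<Rightarrow> 'b::real_vector"
  shows "(\<Sum>i\<in>UNIV. axis j (1::real) $ i *\<^sub>R F i) = F j"
proof -
  have "(\<Sum>i\<in>UNIV. axis j (1::real) $ i *\<^sub>R F i) = (\<Sum>i\<in>UNIV. if i = j then F i else 0)"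
    by (intro sum.cong) (auto simp: axis_def)
  then show ?thesis by simp
qed

lemma partial_deriv_add:
  "f differentiable (at x) \<Longrightarrow> g differentiable (at x) \<Longrightarrow>
    partial_deriv j (\<lambda>x. f x + g x) x = partial_deriv j f x + partial_deriv j g x"
  by (subst partial_deriv_eqI[OF has_derivative_add[OF differentiable_has_derivative_partial
      differentiable_has_derivative_partial]])
     (auto simp: sum_axis_scaleR)

lemma partial_deriv_cmult:
  "f differentiable (at x) \<Longrightarrow> partial_deriv j (\<lambda>x. c * f x) x = c * partial_deriv j f x"
  by (subst partial_deriv_eqI[OF has_derivative_mult_right[OF differentiable_has_derivative_partial]])
     (auto simp: sum_axis_scaleR)

lemma partial_deriv_coord:
  assumes "f differentiable (at x)"
  shows "partial_deriv j (\<lambda>x. of_real (u \<bullet> x) * f x) x = of_real (u \<bullet> x) * partial_deriv j f x + of_real (u $ j)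
      * f x"
proof -
  have "((\<lambda>x. complex_of_real (u \<bullet> x)) has_derivative (\<lambda>h. of_real (u \<bullet> h))) (at x)"
    by (intro has_derivative_of_real has_derivative_inner_right has_derivative_ident)
  from partial_deriv_eqI[OF has_derivative_mult[OF this differentiable_has_derivative_partial[OF assms]], of j]
  show ?thesis by (simp add: sum_axis_scaleR inner_axis)
qed

lemma differentiable_inner_mult:
  fixes f :: "real^'n \<Rightarrow> complex"
  assumes "f differentiable (at x)" shows "(\<lambda>x. of_real (u \<bullet> x) * f x) differentiable (at x)"
proof -
  have "((\<lambda>x. complex_of_real (u \<bullet> x)) has_derivative (\<lambda>h. of_real (u \<bullet> h))) (at x)"
    by (intro has_derivative_of_real has_derivative_inner_right has_derivative_ident)
  from has_derivative_mult[OF this differentiable_has_derivative_partial[OF assms]]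
  show ?thesis by (rule differentiableI)
qed

lemma has_derivative_comp_root_refl:
  assumes "\<And>x. f differentiable (at x)"
  shows "((\<lambda>x. f (root_refl v x)) has_derivative
    (\<lambda>h. \<Sum>i\<in>UNIV. root_refl v h $ i *\<^sub>R partial_deriv i f (root_refl v x))) (at x)"
proof -
  have "(root_refl v has_derivative root_refl v) (at x)"
    using linear_root_refl linear_conv_bounded_linear bounded_linear_imp_has_derivative by blast
  from has_derivative_compose[OF this differentiable_has_derivative_partial[OF assms]] show ?thesis .
qed

text \<open>Differentiability is demanded everywhere but decay only on \<open>A\<close>. The means
  of a rapidly decreasing function over reflection segments are smooth everywhere, yet decay is
  available for them only in a slab along the hyperplane.\<close>

primrec Cn :: "(real^'n) set \<Rightarrow> nat \<Rightarrow> (real^'n \<Rightarrow> complex) \<Rightarrow> bool" where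
  "Cn A 0 f \<longleftrightarrow> (\<forall>x. f differentiable (at x)) \<and> rapid_on A f"
| "Cn A (Suc n) f \<longleftrightarrow> ((\<forall>x. f differentiable (at x)) \<and> rapid_on A f) \<and> (\<forall>j. Cn A n (partial_deriv j f))"

lemma Cn_diff: "Cn A n f \<Longrightarrow> f differentiable (at x)"
  by (cases n) auto

lemma Cn_rapid: "Cn A n f \<Longrightarrow> rapid_on A f"
  by (cases n) auto

lemma Cn_SucD: "Cn A (Suc n) f \<Longrightarrow> Cn A n f"
  by (induction n arbitrary: f) auto

lemma Cn_continuous: "Cn A n f \<Longrightarrow> continuous_on UNIV f"
  by (intro continuous_at_imp_continuous_on ballI differentiable_imp_continuous_within Cn_diff)

lemma Cn_C1:
  assumes "Cn A (Suc n) f" shows "C1 f"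
proof -
  have "Cn A n (partial_deriv j f)" for j using assms by simp
  then show ?thesis unfolding C1_def using Cn_diff[OF assms] Cn_continuous by blast
qed

lemma Cn_add: "Cn A n f \<Longrightarrow> Cn A n g \<Longrightarrow> Cn A n (\<lambda>x. f x + g x)"
proof (induction n arbitrary: f g)
  case (Suc n)
  have "partial_deriv j (\<lambda>x. f x + g x) = (\<lambda>x. partial_deriv j f x + partial_deriv j g x)" for j
    by (rule ext) (intro partial_deriv_add Cn_diff[OF Suc.prems(1)] Cn_diff[OF Suc.prems(2)])
  then show ?case using Suc by (auto intro!: rapid_on_add differentiable_add)
qed (auto intro!: rapid_on_add differentiable_add)

lemma Cn_cmult: "Cn A n f \<Longrightarrow> Cn A n (\<lambda>x. c * f x)"
proof (induction n arbitrary: f)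
  case (Suc n)
  have "partial_deriv j (\<lambda>x. c * f x) = (\<lambda>x. c * partial_deriv j f x)" for j
    by (rule ext) (intro partial_deriv_cmult Cn_diff[OF Suc.prems(1)])
  then show ?case using Suc by (auto intro!: rapid_on_cmult differentiable_mult)
qed (auto intro!: rapid_on_cmult differentiable_mult)

lemma Cn_scaleR: "Cn A n f \<Longrightarrow> Cn A n (\<lambda>x. c *\<^sub>R f x)"
  unfolding scaleR_conv_of_real by (rule Cn_cmult)

lemma Cn_diff_fun: "Cn A n f \<Longrightarrow> Cn A n g \<Longrightarrow> Cn A n (\<lambda>x. f x - g x)"
  using Cn_add[of A n f "\<lambda>x. (-1) * g x"] Cn_cmult[of A n g "-1"] by simp

lemma Cn_zero: "Cn A n (\<lambda>x. 0)"
proof (induction n)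
  case (Suc n)
  have "partial_deriv j (\<lambda>x. 0) = (\<lambda>x. 0)" for j :: 'a
    by (rule ext) (simp add: partial_deriv_eqI[OF has_derivative_const])
  then show ?case using Suc by (auto simp: rapid_on_def)
qed (auto simp: rapid_on_def)

lemma Cn_sum: "finite I \<Longrightarrow> (\<And>i. i \<in> I \<Longrightarrow> Cn A n (f i)) \<Longrightarrow> Cn A n (\<lambda>x. \<Sum>i\<in>I. f i x)"
  by (induction I rule: finite_induct) (auto intro: Cn_zero Cn_add simp del: Cn.simps)

lemma rapid_on_inner_mult:
  assumes "rapid_on A f" shows "rapid_on A (\<lambda>x. of_real (u \<bullet> x) * f x)"
proof (rule rapid_on_bound[OF assms, where M = 1 and c = "norm u"])
  fix x
  have "\<bar>u \<bullet> x\<bar> \<le> norm u * norm x" by (rule Cauchy_Schwarz_ineq2)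
  also have "\<dots> \<le> norm u * (1 + norm x)" by (simp add: mult_left_mono)
  finally have "\<bar>u \<bullet> x\<bar> * norm (f x) \<le> norm u * (1 + norm x) * norm (f x)" by (intro mult_right_mono) auto
  then show "norm (complex_of_real (u \<bullet> x) * f x) \<le> norm u * (norm (f x) * (1 + norm x) ^ 1)"
    by (simp add: norm_mult mult_ac)
qed simp

text \<open>Differentiating the product leaves a lower-order term with \<open>f\<close> itself, so
  the induction also uses the class of order \<open>n\<close> of \<open>f\<close>.\<close>

lemma Cn_inner_mult: "Cn A n f \<Longrightarrow> Cn A n (\<lambda>x. of_real (u \<bullet> x) * f x)"
proof (induction n arbitrary: f)
  case 0
  then show ?case by (auto intro: rapid_on_inner_mult differentiable_inner_mult)
next
  case (Suc n)
  have "partial_deriv j (\<lambda>x. of_real (u \<bullet> x) * f x)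
      = (\<lambda>x. of_real (u \<bullet> x) * partial_deriv j f x + of_real (u $ j) * f x)" for j
    by (rule ext) (intro partial_deriv_coord Cn_diff[OF Suc.prems(1)])
  moreover have "Cn A n f" using Suc.prems by (rule Cn_SucD)
  ultimately show ?case using Suc by (auto intro!: rapid_on_inner_mult differentiable_inner_mult Cn_add Cn_cmult)
qed

lemma rapid_on_root_refl:
  assumes "rapid_on UNIV f" shows "rapid_on UNIV (\<lambda>x. f (root_refl v x))"
  unfolding rapid_on_def
proof
  fix N
  from assms have "\<exists>C. \<forall>x. norm (f x) * (1 + norm x) ^ N \<le> C" unfolding rapid_on_def by simp
  then obtain C where "\<forall>x. norm (f x) * (1 + norm x) ^ N \<le> C" by blast
  then have "norm (f (root_refl v x)) * (1 + norm x) ^ N \<le> C" for x by (metis norm_root_refl)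
  then show "\<exists>C. \<forall>x\<in>UNIV. norm (f (root_refl v x)) * (1 + norm x) ^ N \<le> C" by blast
qed

lemma differentiable_root_refl:
  fixes f :: "real^'n \<Rightarrow> complex"
  shows "(\<And>x. f differentiable (at x)) \<Longrightarrow> (\<lambda>x. f (root_refl v x)) differentiable (at x)"
  by (rule differentiableI[OF has_derivative_comp_root_refl])

lemma Cn_root_refl: "Cn UNIV n f \<Longrightarrow> Cn UNIV n (\<lambda>x. f (root_refl v x))"
proof (induction n arbitrary: f)
  case 0
  then show ?case by (auto intro: rapid_on_root_refl differentiable_root_refl)
next
  case (Suc n)
  have "partial_deriv j (\<lambda>x. f (root_refl v x))
      = (\<lambda>x. \<Sum>i\<in>UNIV. root_refl v (axis j 1) $ i *\<^sub>R partial_deriv i f (root_refl v x))" for j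
    by (rule ext, rule partial_deriv_eqI[OF has_derivative_comp_root_refl]) (rule Cn_diff[OF Suc.prems(1)])
  then show ?case using Suc by (auto intro!: rapid_on_root_refl differentiable_root_refl Cn_sum Cn_scaleR)
qed

section \<open>Reflection means and difference quotients of rapidly decreasing functions\<close>

lemma Cn_dir_deriv: "Cn A (Suc n) f \<Longrightarrow> Cn A n (dir_deriv v f)"
  unfolding dir_deriv_def[abs_def] by (auto intro!: Cn_sum Cn_scaleR)

text \<open>Differentiation under the integral sign; the point on the segment depends linearly on
  \<open>x\<close>.\<close>

lemma refl_mean_has_derivative:
  fixes f :: "real^'n \<Rightarrow> complex"
  assumes "C1 f"
  shows "(refl_mean v m f has_derivative (\<lambda>h. integral {0..1} (\<lambda>s. s ^ m *\<^sub>R (\<Sum>j\<in>UNIV.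
     (h - (s * (2 * (h \<bullet> v) / (norm v)\<^sup>2)) *\<^sub>R v) $ j *\<^sub>R
       partial_deriv j f (x - (s * (2 * (x \<bullet> v) / (norm v)\<^sup>2)) *\<^sub>R v))))) (at x)"
proof -
  let ?p = "\<lambda>x s. x - (s * (2 * (x \<bullet> v) / (norm v)\<^sup>2)) *\<^sub>R v"
  define L where "L x s h = s ^ m *\<^sub>R (\<Sum>j\<in>UNIV. ?p h s $ j *\<^sub>R partial_deriv j f (?p x s))" for x s h
  have pd: "((\<lambda>x. ?p x s) has_derivative (\<lambda>h. ?p h s)) (at x)" for x s
    unfolding divide_inverse by (auto intro!: derivative_eq_intros)
  have Ld: "((\<lambda>x. s ^ m *\<^sub>R f (?p x s)) has_derivative L x s) (at x)" for x s
    unfolding L_def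
    by (intro has_derivative_scaleR_right has_derivative_compose[OF pd C1_has_derivative[OF assms]])
  then have Lb: "bounded_linear (L x s)" for x s by (rule has_derivative_bounded_linear)
  \<comment> \<open>\<open>leibniz_rule\<close> wants the derivative to be continuous as an
    operator-valued map; in finite dimension this can be tested on vectors.\<close>
  have cont: "continuous_on (UNIV \<times> cbox 0 1) (\<lambda>(x, s). Blinfun (L x s))"
  proof (rule continuous_on_blinfun_componentwise)
    fix i :: "real^'n"
    have "continuous_on (UNIV \<times> cbox 0 1) (\<lambda>p. \<Sum>j\<in>UNIV. ?p i (snd p) $ j *\<^sub>R
        ((\<lambda>(x, s). s ^ m *\<^sub>R partial_deriv j f (?p x s)) p))"
      by (intro continuous_on_sum continuous_on_scaleR continuous_refl_integrand C1_continuous_partial[OF assms])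
         (auto simp: divide_inverse intro!: continuous_intros)
    then show "continuous_on (UNIV \<times> cbox 0 1) (\<lambda>p. blinfun_apply (case p of (x, s) \<Rightarrow> Blinfun (L x s)) i)"
      by (simp add: case_prod_beta bounded_linear_Blinfun_apply[OF Lb] L_def scaleR_sum_right mult.commute)
  qed
  have "((\<lambda>x. integral (cbox 0 1) (\<lambda>s. s ^ m *\<^sub>R f (?p x s))) has_derivative
      blinfun_apply (integral (cbox 0 1) (\<lambda>s. Blinfun (L x s)))) (at x within UNIV)"
  proof (rule leibniz_rule)
    show "((\<lambda>x. s ^ m *\<^sub>R f (?p x s)) has_derivative blinfun_apply (Blinfun (L x s))) (at x within UNIV)" for x s
      using Ld by (simp add: bounded_linear_Blinfun_apply[OF Lb])
    show "(\<lambda>s. s ^ m *\<^sub>R f (?p x s)) integrable_on cbox 0 1" for x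
      by (intro integrable_continuous continuous_refl_integrand1 C1_continuous assms)
  qed (use cont in auto)
  moreover have iapp: "blinfun_apply (integral (cbox 0 1) (\<lambda>s. Blinfun (L x s))) h
      = integral (cbox 0 1) (\<lambda>s. L x s h)" for h
  proof -
    have "continuous_on (cbox 0 1) (\<lambda>s. (\<lambda>(x, s). Blinfun (L x s)) (x, s))"
      by (rule continuous_on_compose2[OF cont]) (auto intro!: continuous_intros)
    then have "(\<lambda>s. Blinfun (L x s)) integrable_on cbox 0 1"
      by (intro integrable_continuous) simp
    then show ?thesis by (simp add: blinfun_apply_integral bounded_linear_Blinfun_apply[OF Lb])
  qed
  moreover have "blinfun_apply (integral (cbox 0 1) (\<lambda>s. Blinfun (L x s))) = (\<lambda>h. integral (cbox 0 1) (\<lambda>s. L x s h))"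
    by (rule ext) (rule iapp)
  ultimately have "((\<lambda>x. integral (cbox 0 1) (\<lambda>s. s ^ m *\<^sub>R f (?p x s))) has_derivative
      (\<lambda>h. integral (cbox 0 1) (\<lambda>s. L x s h))) (at x)" by (simp only:)
  then show ?thesis by (simp only: refl_mean_def[abs_def] L_def box_real)
qed

text \<open>Moving \<open>x\<close> along the axis \<open>j\<close> moves the point at parameter
  \<open>s\<close> by the axis vector minus s (2 v_j / |v|^2) v. The extra factor \<open>s\<close>
  is why the means carry an exponent.\<close>

lemma partial_deriv_refl_mean:
  fixes f :: "real^'n \<Rightarrow> complex"
  assumes "C1 f"
  shows "partial_deriv j (refl_mean v m f) x
    = refl_mean v m (partial_deriv j f) x - (2 * v $ j / (norm v)\<^sup>2) *\<^sub>R refl_mean v (Suc m) (dir_deriv v f) x"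
proof -
  let ?p = "\<lambda>x s. x - (s * (2 * (x \<bullet> v) / (norm v)\<^sup>2)) *\<^sub>R v"
  let ?c = "2 * v $ j / (norm v)\<^sup>2"
  have "s ^ m *\<^sub>R (\<Sum>i\<in>UNIV. ?p (axis j 1) s $ i *\<^sub>R partial_deriv i f (?p x s))
     = s ^ m *\<^sub>R partial_deriv j f (?p x s) - ?c *\<^sub>R (s ^ Suc m *\<^sub>R dir_deriv v f (?p x s))" for s
  proof -
    have "(\<Sum>i\<in>UNIV. ?p (axis j 1) s $ i *\<^sub>R F i) = F j - (s * ?c) *\<^sub>R (\<Sum>i\<in>UNIV. v $ i *\<^sub>R F i)"
      for F :: "'n \<Rightarrow> complex"
      by (simp add: inner_axis' scaleR_left_diff_distrib sum_subtractf sum_axis_scaleR scaleR_sum_right)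
    then show ?thesis by (simp add: dir_deriv_def scaleR_diff_right mult_ac)
  qed
  then have "partial_deriv j (refl_mean v m f) x =
     integral {0..1} (\<lambda>s. s ^ m *\<^sub>R partial_deriv j f (?p x s) - ?c *\<^sub>R (s ^ Suc m *\<^sub>R dir_deriv v f (?p x s)))"
    by (subst partial_deriv_eqI[OF refl_mean_has_derivative[OF assms]]) simp
  also have "\<dots> = integral {0..1} (\<lambda>s. s ^ m *\<^sub>R partial_deriv j f (?p x s))
      - integral {0..1} (\<lambda>s. ?c *\<^sub>R (s ^ Suc m *\<^sub>R dir_deriv v f (?p x s)))"
    by (intro Henstock_Kurzweil_Integration.integral_diff integrable_continuous_interval continuous_refl_integrand1
        integrable_cmul C1_continuous_partial continuous_dir_deriv assms)
  also have "integral {0..1} (\<lambda>s. ?c *\<^sub>R (s ^ Suc m *\<^sub>R dir_deriv v f (?p x s)))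
      = ?c *\<^sub>R integral {0..1} (\<lambda>s. s ^ Suc m *\<^sub>R dir_deriv v f (?p x s))" by (rule integral_cmul)
  finally show ?thesis
    by (simp only: refl_mean_def[of v m "partial_deriv j f" x] refl_mean_def[of v "Suc m" "dir_deriv v f" x])
qed

text \<open>In the slab the segment has length at most 2 / |v|, so its points are comparable in size
  to \<open>x\<close>. Far from the hyperplane the segment can pass near the origin and this
  comparison fails.\<close>

lemma rapid_on_refl_mean:
  assumes "rapid_on UNIV f" "continuous_on UNIV f" "v \<noteq> 0"
  shows "rapid_on {x. \<bar>v \<bullet> x\<bar> \<le> 1} (refl_mean v m f)"
  unfolding rapid_on_def
proof
  fix N
  obtain C where C: "C \<ge> 0" "\<And>x. norm (f x) * (1 + norm x) ^ N \<le> C"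
    using rapid_onD[OF assms(1), of N] by auto
  let ?d = "1 + 2 / norm v"
  have "norm (refl_mean v m f x) * (1 + norm x) ^ N \<le> C * ?d ^ N" if x: "\<bar>v \<bullet> x\<bar> \<le> 1" for x
  proof -
    let ?p = "\<lambda>s. x - (s * (2 * (x \<bullet> v) / (norm v)\<^sup>2)) *\<^sub>R v"
    have pb: "norm (s ^ m *\<^sub>R f (?p s)) \<le> C * ?d ^ N / (1 + norm x) ^ N" if s: "s \<in> {0..1}" for s
    proof -
      have "norm ((s * (2 * (x \<bullet> v) / (norm v)\<^sup>2)) *\<^sub>R v) = s * (2 * \<bar>v \<bullet> x\<bar> / norm v)"
        using s assms(3) by (simp add: abs_mult inner_commute power2_eq_square)
      also have "\<dots> \<le> 1 * (2 * 1 / norm v)"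
        using s x by (intro mult_mono divide_right_mono) auto
      finally have le: "norm ((s * (2 * (x \<bullet> v) / (norm v)\<^sup>2)) *\<^sub>R v) \<le> 2 / norm v" by simp
      have "norm x \<le> norm (?p s) + norm ((s * (2 * (x \<bullet> v) / (norm v)\<^sup>2)) *\<^sub>R v)" 
        using norm_triangle_ineq[of "?p s" "(s * (2 * (x \<bullet> v) / (norm v)\<^sup>2)) *\<^sub>R v"] by simp
      with le have "norm x \<le> norm (?p s) + 2 / norm v" by linarith
      moreover have "0 \<le> 2 / norm v * norm (?p s)" by simp
      ultimately have "1 + norm x \<le> ?d * (1 + norm (?p s))"
        unfolding distrib_left distrib_right by linarith
      then have "(1 + norm x) ^ N \<le> (?d * (1 + norm (?p s))) ^ N" by (intro power_mono) auto
      then have "norm (f (?p s)) * (1 + norm x) ^ N \<le> norm (f (?p s)) * (?d * (1 + norm (?p s))) ^ N"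
        by (intro mult_left_mono) auto
      also have "\<dots> = (norm (f (?p s)) * (1 + norm (?p s)) ^ N) * ?d ^ N" by (simp add: power_mult_distrib)
      also have "\<dots> \<le> C * ?d ^ N" by (intro mult_right_mono C) auto
      finally have "norm (f (?p s)) \<le> C * ?d ^ N / (1 + norm x) ^ N"
        by (simp add: pos_le_divide_eq add_pos_nonneg)
      moreover have "norm (s ^ m *\<^sub>R f (?p s)) \<le> norm (f (?p s))"
        using s by (simp add: mult_left_le_one_le power_le_one)
      ultimately show ?thesis by linarith
    qed
    have "norm (integral (cbox 0 1) (\<lambda>s. s ^ m *\<^sub>R f (?p s)))
        \<le> (C * ?d ^ N / (1 + norm x) ^ N) * measure lborel (cbox 0 (1::real))"
    proof (rule integrable_bound)
      show "0 \<le> C * ?d ^ N / (1 + norm x) ^ N" using C(1) by simp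
      show "(\<lambda>s. s ^ m *\<^sub>R f (?p s)) integrable_on cbox 0 1"
        by (intro integrable_continuous continuous_refl_integrand1 assms)
    qed (use pb in auto)
    then show ?thesis by (simp add: refl_mean_def pos_le_divide_eq add_pos_nonneg)
  qed
  then show "\<exists>C. \<forall>x\<in>{x. \<bar>v \<bullet> x\<bar> \<le> 1}. norm (refl_mean v m f x) * (1 + norm x) ^ N \<le> C" by blast
qed

lemma refl_mean_base:
  assumes "v \<noteq> 0" "Cn UNIV (Suc n) f"
  shows "refl_mean v m f differentiable (at x)" "rapid_on {x. \<bar>v \<bullet> x\<bar> \<le> 1} (refl_mean v m f)"
  using differentiableI[OF refl_mean_has_derivative[OF Cn_C1[OF assms(2)]]]
    rapid_on_refl_mean[OF Cn_rapid[OF assms(2)] Cn_continuous[OF assms(2)] assms(1)] by blast+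

lemma Cn_refl_mean:
  assumes "v \<noteq> 0" "Cn UNIV (Suc n) f"
  shows "Cn {x. \<bar>v \<bullet> x\<bar> \<le> 1} n (refl_mean v m f)"
  using assms(2)
proof (induction n arbitrary: f m)
  case 0
  show ?case using refl_mean_base[OF assms(1) 0] by simp
next
  case (Suc n)
  have eq: "partial_deriv j (refl_mean v m f) = (\<lambda>x. refl_mean v m (partial_deriv j f) x
      - (2 * v $ j / (norm v)\<^sup>2) *\<^sub>R refl_mean v (Suc m) (dir_deriv v f) x)" for j
    by (rule ext) (rule partial_deriv_refl_mean[OF Cn_C1[OF Suc.prems]])
  have "Cn UNIV (Suc n) (partial_deriv j f)" for j
    using Suc.prems unfolding Cn.simps(2)[of UNIV "Suc n"] by blast
  then have "Cn {x. \<bar>v \<bullet> x\<bar> \<le> 1} n (partial_deriv j (refl_mean v m f))" for j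
    unfolding eq by (intro Cn_diff_fun Cn_scaleR Suc.IH Cn_dir_deriv[OF Suc.prems])
  then show ?case using refl_mean_base[OF assms(1) Suc.prems] by simp
qed

text \<open>Outside the slab, division by v . x only makes the function smaller; inside it the decay
  is assumed.\<close>

lemma rapid_on_divide_inner:
  assumes slab: "rapid_on {x. \<bar>v \<bullet> x\<bar> \<le> 1} g" and mult: "rapid_on UNIV (\<lambda>x. of_real (v \<bullet> x) * g x)"
  shows "rapid_on UNIV g"
  unfolding rapid_on_def
proof
  fix N
  obtain C where C: "\<And>x. \<bar>v \<bullet> x\<bar> \<le> 1 \<Longrightarrow> norm (g x) * (1 + norm x) ^ N \<le> C"
    using rapid_onD[OF slab, of N] by auto
  obtain D where D: "\<And>x. norm (of_real (v \<bullet> x) * g x) * (1 + norm x) ^ N \<le> D"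
    using rapid_onD[OF mult, of N] by auto
  have "norm (g x) * (1 + norm x) ^ N \<le> max C D" for x
  proof (cases "\<bar>v \<bullet> x\<bar> \<le> 1")
    case False
    have "norm (g x) * (1 + norm x) ^ N \<le> \<bar>v \<bullet> x\<bar> * (norm (g x) * (1 + norm x) ^ N)"
      using mult_right_mono[of 1 "\<bar>v \<bullet> x\<bar>" "norm (g x) * (1 + norm x) ^ N"] False by simp
    also have "\<dots> \<le> D" using D[of x] by (simp add: norm_mult mult.assoc)
    finally show ?thesis by simp
  qed (use C[of x] in auto)
  then show "\<exists>C. \<forall>x\<in>UNIV. norm (g x) * (1 + norm x) ^ N \<le> C" by blast
qed

text \<open>The product rule read backwards: v . x times the derivative of \<open>g\<close> is the
  derivative of the product minus v_j g, so decay of the derivatives follows order by order.\<close>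

lemma Cn_divide_inner:
  assumes "Cn {x. \<bar>v \<bullet> x\<bar> \<le> 1} n g" "Cn UNIV n (\<lambda>x. of_real (v \<bullet> x) * g x)"
  shows "Cn UNIV n g"
  using assms
proof (induction n arbitrary: g)
  case 0
  then show ?case by (auto intro: rapid_on_divide_inner)
next
  case (Suc n)
  have g: "Cn UNIV n g" using Suc.IH Suc.prems Cn_SucD by blast
  have "Cn UNIV n (partial_deriv j g)" for j
  proof (rule Suc.IH)
    show "Cn {x. \<bar>v \<bullet> x\<bar> \<le> 1} n (partial_deriv j g)" using Suc.prems(1) by simp
    have "Cn UNIV n (partial_deriv j (\<lambda>x. of_real (v \<bullet> x) * g x))" using Suc.prems(2) by simp
    then have "Cn UNIV n (\<lambda>x. partial_deriv j (\<lambda>x. of_real (v \<bullet> x) * g x) x - of_real (v $ j) * g x)"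
      by (intro Cn_diff_fun Cn_cmult g)
    moreover have "partial_deriv j (\<lambda>x. of_real (v \<bullet> x) * g x) x - of_real (v $ j) * g x
        = of_real (v \<bullet> x) * partial_deriv j g x" for x
      by (simp add: partial_deriv_coord Cn_diff[OF g])
    ultimately show "Cn UNIV n (\<lambda>x. of_real (v \<bullet> x) * partial_deriv j g x)" by simp
  qed
  then show ?case using Cn_diff[OF g] Cn_rapid[OF g] by simp
qed

text \<open>Two descriptions are combined: the mean formula controls the quotient near the
  hyperplane, and the defining difference controls v . x times the quotient everywhere. The loss of
  two orders does not matter for functions of every order.\<close>

lemma Cn_dunkl_quotient:
  assumes "v \<noteq> 0" "Cn UNIV (Suc (Suc n)) f"
  shows "Cn UNIV n (dunkl_quotient v f)"
proof (rule Cn_divide_inner)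
  have "dunkl_quotient v f = (\<lambda>x. (2 / (norm v)\<^sup>2) *\<^sub>R refl_mean v 0 (dir_deriv v f) x)"
    by (rule ext) (rule dunkl_quotient_eq_mean[OF Cn_C1[OF assms(2)] assms(1)])
  then show "Cn {x. \<bar>v \<bullet> x\<bar> \<le> 1} n (dunkl_quotient v f)"
    using Cn_scaleR[OF Cn_refl_mean[OF assms(1) Cn_dir_deriv[OF assms(2)]]] by simp
  have "Cn UNIV n f" using assms(2) Cn_SucD by blast
  then show "Cn UNIV n (\<lambda>x. of_real (v \<bullet> x) * dunkl_quotient v f x)"
    unfolding inner_dunkl_quotient by (intro Cn_diff_fun Cn_root_refl)
qed

section \<open>Schwartz functions, products and radial functions\<close>

lemma power_1_plus_norm_le:
  "(1 + norm (x::real^'n)) ^ N \<le> 2 ^ N * (1 + real CARD('n) ^ N * (\<Sum>i\<in>UNIV. \<bar>x $ i\<bar> ^ N))"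
proof -
  let ?M = "Max (range (\<lambda>i. \<bar>x $ i\<bar>))"
  have "?M \<in> range (\<lambda>i. \<bar>x $ i\<bar>)" by (rule Max_in) auto
  then obtain i where i: "?M = \<bar>x $ i\<bar>" by (rule imageE)
  have le: "\<bar>x $ j\<bar> \<le> \<bar>x $ i\<bar>" for j unfolding i[symmetric] by (rule Max_ge) auto
  have "norm x \<le> (\<Sum>j\<in>UNIV. \<bar>x $ j\<bar>)" by (rule norm_le_l1_cart)
  also have "\<dots> \<le> (\<Sum>j\<in>(UNIV::'n set). \<bar>x $ i\<bar>)" by (intro sum_mono le)
  finally have 1: "norm x \<le> real CARD('n) * \<bar>x $ i\<bar>" by simp
  have "1 + norm x \<le> 2 * max 1 (norm x)" by simp
  then have "(1 + norm x) ^ N \<le> (2 * max 1 (norm x)) ^ N" by (intro power_mono) auto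
  also have "\<dots> = 2 ^ N * (max 1 (norm x)) ^ N" by (rule power_mult_distrib)
  also have "(max 1 (norm x)) ^ N \<le> 1 + norm x ^ N" by (auto simp: max_def)
  also have "norm x ^ N \<le> (real CARD('n) * \<bar>x $ i\<bar>) ^ N" by (intro power_mono 1) auto
  also have "\<dots> = real CARD('n) ^ N * \<bar>x $ i\<bar> ^ N" by (rule power_mult_distrib)
  also have "\<bar>x $ i\<bar> ^ N \<le> (\<Sum>i\<in>UNIV. \<bar>x $ i\<bar> ^ N)" by (rule member_le_sum) auto
  finally show ?thesis by (simp add: mult_left_mono)
qed

text \<open>Powers of a single coordinate are among the monomials of the definition, and together
  they dominate every power of 1 + |x|.\<close>

lemma schwartz_rapid_on:
  fixes f :: "real^'n \<Rightarrow> complex"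
  assumes "schwartz f" shows "rapid_on UNIV (iter_partial js f)"
  unfolding rapid_on_def
proof
  fix N
  let ?g = "iter_partial js f"
  have "\<exists>C. \<forall>x. \<bar>x $ i\<bar> ^ m * norm (?g x) \<le> C" for i m
  proof -
    have "\<forall>js. \<forall>b::'n \<Rightarrow> nat. bounded (range (\<lambda>x. (\<Prod>i\<in>UNIV. (x $ i) ^ b i) *\<^sub>R iter_partial js f x))"
      using assms unfolding schwartz_def by (rule conjunct2)
    then have "bounded (range (\<lambda>x. (\<Prod>l\<in>UNIV. (x $ l) ^ (if l = i then m else 0)) *\<^sub>R ?g x))"
      by (elim allE)
    then obtain C where C: "\<And>x. norm ((\<Prod>l\<in>UNIV. (x $ l) ^ (if l = i then m else 0)) *\<^sub>R ?g x) \<le> C"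
      unfolding bounded_iff by blast
    have "(\<Prod>l\<in>UNIV. (x $ l) ^ (if l = i then m else 0)) = x $ i ^ m" for x :: "real^'n"
    proof -
      have "(\<Prod>l\<in>UNIV. (x $ l) ^ (if l = i then m else 0)) = (\<Prod>l\<in>UNIV. if l = i then x $ l ^ m else 1)"
        by (intro prod.cong) auto
      then show ?thesis by simp
    qed
    then show ?thesis using C by (auto simp: power_abs)
  qed
  then have "\<forall>i. \<forall>m. \<exists>C. \<forall>x. \<bar>x $ i\<bar> ^ m * norm (?g x) \<le> C" by blast
  then obtain C where C: "\<And>i m x. \<bar>x $ i\<bar> ^ m * norm (?g x) \<le> C i m" by metis
  have "norm (?g x) * (1 + norm x) ^ N \<le> 2 ^ N * (C undefined 0 + real CARD('n) ^ N * (\<Sum>i\<in>UNIV. C i N))" for x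
  proof -
    have "norm (?g x) * (1 + norm x) ^ N \<le> norm (?g x) * (2 ^ N * (1 + real CARD('n) ^ N * (\<Sum>i\<in>UNIV. \<bar>x $ i\<bar> ^ N)))"
      by (intro mult_left_mono power_1_plus_norm_le) auto
    also have "\<dots> = 2 ^ N * (\<bar>x $ undefined\<bar> ^ 0 * norm (?g x) + real CARD('n) ^ N * (\<Sum>i\<in>UNIV. \<bar>x $ i\<bar> ^ N
        * norm (?g x)))"
      by (simp add: sum_distrib_left sum_distrib_right algebra_simps)
    also have "\<dots> \<le> 2 ^ N * (C undefined 0 + real CARD('n) ^ N * (\<Sum>i\<in>UNIV. C i N))"
      by (intro mult_left_mono add_mono sum_mono C) auto
    finally show ?thesis .
  qed
  then show "\<exists>C. \<forall>x\<in>UNIV. norm (?g x) * (1 + norm x) ^ N \<le> C" by blast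
qed

lemma schwartz_Cn:
  assumes "schwartz f" shows "Cn UNIV n (iter_partial js f)"
proof (induction n arbitrary: js)
  case 0
  show ?case using assms schwartz_rapid_on by (simp add: schwartz_def)
next
  case (Suc n)
  have "Cn UNIV n (partial_deriv j (iter_partial js f))" for j using Suc[of "j # js"] by simp
  then show ?case using assms schwartz_rapid_on by (simp add: schwartz_def)
qed

lemma partial_deriv_mult:
  assumes "f differentiable (at x)" "g differentiable (at x)"
  shows "partial_deriv j (\<lambda>x. f x * g x) x = f x * partial_deriv j g x + partial_deriv j f x * g x"
  using partial_deriv_eqI[OF has_derivative_mult[OF assms[THEN differentiable_has_derivative_partial]], of j]
  by (simp add: sum_axis_scaleR)

lemma C1_differentiable: "C1 f \<Longrightarrow> f differentiable (at x)"
  by (simp add: C1_def)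

lemma C1_mult:
  assumes "C1 f" "C1 g" shows "C1 (\<lambda>x. f x * g x)"
proof -
  have "partial_deriv j (\<lambda>x. f x * g x) = (\<lambda>x. f x * partial_deriv j g x + partial_deriv j f x * g x)" for j
    by (rule ext) (intro partial_deriv_mult C1_differentiable assms)
  then show ?thesis unfolding C1_def
    using C1_differentiable[OF assms(1)] C1_differentiable[OF assms(2)] C1_continuous[OF assms(1)]
        C1_continuous[OF assms(2)]
      C1_continuous_partial[OF assms(1)] C1_continuous_partial[OF assms(2)]
    by (auto intro!: differentiable_mult continuous_on_add continuous_on_mult)
qed

lemma C1_add:
  assumes "C1 f" "C1 g" shows "C1 (\<lambda>x. f x + g x)"
proof -
  have "partial_deriv j (\<lambda>x. f x + g x) = (\<lambda>x. partial_deriv j f x + partial_deriv j g x)" for j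
    by (rule ext) (intro partial_deriv_add C1_differentiable assms)
  then show ?thesis unfolding C1_def
    using C1_differentiable[OF assms(1)] C1_differentiable[OF assms(2)]
      C1_continuous_partial[OF assms(1)] C1_continuous_partial[OF assms(2)]
    by (auto intro!: differentiable_add continuous_on_add)
qed

lemma C1_cmult:
  assumes "C1 f" shows "C1 (\<lambda>x. c * f x)"
proof -
  have "partial_deriv j (\<lambda>x. c * f x) = (\<lambda>x. c * partial_deriv j f x)" for j
    by (rule ext) (intro partial_deriv_cmult C1_differentiable assms)
  then show ?thesis unfolding C1_def
    using C1_differentiable[OF assms] C1_continuous_partial[OF assms]
    by (auto intro!: differentiable_mult continuous_on_mult)
qed

lemma C1_inner_mult:
  assumes "C1 f" shows "C1 (\<lambda>x. of_real (u \<bullet> x) * f x)"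
proof -
  have "partial_deriv j (\<lambda>x. of_real (u \<bullet> x) * f x)
      = (\<lambda>x. of_real (u \<bullet> x) * partial_deriv j f x + of_real (u $ j) * f x)" for j
    by (rule ext) (intro partial_deriv_coord C1_differentiable assms)
  then show ?thesis unfolding C1_def
    using C1_differentiable[OF assms] C1_continuous[OF assms] C1_continuous_partial[OF assms]
    by (auto intro!: differentiable_inner_mult continuous_intros)
qed

definition radial :: "(real \<Rightarrow> real) \<Rightarrow> real^'n \<Rightarrow> complex" where
  "radial g x = of_real (g ((norm x)\<^sup>2))"

lemma radial_refl [simp]: "radial g (root_refl v x) = radial g x"
  by (simp add: radial_def)

lemma radial_has_derivative:
  assumes "\<And>r. r \<ge> 0 \<Longrightarrow> (g has_real_derivative g' r) (at r)"
  shows "(radial g has_derivative (\<lambda>h. of_real (g' ((norm x)\<^sup>2) * (2 * (x \<bullet> h))))) (at x)"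
proof -
  have "((\<lambda>x. (norm x)\<^sup>2) has_derivative (\<lambda>h. 2 * (x \<bullet> h))) (at x)"
    unfolding power2_norm_eq_inner by (auto intro!: derivative_eq_intros simp: inner_commute)
  from has_derivative_compose[OF this assms[unfolded has_field_derivative_def]]
  have "((\<lambda>x. g ((norm x)\<^sup>2)) has_derivative (\<lambda>h. g' ((norm x)\<^sup>2) * (2 * (x \<bullet> h)))) (at x)" by simp
  then show ?thesis unfolding radial_def[abs_def] by (rule has_derivative_of_real)
qed

lemma partial_deriv_radial:
  assumes "\<And>r. r \<ge> 0 \<Longrightarrow> (g has_real_derivative g' r) (at r)"
  shows "partial_deriv j (radial g) x = 2 * of_real (x $ j) * radial g' x"
  by (subst partial_deriv_eqI[OF radial_has_derivative[OF assms]]) (auto simp: radial_def inner_axis)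

lemma C1_radial:
  assumes "\<And>r. r \<ge> 0 \<Longrightarrow> (g has_real_derivative g' r) (at r)" "continuous_on {0..} g'"
  shows "C1 (radial g)"
proof (rule C1I[OF radial_has_derivative[OF assms(1)]])
  fix j
  have "continuous_on UNIV (\<lambda>x. g' ((norm x)\<^sup>2))"
    by (rule continuous_on_compose2[OF assms(2)]) (auto intro!: continuous_intros)
  then show "continuous_on UNIV (\<lambda>x. complex_of_real (g' ((norm x)\<^sup>2) * (2 * (x \<bullet> axis j 1))))"
    by (intro continuous_intros)
qed auto

lemma has_vector_derivative_of_quotient:
  fixes f :: "real \<Rightarrow> 'a::real_normed_vector"
  assumes "((\<lambda>s. (f s - f t) /\<^sub>R (s - t)) \<longlongrightarrow> l) (at t)"
  shows "(f has_vector_derivative l) (at t)"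
  unfolding has_vector_derivative_def has_derivative_at2
proof
  show "bounded_linear (\<lambda>x. x *\<^sub>R l)" by (rule bounded_linear_scaleR_left)
  have lim: "((\<lambda>s. norm ((f s - f t) /\<^sub>R (s - t) - l)) \<longlongrightarrow> 0) (at t)"
    using assms by (intro tendsto_norm_zero LIM_zero)
  have eq: "norm ((f s - f t) /\<^sub>R (s - t) - l) = norm ((1 / norm (s - t)) *\<^sub>R (f s - (f t + (s - t) *\<^sub>R l)))"
      if "s \<noteq> t" for s
  proof -
    have "(f s - f t) /\<^sub>R (s - t) - l = (1 / (s - t)) *\<^sub>R (f s - (f t + (s - t) *\<^sub>R l))"
      using that by (simp add: scaleR_diff_right scaleR_add_right divide_inverse)
    then show ?thesis by simp
  qed
  have "((\<lambda>s. norm ((1 / norm (s - t)) *\<^sub>R (f s - (f t + (s - t) *\<^sub>R l)))) \<longlongrightarrow> 0) (at t)"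
    by (rule Lim_transform_eventually[OF lim]) (simp add: eventually_at_filter eq)
  then show "((\<lambda>s. (1 / norm (s - t)) *\<^sub>R (f s - (f t + (s - t) *\<^sub>R l))) \<longlongrightarrow> 0) (at t)"
    by (rule tendsto_norm_zero_cancel)
qed

lemma power_le_fact_exp: "0 \<le> x \<Longrightarrow> (x::real) ^ n \<le> fact n * exp x"
proof -
  assume "0 \<le> x"
  then have "(\<Sum>i\<in>{n}. x ^ i /\<^sub>R fact i) \<le> (\<Sum>i. x ^ i /\<^sub>R fact i)"
    by (intro sum_le_suminf summable_exp_generic) auto
  then show ?thesis by (simp add: exp_def divide_simps mult.commute)
qed

lemma gauss_bound:
  fixes t :: real assumes t: "t > 0"
  shows "\<exists>C\<ge>0. \<forall>x::'a::real_normed_vector. exp (- t * (norm x)\<^sup>2) * (1 + norm x) ^ N \<le> C"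
proof (intro exI conjI allI)
  let ?C = "2 ^ N * (1 + fact N / t ^ N)"
  show "0 \<le> ?C" using t by simp
  fix x :: 'a
  let ?s = "norm x"
  have "1 + ?s \<le> 2 * max 1 ?s" by simp
  then have "(1 + ?s) ^ N \<le> (2 * max 1 ?s) ^ N" by (intro power_mono) auto
  also have "\<dots> = 2 ^ N * (max 1 ?s) ^ N" by (rule power_mult_distrib)
  also have "(max 1 ?s) ^ N \<le> 1 + (?s\<^sup>2) ^ N"
  proof (cases "?s \<le> 1")
    case False
    then have "?s ^ N \<le> ?s ^ (2 * N)" by (intro power_increasing) auto
    then show ?thesis using False by (simp add: max_def power_mult)
  qed (simp add: max_def)
  also have "(?s\<^sup>2) ^ N \<le> fact N / t ^ N * exp (t * ?s\<^sup>2)"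
    using power_le_fact_exp[of "t * ?s\<^sup>2" N] t by (simp add: power_mult_distrib divide_simps mult_ac)
  finally have "exp (- t * ?s\<^sup>2) * (1 + ?s) ^ N \<le> exp (- t * ?s\<^sup>2) * (2 ^ N * (1 + fact N / t ^ N * exp (t * ?s\<^sup>2)))"
    by (simp add: mult_left_mono)
  also have "\<dots> = 2 ^ N * (exp (- t * ?s\<^sup>2) + fact N / t ^ N)"
    by (simp add: distrib_left exp_minus field_simps)
  also have "\<dots> \<le> ?C" using t by (intro mult_left_mono add_right_mono) auto
  finally show "exp (- t * ?s\<^sup>2) * (1 + ?s) ^ N \<le> ?C" .
qed

lemma integral_lborel_scaleR:
  fixes F :: "real^'n \<Rightarrow> 'b::{banach, second_countable_topology}"
  assumes [measurable]: "F \<in> borel_measurable borel" and "c > 0"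
  shows "(LINT x|lborel. F x) = (c ^ CARD('n)) *\<^sub>R (LINT x|lborel. F (c *\<^sub>R x))"
proof -
  have "(LINT x|lborel. F x)
      = (LINT x|density (distr lborel borel (\<lambda>x. 0 + c *\<^sub>R x)) (\<lambda>_. ennreal (c ^ DIM(real^'n))). F x)"
    using lborel_affine[of c "0::real^'n"] \<open>c > 0\<close> by simp
  also have "\<dots> = (LINT x|distr lborel borel (\<lambda>x. 0 + c *\<^sub>R x). c ^ DIM(real^'n) *\<^sub>R F x)"
    using \<open>c > 0\<close> by (subst integral_density) auto
  also have "\<dots> = (LINT x|lborel. c ^ CARD('n) *\<^sub>R F (c *\<^sub>R x))"
    by (subst integral_distr) auto
  finally show ?thesis by simp
qed

lemma fubini_product_bound:
  fixes K :: "(real^'n) \<Rightarrow> (real^'m) \<Rightarrow> complex"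
  assumes [measurable]: "case_prod K \<in> borel_measurable (borel \<Otimes>\<^sub>M borel)"
    and A: "integrable lborel A" and B: "integrable lborel B"
    and le: "\<And>x y. norm (K x y) \<le> A x * B y"
  shows "(LINT x|lborel. LINT y|lborel. K x y) = (LINT y|lborel. LINT x|lborel. K x y)"
proof -
  have [measurable]: "case_prod K \<in> borel_measurable (lborel \<Otimes>\<^sub>M lborel)" by simp
  have [measurable]: "K x \<in> borel_measurable borel" for x
    using measurable_compose[OF measurable_Pair1' assms(1)] by simp
  have Ki: "integrable lborel (K x)" for x
  proof (rule Bochner_Integration.integrable_bound)
    show "integrable lborel (\<lambda>y. A x * B y)" using B by simp
    show "AE y in lborel. norm (K x y) \<le> norm (A x * B y)"
      by (rule AE_I2) (rule order_trans[OF le], simp)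
  qed measurable
  have int: "integrable (lborel \<Otimes>\<^sub>M lborel) (case_prod K)"
  proof (rule lborel_pair.Fubini_integrable)
    show "integrable lborel (\<lambda>x. LINT y|lborel. norm (case (x, y) of (x, y) \<Rightarrow> K x y))"
    proof (rule Bochner_Integration.integrable_bound)
      show "integrable lborel (\<lambda>x. A x * (LINT y|lborel. B y))" using A by simp
      show "AE x in lborel. norm (LINT y|lborel. norm (case (x, y) of (x, y) \<Rightarrow> K x y))
          \<le> norm (A x * (LINT y|lborel. B y))"
      proof (rule AE_I2)
        fix x
        have "(LINT y|lborel. norm (K x y)) \<le> (LINT y|lborel. A x * B y)"
          by (intro integral_mono integrable_norm Ki integrable_mult_right B le)
        also have "\<dots> = A x * (LINT y|lborel. B y)" by simp
        finally show "norm (LINT y|lborel. norm (case (x, y) of (x, y) \<Rightarrow> K x y)) \<le> norm (A x * (LINT y|lborel. B y))"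
          by (simp add: integral_nonneg_AE)
      qed
    qed measurable
  qed (simp_all add: Ki)
  from lborel_pair.Fubini_integral[OF int] show ?thesis by simp
qed

lemma rapid_on_continuous_bound:
  assumes "rapid_on UNIV f" shows "\<exists>C\<ge>0. \<forall>x. norm (f x) * (1 + norm x) ^ N \<le> C"
  using rapid_onD[OF assms, of N] by auto

section \<open>The Dunkl transform of rapidly decreasing functions\<close>

context dunkl
begin

text \<open>The Schwartz class in a form suited to the Dunkl operators: \<open>T\<close> loses
  finitely many orders of \<open>Cn\<close>, so the intersection over all orders is stable.\<close>

definition Sm :: "(real^'n \<Rightarrow> complex) \<Rightarrow> bool" where
  "Sm f \<longleftrightarrow> (\<forall>n. Cn UNIV n f)"

lemma schwartz_Sm: "schwartz f \<Longrightarrow> Sm f"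
  using schwartz_Cn[of f _ "[]"] by (simp add: Sm_def)

lemma Sm_C1: "Sm f \<Longrightarrow> C1 f"
  unfolding Sm_def using Cn_C1 by blast

lemma Sm_rapid: "Sm f \<Longrightarrow> rapid_on UNIV f"
  unfolding Sm_def using Cn_rapid by blast

lemma Sm_continuous: "Sm f \<Longrightarrow> continuous_on UNIV f"
  by (rule C1_continuous[OF Sm_C1])

lemma Sm_inner_mult: "Sm f \<Longrightarrow> Sm (\<lambda>x. of_real (u \<bullet> x) * f x)"
  unfolding Sm_def by (blast intro: Cn_inner_mult)

lemma Sm_sum: "finite I \<Longrightarrow> (\<And>i. i \<in> I \<Longrightarrow> Sm (f i)) \<Longrightarrow> Sm (\<lambda>x. \<Sum>i\<in>I. f i x)"
  unfolding Sm_def by (blast intro: Cn_sum)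

lemma Sm_T:
  assumes "Sm f" shows "Sm (T j f)"
  unfolding Sm_def
proof
  fix n
  have "Cn UNIV (Suc (Suc n)) f" "Cn UNIV (Suc n) f" using assms unfolding Sm_def by blast+
  then show "Cn UNIV n (T j f)"
    unfolding dunkl_op_def[abs_def]
    by (intro Cn_add Cn_sum Cn_cmult Cn_dunkl_quotient Rp_nonzero finite_Rp) auto
qed

lemma dec_bound_iff: "a * (1 + norm x) ^ (2 * CARD('n) + wdeg) \<le> C \<longleftrightarrow> a \<le> C * dec x" for x :: "real^'n"
  by (simp add: dec_def pos_le_divide_eq add_pos_nonneg)

lemma rapid_dec:
  assumes "rapid_on UNIV f" shows "\<exists>C\<ge>0. \<forall>x. norm (f x) * (1 + norm x) ^ N \<le> C * dec x"
proof -
  obtain C where "C \<ge> 0" "\<And>x. norm (f x) * (1 + norm x) ^ (N + (2 * CARD('n) + wdeg)) \<le> C"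
    using rapid_on_continuous_bound[OF assms] by blast
  then show ?thesis by (intro exI[of _ C]) (simp add: dec_bound_iff[symmetric] power_add mult.assoc)
qed

lemma gauss_dec:
  assumes "t > 0" shows "\<exists>C\<ge>0. \<forall>x::real^'n. exp (- t * (norm x)\<^sup>2) * (1 + norm x) ^ N \<le> C * dec x"
proof -
  obtain C where "C \<ge> 0" "\<And>x::real^'n. exp (- t * (norm x)\<^sup>2) * (1 + norm x) ^ (N + (2 * CARD('n) + wdeg)) \<le> C"
    using gauss_bound[OF assms] by blast
  then show ?thesis by (intro exI[of _ C]) (simp add: dec_bound_iff[symmetric] power_add mult.assoc)
qed

lemma measurable_kern1 [measurable]: "kern y \<in> borel_measurable borel"
  by (intro borel_measurable_continuous_onI C1_continuous C1_kern)

lemma measurable_kern2 [measurable (raw)]: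
  "f \<in> borel_measurable M \<Longrightarrow> g \<in> borel_measurable M \<Longrightarrow> (\<lambda>x. kern (f x) (g x)) \<in> borel_measurable M"
  using measurable_compose[OF measurable_Pair measurable_kern, of f M g] by simp

lemma integrable_dec_weight:
  fixes f :: "real^'n \<Rightarrow> complex"
  assumes [measurable]: "f \<in> borel_measurable borel" and "AE x in lborel. norm (f x) \<le> C * dec x"
  shows "integrable lborel (\<lambda>x. f x * of_real (w x))"
    and "norm (LINT x|lborel. f x * of_real (w x)) \<le> C * (LINT x|lborel. w x * dec x)"
proof -
  have le: "AE x in lborel. norm (f x * of_real (w x)) \<le> C * (w x * dec x)"
    using assms(2)
  proof eventually_elim
    case (elim x)
    show ?case using mult_right_mono[OF elim weight_nonneg[of x]] weight_nonneg[of x] by (simp add: norm_mult mult_ac)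
  qed
  have base: "integrable lborel (\<lambda>x. C * (w x * dec x))" by (intro integrable_mult_right integrable_weight_dec)
  show "integrable lborel (\<lambda>x. f x * of_real (w x))"
    by (rule Bochner_Integration.integrable_bound[OF base]) (use le in \<open>auto elim!: eventually_mono\<close>)
  show "norm (LINT x|lborel. f x * of_real (w x)) \<le> C * (LINT x|lborel. w x * dec x)"
    using order_trans[OF integral_norm_bound
        integral_mono_AE[OF integrable_norm[OF \<open>integrable lborel (\<lambda>x. f x * of_real (w x))\<close>] base le]]
    unfolding integral_mult_right_zero .
qed

definition ft :: "(real^'n \<Rightarrow> complex) \<Rightarrow> real^'n \<Rightarrow> complex" where
  "ft f \<xi> = (LINT x|lborel. f x * kern (- \<xi>) x * of_real (w x))"

lemma dunkl_transform_eq: "dunkl_transform Rp k f \<xi> = ft f \<xi> / of_real (dunkl_c Rp k)"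
  unfolding dunkl_transform_def ft_def dunkl_kernel_minus_eq by simp

lemma norm_mult_kern: "norm a \<le> C \<Longrightarrow> norm (a * kern x y) \<le> C * kern_sup"
  unfolding norm_mult by (intro mult_mono norm_kern_le) (auto intro: order_trans[OF norm_ge_zero])

text \<open>Integration by parts against the kernel, which together with its Dunkl derivative is
  bounded. \<open>f'\<close> stands for an explicit formula that agrees with T_j f off the
  hyperplanes, so the values given by limits need never be computed.\<close>

lemma kern_ibp:
  assumes f: "C1 f" "\<And>x. norm (f x) \<le> C * dec x"
    and Tf: "\<And>x. regular x \<Longrightarrow> T j f x = f' x" "\<And>x. norm (f' x) \<le> C * dec x"
    and [measurable]: "f' \<in> borel_measurable borel"
  shows "(LINT x|lborel. f' x * kern y x * of_real (w x))
    = - \<i> * of_real (y $ j) * (LINT x|lborel. f x * kern y x * of_real (w x))"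
proof -
  have "(LINT x|lborel. T j f x * kern y x * of_real (w x)) = - (LINT x|lborel. f x * T j (kern y) x * of_real (w x))"
  proof (rule dunkl_ibp[OF f(1) C1_kern f(2)])
    show "norm (T j f x) \<le> C * dec x" if "regular x" for x using Tf that by simp
    have yj: "\<bar>y $ j\<bar> \<le> norm y" by (rule component_le_norm_cart)
    show "norm (kern y x) \<le> (1 + norm y) * kern_sup" for x
      using mult_mono[of 1 "1 + norm y" "norm (kern y x)" kern_sup] norm_kern_le[of y x] kern_sup_nonneg by simp
    show "norm (T j (kern y) x) \<le> (1 + norm y) * kern_sup" for x
      unfolding kern_dunkl norm_mult using yj kern_sup_nonneg by (intro mult_mono norm_kern_le) auto
  qed
  moreover have "(LINT x|lborel. T j f x * kern y x * of_real (w x))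
      = (LINT x|lborel. f' x * kern y x * of_real (w x))"
  proof (rule integral_cong_AE)
    show "AE x in lborel. T j f x * kern y x * of_real (w x) = f' x * kern y x * of_real (w x)"
      by (rule eventually_mono[OF AE_regular]) (simp add: Tf)
    have [measurable]: "T j f \<in> borel_measurable borel"
      by (intro borel_measurable_continuous_onI continuous_dunkl_op f)
    show "(\<lambda>x. T j f x * kern y x * of_real (w x)) \<in> borel_measurable lborel" by measurable
  qed measurable
  moreover have "(LINT x|lborel. f x * T j (kern y) x * of_real (w x))
      = \<i> * of_real (y $ j) * (LINT x|lborel. f x * kern y x * of_real (w x))"
    unfolding kern_dunkl integral_mult_right_zero[symmetric] by (intro Bochner_Integration.integral_cong) auto
  ultimately show ?thesis by simp
qed

lemma ft_T:
  assumes "Sm f" shows "ft (T j f) \<xi> = \<i> * of_real (\<xi> $ j) * ft f \<xi>"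
proof -
  obtain C1 where C1: "C1 \<ge> 0" "\<And>x. norm (f x) * (1 + norm x) ^ 0 \<le> C1 * dec x"
    using rapid_dec[OF Sm_rapid[OF assms]] by blast
  obtain C2 where C2: "C2 \<ge> 0" "\<And>x. norm (T j f x) * (1 + norm x) ^ 0 \<le> C2 * dec x"
    using rapid_dec[OF Sm_rapid[OF Sm_T[OF assms]]] by blast
  have le: "C1 * dec x \<le> max C1 C2 * dec x" "C2 * dec x \<le> max C1 C2 * dec x" for x
    using dec_pos[of x] by (auto intro!: mult_right_mono)
  have "ft (T j f) \<xi> = - \<i> * of_real ((- \<xi>) $ j) * ft f \<xi>"
    unfolding ft_def
  proof (rule kern_ibp[OF Sm_C1[OF assms]])
    show "norm (f x) \<le> max C1 C2 * dec x" for x using C1(2)[of x] le(1)[of x] by simp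
    show "norm (T j f x) \<le> max C1 C2 * dec x" for x using C2(2)[of x] le(2)[of x] by simp
    show "T j f \<in> borel_measurable borel"
      by (intro borel_measurable_continuous_onI Sm_continuous Sm_T assms)
  qed simp
  then show ?thesis by simp
qed

lemma ft_bounded:
  assumes "Sm f" shows "\<exists>C\<ge>0. \<forall>\<xi>. norm (ft f \<xi>) \<le> C"
proof -
  obtain C where C: "C \<ge> 0" "\<And>x. norm (f x) * (1 + norm x) ^ 0 \<le> C * dec x"
    using rapid_dec[OF Sm_rapid[OF assms]] by blast
  have [measurable]: "f \<in> borel_measurable borel" by (intro borel_measurable_continuous_onI Sm_continuous assms)
  have "norm (ft f \<xi>) \<le> (C * kern_sup) * (LINT x|lborel. w x * dec x)" for \<xi>
    unfolding ft_def
  proof (rule integrable_dec_weight(2))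
    show "AE x in lborel. norm (f x * kern (- \<xi>) x) \<le> C * kern_sup * dec x"
      using norm_mult_kern[OF C(2)[simplified]] by (intro AE_I2) (simp add: mult_ac)
  qed measurable
  moreover have "0 \<le> (C * kern_sup) * (LINT x|lborel. w x * dec x)"
    using C(1) kern_sup_nonneg weight_nonneg dec_pos by (intro mult_nonneg_nonneg integral_nonneg_AE AE_I2)
        (auto intro: less_imp_le)
  ultimately show ?thesis by blast
qed

text \<open>Multiplication by a coordinate of \<xi> corresponds, up to \<i>, to a Dunkl operator on
  \<open>f\<close>. The class is stable under these, and all transforms of its members are
  bounded.\<close>

lemma ft_rapid:
  assumes "Sm f" shows "rapid_on UNIV (ft f)"
  unfolding rapid_on_def
proof
  fix N
  have "\<exists>C. \<forall>\<xi>. \<bar>\<xi> $ j\<bar> ^ n * norm (ft f \<xi>) \<le> C" if "Sm f" for j n f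
    using that
  proof (induction n arbitrary: f)
    case 0
    then show ?case using ft_bounded by fastforce
  next
    case (Suc n)
    have eq: "\<bar>\<xi> $ j\<bar> ^ n * norm (ft (T j f) \<xi>) = \<bar>\<xi> $ j\<bar> ^ Suc n * norm (ft f \<xi>)" for \<xi>
      by (simp add: ft_T[OF Suc.prems] norm_mult)
    show ?case using Suc.IH[OF Sm_T[OF Suc.prems, of j]] unfolding eq .
  qed
  then have "\<forall>j. \<exists>C. \<forall>\<xi>. \<bar>\<xi> $ j\<bar> ^ N * norm (ft f \<xi>) \<le> C" using assms by blast
  then obtain C where C: "\<And>j \<xi>. \<bar>\<xi> $ j\<bar> ^ N * norm (ft f \<xi>) \<le> C j" by metis
  obtain C0 where C0: "\<And>\<xi>. norm (ft f \<xi>) \<le> C0" using ft_bounded[OF assms] by blast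
  have "norm (ft f x) * (1 + norm x) ^ N \<le> 2 ^ N * (C0 + real CARD('n) ^ N * (\<Sum>i\<in>UNIV. C i))" for x
  proof -
    have "norm (ft f x) * (1 + norm x) ^ N
        \<le> norm (ft f x) * (2 ^ N * (1 + real CARD('n) ^ N * (\<Sum>i\<in>UNIV. \<bar>x $ i\<bar> ^ N)))"
      by (intro mult_left_mono power_1_plus_norm_le) auto
    also have "\<dots> = 2 ^ N * (norm (ft f x) + real CARD('n) ^ N * (\<Sum>i\<in>UNIV. \<bar>x $ i\<bar> ^ N * norm (ft f x)))"
      by (simp add: sum_distrib_left sum_distrib_right algebra_simps)
    also have "\<dots> \<le> 2 ^ N * (C0 + real CARD('n) ^ N * (\<Sum>i\<in>UNIV. C i))"
      by (intro mult_left_mono add_mono sum_mono C C0) auto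
    finally show ?thesis .
  qed
  then show "\<exists>C. \<forall>x\<in>UNIV. norm (ft f x) * (1 + norm x) ^ N \<le> C" by blast
qed

lemma measurable_ft [measurable]:
  assumes [measurable]: "f \<in> borel_measurable borel" shows "ft f \<in> borel_measurable borel"
proof -
  have "(\<lambda>\<xi>. LINT x|lborel. f x * kern (- \<xi>) x * of_real (w x)) \<in> borel_measurable borel"
    by (rule lborel.borel_measurable_lebesgue_integral) measurable
  then show ?thesis by (simp add: ft_def[abs_def])
qed

text \<open>A radial factor is invariant under the reflections and passes through the difference
  quotients, so the product rule has no correction.\<close>

lemma T_radial_mult:
  assumes "regular y" "C1 f" "C1 (radial g :: real^'n \<Rightarrow> complex)"
  shows "T j (\<lambda>x. radial g x * f x) y = partial_deriv j (radial g) y * f y + radial g y * T j f y"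
  unfolding dunkl_op_regular[OF assms(1)] radial_refl
    partial_deriv_mult[OF C1_differentiable[OF assms(3)] C1_differentiable[OF assms(2)]]
  by (simp add: sum_distrib_left algebra_simps diff_divide_distrib)

text \<open>The reflection changes the coordinate by a multiple of v . y, which cancels the
  denominator and leaves reflected values of \<open>f\<close> as the correction.\<close>

lemma T_coord_mult:
  assumes y: "regular y" and f: "C1 f"
  shows "T j (\<lambda>x. of_real (x $ j) * f x) y = of_real (y $ j) * T j f y + f y
    + (\<Sum>v\<in>Rp. of_real (k v * (2 * (v $ j)\<^sup>2 / (norm v)\<^sup>2)) * f (root_refl v y))"
proof -
  have pd: "partial_deriv j (\<lambda>x. of_real (x $ j) * f x) y = of_real (y $ j) * partial_deriv j f y + f y"
    using partial_deriv_coord[OF C1_differentiable[OF f], of j "axis j 1" y] by (simp add: inner_axis')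
  have q: "of_real (k v * v $ j) * ((of_real (y $ j) * f y - of_real (root_refl v y $ j) * f (root_refl v y))
      / of_real (v \<bullet> y))
     = of_real (y $ j) * (of_real (k v * v $ j) * ((f y - f (root_refl v y)) / of_real (v \<bullet> y)))
      + of_real (k v * (2 * (v $ j)\<^sup>2 / (norm v)\<^sup>2)) * f (root_refl v y)" if v: "v \<in> Rp" for v
  proof -
    define s where "s = v \<bullet> y"
    define a where "a = 2 * v $ j / (norm v)\<^sup>2"
    have s: "complex_of_real s \<noteq> 0" using y v by (auto simp: regular_def s_def)
    have r: "root_refl v y $ j = y $ j - s * a"
      by (simp add: root_refl_def s_def a_def inner_commute)
    have e: "k v * (2 * (v $ j)\<^sup>2 / (norm v)\<^sup>2) = k v * v $ j * a" by (simp add: a_def power2_eq_square)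
    show ?thesis
      unfolding r e s_def[symmetric] of_real_mult of_real_diff using s by (simp add: field_simps)
  qed
  have S: "(\<Sum>v\<in>Rp. of_real (k v * v $ j) * ((of_real (y $ j) * f y - of_real (root_refl v y $ j) * f (root_refl v y))
      / of_real (v \<bullet> y)))
    = of_real (y $ j) * (\<Sum>v\<in>Rp. of_real (k v * v $ j) * ((f y - f (root_refl v y)) / of_real (v \<bullet> y)))
      + (\<Sum>v\<in>Rp. of_real (k v * (2 * (v $ j)\<^sup>2 / (norm v)\<^sup>2)) * f (root_refl v y))"
    unfolding sum_distrib_left sum.distrib[symmetric] by (rule sum.cong[OF HOL.refl q])
  show ?thesis
    unfolding dunkl_op_regular[OF y] pd S by (simp only: distrib_left add_ac)
qed

lemma sum_coord_sq: "(\<Sum>j\<in>UNIV. (x $ j)\<^sup>2) = (norm (x::real^'n))\<^sup>2"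
  by (simp add: norm_vec_def L2_set_def sum_nonneg)

definition radial_laplace ::
  "(real \<Rightarrow> real) \<Rightarrow> (real \<Rightarrow> real) \<Rightarrow> (real \<Rightarrow> real) \<Rightarrow> real^'n \<Rightarrow> real^'n \<Rightarrow> complex" where
  "radial_laplace g0 g1 g2 z x =
     (4 * of_real ((norm x)\<^sup>2) * radial g2 x + 4 * \<i> * of_real (z \<bullet> x) * radial g1 x
       - of_real ((norm z)\<^sup>2) * radial g0 x) * kern z x
     + 2 * radial g1 x * (of_nat CARD('n) * kern z x + 2 * (\<Sum>v\<in>Rp. of_real (k v) * kern z (root_refl v x)))"

text \<open>\<open>radial_laplace\<close> is the Dunkl Laplacian of \<open>x \<mapsto> g\<^sub>0 (|x|\<^sup>2) E(i z, x)\<close>.\<close>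

lemma radial_ibp:
  assumes d0: "\<And>r. r \<ge> 0 \<Longrightarrow> (g0 has_real_derivative g1 r) (at r)"
    and d1: "\<And>r. r \<ge> 0 \<Longrightarrow> (g1 has_real_derivative g2 r) (at r)"
    and c2: "continuous_on {0..} g2"
    and b0: "\<And>x::real^'n. \<bar>g0 ((norm x)\<^sup>2)\<bar> \<le> C * dec x"
    and b1: "\<And>x::real^'n. (1 + norm x) * \<bar>g1 ((norm x)\<^sup>2)\<bar> \<le> C * dec x"
    and b2: "\<And>x::real^'n. (norm x)\<^sup>2 * \<bar>g2 ((norm x)\<^sup>2)\<bar> \<le> C * dec x"
  shows "(LINT x|lborel. radial_laplace g0 g1 g2 z x * kern y x * of_real (w x))
    = - of_real ((norm y)\<^sup>2) * (LINT x|lborel. radial g0 x * kern z x * kern y x * of_real (w x))"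
proof -
  have c1: "continuous_on {0..} g1"
    using d1 by (intro continuous_at_imp_continuous_on ballI) (auto intro: DERIV_isCont)
  have C: "C1 (radial g0)" "C1 (radial g1)" by (auto intro!: C1_radial d0 d1 c1 c2)
  have contr: "continuous_on UNIV (radial g2)"
    unfolding radial_def[abs_def]
    by (intro continuous_intros continuous_on_compose2[OF c2]) auto
  have [measurable]: "radial g0 \<in> borel_measurable borel" "radial g1 \<in> borel_measurable borel"
      "radial g2 \<in> borel_measurable borel"
    by (intro borel_measurable_continuous_onI C1_continuous C contr)+
  define Z where "Z = (1 + norm z) * (1 + norm z)"
  have Z: "Z \<ge> 1" "norm z \<le> Z" "(norm z)\<^sup>2 \<le> Z"
  proof -
    have "0 \<le> norm z * norm z" by simp
    then show "Z \<ge> 1" "norm z \<le> Z" "(norm z)\<^sup>2 \<le> Z"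
      using norm_ge_zero[of z] unfolding Z_def power2_eq_square distrib_left distrib_right by linarith+
  qed
  have Cdec: "0 \<le> C * dec x" for x using order_trans[OF abs_ge_zero b0] .
  have nr: "norm (radial g x) = \<bar>g ((norm x)\<^sup>2)\<bar>" for g and x :: "real^'n" by (simp add: radial_def)
  have b1': "\<bar>g1 ((norm x)\<^sup>2)\<bar> \<le> C * dec x" "norm x * \<bar>g1 ((norm x)\<^sup>2)\<bar> \<le> C * dec x" for x :: "real^'n"
  proof -
    have "0 \<le> norm x * \<bar>g1 ((norm x)\<^sup>2)\<bar>" by simp
    moreover have "(1 + norm x) * \<bar>g1 ((norm x)\<^sup>2)\<bar> = \<bar>g1 ((norm x)\<^sup>2)\<bar> + norm x * \<bar>g1 ((norm x)\<^sup>2)\<bar>"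
      by (simp add: distrib_right)
    ultimately show "\<bar>g1 ((norm x)\<^sup>2)\<bar> \<le> C * dec x" "norm x * \<bar>g1 ((norm x)\<^sup>2)\<bar> \<le> C * dec x"
      using b1[of x] abs_ge_zero[of "g1 ((norm x)\<^sup>2)"] by linarith+
  qed
  \<comment> \<open>\<open>Z\<close> dominates 1, |z| and |z|^2 at once. The first bracket of
    \<open>f3\<close> contributes 4 + 4 + 1 and the part with the reflections 2 (1 + 2 \<gamma>),
    which adds up to 11 + 4 \<gamma>.\<close>
  let ?M = "(11 + 4 * \<gamma>) * Z * kern_sup * C"
  \<comment> \<open>\<open>f2 j\<close> and \<open>f3 j\<close> are the first and second Dunkl
    derivatives of \<open>f1\<close> written out, valid at regular points and in a form that can be
    bounded everywhere.\<close>
  define f1 where "f1 x = radial g0 x * kern z x" for x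
  define f2 where "f2 j x = of_real (x $ j) * (2 * radial g1 x * kern z x) + \<i> * of_real (z $ j)
      * (radial g0 x * kern z x)" for j x
  define f3 where "f3 j x = (4 * of_real ((x $ j)\<^sup>2) * radial g2 x + 4 * \<i> * of_real (z $ j * x $ j) * radial g1 x
       - of_real ((z $ j)\<^sup>2) * radial g0 x) * kern z x
     + 2 * radial g1 x * (kern z x + (\<Sum>v\<in>Rp. of_real (k v * (2 * (v $ j)\<^sup>2 / (norm v)\<^sup>2)) * kern z
         (root_refl v x)))" for j x
  have [measurable]: "f1 \<in> borel_measurable borel" "f2 j \<in> borel_measurable borel" "f3 j \<in> borel_measurable borel"
      for j
    unfolding f1_def[abs_def] f2_def[abs_def] f3_def[abs_def] by measurable
  have C1f1: "C1 f1" unfolding f1_def[abs_def] by (intro C1_mult C C1_kern)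
  have C1k: "C1 (\<lambda>x. 2 * radial g1 x * kern z x)" unfolding mult.assoc by (intro C1_cmult C1_mult C C1_kern)
  have C1f2: "C1 (f2 j)" for j
  proof -
    have "C1 (\<lambda>x. of_real (axis j 1 \<bullet> x) * (2 * radial g1 x * kern z x) + \<i> * of_real (z $ j)
        * (radial g0 x * kern z x))"
      by (intro C1_add C1_inner_mult C1_cmult C1_mult C1k C C1_kern)
    then show ?thesis by (simp add: f2_def[abs_def] inner_axis')
  qed
  have T1: "T j f1 x = f2 j x" if "regular x" for j x
    unfolding f1_def[abs_def] f2_def
    using that by (simp add: T_radial_mult C C1_kern partial_deriv_radial[OF d0] kern_dunkl algebra_simps)
  have T2: "T j (f2 j) x = f3 j x" if x: "regular x" for j x
  proof -
    have add: "T j (\<lambda>x. a x + b x) x = T j a x + T j b x" if "C1 a" "C1 b" for a b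
      unfolding dunkl_op_regular[OF x] using that
      by (simp add: partial_deriv_add C1_differentiable sum.distrib[symmetric] add_divide_distrib diff_divide_distrib
          algebra_simps)
    have cm: "T j (\<lambda>x. c * a x) x = c * T j a x" if "C1 a" for a c
      unfolding dunkl_op_regular[OF x] using that
      by (simp add: partial_deriv_cmult C1_differentiable sum_distrib_left diff_divide_distrib algebra_simps)
    have r1: "T j (\<lambda>x. 2 * radial g1 x * kern z x) x = 2 * (2 * of_real (x $ j) * radial g2 x * kern z x
        + radial g1 x * (\<i> * of_real (z $ j) * kern z x))"
      unfolding mult.assoc[of 2] using x
      by (simp add: cm C1_mult C C1_kern T_radial_mult partial_deriv_radial[OF d1] kern_dunkl)
    have C1a: "C1 (\<lambda>x. of_real (x $ j) * (2 * radial g1 x * kern z x))"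
      using C1_inner_mult[OF C1k, of "axis j 1"] by (simp add: inner_axis')
    have C1b: "C1 (\<lambda>x. \<i> * of_real (z $ j) * (radial g0 x * kern z x))" by (intro C1_cmult C1_mult C C1_kern)
    have r2: "T j (\<lambda>x. \<i> * of_real (z $ j) * (radial g0 x * kern z x)) x = \<i> * of_real (z $ j) * f2 j x"
      using cm[OF C1f1, of "\<i> * of_real (z $ j)"] T1[OF x, of j] by (simp add: f1_def[abs_def])
    have "T j (f2 j) x = of_real (x $ j) * T j (\<lambda>x. 2 * radial g1 x * kern z x) x + 2 * radial g1 x * kern z x
      + (\<Sum>v\<in>Rp. of_real (k v * (2 * (v $ j)\<^sup>2 / (norm v)\<^sup>2)) * (2 * radial g1 (root_refl v x) * kern z
          (root_refl v x)))
      + \<i> * of_real (z $ j) * f2 j x"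
      unfolding f2_def[abs_def] add[OF C1a C1b] T_coord_mult[OF x C1k] r2[unfolded f2_def] by simp
    also have "\<dots> = f3 j x"
      unfolding r1 f2_def f3_def radial_refl
      by (simp add: sum_distrib_left power2_eq_square algebra_simps)
    finally show ?thesis .
  qed
  have kz: "norm (kern z x) \<le> kern_sup" for x by (rule norm_kern_le)
  have M: "u * kern_sup * (C * dec x) \<le> ?M * dec x" if "u \<le> (11 + 4 * \<gamma>) * Z" for u x
  proof -
    have "u * (kern_sup * (C * dec x)) \<le> (11 + 4 * \<gamma>) * Z * (kern_sup * (C * dec x))"
      using Cdec[of x] kern_sup_nonneg by (intro mult_right_mono that) auto
    then show ?thesis by (simp add: mult_ac)
  qed
  have gZ: "1 \<le> (11 + 4 * \<gamma>) * Z"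
    using mult_mono[of 1 "11 + 4 * \<gamma>" 1 Z] Z(1) gamma_nonneg by simp
  have bf1: "norm (f1 x) \<le> ?M * dec x" for x
  proof -
    have "norm (f1 x) \<le> C * dec x * kern_sup" unfolding f1_def by (rule norm_mult_kern) (simp add: nr b0)
    also have "\<dots> \<le> ?M * dec x" using M[OF gZ, of x] by (simp add: mult_ac)
    finally show ?thesis .
  qed
  have cz: "\<bar>z $ j\<bar> \<le> norm z" for j by (rule component_le_norm_cart)
  have bf2: "norm (f2 j x) \<le> ?M * dec x" for j x
  proof -
    have "f2 j x = (2 * of_real (x $ j) * radial g1 x + \<i> * of_real (z $ j) * radial g0 x) * kern z x"
      by (simp add: f2_def algebra_simps)
    also have "norm \<dots> \<le> (3 * Z * (C * dec x)) * kern_sup"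
    proof (rule norm_mult_kern)
      have "norm (2 * of_real (x $ j) * radial g1 x + \<i> * of_real (z $ j) * radial g0 x)
         \<le> 2 * \<bar>x $ j\<bar> * \<bar>g1 ((norm x)\<^sup>2)\<bar> + \<bar>z $ j\<bar> * \<bar>g0 ((norm x)\<^sup>2)\<bar>"
        by (rule norm_triangle_le) (simp add: norm_mult nr)
      also have "\<dots> \<le> 2 * (C * dec x) + Z * (C * dec x)"
      proof (intro add_mono)
        have "\<bar>x $ j\<bar> * \<bar>g1 ((norm x)\<^sup>2)\<bar> \<le> norm x * \<bar>g1 ((norm x)\<^sup>2)\<bar>"
          by (intro mult_right_mono component_le_norm_cart) auto
        then show "2 * \<bar>x $ j\<bar> * \<bar>g1 ((norm x)\<^sup>2)\<bar> \<le> 2 * (C * dec x)" using b1'(2)[of x] by simp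
        show "\<bar>z $ j\<bar> * \<bar>g0 ((norm x)\<^sup>2)\<bar> \<le> Z * (C * dec x)"
          using cz[of j] Z b0[of x] by (intro mult_mono) auto
      qed
      also have "\<dots> \<le> 3 * Z * (C * dec x)"
        using mult_right_mono[OF Z(1) Cdec[of x]] unfolding mult.assoc mult_1_left by linarith
      finally show "norm (2 * of_real (x $ j) * radial g1 x + \<i> * of_real (z $ j) * radial g0 x)
          \<le> 3 * Z * (C * dec x)" .
    qed
    also have "\<dots> \<le> ?M * dec x"
      using M[of "3 * Z" x] mult_right_mono[of 3 "11 + 4 * \<gamma>" Z] Z(1) gamma_nonneg by (simp add: mult_ac)
    finally show ?thesis .
  qed
  have bf3: "norm (f3 j x) \<le> ?M * dec x" for j x
  proof -
    let ?D = "C * dec x"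
    have 1: "norm (4 * of_real ((x $ j)\<^sup>2) * radial g2 x + 4 * \<i> * of_real (z $ j * x $ j) * radial g1 x
       - of_real ((z $ j)\<^sup>2) * radial g0 x) \<le> 9 * Z * ?D - 2 * ?D * 0" (is "norm (?a + ?b - ?c) \<le> _")
    proof -
      have "(x $ j)\<^sup>2 \<le> (norm x)\<^sup>2" using power_mono[OF component_le_norm_cart[of x j], of 2] by simp
      then have "(x $ j)\<^sup>2 * \<bar>g2 ((norm x)\<^sup>2)\<bar> \<le> (norm x)\<^sup>2 * \<bar>g2 ((norm x)\<^sup>2)\<bar>" by (intro mult_right_mono) auto
      then have a: "norm ?a \<le> 4 * ?D" using b2[of x] by (simp add: norm_mult nr norm_power abs_mult)
      have "(\<bar>x $ j\<bar> * \<bar>g1 ((norm x)\<^sup>2)\<bar>) \<le> norm x * \<bar>g1 ((norm x)\<^sup>2)\<bar>"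
        by (intro mult_right_mono component_le_norm_cart) auto
      also have "\<dots> \<le> ?D" by (rule b1'(2))
      finally have xg: "\<bar>x $ j\<bar> * \<bar>g1 ((norm x)\<^sup>2)\<bar> \<le> ?D" .
      have "\<bar>z $ j\<bar> * (\<bar>x $ j\<bar> * \<bar>g1 ((norm x)\<^sup>2)\<bar>) \<le> Z * ?D"
        by (rule mult_mono[OF order_trans[OF cz Z(2)] xg]) (use Z in auto)
      then have b: "norm ?b \<le> 4 * (Z * ?D)" by (simp add: norm_mult nr abs_mult)
      have "(z $ j)\<^sup>2 \<le> (norm z)\<^sup>2" using power_mono[OF cz[of j], of 2] by simp
      then have "(z $ j)\<^sup>2 * \<bar>g0 ((norm x)\<^sup>2)\<bar> \<le> Z * ?D" using Z b0[of x] by (intro mult_mono) auto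
      then have c: "norm ?c \<le> Z * ?D" by (simp add: norm_mult nr norm_power)
      have "norm (?a + ?b - ?c) \<le> norm ?a + norm ?b + norm ?c"
        using norm_triangle_ineq4[of "?a + ?b" ?c] norm_triangle_ineq[of ?a ?b] by linarith
      also have "\<dots> \<le> 9 * Z * ?D" using a b c mult_right_mono[OF Z(1) Cdec[of x]] unfolding mult.assoc mult_1_left
          by linarith
      finally show ?thesis by simp
    qed
    have 2: "norm (kern z x + (\<Sum>v\<in>Rp. of_real (k v * (2 * (v $ j)\<^sup>2 / (norm v)\<^sup>2)) * kern z (root_refl v x)))
        \<le> (1 + 2 * \<gamma>) * kern_sup"
    proof -
      have "norm (\<Sum>v\<in>Rp. of_real (k v * (2 * (v $ j)\<^sup>2 / (norm v)\<^sup>2)) * kern z (root_refl v x))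
          \<le> (\<Sum>v\<in>Rp. k v * 2 * kern_sup)"
      proof (rule sum_norm_le)
        fix v assume v: "v \<in> Rp"
        have "(v $ j)\<^sup>2 \<le> (norm v)\<^sup>2" using power_mono[OF component_le_norm_cart[of v j], of 2] by simp
        then have "2 * (v $ j)\<^sup>2 / (norm v)\<^sup>2 \<le> 2" using Rp_nonzero[OF v] by (simp add: divide_le_eq)
        then have "k v * (2 * (v $ j)\<^sup>2 / (norm v)\<^sup>2) \<le> k v * 2" using k_nonneg_Rp[OF v] by (intro mult_left_mono)
        then have "norm (complex_of_real (k v * (2 * (v $ j)\<^sup>2 / (norm v)\<^sup>2))) \<le> k v * 2"
          using k_nonneg_Rp[OF v] by (simp only: norm_of_real) (simp add: abs_mult)
        then show "norm (of_real (k v * (2 * (v $ j)\<^sup>2 / (norm v)\<^sup>2)) * kern z (root_refl v x)) \<le> k v * 2 * kern_sup"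
          by (rule norm_mult_kern)
      qed
      also have "\<dots> = 2 * \<gamma> * kern_sup" by (simp add: dunkl_gamma_def sum_distrib_left sum_distrib_right mult_ac)
      finally show ?thesis by (intro norm_triangle_le) (use kz[of x] in \<open>simp add: distrib_right\<close>)
    qed
    have "norm (f3 j x) \<le> (9 * Z * ?D) * kern_sup + 2 * ?D * ((1 + 2 * \<gamma>) * kern_sup)"
      unfolding f3_def
    proof (rule norm_triangle_le[OF add_mono])
      show "norm ((4 * of_real ((x $ j)\<^sup>2) * radial g2 x + 4 * \<i> * of_real (z $ j * x $ j) * radial g1 x
       - of_real ((z $ j)\<^sup>2) * radial g0 x) * kern z x) \<le> (9 * Z * ?D) * kern_sup"
        by (rule norm_mult_kern) (use 1 in simp)
      show "norm (2 * radial g1 x * (kern z x + (\<Sum>v\<in>Rp. of_real (k v * (2 * (v $ j)\<^sup>2 / (norm v)\<^sup>2))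
          * kern z (root_refl v x))))
         \<le> 2 * ?D * ((1 + 2 * \<gamma>) * kern_sup)"
        unfolding norm_mult[of "2 * radial g1 x"]
        by (intro mult_mono 2) (use b1'(1)[of x] Cdec[of x] in \<open>auto simp: norm_mult nr\<close>)
    qed
    also have "\<dots> = (9 * Z + 2 * (1 + 2 * \<gamma>)) * kern_sup * ?D" by (simp add: algebra_simps)
    also have "\<dots> \<le> ?M * dec x"
    proof (rule M)
      show "9 * Z + 2 * (1 + 2 * \<gamma>) \<le> (11 + 4 * \<gamma>) * Z"
        using mult_left_mono[OF Z(1) gamma_nonneg] Z(1) by (simp add: algebra_simps)
    qed
    finally show ?thesis .
  qed
  have I1: "(LINT x|lborel. f2 j x * kern y x * of_real (w x))
      = - \<i> * of_real (y $ j) * (LINT x|lborel. f1 x * kern y x * of_real (w x))" for j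
    by (rule kern_ibp[OF C1f1 bf1 T1 bf2]) measurable
  have I2: "(LINT x|lborel. f3 j x * kern y x * of_real (w x))
      = - \<i> * of_real (y $ j) * (LINT x|lborel. f2 j x * kern y x * of_real (w x))" for j
    by (rule kern_ibp[OF C1f2 bf2 T2 bf3]) measurable
  have I3: "(LINT x|lborel. f3 j x * kern y x * of_real (w x))
      = - of_real ((y $ j)\<^sup>2) * (LINT x|lborel. f1 x * kern y x * of_real (w x))" for j
    unfolding I2 I1 by (simp add: power2_eq_square algebra_simps)
  have sum_f3: "(\<Sum>j\<in>UNIV. f3 j x) = radial_laplace g0 g1 g2 z x" for x
  proof -
    define K where "K = kern z x"
    define S where "S j = (\<Sum>v\<in>Rp. of_real (k v * (2 * (v $ j)\<^sup>2 / (norm v)\<^sup>2)) * kern z (root_refl v x))" for j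
    have f3: "f3 j x = of_real ((x $ j)\<^sup>2) * (4 * radial g2 x * K) + of_real (z $ j * x $ j) * (4 * \<i> * radial g1 x
        * K)
      - of_real ((z $ j)\<^sup>2) * (radial g0 x * K) + (2 * radial g1 x * K + 2 * radial g1 x * S j)" for j
      unfolding f3_def K_def[symmetric] S_def[symmetric] by (simp only: algebra_simps)
    have e1: "(\<Sum>j\<in>UNIV. complex_of_real ((x $ j)\<^sup>2)) = of_real ((norm x)\<^sup>2)" for x :: "real^'n"
      by (simp only: of_real_sum[symmetric] sum_coord_sq)
    have e2: "(\<Sum>j\<in>UNIV. complex_of_real (z $ j * x $ j)) = of_real (z \<bullet> x)"
      by (simp only: of_real_sum[symmetric] inner_vec_def inner_real_def)
    \<comment> \<open>The numbers v_j^2 / |v|^2 add up to 1, so the sum over the coordinates removes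
      the lengths of the roots.\<close>
    have e4: "(\<Sum>j\<in>UNIV. S j) = 2 * (\<Sum>v\<in>Rp. of_real (k v) * kern z (root_refl v x))"
    proof -
      have "(\<Sum>j\<in>UNIV. S j) = (\<Sum>v\<in>Rp. \<Sum>j\<in>UNIV. of_real (k v * (2 * (v $ j)\<^sup>2 / (norm v)\<^sup>2)) * kern z (root_refl v x))"
        unfolding S_def by (rule sum.swap)
      also have "\<dots> = (\<Sum>v\<in>Rp. 2 * (of_real (k v) * kern z (root_refl v x)))"
      proof (rule sum.cong[OF HOL.refl])
        fix v assume v: "v \<in> Rp"
        have "(\<Sum>j\<in>UNIV. k v * (2 * (v $ j)\<^sup>2 / (norm v)\<^sup>2)) = k v * 2 / (norm v)\<^sup>2 * (\<Sum>j\<in>UNIV. (v $ j)\<^sup>2)"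
          unfolding sum_distrib_left by (intro sum.cong) auto
        also have "\<dots> = 2 * k v" using Rp_nonzero[OF v] by (simp add: sum_coord_sq)
        finally have "(\<Sum>j\<in>UNIV. complex_of_real (k v * (2 * (v $ j)\<^sup>2 / (norm v)\<^sup>2))) = of_real (2 * k v)"
          by (simp only: of_real_sum[symmetric])
        then show "(\<Sum>j\<in>UNIV. of_real (k v * (2 * (v $ j)\<^sup>2 / (norm v)\<^sup>2)) * kern z (root_refl v x))
            = 2 * (of_real (k v) * kern z (root_refl v x))"
          by (simp only: sum_distrib_right[symmetric]) simp
      qed
      finally show ?thesis by (simp add: sum_distrib_left)
    qed
    have "(\<Sum>j\<in>UNIV. f3 j x) = of_real ((norm x)\<^sup>2) * (4 * radial g2 x * K) + of_real (z \<bullet> x) * (4 * \<i> * radial g1 x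
        * K)
      - of_real ((norm z)\<^sup>2) * (radial g0 x * K) + (of_nat CARD('n) * (2 * radial g1 x * K)
        + 2 * radial g1 x * (2 * (\<Sum>v\<in>Rp. of_real (k v) * kern z (root_refl v x))))"
      unfolding f3 sum.distrib sum_subtractf sum_distrib_right[symmetric] sum_distrib_left[symmetric] e1 e2 e4 by simp
    then show ?thesis unfolding radial_laplace_def K_def by (simp only: algebra_simps)
  qed
  have int: "integrable lborel (\<lambda>x. f3 j x * kern y x * of_real (w x))" for j
  proof (rule integrable_dec_weight(1))
    show "AE x in lborel. norm (f3 j x * kern y x) \<le> ?M * kern_sup * dec x"
      using norm_mult_kern[OF bf3] by (intro AE_I2) (simp add: mult_ac)
  qed measurable
  have "(LINT x|lborel. radial_laplace g0 g1 g2 z x * kern y x * of_real (w x))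
     = (LINT x|lborel. (\<Sum>j\<in>UNIV. f3 j x * kern y x * of_real (w x)))"
    unfolding sum_f3[symmetric] by (simp add: sum_distrib_right)
  also have "\<dots> = (\<Sum>j\<in>UNIV. (LINT x|lborel. f3 j x * kern y x * of_real (w x)))"
    by (rule Bochner_Integration.integral_sum) (rule int)
  also have "\<dots> = - (\<Sum>j\<in>UNIV. complex_of_real ((y $ j)\<^sup>2)) * (LINT x|lborel. f1 x * kern y x * of_real (w x))"
    unfolding I3 by (simp only: sum_distrib_right[symmetric] sum_negf)
  also have "(\<Sum>j\<in>UNIV. complex_of_real ((y $ j)\<^sup>2)) = of_real ((norm y)\<^sup>2)"
    by (simp only: of_real_sum[symmetric] sum_coord_sq)
  finally show ?thesis unfolding f1_def .
qed

text \<open>Half the homogeneous dimension: the measure with density \<open>w\<close> scales with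
  degree 2 \<open>hdim\<close>.\<close>

definition hdim :: real where "hdim = \<gamma> + real CARD('n) / 2"

section \<open>The transform of the Gaussian\<close>

definition gauss_int :: "real^'n \<Rightarrow> real \<Rightarrow> complex" where
  "gauss_int y t = (LINT x|lborel. of_real (exp (- t * (norm x)\<^sup>2)) * kern y x * of_real (w x))"

lemma integrable_gauss_kern:
  assumes "t > 0"
  shows "integrable lborel (\<lambda>x. of_real ((norm x)\<^sup>2 * exp (- t * (norm x)\<^sup>2)) * kern y x * of_real (w x))" (is ?I1)
    and "integrable lborel (\<lambda>x. of_real (exp (- t * (norm x)\<^sup>2)) * kern y x * of_real (w x))" (is ?I2)
    and "integrable lborel (\<lambda>x. (1 + norm x) ^ N * exp (- t * (norm x)\<^sup>2) * w x)" (is ?I3)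
proof -
  obtain C where C: "\<And>x::real^'n. exp (- t * (norm x)\<^sup>2) * (1 + norm x) ^ 2 \<le> C * dec x"
    using gauss_dec[OF assms] by blast
  obtain D where D: "\<And>x::real^'n. exp (- t * (norm x)\<^sup>2) * (1 + norm x) ^ N \<le> D * dec x"
    using gauss_dec[OF assms] by blast
  have n1: "norm (complex_of_real ((norm x)\<^sup>2 * exp (- t * (norm x)\<^sup>2))) \<le> C * dec x" for x :: "real^'n"
  proof -
    have "(norm x)\<^sup>2 \<le> (1 + norm x)\<^sup>2" by (intro power_mono) auto
    then have "exp (- t * (norm x)\<^sup>2) * (norm x)\<^sup>2 \<le> exp (- t * (norm x)\<^sup>2) * (1 + norm x)\<^sup>2"
        by (intro mult_left_mono) auto
    from order_trans[OF this C[of x]] show ?thesis unfolding norm_of_real by (simp add: abs_mult mult.commute)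
  qed
  have n2: "norm (complex_of_real (exp (- t * (norm x)\<^sup>2))) \<le> C * dec x" for x :: "real^'n"
  proof -
    have "1 \<le> (1 + norm x)\<^sup>2" by (simp add: one_le_power)
    then have "exp (- t * (norm x)\<^sup>2) * 1 \<le> exp (- t * (norm x)\<^sup>2) * (1 + norm x)\<^sup>2" by (intro mult_left_mono) auto
    from order_trans[OF this C[of x]] show ?thesis unfolding norm_of_real by simp
  qed
  show ?I1
  proof (rule integrable_dec_weight(1))
    show "AE x in lborel. norm (of_real ((norm x)\<^sup>2 * exp (- t * (norm x)\<^sup>2)) * kern y x) \<le> C * kern_sup * dec x"
      using norm_mult_kern[OF n1] by (intro AE_I2) (simp only: mult_ac)
  qed measurable
  show ?I2
  proof (rule integrable_dec_weight(1))
    show "AE x in lborel. norm (of_real (exp (- t * (norm x)\<^sup>2)) * kern y x) \<le> C * kern_sup * dec x"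
      using norm_mult_kern[OF n2] by (intro AE_I2) (simp only: mult_ac)
  qed measurable
  show ?I3
  proof (rule Bochner_Integration.integrable_bound)
    show "integrable lborel (\<lambda>x. D * (w x * dec x))" by (intro integrable_mult_right integrable_weight_dec)
    have "(1 + norm x) ^ N * exp (- t * (norm x)\<^sup>2) * w x \<le> D * (w x * dec x)" for x
      using mult_right_mono[OF D[of x] weight_nonneg[of x]] by (simp add: mult_ac)
    then have "norm ((1 + norm x) ^ N * exp (- t * (norm x)\<^sup>2) * w x) \<le> norm (D * (w x * dec x))" for x
      unfolding real_norm_def using weight_nonneg[of x]
      by (intro order_trans[OF _ abs_ge_self]) (simp add: abs_mult)
    then show "AE x in lborel. norm ((1 + norm x) ^ N * exp (- t * (norm x)\<^sup>2) * w x) \<le> norm (D * (w x * dec x))"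
        by simp
  qed measurable
qed

text \<open>\<open>radial_ibp\<close> with z = 0: the Dunkl Laplacian multiplies the Gaussian by 4
  t^2 |x|^2 - 4 t \<open>hdim\<close>. The second moment on the left is minus the derivative of
  \<open>gauss_int\<close> in \<open>t\<close>, so this is a differential equation in
  \<open>t\<close>.\<close>

lemma gauss_int_laplace:
  assumes t: "t > 0"
  shows "4 * of_real (t\<^sup>2) * (LINT x|lborel. of_real ((norm x)\<^sup>2 * exp (- t * (norm x)\<^sup>2)) * kern y x * of_real (w x))
     = of_real (4 * t * hdim - (norm y)\<^sup>2) * gauss_int y t"
proof -
  let ?e = "\<lambda>x::real^'n. exp (- t * (norm x)\<^sup>2)"
  let ?Th = "LINT x|lborel. of_real ((norm x)\<^sup>2 * ?e x) * kern y x * of_real (w x)"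
  obtain C0 where C0: "C0 \<ge> 0" "\<And>x. ?e x * (1 + norm x) ^ 2 \<le> C0 * dec x" using gauss_dec[OF t] by blast
  define C where "C = (1 + t + t\<^sup>2) * C0"
  have cmp: "u * (?e x * (1 + norm x) ^ 2) \<le> C * dec x" if "u \<le> 1 + t + t\<^sup>2" "u \<ge> 0" for u x
  proof -
    have "u * (?e x * (1 + norm x) ^ 2) \<le> (1 + t + t\<^sup>2) * (C0 * dec x)"
      by (rule mult_mono[OF that(1) C0(2)]) (use t in auto)
    then show ?thesis by (simp add: C_def mult.assoc)
  qed
  have "(LINT x|lborel. radial_laplace (\<lambda>r. exp (- t * r)) (\<lambda>r. - t * exp (- t * r)) (\<lambda>r. t\<^sup>2 * exp (- t * r)) 0 x
      * kern y x * of_real (w x))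
    = - of_real ((norm y)\<^sup>2) * (LINT x|lborel. radial (\<lambda>r. exp (- t * r)) x * kern 0 x * kern y x * of_real (w x))"
  proof (rule radial_ibp)
    show "((\<lambda>r. exp (- t * r)) has_real_derivative - t * exp (- t * r)) (at r)" for r
      by (auto intro!: derivative_eq_intros)
    show "((\<lambda>r. - t * exp (- t * r)) has_real_derivative t\<^sup>2 * exp (- t * r)) (at r)" for r
      by (auto intro!: derivative_eq_intros simp: power2_eq_square)
    show "continuous_on {0..} (\<lambda>r. t\<^sup>2 * exp (- t * r))" by (intro continuous_intros)
    fix x :: "real^'n"
    have p: "1 \<le> (1 + norm x)\<^sup>2" "(norm x)\<^sup>2 \<le> (1 + norm x)\<^sup>2" "1 + norm x \<le> (1 + norm x)\<^sup>2"
      using self_le_power[of "1 + norm x" 2] by (auto simp: one_le_power intro: power_mono)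
    have "\<bar>exp (- t * (norm x)\<^sup>2)\<bar> = 1 * (?e x * 1)" by simp
    also have "\<dots> \<le> 1 * (?e x * (1 + norm x)\<^sup>2)" by (intro mult_left_mono p) auto
    also have "\<dots> \<le> C * dec x" by (rule cmp) (use t in auto)
    finally show "\<bar>exp (- t * (norm x)\<^sup>2)\<bar> \<le> C * dec x" .
    have "(1 + norm x) * \<bar>- t * exp (- t * (norm x)\<^sup>2)\<bar> = t * (?e x * (1 + norm x))" using t by (simp add: abs_mult)
    also have "\<dots> \<le> t * (?e x * (1 + norm x)\<^sup>2)" using t by (intro mult_left_mono p) auto
    also have "\<dots> \<le> C * dec x" by (rule cmp) (use t in auto)
    finally show "(1 + norm x) * \<bar>- t * exp (- t * (norm x)\<^sup>2)\<bar> \<le> C * dec x" .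
    have "(norm x)\<^sup>2 * \<bar>t\<^sup>2 * exp (- t * (norm x)\<^sup>2)\<bar> = t\<^sup>2 * (?e x * (norm x)\<^sup>2)" using t by (simp add: abs_mult)
    also have "\<dots> \<le> t\<^sup>2 * (?e x * (1 + norm x)\<^sup>2)" using t by (intro mult_left_mono p) auto
    also have "\<dots> \<le> C * dec x" by (rule cmp) (use t in auto)
    finally show "(norm x)\<^sup>2 * \<bar>t\<^sup>2 * exp (- t * (norm x)\<^sup>2)\<bar> \<le> C * dec x" .
  qed
  also have "(LINT x|lborel. radial (\<lambda>r. exp (- t * r)) x * kern 0 x * kern y x * of_real (w x)) = gauss_int y t"
    by (simp add: radial_def kern_zero_left gauss_int_def)
  also have "(\<lambda>x. radial_laplace (\<lambda>r. exp (- t * r)) (\<lambda>r. - t * exp (- t * r)) (\<lambda>r. t\<^sup>2 * exp (- t * r)) 0 x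
      * kern y x * of_real (w x))
     = (\<lambda>x. (4 * of_real (t\<^sup>2)) * (of_real ((norm x)\<^sup>2 * ?e x) * kern y x * of_real (w x))
        - of_real (4 * t * hdim) * (of_real (?e x) * kern y x * of_real (w x)))"
  proof
    fix x
    have "(\<Sum>v\<in>Rp. complex_of_real (k v)) = of_real \<gamma>" by (simp add: dunkl_gamma_def)
    then have "radial_laplace (\<lambda>r. exp (- t * r)) (\<lambda>r. - t * exp (- t * r)) (\<lambda>r. t\<^sup>2 * exp (- t * r)) 0 x
      = 4 * of_real (t\<^sup>2) * of_real ((norm x)\<^sup>2 * ?e x) - of_real (4 * t * hdim) * of_real (?e x)"
      unfolding radial_laplace_def radial_def kern_zero_left
      by (simp add: hdim_def algebra_simps)
    then show "radial_laplace (\<lambda>r. exp (- t * r)) (\<lambda>r. - t * exp (- t * r)) (\<lambda>r. t\<^sup>2 * exp (- t * r)) 0 x * kern y x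
        * of_real (w x)
      = (4 * of_real (t\<^sup>2)) * (of_real ((norm x)\<^sup>2 * ?e x) * kern y x * of_real (w x))
        - of_real (4 * t * hdim) * (of_real (?e x) * kern y x * of_real (w x))"
      by (simp only: left_diff_distrib mult.assoc)
  qed
  also have "integral\<^sup>L lborel \<dots> = (4 * of_real (t\<^sup>2)) * ?Th - of_real (4 * t * hdim) * gauss_int y t"
  proof -
    have iA: "integrable lborel (\<lambda>x. 4 * complex_of_real (t\<^sup>2) * (of_real ((norm x)\<^sup>2 * ?e x) * kern y x
        * of_real (w x)))"
      by (intro integrable_mult_right integrable_gauss_kern t)
    have iB: "integrable lborel (\<lambda>x. complex_of_real (4 * t * hdim) * (of_real (?e x) * kern y x * of_real (w x)))"
      by (intro integrable_mult_right integrable_gauss_kern t)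
    show ?thesis
      unfolding gauss_int_def
      by (simp only: Bochner_Integration.integral_diff[OF iA iB] integral_mult_right_zero)
  qed
  finally show ?thesis by (simp add: algebra_simps)
qed

text \<open>A mean value estimate with the exponential at its largest; it dominates the difference
  quotients when differentiating under the integral.\<close>

lemma exp_diff_quotient_bound:
  fixes a b m r :: real
  assumes "m \<le> a" "m \<le> b" "r \<ge> 0"
  shows "\<bar>exp (- a * r) - exp (- b * r)\<bar> \<le> r * exp (- m * r) * \<bar>a - b\<bar>"
proof -
  have key: "exp (- a * r) - exp (- b * r) \<le> r * exp (- m * r) * (b - a)" if "m \<le> a" "a \<le> b" for a b
  proof -
    have "1 + - ((b - a) * r) \<le> exp (- ((b - a) * r))" by (rule exp_ge_add_one_self)
    then have "exp (- a * r) * (1 - exp (- ((b - a) * r))) \<le> exp (- m * r) * ((b - a) * r)"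
      using that assms(3) by (intro mult_mono) (auto intro: mult_right_mono)
    moreover have "exp (- a * r) * exp (- ((b - a) * r)) = exp (- b * r)"
      by (simp add: exp_add[symmetric] algebra_simps)
    ultimately show ?thesis by (simp add: algebra_simps)
  qed
  show ?thesis
  proof (cases "a \<le> b")
    case True
    then have "exp (- b * r) \<le> exp (- a * r)" using assms(3) by (simp add: mult_right_mono)
    then show ?thesis using key[OF assms(1) True] True by simp
  next
    case False
    then have "exp (- a * r) \<le> exp (- b * r)" using assms(3) by (simp add: mult_right_mono)
    then show ?thesis using key[OF assms(2), of a] False by simp
  qed
qed

text \<open>Keeping the parameter above t / 2 lets |x|^2 times the Gaussian with parameter t / 2
  dominate all difference quotients, and this is integrable against the weight.\<close>

lemma gauss_int_has_vector_derivative: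
  assumes t: "t > 0"
  shows "(gauss_int y has_vector_derivative
    - (LINT x|lborel. of_real ((norm x)\<^sup>2 * exp (- t * (norm x)\<^sup>2)) * kern y x * of_real (w x))) (at t)"
proof -
  let ?S = "{t/2<..<2*t}"
  let ?q = "\<lambda>s x. (exp (- s * (norm x)\<^sup>2) - exp (- t * (norm x)\<^sup>2)) / (s - t)"
  let ?Th = "LINT x|lborel. of_real (- ((norm x)\<^sup>2 * exp (- t * (norm x)\<^sup>2))) * kern y x * of_real (w x)"
  have quot: "(gauss_int y s - gauss_int y t) /\<^sub>R (s - t)
      = (LINT x|lborel. of_real (?q s x) * kern y x * of_real (w x))"
    if "s > 0" for s
  proof -
    have "gauss_int y s - gauss_int y t = (LINT x|lborel. of_real (exp (- s * (norm x)\<^sup>2)) * kern y x * of_real (w x)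
        - of_real (exp (- t * (norm x)\<^sup>2)) * kern y x * of_real (w x))"
      unfolding gauss_int_def by (rule Bochner_Integration.integral_diff[symmetric])
          (intro integrable_gauss_kern t that)+
    then have "(gauss_int y s - gauss_int y t) /\<^sub>R (s - t)
        = (LINT x|lborel. (of_real (exp (- s * (norm x)\<^sup>2)) * kern y x * of_real (w x)
        - of_real (exp (- t * (norm x)\<^sup>2)) * kern y x * of_real (w x)) /\<^sub>R (s - t))" by simp
    also have "\<dots> = (LINT x|lborel. of_real (?q s x) * kern y x * of_real (w x))"
      by (intro Bochner_Integration.integral_cong) (auto simp: scaleR_conv_of_real field_simps)
    finally show ?thesis .
  qed
  have "((\<lambda>s. (gauss_int y s - gauss_int y t) /\<^sub>R (s - t)) \<longlongrightarrow> ?Th) (at t within ?S)"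
    unfolding tendsto_at_iff_sequentially
  proof (intro allI impI)
    fix X assume X: "\<forall>i. X i \<in> ?S - {t}" and lim: "X \<longlonglongrightarrow> t"
    have "(\<lambda>i. LINT x|lborel. of_real (?q (X i) x) * kern y x * of_real (w x)) \<longlonglongrightarrow> ?Th"
    proof (rule integral_dominated_convergence)
      show "integrable lborel (\<lambda>x. kern_sup * ((1 + norm x) ^ 2 * exp (- (t/2) * (norm x)\<^sup>2) * w x))"
        using t by (intro integrable_mult_right integrable_gauss_kern(3)) simp
      show "AE x in lborel. (\<lambda>i. of_real (?q (X i) x) * kern y x * of_real (w x))
          \<longlonglongrightarrow> of_real (- ((norm x)\<^sup>2 * exp (- t * (norm x)\<^sup>2))) * kern y x * of_real (w x)"
      proof (rule AE_I2)
        fix x :: "real^'n"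
        have "((\<lambda>s. exp (- s * (norm x)\<^sup>2)) has_real_derivative - ((norm x)\<^sup>2 * exp (- t * (norm x)\<^sup>2))) (at t)"
          by (auto intro!: derivative_eq_intros)
        then have "((\<lambda>s. ?q s x) \<longlongrightarrow> - ((norm x)\<^sup>2 * exp (- t * (norm x)\<^sup>2))) (at t)"
          by (simp add: has_field_derivative_iff)
        then have "(\<lambda>i. ?q (X i) x) \<longlonglongrightarrow> - ((norm x)\<^sup>2 * exp (- t * (norm x)\<^sup>2))"
          using X lim unfolding tendsto_at_iff_sequentially o_def by auto
        then show "(\<lambda>i. of_real (?q (X i) x) * kern y x * of_real (w x))
          \<longlonglongrightarrow> of_real (- ((norm x)\<^sup>2 * exp (- t * (norm x)\<^sup>2))) * kern y x * of_real (w x)"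
          by (intro tendsto_mult tendsto_of_real tendsto_const)
      qed
      fix i
      have Xi: "X i \<ge> t/2" "X i \<noteq> t" using X by (auto simp: less_imp_le)
      show "AE x in lborel. norm (of_real (?q (X i) x) * kern y x * of_real (w x))
          \<le> kern_sup * ((1 + norm x) ^ 2 * exp (- (t/2) * (norm x)\<^sup>2) * w x)"
      proof (rule AE_I2)
        fix x :: "real^'n"
        have "\<bar>exp (- X i * (norm x)\<^sup>2) - exp (- t * (norm x)\<^sup>2)\<bar> \<le> (norm x)\<^sup>2 * exp (- (t/2) * (norm x)\<^sup>2) * \<bar>X i
            - t\<bar>"
          using Xi t by (intro exp_diff_quotient_bound) auto
        then have "\<bar>?q (X i) x\<bar> \<le> (norm x)\<^sup>2 * exp (- (t/2) * (norm x)\<^sup>2)"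
          using Xi by (simp add: abs_divide divide_le_eq)
        also have "\<dots> \<le> (1 + norm x)\<^sup>2 * exp (- (t/2) * (norm x)\<^sup>2)" by (intro mult_right_mono power_mono) auto
        finally have "norm (complex_of_real (?q (X i) x)) \<le> (1 + norm x)\<^sup>2 * exp (- (t/2) * (norm x)\<^sup>2)"
          by (simp only: norm_of_real)
        from norm_mult_kern[OF this, of y x]
        have "norm (of_real (?q (X i) x) * kern y x) * w x \<le> (1 + norm x)\<^sup>2 * exp (- (t/2) * (norm x)\<^sup>2) * kern_sup
            * w x"
          using weight_nonneg[of x] by (intro mult_right_mono)
        moreover have "norm (of_real (?q (X i) x) * kern y x * of_real (w x))
            = norm (of_real (?q (X i) x) * kern y x) * w x"
          using weight_nonneg[of x] by (simp only: norm_mult[of _ "of_real (w x)"] norm_of_real abs_of_nonneg)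
        ultimately show "norm (of_real (?q (X i) x) * kern y x * of_real (w x))
          \<le> kern_sup * ((1 + norm x) ^ 2 * exp (- (t/2) * (norm x)\<^sup>2) * w x)"
          by (simp only: mult_ac)
      qed
    qed measurable
    moreover have "(LINT x|lborel. of_real (?q (X i) x) * kern y x * of_real (w x))
        = (gauss_int y (X i) - gauss_int y t) /\<^sub>R (X i - t)" for i
      using X t by (intro quot[symmetric]) (auto dest: spec[of _ i])
    ultimately show "((\<lambda>s. (gauss_int y s - gauss_int y t) /\<^sub>R (s - t)) \<circ> X) \<longlonglongrightarrow> ?Th" by (simp add: o_def)
  qed
  moreover have "at t within ?S = at t" using t by (intro at_within_open) auto
  moreover have "?Th = - (LINT x|lborel. of_real ((norm x)\<^sup>2 * exp (- t * (norm x)\<^sup>2)) * kern y x * of_real (w x))"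
    by (simp flip: Bochner_Integration.integral_minus)
  ultimately have "((\<lambda>s. (gauss_int y s - gauss_int y t) /\<^sub>R (s - t))
     \<longlongrightarrow> - (LINT x|lborel. of_real ((norm x)\<^sup>2 * exp (- t * (norm x)\<^sup>2)) * kern y x * of_real (w x))) (at t)" by simp
  then show ?thesis by (rule has_vector_derivative_of_quotient)
qed

lemma integrable_gauss_weight: "t > 0 \<Longrightarrow> integrable lborel (\<lambda>x. exp (- t * (norm x)\<^sup>2) * w x)"
  using integrable_gauss_kern(3)[of t 0] by simp

abbreviation c\<^sub>k :: real where "c\<^sub>k \<equiv> dunkl_c Rp k"

lemma dunkl_c_eq: "c\<^sub>k = (LINT x|lborel. exp (- (1/2) * (norm x)\<^sup>2) * w x)"
  unfolding dunkl_c_def by (intro Bochner_Integration.integral_cong) auto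

lemma dunkl_c_pos: "c\<^sub>k > 0"
proof -
  have int: "integrable lborel (\<lambda>x. exp (- (1/2) * (norm x)\<^sup>2) * w x)" by (rule integrable_gauss_weight) simp
  have "c\<^sub>k \<noteq> 0"
  proof
    assume "c\<^sub>k = 0"
    then have "AE x in lborel. exp (- (1/2) * (norm x)\<^sup>2) * w x = 0"
      using integral_nonneg_eq_0_iff_AE[OF int] weight_nonneg by (simp add: dunkl_c_eq)
    then have "AE x in (lborel::(real^'n) measure). False"
      using AE_regular
    proof eventually_elim
      case (elim x)
      have "w x > 0" unfolding dunkl_weight_def
        by (intro prod_pos) (use elim(2) in \<open>auto simp: regular_def inner_commute\<close>)
      then show ?case using elim(1) by simp
    qed
    then obtain N where N: "{x \<in> space (lborel::(real^'n) measure). \<not> False} \<subseteq> N" "emeasure lborel N = 0"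
        by (rule AE_E)
    have "N = (UNIV :: (real^'n) set)" using N(1) by auto
    then show False using N(2) by simp
  qed
  moreover have "c\<^sub>k \<ge> 0" unfolding dunkl_c_eq using weight_nonneg by (intro integral_nonneg_AE) auto
  ultimately show ?thesis by simp
qed

lemma weight_scaling:
  assumes "c > 0"
  shows "c ^ CARD('n) * w (c *\<^sub>R x) = c powr (2 * hdim) * w x"
  using assms by (simp add: weight_scaleR hdim_def powr_add powr_realpow distrib_left flip: powr_realpow)

lemma gauss_int_scaling:
  assumes t: "t > 0"
  shows "gauss_int y t = of_real ((2 * t) powr - hdim) *
    (LINT x|lborel. of_real (exp (- (1/2) * (norm x)\<^sup>2)) * kern y ((1 / sqrt (2 * t)) *\<^sub>R x) * of_real (w x))"
proof -
  define c where "c = 1 / sqrt (2 * t)"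
  have c: "c > 0" "c\<^sup>2 = 1 / (2 * t)" using t by (auto simp: c_def power_divide)
  have "c powr (2 * hdim) = (c\<^sup>2) powr hdim" using c(1) by (simp add: powr_powr flip: powr_numeral)
  also have "\<dots> = (2 * t) powr - hdim" using t unfolding c(2) by (simp add: powr_divide powr_minus_divide)
  finally have cp: "c powr (2 * hdim) = (2 * t) powr - hdim" .
  let ?F = "\<lambda>x. of_real (exp (- t * (norm x)\<^sup>2)) * kern y x * of_real (w x)"
  have "gauss_int y t = (c ^ CARD('n)) *\<^sub>R (LINT x|lborel. ?F (c *\<^sub>R x))"
    unfolding gauss_int_def by (rule integral_lborel_scaleR) (use c in measurable)
  also have "\<dots> = (LINT x|lborel. (c ^ CARD('n)) *\<^sub>R ?F (c *\<^sub>R x))" by simp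
  also have "\<dots> = (LINT x|lborel. of_real ((2 * t) powr - hdim) * (of_real (exp (- (1/2) * (norm x)\<^sup>2))
      * kern y (c *\<^sub>R x) * of_real (w x)))"
  proof (intro Bochner_Integration.integral_cong HOL.refl)
    fix x :: "real^'n"
    have "t * (norm (c *\<^sub>R x))\<^sup>2 = (1/2) * (norm x)\<^sup>2" using t c by (simp add: power_mult_distrib field_simps)
    then have "- t * (norm (c *\<^sub>R x))\<^sup>2 = - (1/2) * (norm x)\<^sup>2" by linarith
    moreover have "(c ^ CARD('n)) *\<^sub>R (a * b * complex_of_real (w (c *\<^sub>R x)))
        = of_real (c ^ CARD('n) * w (c *\<^sub>R x)) * (a * b)" for a b
      by (simp add: scaleR_conv_of_real)
    ultimately show "(c ^ CARD('n)) *\<^sub>R ?F (c *\<^sub>R x)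
        = of_real ((2 * t) powr - hdim) * (of_real (exp (- (1/2) * (norm x)\<^sup>2)) * kern y (c *\<^sub>R x) * of_real (w x))"
      by (simp only: weight_scaling[OF c(1)] cp) simp
  qed
  finally show ?thesis by (simp add: c_def)
qed

text \<open>The differential equation in \<open>t\<close> is of first order, so its solution is
  fixed up to a constant, and the constant is read off as \<open>t\<close> tends to
  infinity.\<close>

lemma gauss_transform:
  assumes t: "t > 0"
  shows "gauss_int y t = of_real (c\<^sub>k * (2 * t) powr - hdim * exp (- (norm y)\<^sup>2 / (4 * t)))"
proof -
  \<comment> \<open>The integrating factor, up to a constant the reciprocal of the expected
    transform.\<close>
  define A where "A t = t powr hdim * exp ((norm y)\<^sup>2 / (4 * t))" for t
  define P where "P t = A t *\<^sub>R gauss_int y t" for t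
  have "(P has_derivative (\<lambda>h. 0)) (at t within {0<..})" if t: "t \<in> {0<..}" for t
  proof -
    have t: "t > 0" using that by simp
    let ?Th = "LINT x|lborel. of_real ((norm x)\<^sup>2 * exp (- t * (norm x)\<^sup>2)) * kern y x * of_real (w x)"
    have dA: "(A has_real_derivative A t * (hdim / t - (norm y)\<^sup>2 / (4 * t\<^sup>2))) (at t)"
      unfolding A_def using t
      by (auto intro!: derivative_eq_intros simp: powr_diff field_simps power2_eq_square)
    have Th: "- ?Th = ((norm y)\<^sup>2 / (4 * t\<^sup>2) - hdim / t) *\<^sub>R gauss_int y t"
    proof -
      have div: "b = d / a" if "a * b = d" "a \<noteq> 0" for a b d :: complex using that by auto
      have nz: "complex_of_real (4 * t\<^sup>2) \<noteq> 0" using t by simp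
      have "of_real (4 * t\<^sup>2) * ?Th = of_real (4 * t * hdim - (norm y)\<^sup>2) * gauss_int y t"
        using gauss_int_laplace[OF t, of y] by simp
      from div[OF this nz]
      have "?Th = of_real (4 * t * hdim - (norm y)\<^sup>2) * gauss_int y t / of_real (4 * t\<^sup>2)" .
      also have "\<dots> = of_real ((4 * t * hdim - (norm y)\<^sup>2) / (4 * t\<^sup>2)) * gauss_int y t" by (simp add: field_simps)
      also have "(4 * t * hdim - (norm y)\<^sup>2) / (4 * t\<^sup>2) = - ((norm y)\<^sup>2 / (4 * t\<^sup>2) - hdim / t)"
        using t by (simp add: field_simps power2_eq_square)
      finally show ?thesis
        by (simp only: scaleR_conv_of_real of_real_minus mult_minus_left minus_minus)
    qed
    have "(P has_vector_derivative (A t *\<^sub>R - ?Th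
        + (A t * (hdim / t - (norm y)\<^sup>2 / (4 * t\<^sup>2))) *\<^sub>R gauss_int y t)) (at t)"
      unfolding P_def[abs_def] by (intro has_vector_derivative_scaleR dA gauss_int_has_vector_derivative t)
    also have "A t *\<^sub>R - ?Th + (A t * (hdim / t - (norm y)\<^sup>2 / (4 * t\<^sup>2))) *\<^sub>R gauss_int y t = 0"
      unfolding Th by (simp add: algebra_simps)
    finally show ?thesis by (simp add: has_vector_derivative_def has_derivative_at_withinI)
  qed
  then obtain K where K: "\<And>t. t > 0 \<Longrightarrow> P t = K"
    using has_derivative_zero_constant[of "{0::real<..}" P] by auto
  \<comment> \<open>After rescaling, the second argument of the kernel tends to 0 while the Gaussian
    stays fixed. The kernel is 1 at 0, so the limiting integral is the one defining
    \<open>dunkl_c\<close>.\<close>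
  have "(\<lambda>n. P (real (Suc n))) \<longlonglongrightarrow> 2 powr - hdim *\<^sub>R (1 *\<^sub>R of_real c\<^sub>k)"
  proof -
    define I where "I n = (LINT x|lborel. of_real (exp (- (1/2) * (norm x)\<^sup>2))
        * kern y ((1 / sqrt (2 * real (Suc n))) *\<^sub>R x) * complex_of_real (w x))" for n
    have "I \<longlonglongrightarrow> (LINT x|lborel. of_real (exp (- (1/2) * (norm x)\<^sup>2)) * kern y 0 * complex_of_real (w x))"
      unfolding I_def[abs_def]
    proof (rule integral_dominated_convergence)
      show "integrable lborel (\<lambda>x. kern_sup * (exp (- (1/2) * (norm x)\<^sup>2) * w x))"
        by (intro integrable_mult_right integrable_gauss_weight) simp
      have s0: "(\<lambda>n. 1 / sqrt (2 * real (Suc n))) \<longlonglongrightarrow> 0"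
        by real_asymp
      show "AE x in lborel. (\<lambda>n. of_real (exp (- (1/2) * (norm x)\<^sup>2)) * kern y ((1 / sqrt (2 * real (Suc n))) *\<^sub>R x)
          * complex_of_real (w x))
        \<longlonglongrightarrow> of_real (exp (- (1/2) * (norm x)\<^sup>2)) * kern y 0 * complex_of_real (w x)"
      proof (rule AE_I2)
        fix x :: "real^'n"
        have "(\<lambda>n. (1 / sqrt (2 * real (Suc n))) *\<^sub>R x) \<longlonglongrightarrow> 0 *\<^sub>R x" by (intro tendsto_scaleR s0 tendsto_const)
        then have "(\<lambda>n. kern y ((1 / sqrt (2 * real (Suc n))) *\<^sub>R x)) \<longlonglongrightarrow> kern y 0"
          using continuous_on_tendsto_compose[OF C1_continuous[OF C1_kern, of y]] by simp
        then show "(\<lambda>n. of_real (exp (- (1/2) * (norm x)\<^sup>2)) * kern y ((1 / sqrt (2 * real (Suc n))) *\<^sub>R x)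
            * complex_of_real (w x))
          \<longlonglongrightarrow> of_real (exp (- (1/2) * (norm x)\<^sup>2)) * kern y 0 * complex_of_real (w x)"
          by (intro tendsto_mult tendsto_const)
      qed
      show "AE x in lborel. norm (of_real (exp (- (1/2) * (norm x)\<^sup>2)) * kern y ((1 / sqrt (2 * real (Suc n))) *\<^sub>R x)
          * complex_of_real (w x))
        \<le> kern_sup * (exp (- (1/2) * (norm x)\<^sup>2) * w x)" for n
      proof (rule AE_I2)
        fix x :: "real^'n"
        have "norm (complex_of_real (exp (- (1/2) * (norm x)\<^sup>2))) \<le> exp (- (1/2) * (norm x)\<^sup>2)" by simp
        from mult_right_mono[OF norm_mult_kern[OF this, of y "(1 / sqrt (2 * real (Suc n))) *\<^sub>R x"]
            weight_nonneg[of x]]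
        show "norm (of_real (exp (- (1/2) * (norm x)\<^sup>2)) * kern y ((1 / sqrt (2 * real (Suc n))) *\<^sub>R x)
            * complex_of_real (w x))
          \<le> kern_sup * (exp (- (1/2) * (norm x)\<^sup>2) * w x)"
          by (simp add: norm_mult weight_nonneg mult_ac)
      qed
    qed measurable
    also have "(LINT x|lborel. of_real (exp (- (1/2) * (norm x)\<^sup>2)) * kern y 0 * complex_of_real (w x)) = of_real c\<^sub>k"
      unfolding dunkl_c_eq kern_zero_right by (simp flip: of_real_mult)
    finally have I: "I \<longlonglongrightarrow> of_real c\<^sub>k" .
    have e1: "(\<lambda>n. exp ((norm y)\<^sup>2 / (4 * real (Suc n)))) \<longlonglongrightarrow> 1"
    proof -
      have "(\<lambda>n. (norm y)\<^sup>2 / (4 * real (Suc n))) \<longlonglongrightarrow> 0" by real_asymp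
      from tendsto_exp[OF this] show ?thesis by simp
    qed
    have "(\<lambda>n. 2 powr - hdim *\<^sub>R (exp ((norm y)\<^sup>2 / (4 * real (Suc n))) *\<^sub>R I n))
        \<longlonglongrightarrow> 2 powr - hdim *\<^sub>R (1 *\<^sub>R of_real c\<^sub>k)"
      by (intro tendsto_scaleR tendsto_const e1 I)
    moreover have "P (real (Suc n)) = 2 powr - hdim *\<^sub>R (exp ((norm y)\<^sup>2 / (4 * real (Suc n))) *\<^sub>R I n)" for n
    proof -
      define t where "t = real (Suc n)"
      have t: "t > 0" by (simp add: t_def)
      have "t powr hdim * (2 * t) powr - hdim = 2 powr - hdim"
        using t by (simp add: powr_mult powr_minus field_simps)
      then have "P t = (2 powr - hdim * exp ((norm y)\<^sup>2 / (4 * t))) *\<^sub>R I n"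
        unfolding P_def A_def gauss_int_scaling[OF t] I_def t_def[symmetric]
        by (simp add: scaleR_conv_of_real mult_ac flip: of_real_mult)
      then show ?thesis by (simp add: t_def)
    qed
    ultimately show ?thesis by simp
  qed
  moreover have "(\<lambda>n. P (real (Suc n))) \<longlonglongrightarrow> K" using K by simp
  ultimately have "K = 2 powr - hdim *\<^sub>R of_real c\<^sub>k" using LIMSEQ_unique by fastforce
  then have "A t *\<^sub>R gauss_int y t = of_real (2 powr - hdim * c\<^sub>k)"
    using K[OF t] by (simp add: P_def scaleR_conv_of_real)
  moreover have "A t \<noteq> 0" using t by (simp add: A_def)
  ultimately have "gauss_int y t = of_real (2 powr - hdim * c\<^sub>k / A t)"
    by (simp add: scaleR_conv_of_real field_simps)
  also have "2 powr - hdim * c\<^sub>k / A t = c\<^sub>k * (2 * t) powr - hdim * exp (- (norm y)\<^sup>2 / (4 * t))"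
    using t by (simp add: A_def powr_mult powr_minus exp_minus field_simps)
  finally show ?thesis .
qed

section \<open>The multiplication formula and inversion at the origin\<close>

lemma ft_dec: "Sm f \<Longrightarrow> \<exists>C\<ge>0. \<forall>\<xi>. norm (ft f \<xi>) * (1 + norm \<xi>) ^ N \<le> C * dec \<xi>"
  by (rule rapid_dec[OF ft_rapid])

text \<open>The kernel is symmetric and bounded, so the transform can be moved from one factor to
  the other. The sign \<open>s\<close> covers both the transform and its inverse.\<close>

lemma fubini_kern:
  fixes f g :: "real^'n \<Rightarrow> complex"
  assumes [measurable]: "f \<in> borel_measurable borel" "g \<in> borel_measurable borel"
    and fi: "integrable lborel (\<lambda>x. f x * of_real (w x))" and gi: "integrable lborel (\<lambda>x. g x * of_real (w x))"
    and s: "s = 1 \<or> s = - 1"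
  shows "(LINT x|lborel. f x * (LINT \<xi>|lborel. g \<xi> * kern (s *\<^sub>R x) \<xi> * of_real (w \<xi>)) * of_real (w x))
    = (LINT \<xi>|lborel. g \<xi> * (LINT x|lborel. f x * kern (s *\<^sub>R \<xi>) x * of_real (w x)) * of_real (w \<xi>))"
proof -
  let ?K = "\<lambda>x \<xi>. (f x * of_real (w x)) * (g \<xi> * of_real (w \<xi>)) * kern (s *\<^sub>R x) \<xi>"
  have "(LINT x|lborel. LINT \<xi>|lborel. ?K x \<xi>) = (LINT \<xi>|lborel. LINT x|lborel. ?K x \<xi>)"
  proof (rule fubini_product_bound)
    show "integrable lborel (\<lambda>x. norm (f x * of_real (w x)) * kern_sup)"
      by (intro integrable_mult_left integrable_norm fi)
    show "integrable lborel (\<lambda>x. norm (g x * of_real (w x)))" by (intro integrable_norm gi)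
    fix x \<xi>
    have "norm (?K x \<xi>) \<le> norm ((f x * of_real (w x)) * (g \<xi> * of_real (w \<xi>))) * kern_sup"
      by (rule norm_mult_kern) simp
    then show "norm (?K x \<xi>) \<le> norm (f x * of_real (w x)) * kern_sup * norm (g \<xi> * of_real (w \<xi>))"
      by (simp only: norm_mult mult_ac)
  qed measurable
  moreover have "(LINT \<xi>|lborel. ?K x \<xi>) = f x * (LINT \<xi>|lborel. g \<xi> * kern (s *\<^sub>R x) \<xi> * of_real (w \<xi>))
      * of_real (w x)" for x
  proof -
    have "(LINT \<xi>|lborel. ?K x \<xi>) = (LINT \<xi>|lborel. (f x * of_real (w x)) * (g \<xi> * kern (s *\<^sub>R x) \<xi> * of_real (w \<xi>)))"
      by (intro Bochner_Integration.integral_cong HOL.refl) (simp only: mult_ac)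
    also have "\<dots> = (f x * of_real (w x)) * (LINT \<xi>|lborel. g \<xi> * kern (s *\<^sub>R x) \<xi> * of_real (w \<xi>))"
      by (rule integral_mult_right_zero)
    finally show ?thesis by (simp only: mult_ac)
  qed
  moreover have "(LINT x|lborel. ?K x \<xi>) = g \<xi> * (LINT x|lborel. f x * kern (s *\<^sub>R \<xi>) x * of_real (w x))
      * of_real (w \<xi>)" for \<xi>
  proof -
    have "kern (s *\<^sub>R x) \<xi> = kern (s *\<^sub>R \<xi>) x" for x
      by (metis kern_commute kern_scaleR_left)
    then have "(LINT x|lborel. ?K x \<xi>)
        = (LINT x|lborel. (g \<xi> * of_real (w \<xi>)) * (f x * kern (s *\<^sub>R \<xi>) x * of_real (w x)))"
      by (intro Bochner_Integration.integral_cong HOL.refl) (simp only: mult_ac)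
    also have "\<dots> = (g \<xi> * of_real (w \<xi>)) * (LINT x|lborel. f x * kern (s *\<^sub>R \<xi>) x * of_real (w x))"
      by (rule integral_mult_right_zero)
    finally show ?thesis by (simp only: mult_ac)
  qed
  ultimately show ?thesis by simp
qed

text \<open>Inversion at the origin by an approximate identity: a Gaussian factor is inserted, moved
  onto \<phi> by Fubini, and flattened. One factor c_k comes from \<open>gauss_transform\<close>,
  the other from the integral of the limiting Gaussian.\<close>

lemma integral_ft:
  assumes \<phi>: "Sm \<phi>"
  shows "(LINT \<xi>|lborel. ft \<phi> \<xi> * of_real (w \<xi>)) = of_real (c\<^sub>k\<^sup>2) * \<phi> 0"
proof -
  have cont: "continuous_on UNIV \<phi>" using \<phi> by (rule Sm_continuous)
  have [measurable]: "\<phi> \<in> borel_measurable borel" using cont by (rule borel_measurable_continuous_onI)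
  obtain C where C0: "C \<ge> 0" and C: "\<And>x. norm (\<phi> x) * (1 + norm x) ^ 0 \<le> C * dec x"
    using rapid_dec[OF Sm_rapid[OF \<phi>]] by blast
  obtain D where D: "\<And>x. norm (ft \<phi> x) * (1 + norm x) ^ 0 \<le> D * dec x" using ft_dec[OF \<phi>] by blast
  have intphi: "integrable lborel (\<lambda>x. \<phi> x * of_real (w x))"
    by (rule integrable_dec_weight(1)[of _ C]) (use C in auto)
  have intft: "integrable lborel (\<lambda>x. ft \<phi> x * of_real (w x))"
    by (rule integrable_dec_weight(1)[of _ D]) (use D in auto)
  define e where "e n = 1 / real (Suc n)" for n
  have e: "e n > 0" "e \<longlonglongrightarrow> 0" for n unfolding e_def by (simp, real_asymp)
  \<comment> \<open>With this choice the transformed Gaussian, rescaled by \<open>e n\<close>,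
    becomes exp (-|x|^2 / 2) for every \<open>n\<close>, and all powers of \<open>e n\<close>
    cancel.\<close>
  define t where "t n = (e n)\<^sup>2 / 2" for n
  have t: "t n > 0" for n using e(1)[of n] by (simp add: t_def)
  define L where "L n = (LINT \<xi>|lborel. of_real (exp (- t n * (norm \<xi>)\<^sup>2)) * ft \<phi> \<xi> * of_real (w \<xi>))" for n
  have "L \<longlonglongrightarrow> (LINT \<xi>|lborel. 1 * ft \<phi> \<xi> * of_real (w \<xi>))"
    unfolding L_def[abs_def]
  proof (rule integral_dominated_convergence)
    show "integrable lborel (\<lambda>x. norm (ft \<phi> x * of_real (w x)))" by (intro integrable_norm intft)
    have tn: "t \<longlonglongrightarrow> 0" unfolding t_def[abs_def]
        using tendsto_divide[OF tendsto_power[OF e(2), of 2] tendsto_const, of 2] by simp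
    show "AE \<xi> in lborel. (\<lambda>n. of_real (exp (- t n * (norm \<xi>)\<^sup>2)) * ft \<phi> \<xi> * of_real (w \<xi>))
        \<longlonglongrightarrow> 1 * ft \<phi> \<xi> * of_real (w \<xi>)"
    proof (rule AE_I2)
      fix \<xi> :: "real^'n"
      have "(\<lambda>n. exp (- t n * (norm \<xi>)\<^sup>2)) \<longlonglongrightarrow> exp (- 0 * (norm \<xi>)\<^sup>2)"
        by (intro tendsto_exp tendsto_mult tendsto_minus tn tendsto_const)
      then have "(\<lambda>n. complex_of_real (exp (- t n * (norm \<xi>)\<^sup>2))) \<longlonglongrightarrow> of_real 1" by (intro tendsto_of_real) simp
      then show "(\<lambda>n. of_real (exp (- t n * (norm \<xi>)\<^sup>2)) * ft \<phi> \<xi> * of_real (w \<xi>)) \<longlonglongrightarrow> 1 * ft \<phi> \<xi> * of_real (w \<xi>)"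
        by (intro tendsto_mult tendsto_const) simp
    qed
    show "AE \<xi> in lborel. norm (of_real (exp (- t n * (norm \<xi>)\<^sup>2)) * ft \<phi> \<xi> * of_real (w \<xi>))
        \<le> norm (ft \<phi> \<xi> * of_real (w \<xi>))" for n
    proof (rule AE_I2)
      fix \<xi> :: "real^'n"
      have "norm (complex_of_real (exp (- t n * (norm \<xi>)\<^sup>2))) \<le> 1" using t[of n] by simp
      from mult_right_mono[OF this norm_ge_zero[of "ft \<phi> \<xi> * of_real (w \<xi>)"]]
      show "norm (of_real (exp (- t n * (norm \<xi>)\<^sup>2)) * ft \<phi> \<xi> * of_real (w \<xi>)) \<le> norm (ft \<phi> \<xi> * of_real (w \<xi>))"
        by (simp add: norm_mult mult_ac)
    qed
  qed measurable
  then have L1: "L \<longlonglongrightarrow> (LINT \<xi>|lborel. ft \<phi> \<xi> * of_real (w \<xi>))" by simp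
  have Leq: "L n = of_real c\<^sub>k * (LINT x|lborel. of_real (exp (- (1/2) * (norm x)\<^sup>2)) * \<phi> (e n *\<^sub>R x)
      * of_real (w x))" for n
  proof -
    have "L n = (LINT \<xi>|lborel. of_real (exp (- t n * (norm \<xi>)\<^sup>2)) * (LINT x|lborel. \<phi> x * kern ((-1) *\<^sub>R \<xi>) x
        * of_real (w x)) * of_real (w \<xi>))"
      by (simp add: L_def ft_def)
    also have "\<dots> = (LINT x|lborel. \<phi> x * (LINT \<xi>|lborel. of_real (exp (- t n * (norm \<xi>)\<^sup>2)) * kern ((-1) *\<^sub>R x) \<xi>
        * of_real (w \<xi>)) * of_real (w x))"
    proof (rule fubini_kern[symmetric])
      show "integrable lborel (\<lambda>x. complex_of_real (exp (- t n * (norm x)\<^sup>2)) * of_real (w x))"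
        using integrable_gauss_kern(2)[OF t, of n 0] by (simp add: kern_zero_left)
    qed (use intphi in auto)
    also have "\<dots> = (LINT x|lborel. \<phi> x * gauss_int (- x) (t n) * of_real (w x))"
      by (simp add: gauss_int_def)
    also have "\<dots> = (e n ^ CARD('n)) *\<^sub>R (LINT x|lborel. \<phi> (e n *\<^sub>R x) * gauss_int (- (e n *\<^sub>R x)) (t n)
        * of_real (w (e n *\<^sub>R x)))"
    proof (rule integral_lborel_scaleR[OF _ e(1)])
      show "(\<lambda>x. \<phi> x * gauss_int (- x) (t n) * complex_of_real (w x)) \<in> borel_measurable borel"
        unfolding gauss_transform[OF t] by measurable
    qed
    also have "\<dots> = (LINT x|lborel. (e n ^ CARD('n)) *\<^sub>R (\<phi> (e n *\<^sub>R x) * gauss_int (- (e n *\<^sub>R x)) (t n)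
        * of_real (w (e n *\<^sub>R x))))" by simp
    also have "\<dots> = (LINT x|lborel. of_real c\<^sub>k * (of_real (exp (- (1/2) * (norm x)\<^sup>2)) * \<phi> (e n *\<^sub>R x)
        * of_real (w x)))"
    proof (intro Bochner_Integration.integral_cong HOL.refl)
      fix x :: "real^'n"
      have en: "e n > 0" by (rule e)
      have "(2 * t n) powr - hdim = ((e n)\<^sup>2) powr - hdim" by (simp add: t_def)
      also have "\<dots> = e n powr - (2 * hdim)" using en by (simp add: powr_powr flip: powr_numeral)
      finally have 1: "(2 * t n) powr - hdim * e n powr (2 * hdim) = 1" using en by (simp flip: powr_add)
      have 2: "- (norm (- (e n *\<^sub>R x)))\<^sup>2 / (4 * t n) = - (1/2) * (norm x)\<^sup>2"
        using en by (simp add: t_def power_mult_distrib field_simps)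
      have "(e n ^ CARD('n)) *\<^sub>R (\<phi> (e n *\<^sub>R x) * gauss_int (- (e n *\<^sub>R x)) (t n) * of_real (w (e n *\<^sub>R x)))
        = of_real (e n ^ CARD('n) * w (e n *\<^sub>R x)) * (\<phi> (e n *\<^sub>R x) * gauss_int (- (e n *\<^sub>R x)) (t n))"
        by (simp add: scaleR_conv_of_real)
      also have "\<dots> = of_real (c\<^sub>k * ((2 * t n) powr - hdim * e n powr (2 * hdim)) * exp (- (1/2) * (norm x)\<^sup>2) * w x)
          * \<phi> (e n *\<^sub>R x)"
        unfolding weight_scaling[OF en] gauss_transform[OF t] 2 by simp
      finally show "(e n ^ CARD('n)) *\<^sub>R (\<phi> (e n *\<^sub>R x) * gauss_int (- (e n *\<^sub>R x)) (t n) * of_real (w (e n *\<^sub>R x)))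
        = of_real c\<^sub>k * (of_real (exp (- (1/2) * (norm x)\<^sup>2)) * \<phi> (e n *\<^sub>R x) * of_real (w x))"
        unfolding 1 by simp
    qed
    finally show ?thesis by simp
  qed
  have "(\<lambda>n. LINT x|lborel. of_real (exp (- (1/2) * (norm x)\<^sup>2)) * \<phi> (e n *\<^sub>R x) * of_real (w x))
      \<longlonglongrightarrow> (LINT x|lborel. of_real (exp (- (1/2) * (norm x)\<^sup>2)) * \<phi> 0 * of_real (w x))"
  proof (rule integral_dominated_convergence)
    show "integrable lborel (\<lambda>x. C * (exp (- (1/2) * (norm x)\<^sup>2) * w x))"
      by (intro integrable_mult_right integrable_gauss_weight) simp
    show "AE x in lborel. (\<lambda>n. of_real (exp (- (1/2) * (norm x)\<^sup>2)) * \<phi> (e n *\<^sub>R x) * complex_of_real (w x))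
      \<longlonglongrightarrow> of_real (exp (- (1/2) * (norm x)\<^sup>2)) * \<phi> 0 * of_real (w x)"
    proof (rule AE_I2)
      fix x :: "real^'n"
      have "(\<lambda>n. e n *\<^sub>R x) \<longlonglongrightarrow> 0 *\<^sub>R x" by (intro tendsto_scaleR e tendsto_const)
      then have "(\<lambda>n. \<phi> (e n *\<^sub>R x)) \<longlonglongrightarrow> \<phi> 0" using continuous_on_tendsto_compose[OF cont] by simp
      then show "(\<lambda>n. of_real (exp (- (1/2) * (norm x)\<^sup>2)) * \<phi> (e n *\<^sub>R x) * complex_of_real (w x))
        \<longlonglongrightarrow> of_real (exp (- (1/2) * (norm x)\<^sup>2)) * \<phi> 0 * of_real (w x)" by (intro tendsto_mult tendsto_const)
    qed
    show "AE x in lborel. norm (of_real (exp (- (1/2) * (norm x)\<^sup>2)) * \<phi> (e n *\<^sub>R x) * complex_of_real (w x))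
      \<le> C * (exp (- (1/2) * (norm x)\<^sup>2) * w x)" for n
    proof (rule AE_I2)
      fix x :: "real^'n"
      have "norm (\<phi> (e n *\<^sub>R x)) \<le> C * 1" using C[of "e n *\<^sub>R x"] mult_left_mono[OF dec_le_1[of "e n *\<^sub>R x"] C0]
          by simp
      then have "norm (\<phi> (e n *\<^sub>R x)) * (exp (- (1/2) * (norm x)\<^sup>2) * w x) \<le> C * (exp (- (1/2) * (norm x)\<^sup>2) * w x)"
        using weight_nonneg[of x] by (intro mult_right_mono) auto
      then show "norm (of_real (exp (- (1/2) * (norm x)\<^sup>2)) * \<phi> (e n *\<^sub>R x) * complex_of_real (w x))
        \<le> C * (exp (- (1/2) * (norm x)\<^sup>2) * w x)"
        by (simp add: norm_mult weight_nonneg mult_ac)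
    qed
  qed measurable
  also have "(LINT x|lborel. of_real (exp (- (1/2) * (norm x)\<^sup>2)) * \<phi> 0 * complex_of_real (w x)) = of_real c\<^sub>k * \<phi> 0"
  proof -
    have "(LINT x|lborel. of_real (exp (- (1/2) * (norm x)\<^sup>2)) * \<phi> 0 * complex_of_real (w x))
       = (LINT x|lborel. complex_of_real (exp (- (1/2) * (norm x)\<^sup>2) * w x) * \<phi> 0)"
      by (intro Bochner_Integration.integral_cong) auto
    also have "\<dots> = of_real c\<^sub>k * \<phi> 0" unfolding dunkl_c_eq
        by (simp only: integral_mult_left_zero integral_complex_of_real)
    finally show ?thesis .
  qed
  finally have "L \<longlonglongrightarrow> of_real c\<^sub>k * (of_real c\<^sub>k * \<phi> 0)"
    unfolding Leq[abs_def] by (intro tendsto_mult tendsto_const)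
  with L1 have "(LINT \<xi>|lborel. ft \<phi> \<xi> * of_real (w \<xi>)) = of_real c\<^sub>k * (of_real c\<^sub>k * \<phi> 0)" by (rule LIMSEQ_unique)
  then show ?thesis by (simp add: power2_eq_square)
qed

end

section \<open>Mixtures of Gaussians\<close>

text \<open>The Gamma integral after the substitution of a exp u, which turns the density t powr (s
  - 1) on the half-line into an integral over the whole line. The variant with -u below fits the
  Fourier side, where the Gaussian has the reciprocal parameter.\<close>

lemma gamma_exp_integral:
  fixes s a :: real
  assumes s: "s > 0" and a: "a > 0"
  shows "integrable lborel (\<lambda>u. exp (s * u) * exp (- a * exp u))"
    and "(LINT u|lborel. exp (s * u) * exp (- a * exp u)) = Gamma s * a powr - s"
proof -
  let ?f = "\<lambda>t. t powr (s - 1) / exp t"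
  have hi: "(?f has_integral Gamma s) {0<..}"
  proof -
    have "((\<lambda>t. if t \<in> {0<..} then ?f t else 0) has_integral Gamma s) {0..}"
      by (rule has_integral_spike[OF _ _ Gamma_integral_real[OF s], of "{0}"]) auto
    then show ?thesis by (subst (asm) has_integral_restrict) auto
  qed
  then have "?f absolutely_integrable_on {0<..}"
    by (intro nonnegative_absolutely_integrable_1) (auto simp: integrable_on_def)
  moreover have img: "(\<lambda>u. a * exp u) ` UNIV = {0<..}"
  proof (intro equalityI subsetI)
    fix t :: real assume "t \<in> {0<..}"
    then have "t = a * exp (ln (t / a))" using a by simp
    then show "t \<in> range (\<lambda>u. a * exp u)" by blast
  qed (use a in auto)
  ultimately have *: "(\<lambda>u. \<bar>a * exp u\<bar> * ?f (a * exp u)) absolutely_integrable_on UNIV \<and>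
     integral UNIV (\<lambda>u. \<bar>a * exp u\<bar> * ?f (a * exp u)) = Gamma s"
    using hi a by (subst has_absolute_integral_change_of_variables_1')
      (auto intro!: derivative_eq_intros inj_onI simp: integral_unique)
  have eq: "\<bar>a * exp u\<bar> * ?f (a * exp u) = a powr s * (exp (s * u) * exp (- a * exp u))" for u
  proof -
    have "\<bar>a * exp u\<bar> * (a * exp u) powr (s - 1) = (a * exp u) powr s"
      using a by (simp add: powr_diff)
    also have "\<dots> = a powr s * exp (s * u)" using a by (simp add: powr_mult exp_powr_real mult.commute)
    finally show ?thesis by (simp add: exp_minus divide_inverse mult.assoc)
  qed
  have "integrable lborel (\<lambda>u. a powr s * (exp (s * u) * exp (- a * exp u)))"
    using * unfolding eq set_integrable_def by (simp add: integrable_completion)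
  then show int: "integrable lborel (\<lambda>u. exp (s * u) * exp (- a * exp u))" using a by simp
  have "a powr s * (LINT u|lborel. exp (s * u) * exp (- a * exp u)) = Gamma s"
    using * integral_lborel[OF \<open>integrable lborel (\<lambda>u. a powr s * (exp (s * u) * exp (- a * exp u)))\<close>]
    unfolding eq by simp
  then show "(LINT u|lborel. exp (s * u) * exp (- a * exp u)) = Gamma s * a powr - s"
    using a by (simp add: powr_minus field_simps)
qed

lemma gamma_exp_integral_minus:
  fixes s a :: real
  assumes "s > 0" "a > 0"
  shows "integrable lborel (\<lambda>u. exp (- s * u) * exp (- a * exp (- u)))"
    and "(LINT u|lborel. exp (- s * u) * exp (- a * exp (- u))) = Gamma s * a powr - s"
proof -
  let ?f = "\<lambda>u. exp (s * u) * exp (- a * exp u)"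
  have f: "?f (0 + - 1 * u) = exp (- s * u) * exp (- a * exp (- u))" for u by simp
  show "integrable lborel (\<lambda>u. exp (- s * u) * exp (- a * exp (- u)))"
    using lborel_integrable_real_affine[OF gamma_exp_integral(1)[OF assms], of "- 1" 0] unfolding f by simp
  show "(LINT u|lborel. exp (- s * u) * exp (- a * exp (- u))) = Gamma s * a powr - s"
    using lborel_integral_real_affine[of "- 1" ?f 0] gamma_exp_integral(2)[OF assms] unfolding f by simp
qed

text \<open>The mixing weights are nonnegative, so absolute convergence of the double integral is
  precisely the integrability of Q f; no bound on the mixture is required separately.\<close>

lemma fubini_mixture:
  fixes f :: "real^'n \<Rightarrow> complex" and q :: "real^'n \<Rightarrow> real \<Rightarrow> real"
  assumes [measurable]: "case_prod q \<in> borel_measurable (borel \<Otimes>\<^sub>M borel)" "f \<in> borel_measurable borel"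
    and nonneg: "\<And>x u. q x u \<ge> 0"
    and q: "AE x in lborel. integrable lborel (q x) \<and> (LINT u|lborel. q x u) = Q x"
    and int: "integrable lborel (\<lambda>x. of_real (Q x) * f x)"
  shows "(LINT x|lborel. of_real (Q x) * f x) = (LINT u|lborel. LINT x|lborel. of_real (q x u) * f x)"
proof -
  let ?K = "\<lambda>x u. complex_of_real (q x u) * f x"
  have [measurable]: "q x \<in> borel_measurable borel" for x
    using measurable_compose[OF measurable_Pair1' assms(1)] by simp
  have K [measurable]: "case_prod ?K \<in> borel_measurable (lborel \<Otimes>\<^sub>M lborel)"
  proof -
    have [measurable]: "(\<lambda>p. q (fst p) (snd p)) \<in> borel_measurable (borel \<Otimes>\<^sub>M borel)"
      using assms(1) by (simp add: case_prod_beta')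
    have "(\<lambda>p. ?K (fst p) (snd p)) \<in> borel_measurable (borel \<Otimes>\<^sub>M borel)" by measurable
    then show ?thesis by (simp add: case_prod_beta')
  qed
  have "integrable (lborel \<Otimes>\<^sub>M lborel) (case_prod ?K)"
  proof (rule lborel_pair.Fubini_integrable[OF K])
    show "AE x in lborel. integrable lborel (\<lambda>u. case (x, u) of (x, u) \<Rightarrow> ?K x u)"
      using q by eventually_elim auto
    have "AE x in lborel. norm (of_real (Q x) * f x) = (LINT u|lborel. norm (case (x, u) of (x, u) \<Rightarrow> ?K x u))"
      using q
    proof eventually_elim
      case (elim x)
      have "Q x \<ge> 0" using elim nonneg by (auto intro!: integral_nonneg_AE simp flip: conjunct2[OF elim])
      then show ?case using elim nonneg by (simp add: norm_mult)
    qed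
    then show "integrable lborel (\<lambda>x. LINT u|lborel. norm (case (x, u) of (x, u) \<Rightarrow> ?K x u))"
      by (rule integrable_cong_AE_imp[OF integrable_norm[OF int], rotated]) measurable
  qed
  from lborel_pair.Fubini_integral[OF this]
  have "(LINT u|lborel. LINT x|lborel. ?K x u) = (LINT x|lborel. LINT u|lborel. ?K x u)" by simp
  also have "\<dots> = (LINT x|lborel. of_real (Q x) * f x)"
  proof (rule integral_cong_AE)
    show "AE x in lborel. (LINT u|lborel. ?K x u) = of_real (Q x) * f x"
      using q by eventually_elim simp
    show "(\<lambda>x. LINT u|lborel. ?K x u) \<in> borel_measurable lborel"
      using lborel.borel_measurable_lebesgue_integral[OF K] by simp
  qed (use int in \<open>auto simp: borel_measurable_integrable\<close>)
  finally show ?thesis by simp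
qed

lemma AE_lborel_nonzero: "AE x::real^'n in lborel. x \<noteq> 0"
  using AE_lborel_component_nonzero by eventually_elim auto

section \<open>Decay of the fractional Dunkl Laplacian\<close>

locale dunkl_riesz = dunkl R Rp k for R Rp :: "(real^'n) set" and k +
  fixes \<alpha> :: real
  assumes dim: "CARD('n) \<ge> 2" and alpha_pos: "0 < \<alpha>" and alpha_less: "\<alpha> < 2"
begin

text \<open>A majorant for the regularised symbol and its derivatives up to powers of 1 + |\<xi>|;
  the coefficients 3 and 2 are those of \<open>reg2_le\<close>.\<close>

definition sing :: "real^'n \<Rightarrow> real" where
  "sing \<xi> = 3 * norm \<xi> powr (\<alpha> - 2) + 2"

lemma sing_pos: "sing \<xi> > 0" by (simp add: sing_def add_nonneg_pos)

text \<open>Here the dimension enters: the singularity has order 2 - \<alpha>, which is below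
  \<open>d\<close> because d \<ge> 2 and \<alpha> > 0.\<close>

lemma integrable_sing: "integrable lborel (\<lambda>\<xi>. sing \<xi> * (w \<xi> * dec \<xi>))"
proof -
  have "integrable lborel (\<lambda>\<xi>. norm \<xi> powr (\<alpha> - 2) * (w \<xi> * dec \<xi>))"
  proof (rule Bochner_Integration.integrable_bound)
    show "integrable lborel (\<lambda>\<xi>::real^'n. wC * (norm \<xi> powr - (2 - \<alpha>) * (1 + norm \<xi>) powr - real (2 * CARD('n))))"
      using dim alpha_pos alpha_less by (intro integrable_mult_right integrable_radial) auto
    have "norm (norm \<xi> powr (\<alpha> - 2) * (w \<xi> * dec \<xi>))
      \<le> norm (wC * (norm \<xi> powr - (2 - \<alpha>) * (1 + norm \<xi>) powr - real (2 * CARD('n))))" for \<xi>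
    proof -
      have p: "1 + norm \<xi> > 0" by (simp add: add_pos_nonneg)
      have "w \<xi> * dec \<xi> \<le> (wC * (1 + norm \<xi>) ^ wdeg) * dec \<xi>"
        using dec_pos[of \<xi>] by (intro mult_right_mono weight_le) auto
      also have "\<dots> = wC * (1 + norm \<xi>) powr - real (2 * CARD('n))"
        using p by (simp add: dec_def power_add powr_minus powr_realpow divide_inverse del: of_nat_mult)
      finally have "norm \<xi> powr (\<alpha> - 2) * (w \<xi> * dec \<xi>)
          \<le> norm \<xi> powr (\<alpha> - 2) * (wC * (1 + norm \<xi>) powr - real (2 * CARD('n)))"
        by (intro mult_left_mono) auto
      moreover have "0 \<le> norm \<xi> powr (\<alpha> - 2) * (w \<xi> * dec \<xi>)"
        using weight_nonneg[of \<xi>] dec_pos[of \<xi>] by simp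
      ultimately show ?thesis by (simp add: mult_ac)
    qed
    then show "AE \<xi> in lborel. norm (norm \<xi> powr (\<alpha> - 2) * (w \<xi> * dec \<xi>))
      \<le> norm (wC * (norm \<xi> powr - (2 - \<alpha>) * (1 + norm \<xi>) powr - real (2 * CARD('n))))" by (rule AE_I2)
  qed measurable
  then have "integrable lborel (\<lambda>\<xi>. 3 * (norm \<xi> powr (\<alpha> - 2) * (w \<xi> * dec \<xi>)) + 2 * (w \<xi> * dec \<xi>))"
    by (intro Bochner_Integration.integrable_add integrable_mult_right integrable_weight_dec)
  then show ?thesis by (simp add: sing_def distrib_right mult.assoc)
qed

definition sing_int :: real where "sing_int = (LINT \<xi>|lborel. sing \<xi> * (w \<xi> * dec \<xi>))"

text \<open>The bound sees \<open>g\<close> only through \<kappa> and \<open>K\<close> only through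
  \<open>kern_sup\<close>; it is therefore uniform in the regularisation and in the point at which
  the transform is evaluated.\<close>

lemma sing_bound:
  fixes g F K :: "real^'n \<Rightarrow> complex"
  assumes [measurable]: "g \<in> borel_measurable borel" "F \<in> borel_measurable borel" "K \<in> borel_measurable borel"
    and g: "\<And>\<xi>. \<xi> \<noteq> 0 \<Longrightarrow> norm (g \<xi>) \<le> \<kappa> * (sing \<xi> * (1 + norm \<xi>) ^ 5)"
    and F: "\<And>\<xi>. norm (F \<xi>) * (1 + norm \<xi>) ^ 5 \<le> C * dec \<xi>"
    and K: "\<And>\<xi>. norm (K \<xi>) \<le> kern_sup" and "\<kappa> \<ge> 0"
  shows "norm (LINT \<xi>|lborel. g \<xi> * K \<xi> * F \<xi> * of_real (w \<xi>)) \<le> \<kappa> * kern_sup * C * sing_int"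
    and "integrable lborel (\<lambda>\<xi>. g \<xi> * K \<xi> * F \<xi> * of_real (w \<xi>))"
proof -
  have le: "AE \<xi> in lborel. norm (g \<xi> * K \<xi> * F \<xi> * of_real (w \<xi>)) \<le> \<kappa> * kern_sup * C * (sing \<xi> * (w \<xi> * dec \<xi>))"
    using AE_lborel_nonzero
  proof eventually_elim
    case (elim \<xi>)
    have "norm (g \<xi>) * norm (K \<xi>) * norm (F \<xi>) * w \<xi>
      \<le> (\<kappa> * (sing \<xi> * (1 + norm \<xi>) ^ 5)) * kern_sup * norm (F \<xi>) * w \<xi>"
      using g[OF elim] K[of \<xi>] assms(7) sing_pos[of \<xi>] weight_nonneg[of \<xi>]
      by (intro mult_right_mono mult_mono) auto
    also have "\<dots> = \<kappa> * kern_sup * sing \<xi> * w \<xi> * (norm (F \<xi>) * (1 + norm \<xi>) ^ 5)" by (simp only: mult_ac)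
    also have "\<dots> \<le> \<kappa> * kern_sup * sing \<xi> * w \<xi> * (C * dec \<xi>)"
      using assms(7) kern_sup_nonneg sing_pos[of \<xi>] weight_nonneg[of \<xi>] by (intro mult_left_mono F) auto
    also have "\<dots> = \<kappa> * kern_sup * C * (sing \<xi> * (w \<xi> * dec \<xi>))" by (simp only: mult_ac)
    finally show ?case using weight_nonneg[of \<xi>] by (simp only: norm_mult norm_of_real abs_of_nonneg)
  qed
  have base: "integrable lborel (\<lambda>\<xi>. \<kappa> * kern_sup * C * (sing \<xi> * (w \<xi> * dec \<xi>)))"
    by (intro integrable_mult_right integrable_sing)
  show int: "integrable lborel (\<lambda>\<xi>. g \<xi> * K \<xi> * F \<xi> * of_real (w \<xi>))"
  proof (rule Bochner_Integration.integrable_bound[OF base])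
    show "AE \<xi> in lborel. norm (g \<xi> * K \<xi> * F \<xi> * of_real (w \<xi>)) \<le> norm (\<kappa> * kern_sup * C * (sing \<xi> * (w \<xi> * dec \<xi>)))"
      using le by eventually_elim simp
  qed measurable
  show "norm (LINT \<xi>|lborel. g \<xi> * K \<xi> * F \<xi> * of_real (w \<xi>)) \<le> \<kappa> * kern_sup * C * sing_int"
    using order_trans[OF integral_norm_bound integral_mono_AE[OF integrable_norm[OF int] base le]]
    unfolding integral_mult_right_zero sing_int_def .
qed

text \<open>\<open>reg0\<close> regularises \<open>r \<mapsto> r powr (\<alpha> / 2)\<close> at \<open>0\<close> and at infinity.\<close>

definition reg0 :: "real \<Rightarrow> real \<Rightarrow> real" where
  "reg0 \<epsilon> r = (\<epsilon> + r) powr (\<alpha> / 2) * exp (- \<epsilon> * r)"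
text \<open>The bracket L = \<alpha> / 2 / (\<epsilon> + r) - \<epsilon> is the logarithmic
  derivative of \<open>reg0\<close>. Accordingly the derivatives are L and L^2 + L' times
  \<open>reg0\<close>, which makes them easy to compare with it.\<close>

definition reg1 :: "real \<Rightarrow> real \<Rightarrow> real" where
  "reg1 \<epsilon> r = (\<alpha> / 2 / (\<epsilon> + r) - \<epsilon>) * reg0 \<epsilon> r"
definition reg2 :: "real \<Rightarrow> real \<Rightarrow> real" where
  "reg2 \<epsilon> r = ((\<alpha> / 2 / (\<epsilon> + r) - \<epsilon>)\<^sup>2 - \<alpha> / 2 / (\<epsilon> + r)\<^sup>2) * reg0 \<epsilon> r"

lemma reg0_deriv:
  assumes "\<epsilon> > 0" "r \<ge> 0" shows "(reg0 \<epsilon> has_real_derivative reg1 \<epsilon> r) (at r)"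
proof -
  have p: "\<epsilon> + r > 0" using assms by simp
  have "((\<lambda>r. (\<epsilon> + r) powr (\<alpha> / 2)) has_real_derivative \<alpha> / 2 * (\<epsilon> + r) powr (\<alpha> / 2 - 1)) (at r)"
    using p by (auto intro!: derivative_eq_intros)
  moreover have "((\<lambda>r. exp (- \<epsilon> * r)) has_real_derivative - \<epsilon> * exp (- \<epsilon> * r)) (at r)"
    by (auto intro!: derivative_eq_intros)
  ultimately have d: "(reg0 \<epsilon> has_real_derivative \<alpha> / 2 * (\<epsilon> + r) powr (\<alpha> / 2 - 1) * exp (- \<epsilon> * r)
      + - \<epsilon> * exp (- \<epsilon> * r) * (\<epsilon> + r) powr (\<alpha> / 2)) (at r)"
    unfolding reg0_def[abs_def] by (rule DERIV_mult)
  have q: "(\<epsilon> + r) powr (\<alpha> / 2 - 1) = (\<epsilon> + r) powr (\<alpha> / 2) / (\<epsilon> + r)" using p by (simp add: powr_diff)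
  have "\<alpha> / 2 * (\<epsilon> + r) powr (\<alpha> / 2 - 1) * exp (- \<epsilon> * r)
      + - \<epsilon> * exp (- \<epsilon> * r) * (\<epsilon> + r) powr (\<alpha> / 2) = reg1 \<epsilon> r"
    unfolding q reg1_def reg0_def by (simp add: algebra_simps)
  with d show ?thesis by simp
qed

lemma reg1_deriv:
  assumes "\<epsilon> > 0" "r \<ge> 0" shows "(reg1 \<epsilon> has_real_derivative reg2 \<epsilon> r) (at r)"
proof -
  have ne: "\<epsilon> + r \<noteq> 0" using assms by simp
  have "((\<lambda>r. \<alpha> / 2 / (\<epsilon> + r) - \<epsilon>) has_real_derivative - (\<alpha> / 2 / (\<epsilon> + r)\<^sup>2)) (at r)"
  proof -
    define c where "c = \<alpha> / 2"
    have "((\<lambda>r. c / (\<epsilon> + r) - \<epsilon>) has_real_derivative - (c / (\<epsilon> + r)\<^sup>2)) (at r)"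
      using ne by (auto intro!: derivative_eq_intros simp: power2_eq_square)
    then show ?thesis by (simp only: c_def)
  qed
  from DERIV_mult[OF this reg0_deriv[OF assms]]
  have "(reg1 \<epsilon> has_real_derivative - (\<alpha> / 2 / (\<epsilon> + r)\<^sup>2) * reg0 \<epsilon> r + reg1 \<epsilon> r * (\<alpha> / 2 / (\<epsilon> + r) - \<epsilon>)) (at r)"
    by (simp add: reg1_def[abs_def])
  moreover have "- (\<alpha> / 2 / (\<epsilon> + r)\<^sup>2) * reg0 \<epsilon> r + reg1 \<epsilon> r * (\<alpha> / 2 / (\<epsilon> + r) - \<epsilon>) = reg2 \<epsilon> r"
  proof -
    have "- e * g + (c * g) * c = (c\<^sup>2 - e) * g" for e g c :: real by (simp add: power2_eq_square algebra_simps)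
    then show ?thesis unfolding reg1_def reg2_def .
  qed
  ultimately show ?thesis by simp
qed

lemma reg_continuous: "\<epsilon> > 0 \<Longrightarrow> continuous_on {0..} (reg2 \<epsilon>)"
  unfolding reg2_def[abs_def] reg0_def
  by (intro continuous_intros) auto

section \<open>Estimates for the regularised symbol\<close>

lemma reg0_nonneg: "reg0 \<epsilon> r \<ge> 0"
  by (simp add: reg0_def)

lemma powr_half_le:
  fixes x :: "real^'n"
  assumes "0 < \<epsilon>" "\<epsilon> \<le> 1" shows "(\<epsilon> + (norm x)\<^sup>2) powr (\<alpha> / 2) \<le> (1 + norm x)\<^sup>2"
proof -
  have "(\<epsilon> + (norm x)\<^sup>2) powr (\<alpha> / 2) \<le> (1 + (norm x)\<^sup>2) powr (\<alpha> / 2)"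
    using assms alpha_pos by (intro powr_mono2) auto
  also have "\<dots> \<le> (1 + (norm x)\<^sup>2) powr 1" using alpha_less by (intro powr_mono) auto
  also have "\<dots> \<le> (1 + norm x)\<^sup>2" by (simp add: power2_sum abs_of_nonneg add_nonneg_nonneg)
  finally show ?thesis .
qed

lemma reg0_le:
  fixes x :: "real^'n"
  assumes "0 < \<epsilon>" "\<epsilon> \<le> 1" shows "reg0 \<epsilon> ((norm x)\<^sup>2) \<le> (1 + norm x)\<^sup>2"
proof -
  have "reg0 \<epsilon> ((norm x)\<^sup>2) \<le> (1 + norm x)\<^sup>2 * 1"
    unfolding reg0_def using assms by (intro mult_mono powr_half_le) auto
  then show ?thesis by simp
qed

text \<open>The exponent \<alpha> / 2 - 1 is negative, so dropping \<epsilon> inside the power only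
  enlarges it, and the exponential is at most 1. The result is free of \<epsilon>.\<close>

lemma reg_sing:
  fixes x :: "real^'n"
  assumes e: "0 < \<epsilon>" "\<epsilon> \<le> 1" and x: "x \<noteq> 0"
  shows "reg0 \<epsilon> ((norm x)\<^sup>2) / (\<epsilon> + (norm x)\<^sup>2) \<le> norm x powr (\<alpha> - 2)"
proof -
  let ?r = "(norm x)\<^sup>2"
  have r: "?r > 0" using x by simp
  have "reg0 \<epsilon> ?r / (\<epsilon> + ?r) = (\<epsilon> + ?r) powr (\<alpha> / 2 - 1) * exp (- \<epsilon> * ?r)"
    unfolding reg0_def using e r by (simp add: powr_diff)
  also have "\<dots> \<le> ?r powr (\<alpha> / 2 - 1) * 1"
    using e r alpha_less by (intro mult_mono powr_mono2') auto
  also have "\<dots> = norm x powr (\<alpha> - 2)"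
    using x by (simp add: powr_powr right_diff_distrib flip: powr_numeral)
  finally show ?thesis .
qed

lemma reg1_le:
  fixes x :: "real^'n"
  assumes e: "0 < \<epsilon>" "\<epsilon> \<le> 1"
  shows "\<bar>reg1 \<epsilon> ((norm x)\<^sup>2)\<bar> \<le> reg0 \<epsilon> ((norm x)\<^sup>2) / (\<epsilon> + (norm x)\<^sup>2) + reg0 \<epsilon> ((norm x)\<^sup>2)"
proof -
  let ?r = "(norm x)\<^sup>2" let ?q = "\<epsilon> + (norm x)\<^sup>2"
  have q: "?q > 0" using e by (simp add: add_pos_nonneg)
  have "\<alpha> / 2 / ?q \<le> 1 / ?q" using q alpha_less by (intro divide_right_mono) auto
  moreover have "0 \<le> \<alpha> / 2 / ?q" using q alpha_pos by auto
  ultimately have "\<bar>\<alpha> / 2 / ?q - \<epsilon>\<bar> \<le> 1 / ?q + 1" using e by linarith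
  then have "\<bar>\<alpha> / 2 / ?q - \<epsilon>\<bar> * reg0 \<epsilon> ?r \<le> (1 / ?q + 1) * reg0 \<epsilon> ?r" by (intro mult_right_mono reg0_nonneg)
  then show ?thesis unfolding reg1_def by (simp add: abs_mult reg0_nonneg distrib_right)
qed

text \<open>With q = \<epsilon> + |x|^2, the square of the logarithmic derivative is at most 2 / q^2
  + 2 and its derivative at most 1 / q^2. The factor |x|^2 turns one 1 / q into a constant.\<close>

lemma reg2_le:
  fixes x :: "real^'n"
  assumes e: "0 < \<epsilon>" "\<epsilon> \<le> 1"
  shows "(norm x)\<^sup>2 * \<bar>reg2 \<epsilon> ((norm x)\<^sup>2)\<bar> \<le> 3 * (reg0 \<epsilon> ((norm x)\<^sup>2) / (\<epsilon> + (norm x)\<^sup>2)) + 2 * (norm x)\<^sup>2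
      * reg0 \<epsilon> ((norm x)\<^sup>2)"
proof -
  let ?r = "(norm x)\<^sup>2" let ?q = "\<epsilon> + (norm x)\<^sup>2"
  have q: "?q > 0" "?r \<le> ?q" using e by (auto simp: add_pos_nonneg)
  define a where "a = \<alpha> / 2 / ?q"
  have a: "0 \<le> a" using q alpha_pos by (simp add: a_def)
  have aq: "a \<le> 1 / ?q" using q alpha_less unfolding a_def by (intro divide_right_mono) auto
  have "(a - \<epsilon>)\<^sup>2 \<le> 2 * a\<^sup>2 + 2 * \<epsilon>\<^sup>2"
    using zero_le_power2[of "a + \<epsilon>"] by (simp add: power2_diff power2_sum)
  moreover have "a\<^sup>2 \<le> (1 / ?q)\<^sup>2" using a aq by (intro power_mono)
  moreover have "\<epsilon>\<^sup>2 \<le> 1" using e by (simp add: power_le_one)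
  ultimately have "(a - \<epsilon>)\<^sup>2 \<le> 2 * (1 / ?q)\<^sup>2 + 2" by linarith
  moreover have "\<alpha> / 2 / ?q\<^sup>2 \<le> 1 / ?q\<^sup>2" using alpha_less by (intro divide_right_mono) auto
  then have "\<alpha> / 2 / ?q\<^sup>2 \<le> (1 / ?q)\<^sup>2" by (simp only: power_one_over)
  moreover have "0 \<le> \<alpha> / 2 / ?q\<^sup>2" using alpha_pos by simp
  ultimately have "\<bar>(a - \<epsilon>)\<^sup>2 - \<alpha> / 2 / ?q\<^sup>2\<bar> \<le> 3 * (1 / ?q)\<^sup>2 + 2"
    using zero_le_power2[of "a - \<epsilon>"] by linarith
  then have "?r * \<bar>(a - \<epsilon>)\<^sup>2 - \<alpha> / 2 / ?q\<^sup>2\<bar> \<le> ?r * (3 * (1 / ?q)\<^sup>2 + 2)" by (intro mult_left_mono) auto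
  also have "\<dots> \<le> 3 * (1 / ?q) + 2 * ?r"
  proof -
    have "?r * (1 / ?q)\<^sup>2 \<le> ?q * (1 / ?q)\<^sup>2" using q by (intro mult_right_mono) auto
    also have "\<dots> = 1 / ?q" using q by (simp add: power2_eq_square)
    finally show ?thesis by (simp add: distrib_left)
  qed
  finally have "?r * \<bar>(a - \<epsilon>)\<^sup>2 - \<alpha> / 2 / ?q\<^sup>2\<bar> * reg0 \<epsilon> ?r \<le> (3 * (1 / ?q) + 2 * ?r) * reg0 \<epsilon> ?r"
    by (intro mult_right_mono reg0_nonneg)
  then show ?thesis
    unfolding reg2_def a_def[symmetric] by (simp add: abs_mult reg0_nonneg distrib_right mult.assoc)
qed

text \<open>This is for fixed \<epsilon> and only justifies the integration by parts; the constant
  blows up as \<epsilon> tends to 0. The uniform counterpart is \<open>reg_bounds\<close>.\<close>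

lemma reg_dec:
  assumes e: "0 < \<epsilon>" "\<epsilon> \<le> 1"
  shows "\<exists>C\<ge>0. \<forall>x::real^'n. \<bar>reg0 \<epsilon> ((norm x)\<^sup>2)\<bar> \<le> C * dec x \<and>
    (1 + norm x) * \<bar>reg1 \<epsilon> ((norm x)\<^sup>2)\<bar> \<le> C * dec x \<and> (norm x)\<^sup>2 * \<bar>reg2 \<epsilon> ((norm x)\<^sup>2)\<bar> \<le> C * dec x"
proof -
  obtain C0 where C0: "C0 \<ge> 0" "\<And>x::real^'n. exp (- \<epsilon> * (norm x)\<^sup>2) * (1 + norm x) ^ 4 \<le> C0 * dec x"
    using gauss_dec[OF e(1)] by blast
  define K where "K = 3 / \<epsilon> + 2"
  have K: "1 \<le> K" "1 / \<epsilon> + 1 \<le> K" "3 / \<epsilon> + 2 \<le> K" 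
  proof -
    have "0 \<le> 1 / \<epsilon>" "3 / \<epsilon> = 3 * (1 / \<epsilon>)" using e by auto
    then show "1 \<le> K" "1 / \<epsilon> + 1 \<le> K" "3 / \<epsilon> + 2 \<le> K" unfolding K_def by linarith+
  qed
  show ?thesis
  proof (intro exI[of _ "K * C0"] conjI allI)
    show "0 \<le> K * C0" using K C0 by simp
    fix x :: "real^'n"
    let ?r = "(norm x)\<^sup>2" let ?s = "1 + norm x" let ?E = "exp (- \<epsilon> * (norm x)\<^sup>2)"
    have s: "?s \<ge> 1" by simp
    have fin: "u \<le> K * C0 * dec x" if "u \<le> K * (?E * ?s ^ 4)" for u
    proof -
      have "K * (?E * ?s ^ 4) \<le> K * (C0 * dec x)" using K(1) by (intro mult_left_mono C0) simp
      from order_trans[OF that this] show ?thesis by (simp only: mult.assoc)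
    qed
    have g: "reg0 \<epsilon> ?r \<le> ?s\<^sup>2 * ?E" unfolding reg0_def using powr_half_le[OF e, of x] by (intro mult_right_mono) auto
    have q: "\<epsilon> \<le> \<epsilon> + ?r" "0 < \<epsilon> + ?r" using e by (auto simp: add_pos_nonneg)
    have gq: "reg0 \<epsilon> ?r / (\<epsilon> + ?r) \<le> 1 / \<epsilon> * reg0 \<epsilon> ?r"
    proof -
      have "1 / (\<epsilon> + ?r) \<le> 1 / \<epsilon>" using q e by (intro divide_left_mono) auto
      from mult_right_mono[OF this reg0_nonneg[of \<epsilon> ?r]] show ?thesis by simp
    qed
    have p: "?s\<^sup>2 \<le> ?s ^ 4" "?s ^ 3 \<le> ?s ^ 4" using s by (auto intro!: power_increasing)
    show "\<bar>reg0 \<epsilon> ?r\<bar> \<le> K * C0 * dec x"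
    proof (rule fin)
      have "reg0 \<epsilon> ?r \<le> ?s ^ 4 * ?E" using g p by (meson mult_right_mono exp_ge_zero order_trans)
      also have "\<dots> \<le> K * (?E * ?s ^ 4)" using mult_right_mono[OF K(1), of "?E * ?s ^ 4"] by (simp add: mult.commute)
      finally show "\<bar>reg0 \<epsilon> ?r\<bar> \<le> K * (?E * ?s ^ 4)" by (simp add: reg0_nonneg)
    qed
    show "?s * \<bar>reg1 \<epsilon> ?r\<bar> \<le> K * C0 * dec x"
    proof (rule fin)
      have "\<bar>reg1 \<epsilon> ?r\<bar> \<le> (1 / \<epsilon> + 1) * reg0 \<epsilon> ?r" using reg1_le[OF e, of x] gq unfolding distrib_right mult_1_left
          by linarith
      also have "\<dots> \<le> K * (?s\<^sup>2 * ?E)" using K g reg0_nonneg by (intro mult_mono) auto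
      finally have "?s * \<bar>reg1 \<epsilon> ?r\<bar> \<le> ?s * (K * (?s\<^sup>2 * ?E))" by (intro mult_left_mono) auto
      also have "\<dots> = K * (?E * ?s ^ 3)" by (simp add: power2_eq_square power3_eq_cube mult_ac)
      also have "\<dots> \<le> K * (?E * ?s ^ 4)" using p K by (intro mult_left_mono) auto
      finally show "?s * \<bar>reg1 \<epsilon> ?r\<bar> \<le> K * (?E * ?s ^ 4)" .
    qed
    show "?r * \<bar>reg2 \<epsilon> ?r\<bar> \<le> K * C0 * dec x"
    proof (rule fin)
      have rs: "?r \<le> ?s\<^sup>2" by (intro power_mono) auto
      have s2: "1 \<le> ?s\<^sup>2" using s by (simp add: one_le_power)
      have "?r * \<bar>reg2 \<epsilon> ?r\<bar> \<le> 3 * (1 / \<epsilon> * reg0 \<epsilon> ?r) + 2 * ?r * reg0 \<epsilon> ?r" using reg2_le[OF e, of x] gq by linarith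
      also have "\<dots> = (3 / \<epsilon> * 1 + 2 * ?r) * reg0 \<epsilon> ?r" by (simp add: distrib_right)
      also have "\<dots> \<le> (3 / \<epsilon> * ?s\<^sup>2 + 2 * ?s\<^sup>2) * (?s\<^sup>2 * ?E)"
        using e rs s2 g reg0_nonneg by (intro mult_mono add_mono) auto
      also have "\<dots> = K * (?E * ?s ^ 4)" by (simp add: K_def power2_eq_square power4_eq_xxxx algebra_simps)
      finally show "?r * \<bar>reg2 \<epsilon> ?r\<bar> \<le> K * (?E * ?s ^ 4)" .
    qed
  qed
qed

section \<open>Decay of the regularised fractional Laplacian, uniformly in the
  regularisation\<close>

lemma ft_swap:
  fixes f P :: "real^'n \<Rightarrow> complex"
  assumes "f \<in> borel_measurable borel" "P \<in> borel_measurable borel"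
    and "integrable lborel (\<lambda>x. f x * of_real (w x))" "integrable lborel (\<lambda>x. P x * of_real (w x))"
  shows "(LINT y|lborel. f y * ft P y * of_real (w y)) = (LINT \<xi>|lborel. P \<xi> * ft f \<xi> * of_real (w \<xi>))"
  using fubini_kern[OF assms, of "-1"] by (simp add: ft_def)

lemma ft_dec_bound:
  assumes [measurable]: "P \<in> borel_measurable borel" and P: "\<And>\<xi>. norm (P \<xi>) \<le> C * dec \<xi>"
  shows "norm (ft P y) \<le> C * kern_sup * (LINT x|lborel. w x * dec x)"
    and "integrable lborel (\<lambda>\<xi>. P \<xi> * kern (- y) \<xi> * of_real (w \<xi>))"
    and "integrable lborel (\<lambda>\<xi>. P \<xi> * of_real (w \<xi>))"
proof -
  have "AE \<xi> in lborel. norm (P \<xi> * kern (- y) \<xi>) \<le> C * kern_sup * dec \<xi>"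
    using norm_mult_kern[OF P] by (intro AE_I2) (simp only: mult_ac)
  from integrable_dec_weight[OF _ this]
  show "norm (ft P y) \<le> C * kern_sup * (LINT x|lborel. w x * dec x)"
    and "integrable lborel (\<lambda>\<xi>. P \<xi> * kern (- y) \<xi> * of_real (w \<xi>))" by (simp_all add: ft_def)
  show "integrable lborel (\<lambda>\<xi>. P \<xi> * of_real (w \<xi>))"
    by (rule integrable_dec_weight(1)[of _ C]) (use P in auto)
qed

lemma Sm_coord_mult: "Sm f \<Longrightarrow> Sm (\<lambda>y. of_real (y $ j) * f y)"
  using Sm_inner_mult[of f "axis j 1"] by (simp add: inner_axis')

lemma Sm_norm_mult:
  assumes "Sm f" shows "Sm (\<lambda>y. of_real ((norm y)\<^sup>2) * f y)"
proof -
  have "(\<lambda>y. of_real ((norm y)\<^sup>2) * f y) = (\<lambda>y. \<Sum>j\<in>UNIV. of_real (y $ j) * (of_real (y $ j) * f y))"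
  proof
    fix y :: "real^'n"
    have "complex_of_real ((norm y)\<^sup>2) = (\<Sum>j\<in>UNIV. of_real ((y $ j)\<^sup>2))"
      by (simp only: of_real_sum[symmetric] sum_coord_sq)
    then show "of_real ((norm y)\<^sup>2) * f y = (\<Sum>j\<in>UNIV. of_real (y $ j) * (of_real (y $ j) * f y))"
      by (simp add: sum_distrib_right power2_eq_square mult.assoc)
  qed
  then show ?thesis by (simp add: Sm_sum Sm_coord_mult assms)
qed

lemma Sm_int:
  assumes f: "Sm f" shows "f \<in> borel_measurable borel" "integrable lborel (\<lambda>x. f x * of_real (w x))"
proof -
  show m: "f \<in> borel_measurable borel" by (intro borel_measurable_continuous_onI Sm_continuous f)
  obtain D where "\<And>x. norm (f x) * (1 + norm x) ^ 0 \<le> D * dec x" using rapid_dec[OF Sm_rapid[OF f]] by blast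
  then show "integrable lborel (\<lambda>x. f x * of_real (w x))"
    using m by (intro integrable_dec_weight(1)[of _ D]) auto
qed

text \<open>Differentiating the transform of \<phi> is avoided. The transform is first moved off
  \<phi>, so that for each \<open>y\<close> the integrand is the radial symbol times kern (-y) and
  kern x, to which \<open>radial_ibp\<close> applies. The powers of \<open>y\<close> that arise are
  absorbed into \<phi>, and every term is moved back.\<close>

lemma reg_identity:
  assumes e: "0 < \<epsilon>" "\<epsilon> \<le> 1" and \<phi>: "Sm \<phi>"
  defines "R0 \<equiv> radial (reg0 \<epsilon>)" and "R1 \<equiv> radial (reg1 \<epsilon>)" and "R2 \<equiv> radial (reg2 \<epsilon>)"
  shows "- of_real ((norm x)\<^sup>2) * (LINT \<xi>|lborel. R0 \<xi> * kern x \<xi> * ft \<phi> \<xi> * of_real (w \<xi>))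
   = (LINT \<xi>|lborel. (4 * of_real ((norm \<xi>)\<^sup>2) * R2 \<xi> + 2 * of_nat CARD('n) * R1 \<xi>) * kern x \<xi> * ft \<phi> \<xi> * of_real
       (w \<xi>))
   + (\<Sum>j\<in>UNIV. (LINT \<xi>|lborel. (- 4 * \<i> * of_real (\<xi> $ j) * R1 \<xi>) * kern x \<xi> * ft (\<lambda>y. of_real (y $ j) * \<phi> y) \<xi> *
       of_real (w \<xi>)))
   + (LINT \<xi>|lborel. (- R0 \<xi>) * kern x \<xi> * ft (\<lambda>y. of_real ((norm y)\<^sup>2) * \<phi> y) \<xi> * of_real (w \<xi>))
   + (\<Sum>v\<in>Rp. (LINT \<xi>|lborel. (4 * of_real (k v) * R1 \<xi>) * kern x (root_refl v \<xi>) * ft \<phi> \<xi> * of_real (w \<xi>)))"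
proof -
  obtain C where C: "C \<ge> 0" "\<And>x::real^'n. \<bar>reg0 \<epsilon> ((norm x)\<^sup>2)\<bar> \<le> C * dec x"
    "\<And>x::real^'n. (1 + norm x) * \<bar>reg1 \<epsilon> ((norm x)\<^sup>2)\<bar> \<le> C * dec x" "\<And>x::real^'n. (norm x)\<^sup>2 * \<bar>reg2 \<epsilon> ((norm x)\<^sup>2)\<bar>
        \<le> C * dec x"
    using reg_dec[OF e] by blast
  have Cd: "0 \<le> C * dec x" for x using C(1) dec_pos[of x] by simp
  have c1: "\<bar>reg1 \<epsilon> ((norm x)\<^sup>2)\<bar> \<le> C * dec x" "norm x * \<bar>reg1 \<epsilon> ((norm x)\<^sup>2)\<bar> \<le> C * dec x" for x :: "real^'n"
  proof -
    have "0 \<le> norm x * \<bar>reg1 \<epsilon> ((norm x)\<^sup>2)\<bar>" by simp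
    moreover have "(1 + norm x) * \<bar>reg1 \<epsilon> ((norm x)\<^sup>2)\<bar> = \<bar>reg1 \<epsilon> ((norm x)\<^sup>2)\<bar> + norm x * \<bar>reg1 \<epsilon> ((norm x)\<^sup>2)\<bar>"
      by (simp add: distrib_right)
    ultimately show "\<bar>reg1 \<epsilon> ((norm x)\<^sup>2)\<bar> \<le> C * dec x" "norm x * \<bar>reg1 \<epsilon> ((norm x)\<^sup>2)\<bar> \<le> C * dec x"
      using C(3)[of x] abs_ge_zero[of "reg1 \<epsilon> ((norm x)\<^sup>2)"] by linarith+
  qed
  have [measurable]: "R0 \<in> borel_measurable borel" "R1 \<in> borel_measurable borel" "R2 \<in> borel_measurable borel"
    unfolding R0_def R1_def R2_def radial_def[abs_def] reg0_def[abs_def] reg1_def[abs_def] reg2_def[abs_def]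
        by measurable
  have nR: "norm (R0 \<xi>) = \<bar>reg0 \<epsilon> ((norm \<xi>)\<^sup>2)\<bar>" "norm (R1 \<xi>) = \<bar>reg1 \<epsilon> ((norm \<xi>)\<^sup>2)\<bar>" "norm (R2 \<xi>)
      = \<bar>reg2 \<epsilon> ((norm \<xi>)\<^sup>2)\<bar>" for \<xi>
    by (simp_all add: R0_def R1_def R2_def radial_def)
  have [measurable]: "\<phi> \<in> borel_measurable borel" by (intro borel_measurable_continuous_onI Sm_continuous \<phi>)
  define \<phi>1 where "\<phi>1 j y = of_real (y $ j) * \<phi> y" for j y
  define \<phi>2 where "\<phi>2 y = of_real ((norm y)\<^sup>2) * \<phi> y" for y
  have Sm1: "Sm (\<phi>1 j)" for j unfolding \<phi>1_def[abs_def] by (rule Sm_coord_mult[OF \<phi>])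
  have Sm2: "Sm \<phi>2" unfolding \<phi>2_def[abs_def] by (rule Sm_norm_mult[OF \<phi>])
  define P0 where "P0 \<xi> = R0 \<xi> * kern x \<xi>" for \<xi>
  define P1 where "P1 \<xi> = (4 * of_real ((norm \<xi>)\<^sup>2) * R2 \<xi> + 2 * of_nat CARD('n) * R1 \<xi>) * kern x \<xi>" for \<xi>
  define P2 where "P2 j \<xi> = (- 4 * \<i> * of_real (\<xi> $ j) * R1 \<xi>) * kern x \<xi>" for j \<xi>
  define P3 where "P3 \<xi> = (- R0 \<xi>) * kern x \<xi>" for \<xi>
  define P4 where "P4 v \<xi> = (4 * of_real (k v) * R1 \<xi>) * kern x (root_refl v \<xi>)" for v \<xi>
  have [measurable]: "P0 \<in> borel_measurable borel" "P1 \<in> borel_measurable borel" "P2 j \<in> borel_measurable borel"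
    "P3 \<in> borel_measurable borel" "P4 v \<in> borel_measurable borel" for j v
    unfolding P0_def[abs_def] P1_def[abs_def] P2_def[abs_def] P3_def[abs_def] P4_def[abs_def] by measurable
  have P0: "norm (P0 \<xi>) \<le> (C * kern_sup) * dec \<xi>" for \<xi>
    unfolding P0_def using norm_mult_kern[of "R0 \<xi>" "C * dec \<xi>" x \<xi>] C(2)[of \<xi>] by (simp add: nR mult_ac)
  have P3: "norm (P3 \<xi>) \<le> (C * kern_sup) * dec \<xi>" for \<xi>
    using P0[of \<xi>] by (simp add: P3_def P0_def)
  have P1: "norm (P1 \<xi>) \<le> ((4 + 2 * real CARD('n)) * C * kern_sup) * dec \<xi>" for \<xi>
  proof -
    have "norm (4 * of_real ((norm \<xi>)\<^sup>2) * R2 \<xi> + 2 * of_nat CARD('n) * R1 \<xi>)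
        \<le> 4 * (C * dec \<xi>) + 2 * real CARD('n) * (C * dec \<xi>)"
    proof (rule norm_triangle_le[OF add_mono])
      show "norm (4 * of_real ((norm \<xi>)\<^sup>2) * R2 \<xi>) \<le> 4 * (C * dec \<xi>)"
        using C(4)[of \<xi>] by (simp add: norm_mult nR norm_power)
      show "norm (2 * of_nat CARD('n) * R1 \<xi>) \<le> 2 * real CARD('n) * (C * dec \<xi>)"
        using mult_left_mono[OF c1(1)[of \<xi>], of "2 * real CARD('n)"] by (simp add: norm_mult nR)
    qed
    from norm_mult_kern[OF this, of x \<xi>] show ?thesis unfolding P1_def by (simp add: algebra_simps)
  qed
  have P2: "norm (P2 j \<xi>) \<le> (4 * C * kern_sup) * dec \<xi>" for j \<xi>
  proof -
    have "\<bar>\<xi> $ j\<bar> * \<bar>reg1 \<epsilon> ((norm \<xi>)\<^sup>2)\<bar> \<le> norm \<xi> * \<bar>reg1 \<epsilon> ((norm \<xi>)\<^sup>2)\<bar>"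
      by (intro mult_right_mono component_le_norm_cart) auto
    also note c1(2)[of \<xi>]
    finally have "norm (- 4 * \<i> * of_real (\<xi> $ j) * R1 \<xi>) \<le> 4 * (C * dec \<xi>)" by (simp add: norm_mult nR)
    from norm_mult_kern[OF this, of x \<xi>] show ?thesis unfolding P2_def by (simp add: mult_ac)
  qed
  have P4: "norm (P4 v \<xi>) \<le> (4 * k v * C * kern_sup) * dec \<xi>" if "v \<in> Rp" for v \<xi>
  proof -
    have "norm (4 * of_real (k v) * R1 \<xi>) \<le> 4 * k v * (C * dec \<xi>)"
      using mult_left_mono[OF c1(1)[of \<xi>], of "4 * k v"] k_nonneg_Rp[OF that] by (simp add: norm_mult nR)
    from norm_mult_kern[OF this, of x "root_refl v \<xi>"] show ?thesis unfolding P4_def by (simp add: mult_ac)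
  qed
  have ftint: "integrable lborel (\<lambda>y. f y * ft P y * of_real (w y))"
    if f: "Sm f" and [measurable]: "P \<in> borel_measurable borel" and P: "\<And>\<xi>. norm (P \<xi>) \<le> D * dec \<xi>" for f P D
  proof -
    have [measurable]: "f \<in> borel_measurable borel" using Sm_int(1)[OF f] .
    obtain E where E: "E \<ge> 0" "\<And>y. norm (f y) * (1 + norm y) ^ 0 \<le> E * dec y" using rapid_dec[OF Sm_rapid[OF f]]
        by blast
    let ?B = "D * kern_sup * (LINT x|lborel. w x * dec x)"
    have "norm (f y * ft P y) \<le> (E * ?B) * dec y" for y
    proof -
      have "norm (f y) * norm (ft P y) \<le> (E * dec y) * ?B"
        using E ft_dec_bound(1)[OF _ P, of y] dec_pos[of y] by (intro mult_mono) auto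
      then show ?thesis by (simp add: norm_mult mult_ac)
    qed
    then show ?thesis by (intro integrable_dec_weight(1)) auto
  qed
  have pointwise: "- of_real ((norm x)\<^sup>2) * ft P0 y
     = ft P1 y + (\<Sum>j\<in>UNIV. of_real (y $ j) * ft (P2 j) y) + of_real ((norm y)\<^sup>2) * ft P3 y +
         (\<Sum>v\<in>Rp. ft (P4 v) y)" for y
  proof -
    let ?I = "\<lambda>P \<xi>. P \<xi> * kern (- y) \<xi> * complex_of_real (w \<xi>)"
    \<comment> \<open>\<open>radial_laplace\<close> reflects the argument of kern (-y). Changing
      variables by the same reflection puts it onto kern x instead, so that the term is again a
      transform at \<open>y\<close>.\<close>
    let ?J = "\<lambda>v \<xi>. (4 * of_real (k v) * R1 \<xi>) * kern (- y) (root_refl v \<xi>) * kern x \<xi> * complex_of_real (w \<xi>)"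
    have i1: "integrable lborel (?I P1)" and i2: "integrable lborel (?I (P2 j))" and i3: "integrable lborel (?I P3)"
        for j
      using ft_dec_bound(2)[OF _ P1] ft_dec_bound(2)[OF _ P2] ft_dec_bound(2)[OF _ P3] by auto
    have j4: "integrable lborel (?J v)" "(LINT \<xi>|lborel. ?J v \<xi>) = ft (P4 v) y" if v: "v \<in> Rp" for v
    proof -
      have i4: "integrable lborel (?I (P4 v))" using ft_dec_bound(2)[OF _ P4[OF v]] by simp
      have eq: "?J v (root_refl v \<xi>) = ?I (P4 v) \<xi>" for \<xi>
        by (simp add: P4_def R1_def weight_refl[OF RpD[OF v]] mult_ac)
      have [measurable]: "?J v \<in> borel_measurable borel" by measurable
      have "integrable (distr lborel borel (root_refl v)) (?J v)"
        by (subst integrable_distr_eq) (simp_all only: eq i4, measurable)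
      then show "integrable lborel (?J v)" by (simp only: distr_lborel_root_refl)
      have "(LINT \<xi>|lborel. ?J v \<xi>) = (LINT \<xi>|lborel. ?J v (root_refl v \<xi>))"
          by (rule integral_root_refl[symmetric]) measurable
      then show "(LINT \<xi>|lborel. ?J v \<xi>) = ft (P4 v) y" unfolding eq ft_def .
    qed
    have "ft P0 y = (LINT \<xi>|lborel. R0 \<xi> * kern (- y) \<xi> * kern x \<xi> * of_real (w \<xi>))"
      unfolding ft_def P0_def by (intro HOL.refl Bochner_Integration.integral_cong) (simp only: mult_ac)
    then have "- of_real ((norm x)\<^sup>2) * ft P0 y
        = - of_real ((norm x)\<^sup>2) * (LINT \<xi>|lborel. R0 \<xi> * kern (- y) \<xi> * kern x \<xi> * of_real (w \<xi>))"
      by (rule arg_cong)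
    also have "\<dots> = (LINT \<xi>|lborel. radial_laplace (reg0 \<epsilon>) (reg1 \<epsilon>) (reg2 \<epsilon>) (- y) \<xi> * kern x \<xi> * of_real (w \<xi>))"
      unfolding R0_def
      by (rule radial_ibp[OF reg0_deriv[OF e(1)] reg1_deriv[OF e(1)] reg_continuous[OF e(1)] C(2-4), symmetric])
    also have "\<dots> = (LINT \<xi>|lborel. (?I P1 \<xi> + (\<Sum>j\<in>UNIV. of_real (y $ j) * ?I (P2 j) \<xi>) + of_real ((norm y)\<^sup>2)
        * ?I P3 \<xi>) + (\<Sum>v\<in>Rp. ?J v \<xi>))"
    proof (intro Bochner_Integration.integral_cong HOL.refl)
      fix \<xi> :: "real^'n"
      have yx: "complex_of_real ((- y) \<bullet> \<xi>) = - (\<Sum>j\<in>UNIV. of_real (y $ j) * of_real (\<xi> $ j))"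
        by (simp add: inner_vec_def sum_negf)
      have "(\<Sum>j\<in>UNIV. of_real (y $ j) * ?I (P2 j) \<xi>)
        = (\<Sum>j\<in>UNIV. of_real (y $ j) * of_real (\<xi> $ j)) * (- 4 * \<i> * R1 \<xi> * kern x \<xi> * kern (- y) \<xi> * of_real (w \<xi>))"
        unfolding sum_distrib_right by (intro sum.cong HOL.refl) (simp add: P2_def mult_ac)
      moreover have "(\<Sum>v\<in>Rp. ?J v \<xi>) = (\<Sum>v\<in>Rp. of_real (k v) * kern (- y) (root_refl v \<xi>)) * (4 * R1 \<xi> * kern x \<xi>
          * of_real (w \<xi>))"
        unfolding sum_distrib_right by (intro sum.cong HOL.refl) (simp add: mult_ac)
      ultimately show "radial_laplace (reg0 \<epsilon>) (reg1 \<epsilon>) (reg2 \<epsilon>) (- y) \<xi> * kern x \<xi> * of_real (w \<xi>)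
        = (?I P1 \<xi> + (\<Sum>j\<in>UNIV. of_real (y $ j) * ?I (P2 j) \<xi>) + of_real ((norm y)\<^sup>2) * ?I P3 \<xi>) + (\<Sum>v\<in>Rp. ?J v \<xi>)"
        unfolding radial_laplace_def R0_def[symmetric] R1_def[symmetric] R2_def[symmetric] yx P1_def P3_def
            norm_minus_cancel
        by (simp add: algebra_simps)
    qed
    also have "\<dots> = (ft P1 y + (\<Sum>j\<in>UNIV. of_real (y $ j) * ft (P2 j) y) + of_real ((norm y)\<^sup>2) * ft P3 y)
        + (\<Sum>v\<in>Rp. ft (P4 v) y)"
    proof -
      have s2: "integrable lborel (\<lambda>\<xi>. \<Sum>j\<in>UNIV. of_real (y $ j) * ?I (P2 j) \<xi>)"
        by (intro Bochner_Integration.integrable_sum integrable_mult_right i2)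
      have s3: "integrable lborel (\<lambda>\<xi>. of_real ((norm y)\<^sup>2) * ?I P3 \<xi>)" by (intro integrable_mult_right i3)
      have s4: "integrable lborel (\<lambda>\<xi>. \<Sum>v\<in>Rp. ?J v \<xi>)" by (intro Bochner_Integration.integrable_sum j4)
      have e2: "(LINT \<xi>|lborel. (\<Sum>j\<in>UNIV. of_real (y $ j) * ?I (P2 j) \<xi>)) = (\<Sum>j\<in>UNIV. of_real (y $ j) * ft (P2 j) y)"
        by (subst Bochner_Integration.integral_sum) (auto intro!: integrable_mult_right i2 simp: ft_def)
      have e4: "(LINT \<xi>|lborel. (\<Sum>v\<in>Rp. ?J v \<xi>)) = (\<Sum>v\<in>Rp. ft (P4 v) y)"
        by (subst Bochner_Integration.integral_sum) (auto intro!: sum.cong j4)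
      have e3: "(LINT \<xi>|lborel. of_real ((norm y)\<^sup>2) * ?I P3 \<xi>) = of_real ((norm y)\<^sup>2) * ft P3 y"
        unfolding ft_def by (rule integral_mult_right_zero)
      show ?thesis
        by (simp only: Bochner_Integration.integral_add[OF Bochner_Integration.integrable_add[OF
            Bochner_Integration.integrable_add[OF i1 s2] s3] s4]
            Bochner_Integration.integral_add[OF Bochner_Integration.integrable_add[OF i1 s2] s3]
            Bochner_Integration.integral_add[OF i1 s2] e2 e3 e4 ft_def[of P1, symmetric])
    qed
    finally show ?thesis .
  qed
  have swap: "(LINT y|lborel. f y * ft P y * of_real (w y)) = (LINT \<xi>|lborel. P \<xi> * ft f \<xi> * of_real (w \<xi>))"
    if "Sm f" "P \<in> borel_measurable borel" "\<And>\<xi>. norm (P \<xi>) \<le> D * dec \<xi>" for f P D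
    by (rule ft_swap[OF Sm_int(1)[OF that(1)] that(2) Sm_int(2)[OF that(1)] ft_dec_bound(3)[OF that(2,3)]])
  have m: "P0 \<in> borel_measurable borel" "P1 \<in> borel_measurable borel" "P2 j \<in> borel_measurable borel"
    "P3 \<in> borel_measurable borel" "P4 v \<in> borel_measurable borel" for j v by measurable
  have "- of_real ((norm x)\<^sup>2) * (LINT \<xi>|lborel. P0 \<xi> * ft \<phi> \<xi> * of_real (w \<xi>))
    = - of_real ((norm x)\<^sup>2) * (LINT y|lborel. \<phi> y * ft P0 y * of_real (w y))"
    by (simp only: swap[OF \<phi> m(1) P0])
  also have "\<dots> = (LINT y|lborel. - of_real ((norm x)\<^sup>2) * (\<phi> y * ft P0 y * of_real (w y)))"
    by (rule integral_mult_right_zero[symmetric])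
  also have "\<dots> = (LINT y|lborel. \<phi> y * ft P1 y * of_real (w y) + (\<Sum>j\<in>UNIV. \<phi>1 j y * ft (P2 j) y * of_real (w y))
      + \<phi>2 y * ft P3 y * of_real (w y) + (\<Sum>v\<in>Rp. \<phi> y * ft (P4 v) y * of_real (w y)))"
  proof (intro Bochner_Integration.integral_cong HOL.refl)
    fix y :: "real^'n"
    have "- of_real ((norm x)\<^sup>2) * (\<phi> y * ft P0 y * of_real (w y))
        = (- of_real ((norm x)\<^sup>2) * ft P0 y) * (\<phi> y * of_real (w y))"
      by (simp only: mult_ac minus_mult_commute mult_minus_left mult_minus_right)
    then show "- of_real ((norm x)\<^sup>2) * (\<phi> y * ft P0 y * of_real (w y))
      = \<phi> y * ft P1 y * of_real (w y) + (\<Sum>j\<in>UNIV. \<phi>1 j y * ft (P2 j) y * of_real (w y))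
      + \<phi>2 y * ft P3 y * of_real (w y) + (\<Sum>v\<in>Rp. \<phi> y * ft (P4 v) y * of_real (w y))"
      unfolding pointwise by (simp add: \<phi>1_def \<phi>2_def distrib_right distrib_left sum_distrib_left sum_distrib_right
          mult_ac)
  qed
  also have "\<dots> = (LINT \<xi>|lborel. P1 \<xi> * ft \<phi> \<xi> * of_real (w \<xi>))
      + (\<Sum>j\<in>UNIV. (LINT \<xi>|lborel. P2 j \<xi> * ft (\<phi>1 j) \<xi> * of_real (w \<xi>)))
      + (LINT \<xi>|lborel. P3 \<xi> * ft \<phi>2 \<xi> * of_real (w \<xi>)) + (\<Sum>v\<in>Rp. (LINT \<xi>|lborel. P4 v \<xi> * ft \<phi> \<xi> * of_real (w \<xi>)))"
  proof -
    have s1: "integrable lborel (\<lambda>y. \<phi> y * ft P1 y * of_real (w y))" by (rule ftint[OF \<phi> m(2) P1])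
    have s2: "integrable lborel (\<lambda>y. \<phi>1 j y * ft (P2 j) y * of_real (w y))" for j by (rule ftint[OF Sm1 m(3) P2])
    have s3: "integrable lborel (\<lambda>y. \<phi>2 y * ft P3 y * of_real (w y))" by (rule ftint[OF Sm2 m(4) P3])
    have s4: "integrable lborel (\<lambda>y. \<phi> y * ft (P4 v) y * of_real (w y))" if "v \<in> Rp" for v
        by (rule ftint[OF \<phi> m(5) P4[OF that]])
    have S2: "integrable lborel (\<lambda>y. \<Sum>j\<in>UNIV. \<phi>1 j y * ft (P2 j) y * of_real (w y))"
        by (intro Bochner_Integration.integrable_sum s2)
    have S4: "integrable lborel (\<lambda>y. \<Sum>v\<in>Rp. \<phi> y * ft (P4 v) y * of_real (w y))"
        by (intro Bochner_Integration.integrable_sum s4)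
    have e2: "(LINT y|lborel. (\<Sum>j\<in>UNIV. \<phi>1 j y * ft (P2 j) y * of_real (w y)))
        = (\<Sum>j\<in>UNIV. (LINT \<xi>|lborel. P2 j \<xi> * ft (\<phi>1 j) \<xi> * of_real (w \<xi>)))"
      by (subst Bochner_Integration.integral_sum) (auto intro!: s2 simp only: swap[OF Sm1 m(3) P2])
    have e4: "(LINT y|lborel. (\<Sum>v\<in>Rp. \<phi> y * ft (P4 v) y * of_real (w y)))
        = (\<Sum>v\<in>Rp. (LINT \<xi>|lborel. P4 v \<xi> * ft \<phi> \<xi> * of_real (w \<xi>)))"
      by (subst Bochner_Integration.integral_sum) (auto intro!: s4 sum.cong swap[OF \<phi> m(5) P4])
    show ?thesis
      by (simp only: Bochner_Integration.integral_add[OF Bochner_Integration.integrable_add[OF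
          Bochner_Integration.integrable_add[OF s1 S2] s3] S4]
          Bochner_Integration.integral_add[OF Bochner_Integration.integrable_add[OF s1 S2] s3]
          Bochner_Integration.integral_add[OF s1 S2] e2 e4 swap[OF \<phi> m(2) P1] swap[OF Sm2 m(4) P3])
  qed
  finally show ?thesis
    unfolding P0_def P1_def P2_def P3_def P4_def \<phi>1_def[abs_def] \<phi>2_def[abs_def] .
qed

text \<open>All three bounds are free of \<epsilon>. The fifth power is a common majorant for the
  polynomial growth of the terms, and is paid for by the rapid decay of the transform of
  \<phi>.\<close>

lemma reg_bounds:
  fixes x :: "real^'n"
  assumes e: "0 < \<epsilon>" "\<epsilon> \<le> 1" and x: "x \<noteq> 0"
  shows "\<bar>reg0 \<epsilon> ((norm x)\<^sup>2)\<bar> \<le> sing x * (1 + norm x) ^ 5"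
    and "(1 + norm x) * \<bar>reg1 \<epsilon> ((norm x)\<^sup>2)\<bar> \<le> sing x * (1 + norm x) ^ 5"
    and "(norm x)\<^sup>2 * \<bar>reg2 \<epsilon> ((norm x)\<^sup>2)\<bar> \<le> sing x * (1 + norm x) ^ 5"
proof -
  let ?s = "1 + norm x" let ?p = "norm x powr (\<alpha> - 2)" let ?r = "(norm x)\<^sup>2"
  have s: "?s \<ge> 1" by simp
  have S: "1 \<le> ?s ^ 5" "?s \<le> ?s ^ 5" "?s\<^sup>2 \<le> ?s ^ 5" "?s ^ 3 \<le> ?s ^ 5" "?s ^ 4 \<le> ?s ^ 5"
    using power_increasing[OF _ s, of 0 5] power_increasing[OF _ s, of 1 5] power_increasing[OF _ s, of 2 5]
      power_increasing[OF _ s, of 3 5] power_increasing[OF _ s, of 4 5] by simp_all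
  have p: "0 \<le> ?p" by simp
  have pS: "0 \<le> ?p * ?s ^ 5" by simp
  have SS: "sing x * ?s ^ 5 = 3 * (?p * ?s ^ 5) + 2 * ?s ^ 5" by (simp add: sing_def distrib_right)
  note q = reg_sing[OF e x] and g0 = reg0_le[OF e, of x]
  show "\<bar>reg0 \<epsilon> ?r\<bar> \<le> sing x * ?s ^ 5"
    using g0 S pS unfolding SS abs_of_nonneg[OF reg0_nonneg] by linarith
  have "?s * \<bar>reg1 \<epsilon> ?r\<bar> \<le> ?s * (?p + ?s\<^sup>2)"
    using reg1_le[OF e, of x] q g0 by (intro mult_left_mono) auto
  also have "\<dots> = ?p * ?s + ?s ^ 3" by (simp add: power2_eq_square power3_eq_cube algebra_simps)
  also have "\<dots> \<le> ?p * ?s ^ 5 + ?s ^ 5" using S p by (intro add_mono mult_left_mono) auto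
  finally show "?s * \<bar>reg1 \<epsilon> ?r\<bar> \<le> sing x * ?s ^ 5" using S pS unfolding SS by linarith
  have "?r * reg0 \<epsilon> ?r \<le> ?s\<^sup>2 * ?s\<^sup>2" using g0 by (intro mult_mono power_mono) (auto simp: reg0_nonneg)
  also have "\<dots> = ?s ^ 4" by (simp flip: power_add)
  finally have "2 * ?r * reg0 \<epsilon> ?r \<le> 2 * ?s ^ 5" using S by linarith
  moreover have "?p \<le> ?p * ?s ^ 5" using mult_left_mono[OF S(1) p] by simp
  ultimately show "?r * \<bar>reg2 \<epsilon> ?r\<bar> \<le> sing x * ?s ^ 5"
    using reg2_le[OF e, of x] q unfolding SS by linarith
qed

lemma measurable_reg [measurable]:
  "(radial (reg0 \<epsilon>) :: real^'n \<Rightarrow> complex) \<in> borel_measurable borel"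
  "(radial (reg1 \<epsilon>) :: real^'n \<Rightarrow> complex) \<in> borel_measurable borel"
  "(radial (reg2 \<epsilon>) :: real^'n \<Rightarrow> complex) \<in> borel_measurable borel"
  unfolding radial_def[abs_def] reg0_def[abs_def] reg1_def[abs_def] reg2_def[abs_def] by measurable

text \<open>Each term of \<open>reg_identity\<close> falls under \<open>sing_bound\<close> with
  constants that involve neither \<epsilon> nor \<open>x\<close>, so the estimate survives the limit
  as \<epsilon> tends to 0.\<close>

lemma reg_uniform_decay:
  assumes \<phi>: "Sm \<phi>"
  shows "\<exists>M. \<forall>\<epsilon> x. 0 < \<epsilon> \<longrightarrow> \<epsilon> \<le> 1 \<longrightarrow>
    (norm x)\<^sup>2 * norm (LINT \<xi>|lborel. radial (reg0 \<epsilon>) \<xi> * kern x \<xi> * ft \<phi> \<xi> * of_real (w \<xi>)) \<le> M"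
proof -
  obtain C where C: "\<And>\<xi>. norm (ft \<phi> \<xi>) * (1 + norm \<xi>) ^ 5 \<le> C * dec \<xi>"
    using ft_dec[OF \<phi>] by blast
  have "\<forall>j. \<exists>C. \<forall>\<xi>. norm (ft (\<lambda>y. of_real (y $ j) * \<phi> y) \<xi>) * (1 + norm \<xi>) ^ 5 \<le> C * dec \<xi>"
    using ft_dec[OF Sm_coord_mult[OF \<phi>]] by blast
  then obtain C1 where C1: "\<And>j \<xi>. norm (ft (\<lambda>y. of_real (y $ j) * \<phi> y) \<xi>) * (1 + norm \<xi>) ^ 5 \<le> C1 j * dec \<xi>"
    by (auto dest!: choice)
  obtain C2 where C2: "\<And>\<xi>. norm (ft (\<lambda>y. of_real ((norm y)\<^sup>2) * \<phi> y) \<xi>) * (1 + norm \<xi>) ^ 5 \<le> C2 * dec \<xi>"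
    using ft_dec[OF Sm_norm_mult[OF \<phi>]] by blast
  have m [measurable]: "ft f \<in> borel_measurable borel" if "Sm f" for f
    using Sm_int(1)[OF that] by measurable
  note [measurable] = m[OF \<phi>] m[OF Sm_coord_mult[OF \<phi>]] m[OF Sm_norm_mult[OF \<phi>]]
  define M where "M = (4 + 2 * real CARD('n)) * kern_sup * C * sing_int + (\<Sum>j\<in>UNIV. 4 * kern_sup * C1 j * sing_int)
    + 1 * kern_sup * C2 * sing_int + (\<Sum>v\<in>Rp. 4 * k v * kern_sup * C * sing_int)"
  show ?thesis
  proof (intro exI[of _ M] allI impI)
    fix \<epsilon> :: real and x :: "real^'n"
    assume e: "0 < \<epsilon>" "\<epsilon> \<le> 1"
    let ?R0 = "radial (reg0 \<epsilon>) :: real^'n \<Rightarrow> complex" let ?R1 = "radial (reg1 \<epsilon>) :: real^'n \<Rightarrow> complex"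
    let ?R2 = "radial (reg2 \<epsilon>) :: real^'n \<Rightarrow> complex"
    have nR: "norm (?R0 \<xi>) = \<bar>reg0 \<epsilon> ((norm \<xi>)\<^sup>2)\<bar>" "norm (?R1 \<xi>) = \<bar>reg1 \<epsilon> ((norm \<xi>)\<^sup>2)\<bar>"
      "norm (?R2 \<xi>) = \<bar>reg2 \<epsilon> ((norm \<xi>)\<^sup>2)\<bar>" for \<xi>
      by (simp_all add: radial_def)
    have b1: "\<bar>reg1 \<epsilon> ((norm \<xi>)\<^sup>2)\<bar> \<le> sing \<xi> * (1 + norm \<xi>) ^ 5"
      "norm \<xi> * \<bar>reg1 \<epsilon> ((norm \<xi>)\<^sup>2)\<bar> \<le> sing \<xi> * (1 + norm \<xi>) ^ 5" if "\<xi> \<noteq> 0" for \<xi> :: "real^'n"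
    proof -
      have "0 \<le> norm \<xi> * \<bar>reg1 \<epsilon> ((norm \<xi>)\<^sup>2)\<bar>" by simp
      moreover have "(1 + norm \<xi>) * \<bar>reg1 \<epsilon> ((norm \<xi>)\<^sup>2)\<bar> = \<bar>reg1 \<epsilon> ((norm \<xi>)\<^sup>2)\<bar> + norm \<xi> * \<bar>reg1 \<epsilon> ((norm \<xi>)\<^sup>2)\<bar>"
        by (simp add: distrib_right)
      ultimately show "\<bar>reg1 \<epsilon> ((norm \<xi>)\<^sup>2)\<bar> \<le> sing \<xi> * (1 + norm \<xi>) ^ 5"
        "norm \<xi> * \<bar>reg1 \<epsilon> ((norm \<xi>)\<^sup>2)\<bar> \<le> sing \<xi> * (1 + norm \<xi>) ^ 5"
        using reg_bounds(2)[OF e that] abs_ge_zero[of "reg1 \<epsilon> ((norm \<xi>)\<^sup>2)"] by linarith+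
    qed
    define I1 where "I1 = (LINT \<xi>|lborel. (4 * of_real ((norm \<xi>)\<^sup>2) * ?R2 \<xi> + 2 * of_nat CARD('n) * ?R1 \<xi>) * kern x \<xi>
        * ft \<phi> \<xi> * of_real (w \<xi>))"
    define I2 where "I2 j = (LINT \<xi>|lborel. (- 4 * \<i> * of_real (\<xi> $ j) * ?R1 \<xi>) * kern x \<xi> * ft (\<lambda>y. of_real (y $ j)
        * \<phi> y) \<xi> * of_real (w \<xi>))" for j
    define I3 where "I3 = (LINT \<xi>|lborel. (- ?R0 \<xi>) * kern x \<xi> * ft (\<lambda>y. of_real ((norm y)\<^sup>2) * \<phi> y) \<xi>
        * of_real (w \<xi>))"
    define I4 where "I4 v = (LINT \<xi>|lborel. (4 * of_real (k v) * ?R1 \<xi>) * kern x (root_refl v \<xi>) * ft \<phi> \<xi>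
        * of_real (w \<xi>))" for v
    have B1: "norm I1 \<le> (4 + 2 * real CARD('n)) * kern_sup * C * sing_int"
      unfolding I1_def
    proof (rule sing_bound(1)[OF _ _ _ _ C norm_kern_le])
      fix \<xi> :: "real^'n" assume \<xi>: "\<xi> \<noteq> 0"
      let ?S = "sing \<xi> * (1 + norm \<xi>) ^ 5"
      have "norm (4 * of_real ((norm \<xi>)\<^sup>2) * ?R2 \<xi> + 2 * of_nat CARD('n) * ?R1 \<xi>) \<le> 4 * ?S + 2 * real CARD('n) * ?S"
      proof (rule norm_triangle_le[OF add_mono])
        show "norm (4 * of_real ((norm \<xi>)\<^sup>2) * ?R2 \<xi>) \<le> 4 * ?S"
          using reg_bounds(3)[OF e \<xi>] by (simp add: norm_mult nR norm_power)
        show "norm (2 * of_nat CARD('n) * ?R1 \<xi>) \<le> 2 * real CARD('n) * ?S"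
          using mult_left_mono[OF b1(1)[OF \<xi>], of "2 * real CARD('n)"] by (simp add: norm_mult nR)
      qed
      then show "norm (4 * of_real ((norm \<xi>)\<^sup>2) * ?R2 \<xi> + 2 * of_nat CARD('n) * ?R1 \<xi>) \<le> (4 + 2 * real CARD('n)) * ?S"
        by (simp only: distrib_right)
    next
      show "0 \<le> 4 + 2 * real CARD('n)" by simp
    qed measurable
    have B2: "norm (I2 j) \<le> 4 * kern_sup * C1 j * sing_int" for j
      unfolding I2_def
    proof (rule sing_bound(1)[OF _ _ _ _ C1 norm_kern_le])
      fix \<xi> :: "real^'n" assume \<xi>: "\<xi> \<noteq> 0"
      have "\<bar>\<xi> $ j\<bar> * \<bar>reg1 \<epsilon> ((norm \<xi>)\<^sup>2)\<bar> \<le> norm \<xi> * \<bar>reg1 \<epsilon> ((norm \<xi>)\<^sup>2)\<bar>"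
        by (intro mult_right_mono component_le_norm_cart) auto
      also note b1(2)[OF \<xi>]
      finally show "norm (- 4 * \<i> * of_real (\<xi> $ j) * ?R1 \<xi>) \<le> 4 * (sing \<xi> * (1 + norm \<xi>) ^ 5)"
        by (simp add: norm_mult nR)
    next
      show "0 \<le> (4::real)" by simp
    qed measurable
    have B3: "norm I3 \<le> 1 * kern_sup * C2 * sing_int"
      unfolding I3_def
    proof (rule sing_bound(1)[OF _ _ _ _ C2 norm_kern_le])
      fix \<xi> :: "real^'n" assume \<xi>: "\<xi> \<noteq> 0"
      show "norm (- ?R0 \<xi>) \<le> 1 * (sing \<xi> * (1 + norm \<xi>) ^ 5)"
        using reg_bounds(1)[OF e \<xi>] by (simp add: nR)
    next
      show "0 \<le> (1::real)" by simp
    qed measurable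
    have B4: "norm (I4 v) \<le> 4 * k v * kern_sup * C * sing_int" if v: "v \<in> Rp" for v
      unfolding I4_def
    proof (rule sing_bound(1)[OF _ _ _ _ C norm_kern_le])
      fix \<xi> :: "real^'n" assume \<xi>: "\<xi> \<noteq> 0"
      show "norm (4 * of_real (k v) * ?R1 \<xi>) \<le> 4 * k v * (sing \<xi> * (1 + norm \<xi>) ^ 5)"
        using mult_left_mono[OF b1(1)[OF \<xi>], of "4 * k v"] k_nonneg_Rp[OF v] by (simp add: norm_mult nR)
    next
      show "0 \<le> 4 * k v" using k_nonneg_Rp[OF v] by simp
    qed measurable
    have "(norm x)\<^sup>2 * norm (LINT \<xi>|lborel. ?R0 \<xi> * kern x \<xi> * ft \<phi> \<xi> * of_real (w \<xi>))
      = norm (- of_real ((norm x)\<^sup>2) * (LINT \<xi>|lborel. ?R0 \<xi> * kern x \<xi> * ft \<phi> \<xi> * of_real (w \<xi>)))"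
      by (simp add: norm_mult norm_power)
    also have "\<dots> = norm (I1 + (\<Sum>j\<in>UNIV. I2 j) + I3 + (\<Sum>v\<in>Rp. I4 v))"
      unfolding reg_identity[OF e \<phi>] I1_def I2_def I3_def I4_def ..
    also have "\<dots> \<le> norm I1 + (\<Sum>j\<in>UNIV. norm (I2 j)) + norm I3 + (\<Sum>v\<in>Rp. norm (I4 v))"
      by (intro norm_triangle_mono norm_sum order_refl)
    also have "\<dots> \<le> M"
      unfolding M_def by (intro add_mono sum_mono B1 B2 B3 B4)
    finally show "(norm x)\<^sup>2 * norm (LINT \<xi>|lborel. ?R0 \<xi> * kern x \<xi> * ft \<phi> \<xi> * of_real (w \<xi>)) \<le> M" .
  qed
qed

section \<open>The fractional Laplacian without its normalising constants\<close>

definition riesz_int :: "(real^'n \<Rightarrow> complex) \<Rightarrow> real^'n \<Rightarrow> complex" where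
  "riesz_int \<phi> x = (LINT \<xi>|lborel. of_real (norm \<xi> powr \<alpha>) * kern x \<xi> * ft \<phi> \<xi> * of_real (w \<xi>))"

lemma frac_dunkl_laplacian_eq: "frac_dunkl_laplacian Rp k \<alpha> \<phi> x = riesz_int \<phi> x / of_real (c\<^sub>k\<^sup>2)"
proof -
  have eq: "of_real (norm \<xi> powr \<alpha>) * (ft \<phi> \<xi> / of_real c\<^sub>k) * kern x \<xi> * of_real (w \<xi>)
    = 1 / of_real c\<^sub>k * (of_real (norm \<xi> powr \<alpha>) * kern x \<xi> * ft \<phi> \<xi> * of_real (w \<xi>))" for \<xi>
    by (simp add: divide_inverse mult_ac)
  show ?thesis
    unfolding frac_dunkl_laplacian_def inv_dunkl_transform_def dunkl_kernel_eq dunkl_transform_eq eq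
      integral_mult_right_zero riesz_int_def[symmetric] by (simp add: power2_eq_square)
qed

lemma measurable_riesz_int [measurable]:
  assumes [measurable]: "\<phi> \<in> borel_measurable borel" shows "riesz_int \<phi> \<in> borel_measurable borel"
proof -
  have "(\<lambda>x. LINT \<xi>|lborel. of_real (norm \<xi> powr \<alpha>) * kern x \<xi> * ft \<phi> \<xi> * of_real (w \<xi>)) \<in> borel_measurable borel"
    by (rule lborel.borel_measurable_lebesgue_integral) measurable
  then show ?thesis by (simp add: riesz_int_def[abs_def])
qed

lemma norm_powr_alpha_le: "norm x powr \<alpha> \<le> (1 + norm x)\<^sup>2"
proof -
  have "norm x powr \<alpha> \<le> (1 + norm x) powr \<alpha>" using alpha_pos by (intro powr_mono2) auto
  also have "\<dots> \<le> (1 + norm x) powr 2" using alpha_less by (intro powr_mono) auto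
  finally show ?thesis by (simp add: add_pos_nonneg)
qed

lemma riesz_multiplier_dec:
  assumes "Sm \<phi>" shows "\<exists>C. \<forall>\<xi>. norm (of_real (norm \<xi> powr \<alpha>) * ft \<phi> \<xi>) \<le> C * dec \<xi>"
proof -
  obtain C where C: "\<And>\<xi>. norm (ft \<phi> \<xi>) * (1 + norm \<xi>) ^ 2 \<le> C * dec \<xi>" using ft_dec[OF assms] by blast
  have "norm (of_real (norm \<xi> powr \<alpha>) * ft \<phi> \<xi>) \<le> C * dec \<xi>" for \<xi>
    using mult_left_mono[OF norm_powr_alpha_le norm_ge_zero, of "ft \<phi> \<xi>" \<xi>] C[of \<xi>]
    by (simp add: norm_mult mult.commute)
  then show ?thesis by blast
qed

text \<open>The quadratic decay passes from the regularised symbols to the limit by dominated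
  convergence. Boundedness near 0 comes directly from the integrability of the transform against the
  weight.\<close>

lemma riesz_int_decay:
  assumes \<phi>: "Sm \<phi>" shows "\<exists>K\<ge>0. \<forall>x. norm (riesz_int \<phi> x) * (1 + norm x)\<^sup>2 \<le> K"
proof -
  have [measurable]: "\<phi> \<in> borel_measurable borel" by (rule Sm_int(1)[OF \<phi>])
  obtain M where M: "\<And>\<epsilon> x. 0 < \<epsilon> \<Longrightarrow> \<epsilon> \<le> 1 \<Longrightarrow>
    (norm x)\<^sup>2 * norm (LINT \<xi>|lborel. radial (reg0 \<epsilon>) \<xi> * kern x \<xi> * ft \<phi> \<xi> * of_real (w \<xi>)) \<le> M"
    using reg_uniform_decay[OF \<phi>] by blast
  obtain C where C: "\<And>\<xi>. norm (ft \<phi> \<xi>) * (1 + norm \<xi>) ^ 2 \<le> C * dec \<xi>" using ft_dec[OF \<phi>] by blast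
  obtain D where D: "\<And>\<xi>. norm (of_real (norm \<xi> powr \<alpha>) * ft \<phi> \<xi>) \<le> D * dec \<xi>"
    using riesz_multiplier_dec[OF \<phi>] by blast
  define e where "e n = 1 / real (Suc n)" for n
  have e: "e n > 0" "e n \<le> 1" "e \<longlonglongrightarrow> 0" for n unfolding e_def by (simp, simp, real_asymp)
  have M': "(norm x)\<^sup>2 * norm (riesz_int \<phi> x) \<le> M" for x
  proof (rule LIMSEQ_le_const2)
    have "(\<lambda>n. LINT \<xi>|lborel. radial (reg0 (e n)) \<xi> * kern x \<xi> * ft \<phi> \<xi> * of_real (w \<xi>)) \<longlonglongrightarrow> riesz_int \<phi> x"
      unfolding riesz_int_def
    proof (rule integral_dominated_convergence)
      show "integrable lborel (\<lambda>\<xi>. C * kern_sup * (w \<xi> * dec \<xi>))"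
        by (intro integrable_mult_right integrable_weight_dec)
      show "AE \<xi> in lborel. (\<lambda>n. radial (reg0 (e n)) \<xi> * kern x \<xi> * ft \<phi> \<xi> * of_real (w \<xi>))
        \<longlonglongrightarrow> of_real (norm \<xi> powr \<alpha>) * kern x \<xi> * ft \<phi> \<xi> * of_real (w \<xi>)"
      proof (intro AE_I2 tendsto_mult tendsto_const)
        fix \<xi> :: "real^'n"
        have "(\<lambda>n. (e n + (norm \<xi>)\<^sup>2) powr (\<alpha> / 2) * exp (- e n * (norm \<xi>)\<^sup>2))
            \<longlonglongrightarrow> (0 + (norm \<xi>)\<^sup>2) powr (\<alpha> / 2) * exp (- 0 * (norm \<xi>)\<^sup>2)"
          using e alpha_pos
          by (intro tendsto_intros tendsto_powr') (auto intro!: always_eventually add_nonneg_nonneg less_imp_le)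
        moreover have "(0 + (norm \<xi>)\<^sup>2) powr (\<alpha> / 2) * exp (- 0 * (norm \<xi>)\<^sup>2) = norm \<xi> powr \<alpha>"
          by (cases "\<xi> = 0") (simp_all add: powr_powr flip: powr_numeral)
        ultimately have "(\<lambda>n. reg0 (e n) ((norm \<xi>)\<^sup>2)) \<longlonglongrightarrow> norm \<xi> powr \<alpha>" by (simp only: reg0_def)
        then show "(\<lambda>n. radial (reg0 (e n)) \<xi>) \<longlonglongrightarrow> complex_of_real (norm \<xi> powr \<alpha>)"
          unfolding radial_def by (rule tendsto_of_real)
      qed
      fix n
      show "AE \<xi> in lborel. norm (radial (reg0 (e n)) \<xi> * kern x \<xi> * ft \<phi> \<xi> * of_real (w \<xi>))
          \<le> C * kern_sup * (w \<xi> * dec \<xi>)"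
      proof (rule AE_I2)
        fix \<xi> :: "real^'n"
        have "norm (radial (reg0 (e n)) \<xi>) \<le> (1 + norm \<xi>)\<^sup>2"
          using reg0_le[OF e(1,2), of n \<xi>] by (simp add: radial_def reg0_nonneg)
        then have "norm (radial (reg0 (e n)) \<xi>) * norm (kern x \<xi>) * norm (ft \<phi> \<xi>) * w \<xi>
            \<le> (1 + norm \<xi>)\<^sup>2 * kern_sup * norm (ft \<phi> \<xi>) * w \<xi>"
          by (intro mult_right_mono mult_mono norm_kern_le weight_nonneg) auto
        also have "\<dots> = kern_sup * w \<xi> * (norm (ft \<phi> \<xi>) * (1 + norm \<xi>)\<^sup>2)" by (simp only: mult_ac)
        also have "\<dots> \<le> kern_sup * w \<xi> * (C * dec \<xi>)"
            by (intro mult_left_mono C mult_nonneg_nonneg kern_sup_nonneg weight_nonneg)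
        also have "\<dots> = C * kern_sup * (w \<xi> * dec \<xi>)" by (simp only: mult_ac)
        finally show "norm (radial (reg0 (e n)) \<xi> * kern x \<xi> * ft \<phi> \<xi> * of_real (w \<xi>)) \<le> C * kern_sup * (w \<xi> * dec \<xi>)"
          using weight_nonneg[of \<xi>] by (simp only: norm_mult norm_of_real abs_of_nonneg)
      qed
    qed measurable
    then show "(\<lambda>n. (norm x)\<^sup>2 * norm (LINT \<xi>|lborel. radial (reg0 (e n)) \<xi> * kern x \<xi> * ft \<phi> \<xi> * of_real (w \<xi>)))
      \<longlonglongrightarrow> (norm x)\<^sup>2 * norm (riesz_int \<phi> x)"
      by (intro tendsto_intros)
    show "\<exists>N. \<forall>n\<ge>N. (norm x)\<^sup>2 * norm (LINT \<xi>|lborel. radial (reg0 (e n)) \<xi> * kern x \<xi> * ft \<phi> \<xi> * of_real (w \<xi>)) \<le> M"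
      using M[OF e(1,2)] by blast
  qed
  define B where "B = D * kern_sup * (LINT x|lborel. w x * dec x)"
  have B: "norm (riesz_int \<phi> x) \<le> B" for x
  proof -
    have "norm (LINT \<xi>|lborel. (of_real (norm \<xi> powr \<alpha>) * ft \<phi> \<xi> * kern x \<xi>) * of_real (w \<xi>)) \<le> B"
      unfolding B_def
    proof (rule integrable_dec_weight(2))
      show "AE \<xi> in lborel. norm (of_real (norm \<xi> powr \<alpha>) * ft \<phi> \<xi> * kern x \<xi>) \<le> D * kern_sup * dec \<xi>"
        using norm_mult_kern[OF D] by (intro AE_I2) (simp only: mult_ac)
    qed measurable
    moreover have "(LINT \<xi>|lborel. (of_real (norm \<xi> powr \<alpha>) * ft \<phi> \<xi> * kern x \<xi>) * of_real (w \<xi>)) = riesz_int \<phi> x"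
      unfolding riesz_int_def by (intro Bochner_Integration.integral_cong HOL.refl) (simp only: mult_ac)
    ultimately show ?thesis by simp
  qed
  have "norm (riesz_int \<phi> x) * (1 + norm x)\<^sup>2 \<le> 2 * B + 2 * M" for x
  proof -
    have "(1 + norm x)\<^sup>2 \<le> 2 + 2 * (norm x)\<^sup>2"
      using zero_le_power2[of "1 - norm x"] by (simp add: power2_sum power2_diff)
    then have "norm (riesz_int \<phi> x) * (1 + norm x)\<^sup>2 \<le> norm (riesz_int \<phi> x) * (2 + 2 * (norm x)\<^sup>2)"
      by (intro mult_left_mono) auto
    also have "\<dots> = 2 * norm (riesz_int \<phi> x) + 2 * ((norm x)\<^sup>2 * norm (riesz_int \<phi> x))" by (simp add: algebra_simps)
    also have "\<dots> \<le> 2 * B + 2 * M" using B[of x] M'[of x] by linarith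
    finally show ?thesis .
  qed
  moreover from this[of 0] have "0 \<le> 2 * B + 2 * M" using norm_ge_zero[of "riesz_int \<phi> 0"] by (simp del: norm_ge_zero)
  ultimately show ?thesis by blast
qed

text \<open>The homogeneous weight bound reduces the exponent to d - \<alpha>, below
  \<open>d\<close> at the origin since \<alpha> > 0. At infinity the quadratic decay raises it to d
  - \<alpha> + 2, above \<open>d\<close> since \<alpha> < 2.\<close>

lemma integrable_riesz_pairing:
  assumes \<phi>: "Sm \<phi>"
  shows "integrable lborel (\<lambda>x. of_real (norm x powr - (2 * \<gamma> + real CARD('n) - \<alpha>))
      * (riesz_int \<phi> x * of_real (w x)))"
proof -
  have [measurable]: "\<phi> \<in> borel_measurable borel" by (rule Sm_int(1)[OF \<phi>])
  obtain K where K: "K \<ge> 0" "\<And>x. norm (riesz_int \<phi> x) * (1 + norm x)\<^sup>2 \<le> K" using riesz_int_decay[OF \<phi>] by blast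
  let ?d = "real CARD('n)"
  show ?thesis
  proof (rule Bochner_Integration.integrable_bound)
    show "integrable lborel (\<lambda>x::real^'n. K * wC * (norm x powr - (?d - \<alpha>) * (1 + norm x) powr - 2))"
      using dim alpha_pos alpha_less by (intro integrable_mult_right integrable_radial) auto
    show "AE x in lborel. norm (of_real (norm x powr - (2 * \<gamma> + ?d - \<alpha>)) * (riesz_int \<phi> x * of_real (w x)))
      \<le> norm (K * wC * (norm x powr - (?d - \<alpha>) * (1 + norm x) powr - 2))"
      using AE_lborel_nonzero
    proof eventually_elim
      case (elim x)
      have s: "1 + norm x > 0" by (simp add: add_pos_nonneg)
      have h: "norm (riesz_int \<phi> x) \<le> K * (1 + norm x) powr - 2"
        using K(2)[of x] s by (simp add: powr_minus field_simps)
      have "norm x powr - (2 * \<gamma> + ?d - \<alpha>) * (norm (riesz_int \<phi> x) * w x)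
        \<le> norm x powr - (2 * \<gamma> + ?d - \<alpha>) * ((K * (1 + norm x) powr - 2) * (wC * norm x powr (2 * \<gamma>)))"
        using K(1) by (intro mult_left_mono mult_mono h weight_le_norm[OF elim] weight_nonneg) auto
      also have "\<dots> = K * wC * ((norm x powr - (2 * \<gamma> + ?d - \<alpha>) * norm x powr (2 * \<gamma>)) * (1 + norm x) powr - 2)"
        by (simp only: mult_ac)
      also have "norm x powr - (2 * \<gamma> + ?d - \<alpha>) * norm x powr (2 * \<gamma>) = norm x powr - (?d - \<alpha>)"
        by (simp flip: powr_add)
      finally have "norm x powr - (2 * \<gamma> + ?d - \<alpha>) * (norm (riesz_int \<phi> x) * w x)
        \<le> norm (K * wC * (norm x powr - (?d - \<alpha>) *
            (1 + norm x) powr - 2))" by (simp only: real_norm_def order_trans[OF _ abs_ge_self])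
      then show ?case using weight_nonneg[of x] by (simp add: norm_mult)
    qed
  qed measurable
qed

section \<open>The fundamental solution\<close>

text \<open>Up to a Gamma factor both |x| powr (-2 s) and |\<xi>| powr (-\<alpha>) are Gaussian
  mixtures in the same parameter. For each value of the parameter the pairing is carried to the
  Fourier side exactly.\<close>

lemma riesz_pairing:
  assumes \<phi>: "Sm \<phi>"
  shows "(LINT x|lborel. of_real (norm x powr - (2 * \<gamma> + real CARD('n) - \<alpha>)) * (riesz_int \<phi> x * of_real (w x)))
    = of_real (c\<^sub>k ^ 3 * 2 powr (\<alpha> - hdim) * Gamma (\<alpha> / 2) / Gamma (\<gamma> + (real CARD('n) - \<alpha>) / 2)) * \<phi> 0"
proof -
  have m\<phi> [measurable]: "\<phi> \<in> borel_measurable borel" by (rule Sm_int(1)[OF \<phi>])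
  define s where "s = \<gamma> + (real CARD('n) - \<alpha>) / 2"
  have s: "s > 0" using gamma_nonneg dim alpha_less by (simp add: s_def add_nonneg_pos)
  have s2: "2 * \<gamma> + real CARD('n) - \<alpha> = 2 * s" and hs: "hdim = s + \<alpha> / 2"
      by (simp_all add: s_def hdim_def field_simps)
  define g where "g \<xi> = of_real (norm \<xi> powr \<alpha>) * ft \<phi> \<xi>" for \<xi>
  have [measurable]: "g \<in> borel_measurable borel" unfolding g_def[abs_def] by measurable
  obtain D where D: "\<And>\<xi>. norm (g \<xi>) \<le> D * dec \<xi>" using riesz_multiplier_dec[OF \<phi>] unfolding g_def by blast
  have gi: "integrable lborel (\<lambda>\<xi>. g \<xi> * of_real (w \<xi>))"
    by (rule integrable_dec_weight(1)[of _ D]) (use D in auto)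
  define q1 where "q1 x u = exp (s * u) * exp (- (norm x)\<^sup>2 * exp u)" for x :: "real^'n" and u
  define b where "b = c\<^sub>k * 2 powr - hdim"
  have b: "b > 0" using dunkl_c_pos by (simp add: b_def)
  \<comment> \<open>The weight exp (s u) times the transform of the Gaussian with parameter exp u.
    The transform contributes exp (-\<open>hdim\<close> u), and s - \<open>hdim\<close> = -\<alpha>
    / 2.\<close>
  define q2 where "q2 \<xi> u = b * (exp (- (\<alpha> / 2) * u) * exp (- ((norm \<xi>)\<^sup>2 / 4) * exp (- u)))" for \<xi> :: "real^'n" and u
  define Q1 where "Q1 x = Gamma s * norm x powr - (2 * s)" for x :: "real^'n"
  define Q2 where "Q2 \<xi> = b * (Gamma (\<alpha> / 2) * ((norm \<xi>)\<^sup>2 / 4) powr - (\<alpha> / 2))" for \<xi> :: "real^'n"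
  \<comment> \<open>Here the mixture cancels the symbol. At \<xi> = 0 the convention
    \<open>0 powr a = 0\<close> breaks the cancellation, so it is available almost everywhere
    only.\<close>
  have Q2_eq: "of_real (Q2 \<xi>) * (g \<xi> * of_real (w \<xi>))
      = of_real (b * Gamma (\<alpha> / 2) * 2 powr \<alpha>) * (ft \<phi> \<xi> * of_real (w \<xi>))"
    if "\<xi> \<noteq> 0" for \<xi>
  proof -
    have "(norm \<xi>)\<^sup>2 / 4 = (norm \<xi> / 2) powr 2" using that by (simp add: power_divide)
    then have "((norm \<xi>)\<^sup>2 / 4) powr - (\<alpha> / 2) = (norm \<xi> / 2) powr - \<alpha>" by (simp only: powr_powr) simp
    also have "\<dots> = norm \<xi> powr - \<alpha> * 2 powr \<alpha>" by (simp add: powr_divide powr_minus field_simps)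
    finally have Q: "Q2 \<xi> = b * Gamma (\<alpha> / 2) * 2 powr \<alpha> * norm \<xi> powr - \<alpha>" by (simp add: Q2_def mult_ac)
    have "Q2 \<xi> * norm \<xi> powr \<alpha> = b * Gamma (\<alpha> / 2) * 2 powr \<alpha> * (norm \<xi> powr - \<alpha> * norm \<xi> powr \<alpha>)"
      unfolding Q by (simp only: mult_ac)
    also have "norm \<xi> powr - \<alpha> * norm \<xi> powr \<alpha> = 1" using that by (simp flip: powr_add)
    finally have *: "Q2 \<xi> * norm \<xi> powr \<alpha> = b * Gamma (\<alpha> / 2) * 2 powr \<alpha>" by simp
    have "of_real (Q2 \<xi>) * (g \<xi> * of_real (w \<xi>)) = of_real (Q2 \<xi> * norm \<xi> powr \<alpha>) * (ft \<phi> \<xi> * of_real (w \<xi>))"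
      by (simp only: g_def of_real_mult mult.assoc)
    then show ?thesis by (simp only: *)
  qed
  have fti: "integrable lborel (\<lambda>\<xi>. ft \<phi> \<xi> * of_real (w \<xi>))"
  proof -
    obtain E where "\<And>\<xi>. norm (ft \<phi> \<xi>) * (1 + norm \<xi>) ^ 0 \<le> E * dec \<xi>" using ft_dec[OF \<phi>] by blast
    then show ?thesis by (intro integrable_dec_weight(1)[of _ E]) auto
  qed
  have Q2_AE: "AE \<xi> in lborel. of_real (Q2 \<xi>) * (g \<xi> * of_real (w \<xi>))
      = of_real (b * Gamma (\<alpha> / 2) * 2 powr \<alpha>) * (ft \<phi> \<xi> * of_real (w \<xi>))"
    using AE_lborel_nonzero by eventually_elim (rule Q2_eq)
  have m2: "(\<lambda>\<xi>. of_real (Q2 \<xi>) * (g \<xi> * of_real (w \<xi>))) \<in> borel_measurable lborel"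
    unfolding Q2_def by measurable
  have m3: "(\<lambda>\<xi>. of_real (b * Gamma (\<alpha> / 2) * 2 powr \<alpha>) * (ft \<phi> \<xi> * of_real (w \<xi>))) \<in> borel_measurable lborel"
    by measurable
  have Q2i: "integrable lborel (\<lambda>\<xi>. of_real (Q2 \<xi>) * (g \<xi> * of_real (w \<xi>)))"
    unfolding integrable_cong_AE[OF m2 m3 Q2_AE] by (intro integrable_mult_right fti)
  have inner: "(LINT x|lborel. of_real (q1 x u) * (riesz_int \<phi> x * of_real (w x)))
    = (LINT \<xi>|lborel. of_real (q2 \<xi> u) * (g \<xi> * of_real (w \<xi>)))" for u
  proof -
    let ?t = "exp u"
    let ?f = "\<lambda>x. complex_of_real (exp (- ?t * (norm x)\<^sup>2))"
    have fi: "integrable lborel (\<lambda>x. ?f x * of_real (w x))"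
      using integrable_of_real[OF integrable_gauss_weight[of ?t]] by simp
    have "(LINT x|lborel. of_real (q1 x u) * (riesz_int \<phi> x * of_real (w x)))
      = (LINT x|lborel. of_real (exp (s * u)) * (?f x * (LINT \<xi>|lborel. g \<xi> * kern (1 *\<^sub>R x) \<xi> * of_real (w \<xi>)) *
          of_real (w x)))"
    proof (intro Bochner_Integration.integral_cong HOL.refl)
      fix x :: "real^'n"
      have "riesz_int \<phi> x = (LINT \<xi>|lborel. g \<xi> * kern (1 *\<^sub>R x) \<xi> * of_real (w \<xi>))"
        unfolding riesz_int_def g_def scaleR_one
        by (intro Bochner_Integration.integral_cong HOL.refl) (simp only: mult_ac)
      moreover have "q1 x u = exp (s * u) * exp (- ?t * (norm x)\<^sup>2)"
        by (simp add: q1_def mult.commute)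
      ultimately show "of_real (q1 x u) * (riesz_int \<phi> x * of_real (w x))
        = of_real (exp (s * u)) * (?f x * (LINT \<xi>|lborel. g \<xi> * kern (1 *\<^sub>R x) \<xi> * of_real (w \<xi>)) * of_real (w x))"
        by (simp only: of_real_mult mult.assoc)
    qed
    also have "\<dots> = of_real (exp (s * u)) * (LINT x|lborel. ?f x * (LINT \<xi>|lborel. g \<xi> * kern (1 *\<^sub>R x) \<xi>
        * of_real (w \<xi>)) * of_real (w x))"
      by (rule integral_mult_right_zero)
    also have "\<dots> = of_real (exp (s * u)) * (LINT \<xi>|lborel. g \<xi> * (LINT x|lborel. ?f x * kern (1 *\<^sub>R \<xi>) x
        * of_real (w x)) * of_real (w \<xi>))"
      by (subst fubini_kern[OF _ _ fi gi]) auto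
    also have "\<dots> = (LINT \<xi>|lborel. of_real (exp (s * u)) * (g \<xi> * gauss_int \<xi> ?t * of_real (w \<xi>)))"
      unfolding gauss_int_def scaleR_one by (rule integral_mult_right_zero[symmetric])
    also have "\<dots> = (LINT \<xi>|lborel. of_real (q2 \<xi> u) * (g \<xi> * of_real (w \<xi>)))"
    proof (intro Bochner_Integration.integral_cong HOL.refl)
      fix \<xi> :: "real^'n"
      have e1: "(2 * ?t) powr - hdim = 2 powr - hdim * exp (- hdim * u)"
          by (simp add: powr_mult exp_powr_real mult.commute)
      have e2: "exp (s * u) * exp (- hdim * u) = exp (- (\<alpha> / 2) * u)"
        unfolding exp_add[symmetric] hs by (simp add: algebra_simps)
      have e3: "- (norm \<xi>)\<^sup>2 / (4 * ?t) = - ((norm \<xi>)\<^sup>2 / 4) * exp (- u)" by (simp add: exp_minus field_simps)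
      have "q2 \<xi> u = exp (s * u) * (c\<^sub>k * (2 * ?t) powr - hdim * exp (- (norm \<xi>)\<^sup>2 / (4 * ?t)))"
        unfolding q2_def b_def e1 e3 e2[symmetric] by (simp only: mult_ac)
      then have "of_real (q2 \<xi> u) = of_real (exp (s * u)) * gauss_int \<xi> ?t"
        by (simp only: gauss_transform[OF exp_gt_zero] of_real_mult)
      then show "of_real (exp (s * u)) * (g \<xi> * gauss_int \<xi> ?t * of_real (w \<xi>))
          = of_real (q2 \<xi> u) * (g \<xi> * of_real (w \<xi>))"
        by (simp only: mult_ac)
    qed
    finally show ?thesis .
  qed
  have "(LINT x|lborel. of_real (Q1 x) * (riesz_int \<phi> x * of_real (w x)))
    = (LINT u|lborel. LINT x|lborel. of_real (q1 x u) * (riesz_int \<phi> x * of_real (w x)))"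
  proof (rule fubini_mixture)
    show "case_prod q1 \<in> borel_measurable (borel \<Otimes>\<^sub>M borel)" unfolding q1_def[abs_def] by measurable
    show "(\<lambda>x. riesz_int \<phi> x * of_real (w x)) \<in> borel_measurable borel" by measurable
    show "0 \<le> q1 x u" for x u by (simp add: q1_def)
    show "AE x in lborel. integrable lborel (q1 x) \<and> (LINT u|lborel. q1 x u) = Q1 x"
      using AE_lborel_nonzero
    proof eventually_elim
      case (elim x)
      have a: "(norm x)\<^sup>2 > 0" using elim by simp
      have "((norm x)\<^sup>2) powr - s = norm x powr - (2 * s)"
        using elim by (simp add: powr_powr flip: powr_numeral)
      then show ?case using gamma_exp_integral[OF s a] by (simp add: q1_def[abs_def] Q1_def)
    qed
    have "integrable lborel (\<lambda>x. of_real (Gamma s) * (of_real (norm x powr - (2 * s))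
        * (riesz_int \<phi> x * of_real (w x))))"
      using integrable_riesz_pairing[OF \<phi>] unfolding s2 by (intro integrable_mult_right)
    then show "integrable lborel (\<lambda>x. of_real (Q1 x) * (riesz_int \<phi> x * of_real (w x)))"
      by (simp only: Q1_def of_real_mult mult.assoc)
  qed
  also have "\<dots> = (LINT u|lborel. LINT \<xi>|lborel. of_real (q2 \<xi> u) * (g \<xi> * of_real (w \<xi>)))"
    unfolding inner ..
  also have "\<dots> = (LINT \<xi>|lborel. of_real (Q2 \<xi>) * (g \<xi> * of_real (w \<xi>)))"
  proof (rule fubini_mixture[symmetric, OF _ _ _ _ Q2i])
    show "case_prod q2 \<in> borel_measurable (borel \<Otimes>\<^sub>M borel)" unfolding q2_def[abs_def] by measurable
    show "(\<lambda>\<xi>. g \<xi> * of_real (w \<xi>)) \<in> borel_measurable borel" by measurable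
    show "0 \<le> q2 x u" for x u using b by (simp add: q2_def)
    show "AE \<xi> in lborel. integrable lborel (q2 \<xi>) \<and> (LINT u|lborel. q2 \<xi> u) = Q2 \<xi>"
      using AE_lborel_nonzero
    proof eventually_elim
      case (elim \<xi>)
      have a: "(norm \<xi>)\<^sup>2 / 4 > 0" "\<alpha> / 2 > 0" using elim alpha_pos by simp_all
      show ?case
        unfolding q2_def Q2_def integral_mult_right_zero gamma_exp_integral_minus(2)[OF a(2,1)]
        by (intro conjI HOL.refl integrable_mult_right gamma_exp_integral_minus(1) a)
    qed
  qed
  also have "\<dots> = (LINT \<xi>|lborel. of_real (b * Gamma (\<alpha> / 2) * 2 powr \<alpha>) * (ft \<phi> \<xi> * of_real (w \<xi>)))"
    by (rule integral_cong_AE[OF m2 m3 Q2_AE])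
  also have "\<dots> = of_real (b * Gamma (\<alpha> / 2) * 2 powr \<alpha>) * (of_real (c\<^sub>k\<^sup>2) * \<phi> 0)"
    unfolding integral_mult_right_zero integral_ft[OF \<phi>] ..
  also have "\<dots> = of_real (c\<^sub>k ^ 3 * 2 powr (\<alpha> - hdim) * Gamma (\<alpha> / 2)) * \<phi> 0"
  proof -
    have "b * Gamma (\<alpha> / 2) * 2 powr \<alpha> * c\<^sub>k\<^sup>2 = c\<^sub>k ^ 3 * 2 powr (\<alpha> - hdim) * Gamma (\<alpha> / 2)"
      by (simp add: b_def powr_diff powr_minus power2_eq_square power3_eq_cube field_simps)
    then show ?thesis by (simp only: mult.assoc[symmetric] of_real_mult[symmetric])
  qed
  finally have "of_real (Gamma s) * (LINT x|lborel. of_real (norm x powr - (2 * s)) * (riesz_int \<phi> x * of_real (w x)))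
      = of_real (c\<^sub>k ^ 3 * 2 powr (\<alpha> - hdim) * Gamma (\<alpha> / 2)) * \<phi> 0"
    by (simp only: Q1_def of_real_mult mult.assoc integral_mult_right_zero)
  moreover have "Gamma s > 0" using s by (rule Gamma_real_pos)
  ultimately show ?thesis unfolding s2 s_def[symmetric] by (simp add: field_simps)
qed

lemma riesz_fundamental_solution:
  assumes \<phi>: "Sm \<phi>"
  shows "has_bochner_integral lborel
    (\<lambda>x. of_real (riesz_fun Rp k \<alpha> x) * frac_dunkl_laplacian Rp k \<alpha> \<phi> x * of_real (w x)) (\<phi> 0)"
proof -
  let ?h = "\<lambda>x. complex_of_real (norm x powr - (2 * \<gamma> + real CARD('n) - \<alpha>)) * (riesz_int \<phi> x * of_real (w x))"
  let ?c = "riesz_const Rp k \<alpha> / c\<^sub>k\<^sup>2"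
  have eq: "of_real (riesz_fun Rp k \<alpha> x) * frac_dunkl_laplacian Rp k \<alpha> \<phi> x * of_real (w x) = of_real ?c * ?h x" for x
    by (simp add: riesz_fun_def frac_dunkl_laplacian_eq divide_inverse mult_ac)
  have G: "Gamma (\<alpha> / 2) > 0" "Gamma (\<gamma> + (real CARD('n) - \<alpha>) / 2) > 0"
    using alpha_pos alpha_less dim gamma_nonneg by (auto intro!: Gamma_real_pos add_nonneg_pos)
  have p: "\<alpha> - \<gamma> - real CARD('n) / 2 = \<alpha> - hdim" by (simp add: hdim_def)
  let ?v = "c\<^sub>k ^ 3 * 2 powr (\<alpha> - hdim) * Gamma (\<alpha> / 2) / Gamma (\<gamma> + (real CARD('n) - \<alpha>) / 2)"
  \<comment> \<open>Of the three powers of c_k, two are removed by the normalisations of the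
    transform and its inverse, and the third by \<open>riesz_const\<close>.\<close>
  have cv: "?c * ?v = 1"
    using G dunkl_c_pos unfolding riesz_const_def p by (simp add: power2_eq_square power3_eq_cube)
  have "of_real ?c * (LINT x|lborel. ?h x) = of_real (?c * ?v) * \<phi> 0"
    by (simp only: riesz_pairing[OF \<phi>] of_real_mult mult.assoc)
  then have "of_real ?c * (LINT x|lborel. ?h x) = \<phi> 0" by (simp only: cv of_real_1 mult_1_left)
  moreover have "has_bochner_integral lborel (\<lambda>x. of_real ?c * ?h x) (of_real ?c * (LINT x|lborel. ?h x))"
    by (rule has_bochner_integral_mult_right)
       (rule has_bochner_integral_integrable[OF integrable_riesz_pairing[OF \<phi>]])
  ultimately show ?thesis unfolding eq by (simp only:)
qed

end

theorem theorem5p4: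
  fixes R Rp :: "(real^'n) set" and k :: "real^'n \<Rightarrow> real" and \<alpha> :: real
  assumes "CARD('n) \<ge> 2"
    and "reduced_root_system R"
    and "positive_subsystem R Rp"
    and "multiplicity_function R k"
    and "0 < \<alpha>" and "\<alpha> < 2"
  shows "\<forall>\<phi>. schwartz \<phi> \<longrightarrow>
    has_bochner_integral lborel
      (\<lambda>x. of_real (riesz_fun Rp k \<alpha> x) * frac_dunkl_laplacian Rp k \<alpha> \<phi> x
             * of_real (dunkl_weight Rp k x))
      (\<phi> 0)"
proof -
  interpret dunkl_riesz R Rp k \<alpha> using assms by unfold_locales
  show ?thesis using riesz_fundamental_solution schwartz_Sm by blast
qed

end
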